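(* For a semantics $\sigma\in\{\mathtt{co},\mathtt{st},\mathtt{pr},\mathtt{sst}\}$, let $\mathsf{CF\text{-}VE}^{\sigma}$ be the following decision problem. Input: an argumentation framework $\Lambda=\langle A,R\rangle$, a goal argument $g\in A$, a $\sigma$-labelling $\mathcal{L}$ of $\Lambda$, and a labelling $\mathcal{L}'$. Question: does $\mathcal{L}'$ belong to the set $\mathcal{CF}^{\sigma}(g,\mathcal{L})$ of counterfactuals of $\mathcal{L}$ w.r.t. $g$? Then $\mathsf{CF\text{-}VE}^{\sigma}$ is: (1) $coNP$-complete for $\sigma\in\{\mathtt{co},\mathtt{st}\}$; and (2) $\Pi_2^p$-complete for $\sigma\in\{\mathtt{pr},\mathtt{sst}\}$.
   Context: An argumentation framework (AF) is a pair $\Lambda=\langle A,R\rangle$ with $A$ a (finite) set of arguments and $R\subseteq A\times A$ a set of attacks. For $S\subseteq A$ let $\mathit{Def}(S)=\{a\in A\mid \exists b\in S,\ (b,a)\in R\}$ and $\mathit{Acc}(S)=\{a\in A\mid \forall (b,a)\in R,\ b\in \mathit{Def}(S)\}$. $S$ is conflict-free iff $S\cap \mathit{Def}(S)=\emptyset$, and admissible iff it is conflict-free and $S\subseteq \mathit{Acc}(S)$. A set $S\subseteq A$ is an extension called: complete ($\mathtt{co}$) iff it is admissible and $S=\mathit{Acc}(S)$; preferred ($\mathtt{pr}$) iff it is a $\subseteq$-maximal complete extension; stable ($\mathtt{st}$) iff it is a preferred extension with $S\cup \mathit{Def}(S)=A$; semi-stable ($\mathtt{sst}$) iff it is a preferred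 extension such that $S\cup \mathit{Def}(S)$ is $\subseteq$-maximal (among preferred extensions). A labelling is a total function $\mathcal{L}:A\to\{\mathbf{in},\mathbf{out},\mathbf{und}\}$. The labelling corresponding to an extension $E$ assigns $\mathbf{in}$ to the elements of $E$, $\mathbf{out}$ to the elements of $\mathit{Def}(E)$, and $\mathbf{und}$ to all other arguments. A $\sigma$-labelling of $\Lambda$ is the labelling corresponding to a $\sigma$-extension of $\Lambda$; $\sigma(\Lambda)$ denotes the set of $\sigma$-labellings of $\Lambda$. The distance between labellings is $\delta(\mathcal{L},\mathcal{L}')=|\{a\in A\mid \mathcal{L}(a)\neq\mathcal{L}'(a)\}|$. Counterfactuals: for $g\in A$ and $\mathcal{L}\in\sigma(\Lambda)$, a labelling $\mathcal{L}'\in\sigma(\Lambda)$ is a counterfactual of $\mathcal{L}$ w.r.t. $g$ if (i) $\mathcal{L}(g)\neq\mathcal{L}'(g)$, and (ii) there is no $\mathcal{L}''\in\sigma(\Lambda)$ with $\mathcal{L}(g)\neq\mathcal{L}''(g)$ and $\delta(\mathcal{L},\mathcal{L}'')<\delta(\mathcal{L},\mathcal{L}')$. $\mathcal{CF}^{\sigma}(g,\mathcal{L})$ denotes the set of all of them. Complexity: $\Sigma_2^p=NP^{NP}$ and $\Pi_2^p=co\Sigma_2^p$. *)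

theory Defs
  imports Main "HOL-Library.FuncSet" "HOL-Computational_Algebra.Polynomial"
begin

section \<open>Argumentation frameworks\<close>

record 'a af =
  args :: "'a set"
  atts :: "('a \<times> 'a) set"

definition finite_af :: "'a af \<Rightarrow> bool" where
  "finite_af F \<longleftrightarrow> finite (args F) \<and> atts F \<subseteq> args F \<times> args F"

definition defeated :: "'a af \<Rightarrow> 'a set \<Rightarrow> 'a set" where
  "defeated F S = {a \<in> args F. \<exists>b\<in>S. (b, a) \<in> atts F}"

definition acceptable :: "'a af \<Rightarrow> 'a set \<Rightarrow> 'a set" where
  "acceptable F S = {a \<in> args F. \<forall>b. (b, a) \<in> atts F \<longrightarrow> b \<in> defeated F S}"

definition conflict_free :: "'a af \<Rightarrow> 'a set \<Rightarrow> bool" where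
  "conflict_free F S \<longleftrightarrow> S \<subseteq> args F \<and> S \<inter> defeated F S = {}"

definition admissible :: "'a af \<Rightarrow> 'a set \<Rightarrow> bool" where
  "admissible F S \<longleftrightarrow> conflict_free F S \<and> S \<subseteq> acceptable F S"

definition complete_ext :: "'a af \<Rightarrow> 'a set \<Rightarrow> bool" where
  "complete_ext F S \<longleftrightarrow> admissible F S \<and> S = acceptable F S"

definition preferred_ext :: "'a af \<Rightarrow> 'a set \<Rightarrow> bool" where
  "preferred_ext F S \<longleftrightarrow>
     complete_ext F S \<and> \<not> (\<exists>T. complete_ext F T \<and> S \<subset> T)"

definition stable_ext :: "'a af \<Rightarrow> 'a set \<Rightarrow> bool" where
  "stable_ext F S \<longleftrightarrow> preferred_ext F S \<and> S \<union> defeated F S = args F"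

definition semi_stable_ext :: "'a af \<Rightarrow> 'a set \<Rightarrow> bool" where
  "semi_stable_ext F S \<longleftrightarrow>
     preferred_ext F S \<and>
     \<not> (\<exists>T. preferred_ext F T \<and> S \<union> defeated F S \<subset> T \<union> defeated F T)"

datatype semantics = CO | ST | PR | SST

fun extension :: "semantics \<Rightarrow> 'a af \<Rightarrow> 'a set \<Rightarrow> bool" where
  "extension CO = complete_ext"
| "extension ST = stable_ext"
| "extension PR = preferred_ext"
| "extension SST = semi_stable_ext"


section \<open>Labellings and counterfactuals\<close>

datatype label = In | Out | Und

text \<open>A labelling of \<open>F\<close> is an element of \<open>args F \<rightarrow>\<^sub>E UNIV\<close>; being extensional, it is
  determined by its values on the arguments.\<close>

definition labelling_of :: "'a af \<Rightarrow> 'a set \<Rightarrow> 'a \<Rightarrow> label" where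
  "labelling_of F E =
     (\<lambda>a\<in>args F. if a \<in> E then In else if a \<in> defeated F E then Out else Und)"

definition labellings :: "semantics \<Rightarrow> 'a af \<Rightarrow> ('a \<Rightarrow> label) set" where
  "labellings \<sigma> F = {labelling_of F E |E. extension \<sigma> F E}"

definition distance :: "'a af \<Rightarrow> ('a \<Rightarrow> label) \<Rightarrow> ('a \<Rightarrow> label) \<Rightarrow> nat" where
  "distance F L L' = card {a \<in> args F. L a \<noteq> L' a}"

definition counterfactuals ::
    "semantics \<Rightarrow> 'a af \<Rightarrow> 'a \<Rightarrow> ('a \<Rightarrow> label) \<Rightarrow> ('a \<Rightarrow> label) set" where
  "counterfactuals \<sigma> F g L =
     {L' \<in> labellings \<sigma> F. L g \<noteq> L' g \<and>
        \<not> (\<exists>L''\<in>labellings \<sigma> F. L g \<noteq> L'' g \<and> distance F L L'' < distance F L L')}"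


section \<open>Nondeterministic multitape Turing machines with an oracle\<close>

text \<open>Tapes are infinite in both directions. States and tape symbols are natural numbers;
  a machine has finitely many transitions, so only finitely many of them are relevant.
  Symbol 0 is the blank, symbols 1 and 2 are the bits. Tape 0 holds the input; tape 1 is the
  output tape and also the tape on which oracle queries are written.\<close>

type_synonym tape = "(int \<Rightarrow> nat) \<times> int"
type_synonym config = "nat \<times> tape list"

datatype move = MLeft | MStay | MRight

fun shift :: "move \<Rightarrow> int" where
  "shift MLeft = -1"
| "shift MStay = 0"
| "shift MRight = 1"

fun read :: "tape \<Rightarrow> nat" where
  "read (t, h) = t h"

fun act :: "nat \<times> move \<Rightarrow> tape \<Rightarrow> tape" where
  "act (s, m) (t, h) = (t(h := s), h + shift m)"

definition bit_symbol :: "bool \<Rightarrow> nat" where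
  "bit_symbol b = (if b then 2 else 1)"

text \<open>The longest word of bits that starts in cell 0. It is finite for every tape with finitely
  many nonblank cells, hence for all tapes that occur in a computation.\<close>

fun tape_word :: "tape \<Rightarrow> bool list" where
  "tape_word (t, h) =
     map (\<lambda>i. t (int i) = bit_symbol True)
       [0..<(LEAST n. t (int n) \<notin> range bit_symbol)]"

text \<open>A transition \<open>(q, ss, q', as)\<close> applies in state \<open>q\<close> when the heads read \<open>ss\<close>; it leads to
  state \<open>q'\<close>, every head writing a symbol and then moving. If \<open>query M = Some (q, y, n)\<close>,
  then \<open>q\<close> is the query state, and the state following it is \<open>y\<close> or \<open>n\<close> according to the
  answer of the oracle.\<close>

record tm =
  tapes :: nat
  trans :: "(nat \<times> nat list \<times> nat \<times> (nat \<times> move) list) set"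
  start :: nat
  accept :: nat
  query :: "(nat \<times> nat \<times> nat) option"

definition wf_tm :: "tm \<Rightarrow> bool" where
  "wf_tm M \<longleftrightarrow>
     2 \<le> tapes M \<and> finite (trans M) \<and>
     (\<forall>(q, ss, q', as) \<in> trans M.
        length ss = tapes M \<and> length as = tapes M \<and> q \<noteq> accept M) \<and>
     (\<forall>q y n. query M = Some (q, y, n) \<longrightarrow> q \<noteq> accept M \<and> q \<notin> fst ` trans M)"

definition deterministic :: "tm \<Rightarrow> bool" where
  "deterministic M \<longleftrightarrow>
     (\<forall>q ss q1 as1 q2 as2. (q, ss, q1, as1) \<in> trans M \<and> (q, ss, q2, as2) \<in> trans M
        \<longrightarrow> q1 = q2 \<and> as1 = as2)"

inductive step :: "tm \<Rightarrow> bool list set \<Rightarrow> config \<Rightarrow> config \<Rightarrow> bool" for M B where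
  trans: "(q, map read ts, q', as) \<in> trans M \<Longrightarrow> step M B (q, ts) (q', map2 act as ts)"
| query: "query M = Some (q, y, n) \<Longrightarrow>
    step M B (q, ts) (if tape_word (ts ! 1) \<in> B then y else n, ts)"

definition input_tape :: "bool list \<Rightarrow> tape" where
  "input_tape x =
     ((\<lambda>i. if 0 \<le> i \<and> i < int (length x) then bit_symbol (x ! nat i) else 0), 0)"

definition init :: "tm \<Rightarrow> bool list \<Rightarrow> config" where
  "init M x = (start M, input_tape x # replicate (tapes M - 1) (input_tape []))"

definition accepts :: "tm \<Rightarrow> bool list set \<Rightarrow> bool list \<Rightarrow> bool" where
  "accepts M B x \<longleftrightarrow> (\<exists>c. (step M B)\<^sup>*\<^sup>* (init M x) c \<and> fst c = accept M)"

text \<open>All computation paths halt within polynomially many steps.\<close>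

definition poly_time :: "tm \<Rightarrow> bool list set \<Rightarrow> bool" where
  "poly_time M B \<longleftrightarrow>
     (\<exists>p :: nat poly. \<forall>x n c. (step M B ^^ n) (init M x) c \<longrightarrow> n \<le> poly p (length x))"


section \<open>Complexity classes\<close>

type_synonym language = "bool list set"

definition NP :: "language set" where
  "NP = {{x. accepts M {} x} |M. wf_tm M \<and> query M = None \<and> poly_time M {}}"

definition NP_oracle :: "language \<Rightarrow> language set" where
  "NP_oracle B = {{x. accepts M B x} |M. wf_tm M \<and> poly_time M B}"

definition co :: "language set \<Rightarrow> language set" where
  "co C = {L. - L \<in> C}"

definition coNP :: "language set" where
  "coNP = co NP"

definition Sigma2p :: "language set" where
  "Sigma2p = (\<Union>B\<in>NP. NP_oracle B)"

definition Pi2p :: "language set" where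
  "Pi2p = co Sigma2p"

definition FP :: "(bool list \<Rightarrow> bool list) set" where
  "FP = {f. \<exists>M. wf_tm M \<and> query M = None \<and> deterministic M \<and> poly_time M {} \<and>
     (\<forall>x. \<exists>c. (step M {})\<^sup>*\<^sup>* (init M x) c \<and> fst c = accept M \<and> tape_word (snd c ! 1) = f x)}"

text \<open>A decision problem is given by the set \<open>I\<close> of encodings of its inputs and the set
  \<open>Y \<subseteq> I\<close> of encodings of its yes-instances. Membership in a class refers to the language
  \<open>Y\<close>; reductions produce proper inputs only, so hardness does not
  rely on words outside \<open>I\<close>.\<close>

definition complete_for :: "language set \<Rightarrow> language \<times> language \<Rightarrow> bool" where
  "complete_for C = (\<lambda>(I, Y).
     Y \<in> C \<and> (\<forall>L\<in>C. \<exists>f\<in>FP. \<forall>x. f x \<in> I \<and> (x \<in> L \<longleftrightarrow> f x \<in> Y)))"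


section \<open>The verification problem for counterfactuals\<close>

text \<open>In inputs, the arguments are numbered \<open>0, \<dots>, n - 1\<close>. The encoding consists of \<open>n\<close> in
  unary, the adjacency matrix of the attacks, the characteristic vector of the goal,
  and two bits per argument for each of the two labellings.\<close>

type_synonym cf_input = "nat af \<times> nat \<times> (nat \<Rightarrow> label) \<times> (nat \<Rightarrow> label)"

definition cf_inputs :: "semantics \<Rightarrow> cf_input set" where
  "cf_inputs \<sigma> = {(F, g, L, L'). finite_af F \<and> (\<exists>n. args F = {..<n}) \<and> g \<in> args F \<and>
     L \<in> labellings \<sigma> F \<and> L' \<in> args F \<rightarrow>\<^sub>E UNIV}"

fun label_bits :: "label \<Rightarrow> bool list" where
  "label_bits In = [True, False]"
| "label_bits Out = [False, True]"
| "label_bits Und = [False, False]"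

fun encode :: "cf_input \<Rightarrow> bool list" where
  "encode (F, g, L, L') = (let as = [0..<card (args F)] in
     replicate (length as) True @ [False] @
     [(a, b) \<in> atts F. a \<leftarrow> as, b \<leftarrow> as] @
     [a = g. a \<leftarrow> as] @
     concat [label_bits (L a). a \<leftarrow> as] @
     concat [label_bits (L' a). a \<leftarrow> as])"

lemma replicate_sentinel_inj:
  "replicate n True @ False # r = replicate m True @ False # s \<Longrightarrow> n = m \<and> r = s"
proof (induction n arbitrary: m)
  case 0
  then show ?case by (cases m) auto
next
  case (Suc n)
  then show ?case by (cases m) auto
qed

lemma label_bits_inj: "label_bits l = label_bits l' \<Longrightarrow> l = l'"
  by (cases l; cases l') auto

lemma length_label_bits [simp]: "length (label_bits l) = 2"
  by (cases l) auto

lemma length_concat_label_bits: "length (concat (map (\<lambda>a. label_bits (L a)) as)) = 2 * length as"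
  by (induction as) auto

lemma concat_label_bits_inj:
  "concat (map (\<lambda>a. label_bits (L a)) as) = concat (map (\<lambda>a. label_bits (L' a)) as) \<Longrightarrow>
   a \<in> set as \<Longrightarrow> L a = L' a"
  by (induction as) (auto dest: label_bits_inj)

lemma length_matrix: "length (concat (map (\<lambda>a. map (P a) bs) as)) = length as * length bs"
  by (induction as) auto

lemma matrix_inj:
  "concat (map (\<lambda>a. map (P a) bs) as) = concat (map (\<lambda>a. map (Q a) bs) as) \<Longrightarrow>
   a \<in> set as \<Longrightarrow> b \<in> set bs \<Longrightarrow> P a b = Q a b"
  by (induction as) auto

lemma labellings_extensional: "L \<in> labellings \<sigma> F \<Longrightarrow> L \<in> extensional (args F)"
  by (auto simp: labellings_def labelling_of_def)

text \<open>Distinct inputs have distinct encodings.\<close>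

lemma inj_on_encode: "inj_on encode (cf_inputs \<sigma>)"
proof (rule inj_onI)
  fix x y assume xy: "x \<in> cf_inputs \<sigma>" "y \<in> cf_inputs \<sigma>" and eq: "encode x = encode y"
  obtain F g L1 L2 where x: "x = (F, g, L1, L2)" by (cases x)
  obtain G h K1 K2 where y: "y = (G, h, K1, K2)" by (cases y)
  obtain n where n: "args F = {..<n}" using xy x by (auto simp: cf_inputs_def)
  obtain m where m: "args G = {..<m}" using xy y by (auto simp: cf_inputs_def)
  have ext: "L1 \<in> extensional (args F)" "L2 \<in> extensional (args F)"
      "K1 \<in> extensional (args G)" "K2 \<in> extensional (args G)"
    using xy x y by (auto simp: cf_inputs_def PiE_def dest: labellings_extensional)
  have sub: "atts F \<subseteq> args F \<times> args F" "atts G \<subseteq> args G \<times> args G" and gh: "g < n" "h < m"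
    using xy x y n m by (auto simp: cf_inputs_def finite_af_def)
  let ?enc = "\<lambda>F g L L' as. [(a, b) \<in> atts F. a \<leftarrow> as, b \<leftarrow> as] @ [a = g. a \<leftarrow> as] @
     concat [label_bits (L a). a \<leftarrow> as] @ concat [label_bits (L' a). a \<leftarrow> as]"
  have "encode x = replicate n True @ False # ?enc F g L1 L2 [0..<n]"
    unfolding x encode.simps n Let_def by simp
  moreover have "encode y = replicate m True @ False # ?enc G h K1 K2 [0..<m]"
    unfolding y encode.simps m Let_def by simp
  ultimately have eq': "n = m \<and> ?enc F g L1 L2 [0..<n] = ?enc G h K1 K2 [0..<m]"
    using eq by (intro replicate_sentinel_inj) simp
  then have nm: "m = n" by simp
  have rest: "?enc F g L1 L2 [0..<n] = ?enc G h K1 K2 [0..<n]"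
    using eq' by (simp only: nm)
  let ?as = "[0..<n]"
  have mat: "concat (map (\<lambda>a. map (\<lambda>b. (a, b) \<in> atts F) ?as) ?as) =
             concat (map (\<lambda>a. map (\<lambda>b. (a, b) \<in> atts G) ?as) ?as)"
    and goal: "map (\<lambda>a. a = g) ?as = map (\<lambda>a. a = h) ?as"
    and l1: "concat (map (\<lambda>a. label_bits (L1 a)) ?as) = concat (map (\<lambda>a. label_bits (K1 a)) ?as)"
    and l2: "concat (map (\<lambda>a. label_bits (L2 a)) ?as) = concat (map (\<lambda>a. label_bits (K2 a)) ?as)"
    using rest by (simp_all add: length_matrix length_concat_label_bits)
  have "(a, b) \<in> atts F \<longleftrightarrow> (a, b) \<in> atts G" if "a < n" "b < n" for a b
    using matrix_inj[OF mat, of a b] that by simp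
  then have "atts F = atts G" using sub n m nm by auto
  then have "F = G" using n m nm by simp
  moreover have "g = h" using goal gh(1) by (auto simp: map_eq_conv)
  moreover have "L1 = K1"
    using ext concat_label_bits_inj[OF l1] n m nm by (intro extensionalityI[of _ "args F"]) auto
  moreover have "L2 = K2"
    using ext concat_label_bits_inj[OF l2] n m nm by (intro extensionalityI[of _ "args F"]) auto
  ultimately show "x = y" by (simp add: x y)
qed

definition CF_VE :: "semantics \<Rightarrow> language \<times> language" where
  "CF_VE \<sigma> =
     (encode ` cf_inputs \<sigma>,
      encode ` {(F, g, L, L') \<in> cf_inputs \<sigma>. L' \<in> counterfactuals \<sigma> F g L})"

end

theory Submission
  imports Defs "HOL-Library.Nat_Bijection"
begin

text \<open>A language is in NP iff membership is expressed by a bounded arithmetic formula about the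
  input and a certificate of polynomial length; for \<open>Sigma2p\<close> there is a second, universally
  quantified certificate. For one direction such formulas are compiled to Turing machines, for the
  other one a run of a machine is described by a tableau.

  The complement of the verification problem has such a definition: a certificate is an
  extension that is better than one of the two given ones, or a closer one together with an injection that
  compares the distances; only for preferred and semi-stable semantics must one rule out
  that the closer extension can itself be improved.

  For hardness, the pairs of a subformula and an environment are the gates of a circuit of NORs,
  which is an argumentation framework. Two further labellings are added that switch the circuit off,
  differ at the goal, and are further apart than any labelling that uses the circuit is from the
  first one. The second one is then a counterfactual of the first one iff the circuit cannot be
  used, that is, iff the formula is unsatisfiable (or, in the second case, iff every choice of the
  first certificate can be completed to a model).\<close>

section \<open>Definability by bounded arithmetic formulas\<close>

text \<open>Bounded arithmetic confines the machine model to two translations. After these,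
  membership only asks for a formula that checks certificates, and the reduction only for a formula
  that yields each output bit. In the reduction the obstacle is the label for undecided arguments. A
  complete extension may decide no mode at all; it must then not be closer to the first labelling
  than the second one is. Preferred semantics rules out undecided modes but may leave literals
  undecided, and this supplies the universal quantifier: maximality accepts the literals from
  \<open>l\<close> on as soon as some choice of them makes the formula true. Semi-stable semantics
  compares ranges, so no other choice of the first \<open>l\<close> literals may have a larger
  range; self-attacking arguments make a range reveal its mode and these literals. The circuit has
  polynomial size because the formula is fixed: its nesting of quantifiers is constant and every
  bound is a polynomial, so the environments are coded by polynomially many numbers.\<close>

datatype trm = Var nat | Len | Const nat | Add trm trm | Mul trm trm

primrec tval :: "nat \<Rightarrow> (nat \<Rightarrow> nat) \<Rightarrow> trm \<Rightarrow> nat" where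
  "tval n e (Var i) = e i"
| "tval n e Len = n"
| "tval n e (Const c) = c"
| "tval n e (Add s t) = tval n e s + tval n e t"
| "tval n e (Mul s t) = tval n e s * tval n e t"

text \<open>\<open>X\<close> holds the positions of the 1-bits of the input of length \<open>n\<close>, and \<open>Y\<close> is
  the certificate. Variables are de Bruijn indices; \<open>Nor\<close> and the negated bounded
  quantifier \<open>NEx\<close> are the only connectives because an argument of an argumentation framework
  computes the NOR of its attackers.\<close>

datatype fm = Leq trm trm | InX trm | InY trm | Nor fm fm | NEx trm fm

primrec sat :: "nat \<Rightarrow> nat set \<Rightarrow> nat set \<Rightarrow> (nat \<Rightarrow> nat) \<Rightarrow> fm \<Rightarrow> bool" where
  "sat n X Y e (Leq s t) \<longleftrightarrow> tval n e s \<le> tval n e t"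
| "sat n X Y e (InX t) \<longleftrightarrow> tval n e t \<in> X"
| "sat n X Y e (InY t) \<longleftrightarrow> tval n e t \<in> Y"
| "sat n X Y e (Nor f g) \<longleftrightarrow> \<not> sat n X Y e f \<and> \<not> sat n X Y e g"
| "sat n X Y e (NEx t f) \<longleftrightarrow> \<not> (\<exists>i<tval n e t. sat n X Y (case_nat i e) f)"

type_synonym pred = "nat \<Rightarrow> nat set \<Rightarrow> nat set \<Rightarrow> (nat \<Rightarrow> nat) \<Rightarrow> bool"
type_synonym func = "nat \<Rightarrow> nat set \<Rightarrow> nat set \<Rightarrow> (nat \<Rightarrow> nat) \<Rightarrow> nat"

definition definable :: "pred \<Rightarrow> bool" where
  "definable P \<longleftrightarrow> (\<exists>f. \<forall>n X Y e. P n X Y e \<longleftrightarrow> sat n X Y e f)"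

definition is_term :: "(nat \<Rightarrow> (nat \<Rightarrow> nat) \<Rightarrow> nat) \<Rightarrow> bool" where
  "is_term g \<longleftrightarrow> (\<exists>t. \<forall>n e. g n e = tval n e t)"

text \<open>Terms know only addition and multiplication, so other functions enter formulas through
  their graphs. The bounding term makes it possible to quantify over the value with a bounded
  quantifier. In the graph, index 0 is the value and the arguments are shifted by one.\<close>

definition definable_fun :: "func \<Rightarrow> bool" where
  "definable_fun f \<longleftrightarrow>
     (\<exists>g. is_term g \<and> (\<forall>n X Y e. f n X Y e \<le> g n e)) \<and>
     definable (\<lambda>n X Y e. e 0 = f n X Y (\<lambda>i. e (Suc i)))"

lemma definableI: "(\<And>n X Y e. P n X Y e \<longleftrightarrow> sat n X Y e f) \<Longrightarrow> definable P"
  unfolding definable_def by blast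

lemma definableE:
  assumes "definable P" obtains f where "P = (\<lambda>n X Y e. sat n X Y e f)"
  using assms unfolding definable_def by blast

lemma is_term_tval: "is_term (\<lambda>n e. tval n e t)"
  unfolding is_term_def by blast

lemma is_termE:
  assumes "is_term g" obtains t where "g = (\<lambda>n e. tval n e t)"
  using assms unfolding is_term_def by blast

lemma is_term_intros:
  "is_term (\<lambda>n e. e i)" "is_term (\<lambda>n e. n)" "is_term (\<lambda>n e. c)"
  "is_term f \<Longrightarrow> is_term g \<Longrightarrow> is_term (\<lambda>n e. f n e + g n e)"
  "is_term f \<Longrightarrow> is_term g \<Longrightarrow> is_term (\<lambda>n e. f n e * g n e)"
  using is_term_tval[of "Var i"] is_term_tval[of Len] is_term_tval[of "Const c"]
  by (auto simp: is_term_def simp flip: tval.simps(4,5))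

section \<open>Closure of definability under connectives\<close>

named_theorems definable_intros

lemma definable_nor:
  assumes "definable P" "definable Q"
  shows "definable (\<lambda>n X Y e. \<not> P n X Y e \<and> \<not> Q n X Y e)"
  proof -
  obtain f g where "P = (\<lambda>n X Y e. sat n X Y e f)" "Q = (\<lambda>n X Y e. sat n X Y e g)"
    using assms by (elim definableE)
  then show ?thesis by (intro definableI[of _ "Nor f g"]) simp
qed

lemma definable_not [definable_intros]: "definable P \<Longrightarrow> definable (\<lambda>n X Y e. \<not> P n X Y e)"
  using definable_nor[of P P] by simp

lemma definable_disj [definable_intros]:
  "definable P \<Longrightarrow> definable Q \<Longrightarrow> definable (\<lambda>n X Y e. P n X Y e \<or> Q n X Y e)"
  using definable_not[OF definable_nor[of P Q]] by simp

lemma definable_conj [definable_intros]: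
  "definable P \<Longrightarrow> definable Q \<Longrightarrow> definable (\<lambda>n X Y e. P n X Y e \<and> Q n X Y e)"
  using definable_nor[OF definable_not definable_not, of P Q] by simp

lemma definable_imp [definable_intros]:
  "definable P \<Longrightarrow> definable Q \<Longrightarrow> definable (\<lambda>n X Y e. P n X Y e \<longrightarrow> Q n X Y e)"
  using definable_disj[OF definable_not, of P Q] by (simp only: imp_conv_disj)

lemma definable_iff [definable_intros]:
  "definable P \<Longrightarrow> definable Q \<Longrightarrow> definable (\<lambda>n X Y e. P n X Y e \<longleftrightarrow> Q n X Y e)"
  using definable_conj[OF definable_imp definable_imp, of P Q Q P] by (simp only: iff_conv_conj_imp)

lemma definable_If [definable_intros]:
  "definable P \<Longrightarrow> definable Q \<Longrightarrow> definable R \<Longrightarrow>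
   definable (\<lambda>n X Y e. if P n X Y e then Q n X Y e else R n X Y e)"
  using definable_conj[OF definable_imp[of P Q] definable_imp[OF definable_not[of P], of R]]
  by (simp add: if_bool_eq_conj)

lemma definable_const [definable_intros]: "definable (\<lambda>n X Y e. c)"
proof -
  have "definable (\<lambda>n X Y e. 0 \<le> (0::nat))"
    by (rule definableI[of _ "Leq (Const 0) (Const 0)"]) simp
  from this definable_not[OF this] show ?thesis by (cases c) simp_all
qed

text \<open>Quantification over a fixed finite set, such as the transitions of a machine, is a
  finite disjunction, so the predicate may depend on \<open>a\<close> in an arbitrary way.\<close>

lemma definable_Bex_const [definable_intros]:
  assumes "finite A" "\<And>a. a \<in> A \<Longrightarrow> definable (P a)"
  shows "definable (\<lambda>n X Y e. \<exists>a\<in>A. P a n X Y e)"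
  using assms
proof (induction A)
  case (insert a A)
  then have "definable (\<lambda>n X Y e. P a n X Y e \<or> (\<exists>a\<in>A. P a n X Y e))"
    by (intro definable_disj) simp_all
  then show ?case by simp
qed (simp add: definable_const)

lemma definable_Ball_const [definable_intros]:
  assumes "finite A" "\<And>a. a \<in> A \<Longrightarrow> definable (P a)"
  shows "definable (\<lambda>n X Y e. \<forall>a\<in>A. P a n X Y e)"
  using definable_not[OF definable_Bex_const[OF assms(1) definable_not[OF assms(2)]]] by simp

section \<open>Renaming of variables and substitution of functions\<close>

lemma tval_rename: "\<exists>t'. \<forall>n e. tval n (\<lambda>i. e (r i)) t = tval n e t'"
proof (induction t)
  case (Var i) then show ?case by (intro exI[of _ "Var (r i)"]) simp
next
  case Len then show ?case by (intro exI[of _ Len]) simp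
next
  case (Const c) then show ?case by (intro exI[of _ "Const c"]) simp
next
  case (Add s t)
  then obtain s' t' where "\<forall>n e. tval n (\<lambda>i. e (r i)) s = tval n e s'"
    "\<forall>n e. tval n (\<lambda>i. e (r i)) t = tval n e t'" by blast
  then show ?case by (intro exI[of _ "Add s' t'"]) simp
next
  case (Mul s t)
  then obtain s' t' where "\<forall>n e. tval n (\<lambda>i. e (r i)) s = tval n e s'"
    "\<forall>n e. tval n (\<lambda>i. e (r i)) t = tval n e t'" by blast
  then show ?case by (intro exI[of _ "Mul s' t'"]) simp
qed

lemma sat_rename: "\<exists>f'. \<forall>n X Y e. sat n X Y (\<lambda>i. e (r i)) f \<longleftrightarrow> sat n X Y e f'"
proof (induction f arbitrary: r)
  case (Leq s t)
  obtain s' t' where "\<forall>n e. tval n (\<lambda>i. e (r i)) s = tval n e s'"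
    "\<forall>n e. tval n (\<lambda>i. e (r i)) t = tval n e t'" using tval_rename by metis
  then show ?case by (intro exI[of _ "Leq s' t'"]) simp
next
  case (InX t)
  obtain t' where "\<forall>n e. tval n (\<lambda>i. e (r i)) t = tval n e t'" using tval_rename by metis
  then show ?case by (intro exI[of _ "InX t'"]) simp
next
  case (InY t)
  obtain t' where "\<forall>n e. tval n (\<lambda>i. e (r i)) t = tval n e t'" using tval_rename by metis
  then show ?case by (intro exI[of _ "InY t'"]) simp
next
  case (Nor f g)
  then obtain f' g' where "\<forall>n X Y e. sat n X Y (\<lambda>i. e (r i)) f \<longleftrightarrow> sat n X Y e f'"
    "\<forall>n X Y e. sat n X Y (\<lambda>i. e (r i)) g \<longleftrightarrow> sat n X Y e g'" by metis
  then show ?case by (intro exI[of _ "Nor f' g'"]) simp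
next
  case (NEx t f)
  obtain t' where t': "\<forall>n e. tval n (\<lambda>i. e (r i)) t = tval n e t'" using tval_rename by metis
  \<comment> \<open>Below the quantifier index 0 is the bound variable; it stays fixed and the
    renaming is shifted past it.\<close>
  let ?r = "case_nat 0 (\<lambda>i. Suc (r i))"
  obtain f' where f': "\<forall>n X Y e. sat n X Y (\<lambda>i. e (?r i)) f \<longleftrightarrow> sat n X Y e f'"
    using NEx by meson
  have "(\<lambda>i. case_nat v e (?r i)) = case_nat v (\<lambda>i. e (r i))" for v and e :: "nat \<Rightarrow> nat"
    by (auto split: nat.split)
  then have "sat n X Y (case_nat v (\<lambda>i. e (r i))) f \<longleftrightarrow> sat n X Y (case_nat v e) f'" for n X Y v e
    using f' by metis
  with t' show ?case by (intro exI[of _ "NEx t' f'"]) simp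
qed

lemma definable_rename:
  assumes "definable P" shows "definable (\<lambda>n X Y e. P n X Y (\<lambda>i. e (r i)))"
proof -
  obtain f where "P = (\<lambda>n X Y e. sat n X Y e f)" using assms by (rule definableE)
  then show ?thesis using sat_rename[of r f] unfolding definable_def by simp
qed

lemma is_term_rename:
  assumes "is_term g" shows "is_term (\<lambda>n e. g n (\<lambda>i. e (r i)))"
proof -
  obtain t where "g = (\<lambda>n e. tval n e t)" using assms by (rule is_termE)
  then show ?thesis using tval_rename[of r t] unfolding is_term_def by simp
qed

lemma definable_fun_rename:
  assumes "definable_fun f" shows "definable_fun (\<lambda>n X Y e. f n X Y (\<lambda>i. e (r i)))"
proof -
  obtain g where g: "is_term g" "\<And>n X Y e. f n X Y e \<le> g n e"
    and f: "definable (\<lambda>n X Y e. e 0 = f n X Y (\<lambda>i. e (Suc i)))"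
    using assms unfolding definable_fun_def by blast
  have "definable (\<lambda>n X Y e. e 0 = f n X Y (\<lambda>i. e (Suc (r i))))"
    using definable_rename[OF f, of "case_nat 0 (\<lambda>i. Suc (r i))"] by simp
  then show ?thesis using g is_term_rename[OF g(1), of r] unfolding definable_fun_def
    by (auto intro!: exI[of _ "\<lambda>n e. g n (\<lambda>i. e (r i))"])
qed

lemma definable_leq_term:
  assumes "is_term f" "is_term g" shows "definable (\<lambda>n X Y e. f n e \<le> g n e)"
  proof -
  obtain s t where "f = (\<lambda>n e. tval n e s)" "g = (\<lambda>n e. tval n e t)"
    using assms by (elim is_termE)
  then show ?thesis by (intro definableI[of _ "Leq s t"]) simp
qed

lemma definable_eq_term:
  assumes "is_term f" "is_term g" shows "definable (\<lambda>n X Y e. f n e = g n e)"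
  using definable_conj[OF definable_leq_term definable_leq_term, OF assms assms(2,1)]
  by (simp add: eq_iff)

text \<open>The hypothesis presents the body as a function of the outer environment and the bound
  value; in this form higher-order unification finds \<open>Q\<close> when the rule is applied to a
  concrete predicate.\<close>

lemma definable_ex_term:
  assumes "is_term g" "definable (\<lambda>n X Y e. Q n X Y (\<lambda>i. e (Suc i)) (e 0))"
  shows "definable (\<lambda>n X Y e. \<exists>i<g n e. Q n X Y e i)"
proof -
  obtain t where t: "g = (\<lambda>n e. tval n e t)" using assms(1) by (rule is_termE)
  obtain f where f: "(\<lambda>n X Y e. Q n X Y (\<lambda>i. e (Suc i)) (e 0)) = (\<lambda>n X Y e. sat n X Y e f)"
    using assms(2) by (rule definableE)
  have "Q n X Y e i \<longleftrightarrow> sat n X Y (case_nat i e) f" for n X Y e i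
    using fun_cong[OF fun_cong[OF fun_cong[OF fun_cong[OF f]]], of n X Y "case_nat i e"] by simp
  then have "definable (\<lambda>n X Y e. \<not> (\<exists>i<g n e. Q n X Y e i))"
    using t by (intro definableI[of _ "NEx t f"]) simp
  then show ?thesis using definable_not by fastforce
qed

text \<open>The value of \<open>f\<close> is introduced by a quantifier that is bounded by the term
  for \<open>f\<close>; one is added because the bound is strict.\<close>

lemma definable_subst:
  assumes "definable (\<lambda>n X Y e. Q n X Y (\<lambda>i. e (Suc i)) (e 0))" "definable_fun f"
  shows "definable (\<lambda>n X Y e. Q n X Y e (f n X Y e))"
proof -
  obtain g where g: "is_term g" "\<And>n X Y e. f n X Y e \<le> g n e"
    and f: "definable (\<lambda>n X Y e. e 0 = f n X Y (\<lambda>i. e (Suc i)))"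
    using assms unfolding definable_fun_def by blast
  have "definable (\<lambda>n X Y e. \<exists>v<g n e + 1. v = f n X Y e \<and> Q n X Y e v)"
    using assms f g by (intro definable_ex_term definable_conj is_term_intros)
  moreover have "(\<exists>v<g n e + 1. v = f n X Y e \<and> Q n X Y e v) \<longleftrightarrow> Q n X Y e (f n X Y e)" for n X Y e
    using g(2)[of n X Y e] by (simp add: less_Suc_eq_le)
  ultimately show ?thesis by simp
qed

lemma definable_subst2:
  assumes "definable (\<lambda>n X Y e. Q n X Y (\<lambda>i. e (Suc (Suc i))) (e 1) (e 0))"
    "definable_fun f" "definable_fun g"
  shows "definable (\<lambda>n X Y e. Q n X Y e (f n X Y e) (g n X Y e))"
proof -
  have "definable (\<lambda>n X Y e. Q n X Y (\<lambda>i. e (Suc i)) (e 0) (g n X Y (\<lambda>i. e (Suc i))))"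
    using definable_subst[OF _ definable_fun_rename[OF assms(3), of Suc],
      of "\<lambda>n X Y e v. Q n X Y (\<lambda>i. e (Suc i)) (e 0) v"] assms(1) by simp
  from definable_subst[OF this assms(2)] show ?thesis by simp
qed

lemma definable_fun_term:
  assumes "is_term f" shows "definable_fun (\<lambda>n X Y e. f n e)"
proof -
  have "definable (\<lambda>n X Y e. e 0 = f n (\<lambda>i. e (Suc i)))"
    by (rule definable_eq_term[OF is_term_intros(1) is_term_rename[OF assms]])
  then show ?thesis unfolding definable_fun_def using assms by blast
qed

section \<open>Atoms, bounded quantifiers and arithmetic functions\<close>

lemma definable_fun_var [definable_intros]: "definable_fun (\<lambda>n X Y e. e i)"
  and definable_fun_len [definable_intros]: "definable_fun (\<lambda>n X Y e. n)"
  and definable_fun_const [definable_intros]: "definable_fun (\<lambda>n X Y e. c)"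
  by (intro definable_fun_term is_term_intros)+

lemma definable_leq [definable_intros]:
  "definable_fun f \<Longrightarrow> definable_fun g \<Longrightarrow> definable (\<lambda>n X Y e. f n X Y e \<le> g n X Y e)"
  by (rule definable_subst2[where Q = "\<lambda>n X Y e a b. a \<le> b"])
    (intro definable_leq_term is_term_intros)

lemma definable_eq [definable_intros]:
  "definable_fun f \<Longrightarrow> definable_fun g \<Longrightarrow> definable (\<lambda>n X Y e. f n X Y e = g n X Y e)"
  by (rule definable_subst2[where Q = "\<lambda>n X Y e a b. a = b"])
    (intro definable_eq_term is_term_intros)

lemma definable_less [definable_intros]:
  assumes "definable_fun f" "definable_fun g"
  shows "definable (\<lambda>n X Y e. f n X Y e < g n X Y e)"
  using definable_not[OF definable_leq[OF assms(2,1)]] by (simp add: not_le)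

lemma definable_in_X [definable_intros]:
  assumes "definable_fun f" shows "definable (\<lambda>n X Y e. f n X Y e \<in> X)"
  by (rule definable_subst[OF _ assms, where Q = "\<lambda>n X Y e a. a \<in> X"])
    (rule definableI[of _ "InX (Var 0)"], simp)

lemma definable_in_Y [definable_intros]:
  assumes "definable_fun f" shows "definable (\<lambda>n X Y e. f n X Y e \<in> Y)"
  by (rule definable_subst[OF _ assms, where Q = "\<lambda>n X Y e a. a \<in> Y"])
    (rule definableI[of _ "InY (Var 0)"], simp)

lemma definable_ex [definable_intros]:
  assumes "definable_fun f" "definable (\<lambda>n X Y e. Q n X Y (\<lambda>i. e (Suc i)) (e 0))"
  shows "definable (\<lambda>n X Y e. \<exists>i<f n X Y e. Q n X Y e i)"
proof -
  \<comment> \<open>The bound is a variable at first. Below the quantifier it has index 1, so the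
    other variables are shifted by two; afterwards \<open>f\<close> is substituted for it.\<close>
  have "definable (\<lambda>n X Y e. \<exists>i<e 0. Q n X Y (\<lambda>i. e (Suc i)) i)"
    using definable_rename[OF assms(2), of "case_nat 0 (\<lambda>i. Suc (Suc i))"]
    by (intro definable_ex_term is_term_intros) simp
  from definable_subst[OF this assms(1)] show ?thesis by simp
qed

lemma definable_all [definable_intros]:
  assumes "definable_fun f" "definable (\<lambda>n X Y e. Q n X Y (\<lambda>i. e (Suc i)) (e 0))"
  shows "definable (\<lambda>n X Y e. \<forall>i<f n X Y e. Q n X Y e i)"
  using definable_not[OF definable_ex[OF assms(1) definable_not[OF assms(2)]]] by simp

text \<open>One bound dominates the ring operations as well as subtraction and division. Because it
  is monotone, the bounding terms of the arguments can be inserted into it.\<close>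

lemma definable_fun_binary:
  assumes "\<And>a b. h a b \<le> a + b + a * b" "definable (\<lambda>n X Y e. e 2 = h (e 1) (e 0))"
    "definable_fun f" "definable_fun g"
  shows "definable_fun (\<lambda>n X Y e. h (f n X Y e) (g n X Y e))"
proof -
  obtain bf where bf: "is_term bf" "\<And>n X Y e. f n X Y e \<le> bf n e"
    using assms unfolding definable_fun_def by blast
  obtain bg where bg: "is_term bg" "\<And>n X Y e. g n X Y e \<le> bg n e"
    using assms unfolding definable_fun_def by blast
  have h: "definable (\<lambda>n X Y e. e (Suc (Suc 0)) = h (e (Suc 0)) (e 0))"
    using assms(2) by (simp add: numeral_2_eq_2)
  have "definable (\<lambda>n X Y e. e 0 = h (f n X Y (\<lambda>i. e (Suc i))) (g n X Y (\<lambda>i. e (Suc i))))"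
    by (rule definable_subst2[where Q = "\<lambda>n X Y e a b. e 0 = h a b",
          OF _ definable_fun_rename[OF assms(3), of Suc]
          definable_fun_rename[OF assms(4), of Suc]])
      (simp add: h)
  moreover have "h (f n X Y e) (g n X Y e) \<le> bf n e + bg n e + bf n e * bg n e" for n X Y e
    using bf(2)[of n X Y e] bg(2)[of n X Y e]
    by (intro order_trans[OF assms(1)] add_mono mult_mono) auto
  ultimately show ?thesis unfolding definable_fun_def
    using bf(1) bg(1)
    by (intro conjI exI[of _ "\<lambda>n e. bf n e + bg n e + bf n e * bg n e"] is_term_intros allI)
qed

lemma definable_fun_add [definable_intros]:
  "definable_fun f \<Longrightarrow> definable_fun g \<Longrightarrow> definable_fun (\<lambda>n X Y e. f n X Y e + g n X Y e)"
  by (rule definable_fun_binary[where h = "(+)"]) (simp, intro definable_eq_term is_term_intros)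

lemma definable_fun_mult [definable_intros]:
  "definable_fun f \<Longrightarrow> definable_fun g \<Longrightarrow> definable_fun (\<lambda>n X Y e. f n X Y e * g n X Y e)"
  by (rule definable_fun_binary[where h = "(*)"]) (simp, intro definable_eq_term is_term_intros)

lemma definable_fun_diff [definable_intros]:
  assumes "definable_fun f" "definable_fun g"
  shows "definable_fun (\<lambda>n X Y e. f n X Y e - g n X Y e)"
proof (rule definable_fun_binary[where h = "(-)", OF _ _ assms])
  have "definable (\<lambda>n X Y e. (e 1 \<le> e 0 \<and> e 2 = 0) \<or> e 1 = e 2 + e 0)"
    by (intro definable_intros)
  moreover have "(a \<le> b \<and> c = 0) \<or> a = c + b \<longleftrightarrow> c = a - b" for a b c :: nat by auto
  ultimately show "definable (\<lambda>n X Y e. e 2 = e 1 - e 0)" by simp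
qed simp

text \<open>The inequalities of division with remainder characterise the quotient; division by 0,
  which yields 0, is a case of its own.\<close>

lemma definable_fun_div [definable_intros]:
  assumes "definable_fun f" "definable_fun g"
  shows "definable_fun (\<lambda>n X Y e. f n X Y e div g n X Y e)"
proof (rule definable_fun_binary[where h = "(div)", OF _ _ assms])
  have "definable (\<lambda>n X Y e. if e 0 = 0 then e 2 = 0 else
      e 0 * e 2 \<le> e 1 \<and> e 1 < e 0 * e 2 + e 0)" by (intro definable_intros)
  moreover have "(if b = 0 then q = 0 else b * q \<le> a \<and> a < b * q + b) \<longleftrightarrow> q = a div b" for a b q :: nat
    using dividend_less_times_div[of b a]
    by (auto simp: mult.commute intro!: div_nat_eqI[symmetric])
  ultimately show "definable (\<lambda>n X Y e. e 2 = e 1 div e 0)" by simp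
  show "a div b \<le> a + b + a * b" for a b :: nat using div_le_dividend[of a b] by linarith
qed

lemma definable_fun_mod [definable_intros]:
  assumes "definable_fun f" "definable_fun g"
  shows "definable_fun (\<lambda>n X Y e. f n X Y e mod g n X Y e)"
  using definable_fun_diff[OF assms(1) definable_fun_mult[OF definable_fun_div[OF assms] assms(2)]]
  by (simp add: minus_div_mult_eq_mod)

lemma definable_fun_power [definable_intros]:
  "definable_fun f \<Longrightarrow> definable_fun (\<lambda>n X Y e. f n X Y e ^ d)"
  by (induction d) (auto intro: definable_intros)

lemma definable_fun_If [definable_intros]:
  assumes P: "definable P" and fg: "definable_fun f" "definable_fun g"
  shows "definable_fun (\<lambda>n X Y e. if P n X Y e then f n X Y e else g n X Y e)"
proof -
  obtain bf where bf: "is_term bf" "\<And>n X Y e. f n X Y e \<le> bf n e"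
    using fg unfolding definable_fun_def by blast
  obtain bg where bg: "is_term bg" "\<And>n X Y e. g n X Y e \<le> bg n e"
    using fg unfolding definable_fun_def by blast
  have "definable (\<lambda>n X Y e. if P n X Y (\<lambda>i. e (Suc i)) then e 0 = f n X Y (\<lambda>i. e (Suc i))
      else e 0 = g n X Y (\<lambda>i. e (Suc i)))"
    by (rule definable_If[OF definable_rename[OF P, of Suc]
          definable_eq[OF definable_fun_var definable_fun_rename[OF fg(1), of Suc]]
          definable_eq[OF definable_fun_var definable_fun_rename[OF fg(2), of Suc]]])
  moreover have "(if P n X Y e then f n X Y e else g n X Y e) \<le> bf n e + bg n e" for n X Y e
    using bf(2)[of n X Y e] bg(2)[of n X Y e] by auto
  ultimately show ?thesis unfolding definable_fun_def using bf(1) bg(1)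
    by (intro conjI exI[of _ "\<lambda>n e. bf n e + bg n e"] is_term_intros allI) (simp_all add: if_distrib)
qed

lemma definable_fun_Suc [definable_intros]: "definable_fun f \<Longrightarrow> definable_fun (\<lambda>n X Y e. Suc (f n X Y e))"
  using definable_fun_add[of f "\<lambda>n X Y e. 1"] by (simp add: definable_fun_const)

lemma definable_fun_poly [definable_intros]:
  fixes p :: "nat poly"
  shows "definable_fun f \<Longrightarrow> definable_fun (\<lambda>n X Y e. poly p (f n X Y e))"
  by (induction p) (auto intro: definable_intros)

lemma poly_is_term:
  fixes p :: "nat poly"
  shows "\<exists>t. \<forall>n e. tval n e t = poly p n"
proof (induction p)
  case 0
  show ?case by (rule exI[of _ "Const 0"]) simp
next
  case (pCons a p)
  then obtain t where "\<forall>n e. tval n e t = poly p n" by blast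
  then show ?case by (intro exI[of _ "Add (Const a) (Mul Len t)"]) simp
qed

lemma definable_fun_tval:
  assumes "definable_fun l" "\<And>j. definable_fun (s j)"
  shows "definable_fun (\<lambda>n X Y e. tval (l n X Y e) (\<lambda>j. s j n X Y e) t)"
  using assms by (induction t) (auto intro: definable_intros)

text \<open>A formula is evaluated over a computed length and computed sets, by replacing its atoms
  with the definitions of these. In this way a verifier can be used inside another formula, for
  instance on the word that a machine has written as a query.\<close>

lemma definable_comp_sat:
  assumes "definable_fun l" "\<And>j. definable_fun (s j)"
    "definable (\<lambda>n X Y e. A n X Y (\<lambda>i. e (Suc i)) (e 0))"
    "definable (\<lambda>n X Y e. B n X Y (\<lambda>i. e (Suc i)) (e 0))"
  shows "definable (\<lambda>n X Y e.
    sat (l n X Y e) {i. A n X Y e i} {i. B n X Y e i} (\<lambda>j. s j n X Y e) f)"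
  using assms
proof (induction f arbitrary: l s A B)
  case (Leq t u)
  then show ?case using definable_fun_tval[of l s] by (simp add: definable_leq)
next
  case (InX t)
  show ?case using definable_subst[OF InX(3) definable_fun_tval[where t = t, OF InX(1,2)]] by simp
next
  case (InY t)
  show ?case using definable_subst[OF InY(4) definable_fun_tval[where t = t, OF InY(1,2)]] by simp
next
  case (Nor f g)
  then show ?case by (simp add: definable_nor)
next
  case (NEx t f)
  have s: "definable_fun (\<lambda>n X Y e. (case_nat (e 0) (\<lambda>j. s j n X Y (\<lambda>i. e (Suc i)))) j)" for j
    using definable_fun_rename[OF NEx(3)] by (cases j) (simp_all add: definable_fun_var)
  have "definable (\<lambda>n X Y e. sat (l n X Y (\<lambda>i. e (Suc i))) {i. A n X Y (\<lambda>i. e (Suc i)) i}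
      {i. B n X Y (\<lambda>i. e (Suc i)) i} (\<lambda>j. case_nat (e 0) (\<lambda>j. s j n X Y (\<lambda>i. e (Suc i))) j) f)"
    using definable_rename[OF NEx(4), of "case_nat 0 (\<lambda>i. Suc (Suc i))"]
      definable_rename[OF NEx(5), of "case_nat 0 (\<lambda>i. Suc (Suc i))"]
    by (intro NEx.IH[OF definable_fun_rename[where r = Suc, OF NEx.prems(1)] s]) simp_all
  then show ?case
    using definable_not[OF definable_ex[OF definable_fun_tval[where t = t, OF NEx(2,3)]]] by simp
qed

lemma definable_comp:
  assumes "definable P" "definable_fun l"
    "definable (\<lambda>n X Y e. A n X Y (\<lambda>i. e (Suc i)) (e 0))"
    "definable (\<lambda>n X Y e. B n X Y (\<lambda>i. e (Suc i)) (e 0))"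
  shows "definable (\<lambda>n X Y e. P (l n X Y e) {i. A n X Y e i} {i. B n X Y e i} (\<lambda>_. 0))"
proof -
  obtain f where f: "P = (\<lambda>n X Y e. sat n X Y e f)" using assms(1) by (rule definableE)
  show ?thesis using definable_comp_sat[OF assms(2) _ assms(3,4), of "\<lambda>_ _ _ _ _. 0" f]
    by (simp add: f definable_fun_const)
qed

section \<open>An assembly language for Turing machines\<close>

text \<open>All runs from \<open>s\<close> reach \<open>R\<close> within \<open>t\<close> steps; the
  witness \<open>s0\<close> excludes runs that get stuck earlier. For nondeterministic code this is
  a time bound and a restriction of the outcomes at once.\<close>

inductive hits :: "('s \<Rightarrow> 's \<Rightarrow> bool) \<Rightarrow> 's set \<Rightarrow> nat \<Rightarrow> 's \<Rightarrow> bool" for r R where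
  stop: "s \<in> R \<Longrightarrow> hits r R t s"
| go: "r s s0 \<Longrightarrow> (\<And>s'. r s s' \<Longrightarrow> hits r R t s') \<Longrightarrow> hits r R (Suc t) s"

lemma hits_mono: "hits r R t s \<Longrightarrow> t \<le> t' \<Longrightarrow> hits r R t' s"
proof (induction arbitrary: t' rule: hits.induct)
  case (go s s0 t)
  obtain u where "t' = Suc u" "t \<le> u" using go.prems by (cases t') auto
  then show ?case using go by (auto intro: hits.go)
qed (rule hits.stop)

lemma hits_trans:
  assumes "hits r R t s" "\<And>s'. s' \<in> R \<Longrightarrow> hits r Q u s'"
  shows "hits r Q (t + u) s"
  using assms
proof (induction rule: hits.induct)
  case (stop s t)
  then show ?case using hits_mono[of r Q u s "t + u"] by simp
next
  case (go s s0 t)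
  then show ?case by (auto intro: hits.go)
qed

lemma hits_weaken: "hits r R t s \<Longrightarrow> R \<subseteq> Q \<Longrightarrow> hits r Q t s"
  using hits_trans[of r R t s Q 0] by (auto intro: hits.stop)

lemma hits_first:
  assumes "\<And>s'. r s s' \<longleftrightarrow> s' = s1" "hits r R t s1" shows "hits r R (Suc t) s"
  using hits.go[of r s s1 R t] assms by auto

lemma rtranclp_first: "(\<And>s'. r s s' \<longleftrightarrow> s' = s1) \<Longrightarrow> r\<^sup>*\<^sup>* s1 c \<Longrightarrow> r\<^sup>*\<^sup>* s c"
  by (simp add: converse_rtranclp_into_rtranclp)

lemma hits_bound:
  assumes "hits r R t s" "\<And>s' s''. s' \<in> R \<Longrightarrow> \<not> r s' s''" "(r ^^ n) s c"
  shows "n \<le> t" and "\<forall>c'. \<not> r c c' \<Longrightarrow> c \<in> R"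
proof -
  have "n \<le> t \<and> ((\<forall>c'. \<not> r c c') \<longrightarrow> c \<in> R)"
    using assms
  proof (induction arbitrary: n rule: hits.induct)
    case (stop s t)
    then show ?case by (cases n) (auto simp del: relpowp.simps(2) dest: relpowp_Suc_D2)
  next
    case (go s s0 t)
    show ?case
    proof (cases n)
      case 0
      then show ?thesis using go by auto
    next
      case (Suc m)
      then obtain s' where s': "r s s'" "(r ^^ m) s' c"
        using go.prems by (metis relpowp_Suc_E2)
      then show ?thesis using Suc go.IH[OF s'(1) go.prems(1) s'(2)] by auto
    qed
  qed
  then show "n \<le> t" "\<forall>c'. \<not> r c c' \<Longrightarrow> c \<in> R" by auto
qed

text \<open>The two systems are compared only at states with a successor: where the code has ended,
  the machine may still go on, namely by asking its query.\<close>

lemma hits_simulate: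
  assumes "hits r R t s" "I s"
    "\<And>s s'. I s \<Longrightarrow> r s s' \<Longrightarrow> I s'"
    "\<And>s s0 c. I s \<Longrightarrow> r s s0 \<Longrightarrow> r' (g s) c \<longleftrightarrow> (\<exists>s'. r s s' \<and> c = g s')"
  shows "hits r' (g ` R) t (g s)"
  using assms(1,2)
proof (induction rule: hits.induct)
  case (stop s t)
  then show ?case by (auto intro: hits.stop)
next
  case (go s s0 t)
  then show ?case using assms(3)[OF \<open>I s\<close>] assms(4)[OF \<open>I s\<close> go(1)] by (auto intro!: hits.go[of r' "g s" "g s0"])
qed

lemma rtranclp_simulate:
  assumes "r\<^sup>*\<^sup>* s s'" "I s"
    "\<And>s s'. I s \<Longrightarrow> r s s' \<Longrightarrow> I s'"
    "\<And>s s'. I s \<Longrightarrow> r s s' \<Longrightarrow> r' (g s) (g s')"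
  shows "r'\<^sup>*\<^sup>* (g s) (g s')"
proof -
  have "r'\<^sup>*\<^sup>* (g s) (g s') \<and> I s'"
    using assms(1)
    by (induction rule: rtranclp_induct) (use assms in \<open>auto intro: rtranclp.rtrancl_into_rtrancl\<close>)
  then show ?thesis ..
qed

text \<open>Jumps are relative to the address of the instruction; \<open>Br j a d\<close> jumps if head \<open>j\<close>
  reads \<open>a\<close>, and \<open>Flip d\<close> jumps nondeterministically.\<close>

datatype instr = Mv nat move | Put nat nat move | Br nat nat int | Jmp int | Flip int

type_synonym store = "(nat \<Rightarrow> int \<Rightarrow> nat) \<times> (nat \<Rightarrow> int)"

abbreviation jump :: "nat \<Rightarrow> int \<Rightarrow> nat" where
  "jump q d \<equiv> nat (int q + d)"

fun isem :: "instr \<Rightarrow> nat \<Rightarrow> store \<Rightarrow> (nat \<times> store) set" where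
  "isem (Mv j m) q (T, h) = {(Suc q, T, h(j := h j + shift m))}"
| "isem (Put j a m) q (T, h) = {(Suc q, T(j := (T j)(h j := a)), h(j := h j + shift m))}"
| "isem (Br j a d) q (T, h) = {(if T j (h j) = a then jump q d else Suc q, T, h)}"
| "isem (Jmp d) q \<sigma> = {(jump q d, \<sigma>)}"
| "isem (Flip d) q \<sigma> = {(Suc q, \<sigma>), (jump q d, \<sigma>)}"

definition istep :: "instr list \<Rightarrow> nat \<times> store \<Rightarrow> nat \<times> store \<Rightarrow> bool" where
  "istep p = (\<lambda>(q, \<sigma>) s'. q < length p \<and> s' \<in> isem (p ! q) q \<sigma>)"

definition located :: "instr list \<Rightarrow> nat \<Rightarrow> instr list \<Rightarrow> bool" where
  "located p a c \<longleftrightarrow> (\<exists>u v. p = u @ c @ v \<and> length u = a)"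

text \<open>The quantifier over all programs containing \<open>c\<close> makes such statements
  composable. The first half says that there are no outcomes besides \<open>R\<close>, the second
  that each of them occurs; existential acceptance needs both.\<close>

definition exec :: "instr list \<Rightarrow> store \<Rightarrow> store set \<Rightarrow> nat \<Rightarrow> bool" where
  "exec c \<sigma> R t \<longleftrightarrow> (\<forall>p a. located p a c \<longrightarrow>
     hits (istep p) (Pair (a + length c) ` R) t (a, \<sigma>) \<and>
     (\<forall>\<sigma>'\<in>R. (istep p)\<^sup>*\<^sup>* (a, \<sigma>) (a + length c, \<sigma>')))"

lemma located_append:
  "located p a (c @ d) \<Longrightarrow> located p a c" "located p a (c @ d) \<Longrightarrow> located p (a + length c) d"
  unfolding located_def by (metis append.assoc, metis append.assoc length_append)

lemma located_Cons:
  "located p a (i # c) \<Longrightarrow> located p (Suc a) c" "located p a (i # c) \<Longrightarrow> a < length p \<and> p ! a = i"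
proof -
  show "located p a (i # c) \<Longrightarrow> located p (Suc a) c"
    using located_append(2)[of p a "[i]" c] by simp
  show "located p a (i # c) \<Longrightarrow> a < length p \<and> p ! a = i"
    by (auto simp: located_def nth_append)
qed

lemma exec_Nil: "exec [] \<sigma> {\<sigma>} t"
  unfolding exec_def by (auto intro: hits.stop)

lemma exec_mono: "exec c \<sigma> R t \<Longrightarrow> t \<le> t' \<Longrightarrow> exec c \<sigma> R t'"
  unfolding exec_def by (blast intro: hits_mono)

lemma exec_append:
  assumes "exec c \<sigma> R t" "\<And>\<sigma>'. \<sigma>' \<in> R \<Longrightarrow> exec d \<sigma>' (Q \<sigma>') u"
  shows "exec (c @ d) \<sigma> (\<Union>\<sigma>'\<in>R. Q \<sigma>') (t + u)"
  unfolding exec_def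
proof (intro allI impI conjI)
  fix p a assume "located p a (c @ d)"
  then have l: "located p a c" "located p (a + length c) d" using located_append by blast+
  let ?b = "a + length (c @ d)" and ?R = "\<Union>\<sigma>'\<in>R. Q \<sigma>'"
  have b: "?b = a + length c + length d" by simp
  have d: "hits (istep p) (Pair ?b ` ?R) u (a + length c, \<sigma>')"
    "\<forall>\<sigma>''\<in>Q \<sigma>'. (istep p)\<^sup>*\<^sup>* (a + length c, \<sigma>') (?b, \<sigma>'')" if "\<sigma>' \<in> R" for \<sigma>'
  proof -
    have "hits (istep p) (Pair ?b ` Q \<sigma>') u (a + length c, \<sigma>')"
      using assms(2)[OF that] l(2) unfolding exec_def b by blast
    then show "hits (istep p) (Pair ?b ` ?R) u (a + length c, \<sigma>')"
      by (rule hits_weaken) (use that in auto)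
    show "\<forall>\<sigma>''\<in>Q \<sigma>'. (istep p)\<^sup>*\<^sup>* (a + length c, \<sigma>') (?b, \<sigma>'')"
      using assms(2)[OF that] l(2) unfolding exec_def b by blast
  qed
  have c: "hits (istep p) (Pair (a + length c) ` R) t (a, \<sigma>)"
    "\<forall>\<sigma>'\<in>R. (istep p)\<^sup>*\<^sup>* (a, \<sigma>) (a + length c, \<sigma>')"
    using assms(1) l unfolding exec_def by blast+
  show "hits (istep p) (Pair ?b ` ?R) (t + u) (a, \<sigma>)"
    by (rule hits_trans[OF c(1)]) (use d in auto)
  show "\<forall>\<sigma>'\<in>?R. (istep p)\<^sup>*\<^sup>* (a, \<sigma>) (?b, \<sigma>')"
    using c(2) d(2) by (blast intro: rtranclp_trans)
qed

lemma exec_Union: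
  "I \<noteq> {} \<Longrightarrow> (\<And>i. i \<in> I \<Longrightarrow> exec c \<sigma> (Q i) t) \<Longrightarrow> exec c \<sigma> (\<Union>i\<in>I. Q i) t"
  unfolding exec_def by (fastforce intro: hits_weaken[where R = "Pair _ ` Q _"])

abbreviation exec1 :: "instr list \<Rightarrow> store \<Rightarrow> store \<Rightarrow> nat \<Rightarrow> bool" where
  "exec1 c \<sigma> \<sigma>' t \<equiv> exec c \<sigma> {\<sigma>'} t"

lemma exec1_append: "exec1 c \<sigma> \<sigma>' t \<Longrightarrow> exec1 d \<sigma>' \<sigma>'' u \<Longrightarrow> exec1 (c @ d) \<sigma> \<sigma>'' (t + u)"
  using exec_append[of c \<sigma> "{\<sigma>'}" t d "\<lambda>_. {\<sigma>''}" u] by simp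

lemma exec_single:
  assumes "\<And>q. isem i q \<sigma> = Pair (Suc q) ` R" "R \<noteq> {}"
  shows "exec [i] \<sigma> R 1"
  unfolding exec_def
proof (intro allI impI conjI)
  fix p a assume "located p a [i]"
  then have s: "istep p (a, \<sigma>) s' \<longleftrightarrow> s' \<in> Pair (Suc a) ` R" for s'
    using located_Cons[of p a i "[]"] assms(1)[of a] by (simp add: istep_def)
  show "\<forall>\<sigma>'\<in>R. (istep p)\<^sup>*\<^sup>* (a, \<sigma>) (a + length [i], \<sigma>')" using s by auto
  obtain \<sigma>0 where "\<sigma>0 \<in> R" using assms(2) by auto
  then have "hits (istep p) (Pair (Suc a) ` R) (Suc 0) (a, \<sigma>)"
    by (intro hits.go[of "istep p" "(a, \<sigma>)" "(Suc a, \<sigma>0)"] hits.stop) (use s in auto)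
  then show "hits (istep p) (Pair (a + length [i]) ` R) 1 (a, \<sigma>)" by simp
qed

lemma exec_Mv: "exec1 [Mv j m] (T, h) (T, h(j := h j + shift m)) 1"
  and exec_Put: "exec1 [Put j a m] (T, h) (T(j := (T j)(h j := a)), h(j := h j + shift m)) 1"
  by (rule exec_single; simp)+

lemma exec1_Cons:
  "exec1 [i] \<sigma> \<sigma>' 1 \<Longrightarrow> exec1 c \<sigma>' \<sigma>'' t \<Longrightarrow> exec1 (i # c) \<sigma> \<sigma>'' (Suc t)"
  using exec1_append[of "[i]" \<sigma> \<sigma>' 1 c \<sigma>'' t] by simp

section \<open>Conditionals and loops\<close>

definition ite :: "nat \<Rightarrow> nat \<Rightarrow> instr list \<Rightarrow> instr list \<Rightarrow> instr list" where
  "ite j a c d = Br j a (int (length d) + 2) # d @ Jmp (int (length c) + 1) # c"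

text \<open>The symbol \<open>a\<close> is the exit condition: if tape \<open>j\<close> is a counter
  and \<open>a\<close> its mark 1, the loop runs until the counter is 0.\<close>

definition while :: "nat \<Rightarrow> nat \<Rightarrow> instr list \<Rightarrow> instr list" where
  "while j a c = Br j a (int (length c) + 2) # c @ [Jmp (- int (length c) - 1)]"

lemma exec_ite_True:
  assumes "T j (h j) = a" "exec c (T, h) R t"
  shows "exec (ite j a c d) (T, h) R (Suc t)"
  unfolding exec_def
proof (intro allI impI conjI)
  fix p b assume l: "located p b (ite j a c d)"
  let ?b = "Suc (Suc (b + length d))"
  have 1: "istep p (b, T, h) s' \<longleftrightarrow> s' = (?b, T, h)" for s'
    using located_Cons(2)[OF l[unfolded ite_def]] assms(1)
    by (auto simp: istep_def nat_add_distrib intro!: arg_cong[of _ _ nat])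
  have "located p ?b c"
    using located_append(2)[of p b "Br j a (int (length d) + 2) # d @ [Jmp (int (length c) + 1)]" c] l
    by (simp add: ite_def)
  moreover have e: "b + length (ite j a c d) = ?b + length c" by (simp add: ite_def)
  ultimately have 2: "hits (istep p) (Pair (b + length (ite j a c d)) ` R) t (?b, T, h)"
    "\<forall>\<sigma>'\<in>R. (istep p)\<^sup>*\<^sup>* (?b, T, h) (b + length (ite j a c d), \<sigma>')"
    using assms(2) unfolding exec_def e by blast+
  show "hits (istep p) (Pair (b + length (ite j a c d)) ` R) (Suc t) (b, T, h)"
    using hits_first[OF 1 2(1)] .
  show "\<forall>\<sigma>'\<in>R. (istep p)\<^sup>*\<^sup>* (b, T, h) (b + length (ite j a c d), \<sigma>')"
    using rtranclp_first[of "istep p", OF 1] 2(2) by blast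
qed

lemma exec_ite_False:
  assumes "T j (h j) \<noteq> a" "exec d (T, h) R t"
  shows "exec (ite j a c d) (T, h) R (t + 2)"
  unfolding exec_def
proof (intro allI impI conjI)
  fix p b assume l: "located p b (ite j a c d)"
  let ?b = "Suc (b + length d)" and ?e = "b + length (ite j a c d)"
  have 1: "istep p (b, T, h) s' \<longleftrightarrow> s' = (Suc b, T, h)" for s'
    using located_Cons(2)[OF l[unfolded ite_def]] assms(1) by (auto simp: istep_def)
  have l2: "located p (Suc b) (d @ Jmp (int (length c) + 1) # c)"
    using located_Cons(1)[OF l[unfolded ite_def]] .
  have 2: "hits (istep p) (Pair ?b ` R) t (Suc b, T, h)"
    "\<forall>\<sigma>'\<in>R. (istep p)\<^sup>*\<^sup>* (Suc b, T, h) (?b, \<sigma>')"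
    using located_append(1)[OF l2] assms(2) unfolding exec_def by fastforce+
  have 3: "istep p (?b, \<sigma>') s' \<longleftrightarrow> s' = (?e, \<sigma>')" for s' \<sigma>'
    using located_Cons(2)[OF located_append(2)[OF l2]]
    by (auto simp: istep_def ite_def intro!: arg_cong[of _ _ nat])
  have "hits (istep p) (Pair ?e ` R) (Suc 0) s" if "s \<in> Pair ?b ` R" for s
  proof -
    obtain \<sigma>' where "s = (?b, \<sigma>')" "\<sigma>' \<in> R" using \<open>s \<in> Pair ?b ` R\<close> by blast
    then show ?thesis using hits_first[of "istep p", OF 3 hits.stop] by blast
  qed
  from hits_first[OF 1 hits_trans[OF 2(1) this]]
  show "hits (istep p) (Pair ?e ` R) (t + 2) (b, T, h)" by simp
  show "\<forall>\<sigma>'\<in>R. (istep p)\<^sup>*\<^sup>* (b, T, h) (?e, \<sigma>')"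
    using rtranclp_first[of "istep p", OF 1] 2(2) rtranclp_first[of "istep p", OF 3]
    by (meson rtranclp.rtrancl_refl rtranclp_trans)
qed

lemma exec_while_False:
  assumes "T j (h j) = a" shows "exec1 (while j a c) (T, h) (T, h) 1"
  unfolding exec_def
proof (intro allI impI)
  fix p b assume l: "located p b (while j a c)"
  have 1: "istep p (b, T, h) s' \<longleftrightarrow> s' = (b + length (while j a c), T, h)" for s'
    using located_Cons(2)[OF l[unfolded while_def]] assms
    by (auto simp: istep_def while_def intro!: arg_cong[of _ _ nat])
  show "hits (istep p) (Pair (b + length (while j a c)) ` {(T, h)}) 1 (b, T, h) \<and>
    (\<forall>\<sigma>'\<in>{(T, h)}. (istep p)\<^sup>*\<^sup>* (b, T, h) (b + length (while j a c), \<sigma>'))"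
    using hits_first[of "istep p", OF 1 hits.stop, of _ 0] rtranclp_first[of "istep p", OF 1] by simp
qed

lemma exec_while_True:
  assumes "T j (h j) \<noteq> a" "exec c (T, h) R t"
    "\<And>\<sigma>'. \<sigma>' \<in> R \<Longrightarrow> exec (while j a c) \<sigma>' (Q \<sigma>') u"
  shows "exec (while j a c) (T, h) (\<Union>\<sigma>'\<in>R. Q \<sigma>') (t + 2 + u)"
  unfolding exec_def
proof (intro allI impI conjI)
  fix p b assume l: "located p b (while j a c)"
  let ?b = "Suc (b + length c)" and ?e = "b + length (while j a c)" and ?R = "\<Union>\<sigma>'\<in>R. Q \<sigma>'"
  have 1: "istep p (b, T, h) s' \<longleftrightarrow> s' = (Suc b, T, h)" for s'
    using located_Cons(2)[OF l[unfolded while_def]] assms(1) by (auto simp: istep_def)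
  have l2: "located p (Suc b) (c @ [Jmp (- int (length c) - 1)])"
    using located_Cons(1)[OF l[unfolded while_def]] .
  have 2: "hits (istep p) (Pair ?b ` R) t (Suc b, T, h)"
    "\<forall>\<sigma>'\<in>R. (istep p)\<^sup>*\<^sup>* (Suc b, T, h) (?b, \<sigma>')"
    using located_append(1)[OF l2] assms(2) unfolding exec_def by fastforce+
  have 3: "istep p (?b, \<sigma>') s' \<longleftrightarrow> s' = (b, \<sigma>')" for s' \<sigma>'
    using located_Cons(2)[OF located_append(2)[OF l2]]
    by (auto simp: istep_def)
  have 4: "hits (istep p) (Pair ?e ` ?R) u (b, \<sigma>')"
    "\<forall>\<sigma>''\<in>Q \<sigma>'. (istep p)\<^sup>*\<^sup>* (b, \<sigma>') (?e, \<sigma>'')" if "\<sigma>' \<in> R" for \<sigma>'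
  proof -
    have "hits (istep p) (Pair ?e ` Q \<sigma>') u (b, \<sigma>')"
      using assms(3)[OF that] l unfolding exec_def by blast
    then show "hits (istep p) (Pair ?e ` ?R) u (b, \<sigma>')"
      by (rule hits_weaken) (use that in auto)
    show "\<forall>\<sigma>''\<in>Q \<sigma>'. (istep p)\<^sup>*\<^sup>* (b, \<sigma>') (?e, \<sigma>'')"
      using assms(3)[OF that] l unfolding exec_def by blast
  qed
  have "hits (istep p) (Pair ?e ` ?R) (Suc u) s" if "s \<in> Pair ?b ` R" for s
    using that 4(1) by (auto intro!: hits_first[of "istep p", OF 3])
  from hits_first[OF 1 hits_trans[OF 2(1) this]]
  show "hits (istep p) (Pair ?e ` ?R) (t + 2 + u) (b, T, h)" by simp
  show "\<forall>\<sigma>'\<in>?R. (istep p)\<^sup>*\<^sup>* (b, T, h) (?e, \<sigma>')"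
  proof
    fix \<sigma>'' assume "\<sigma>'' \<in> ?R"
    then obtain \<sigma>' where "\<sigma>' \<in> R" "\<sigma>'' \<in> Q \<sigma>'" by blast
    then have "(istep p)\<^sup>*\<^sup>* (Suc b, T, h) (?b, \<sigma>')" "(istep p)\<^sup>*\<^sup>* (b, \<sigma>') (?e, \<sigma>'')"
      using 2 4 by blast+
    then show "(istep p)\<^sup>*\<^sup>* (b, T, h) (?e, \<sigma>'')"
      using rtranclp_first[of "istep p", OF 1] rtranclp_first[of "istep p", OF 3]
      by (meson rtranclp_trans)
  qed
qed

text \<open>Outcomes are indexed, for instance by guessed bits, and several indices may give the
  same store. They are grouped by store before the continuation is applied.\<close>

lemma exec_append_image:
  assumes "exec c \<sigma> (f ` I) t" "\<And>i. i \<in> I \<Longrightarrow> exec d (f i) (Q i) u"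
  shows "exec (c @ d) \<sigma> (\<Union>i\<in>I. Q i) (t + u)"
proof -
  have "exec d \<sigma>' (\<Union>i\<in>{i \<in> I. f i = \<sigma>'}. Q i) u" if "\<sigma>' \<in> f ` I" for \<sigma>'
    by (rule exec_Union) (use that assms(2) in \<open>blast, fastforce\<close>)
  from exec_append[OF assms(1) this]
  have "exec (c @ d) \<sigma> (\<Union>\<sigma>'\<in>f ` I. \<Union>i\<in>{i \<in> I. f i = \<sigma>'}. Q i) (t + u)" .
  moreover have "(\<Union>\<sigma>'\<in>f ` I. \<Union>i\<in>{i \<in> I. f i = \<sigma>'}. Q i) = (\<Union>i\<in>I. Q i)" by blast
  ultimately show ?thesis by simp
qed

lemma exec_while_image:
  assumes "T j (h j) \<noteq> a" "exec c (T, h) (f ` I) t"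
    "\<And>i. i \<in> I \<Longrightarrow> exec (while j a c) (f i) (Q i) u"
  shows "exec (while j a c) (T, h) (\<Union>i\<in>I. Q i) (t + 2 + u)"
proof -
  have "exec (while j a c) \<sigma>' (\<Union>i\<in>{i \<in> I. f i = \<sigma>'}. Q i) u" if "\<sigma>' \<in> f ` I" for \<sigma>'
    by (rule exec_Union) (use that assms(3) in \<open>blast, fastforce\<close>)
  from exec_while_True[OF assms(1,2) this]
  have "exec (while j a c) (T, h) (\<Union>\<sigma>'\<in>f ` I. \<Union>i\<in>{i \<in> I. f i = \<sigma>'}. Q i) (t + 2 + u)" .
  moreover have "(\<Union>\<sigma>'\<in>f ` I. \<Union>i\<in>{i \<in> I. f i = \<sigma>'}. Q i) = (\<Union>i\<in>I. Q i)" by blast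
  ultimately show ?thesis by simp
qed

text \<open>\<open>f i\<close> is the store before pass \<open>i\<close>. A pass costs its body, the
  test and the jump back; the final test adds 1.\<close>

lemma exec1_while:
  assumes "\<And>i. i < m \<Longrightarrow> fst (f i) j (snd (f i) j) \<noteq> a"
    "\<And>i. i < m \<Longrightarrow> exec1 c (f i) (f (Suc i)) t"
    "fst (f m) j (snd (f m) j) = a"
  shows "exec1 (while j a c) (f 0) (f m) (m * (t + 2) + 1)"
  using assms
proof (induction m arbitrary: f)
  case 0
  then show ?case using exec_while_False[of "fst (f 0)" j "snd (f 0)" a c] by simp
next
  case (Suc m)
  have "exec1 (while j a c) (f (Suc 0)) (f (Suc m)) (m * (t + 2) + 1)"
    using Suc.IH[of "\<lambda>i. f (Suc i)"] Suc.prems by simp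
  then show ?case
    using exec_while_True[of "fst (f 0)" j "snd (f 0)" a c "{f (Suc 0)}" t "\<lambda>_. {f (Suc m)}"
        "m * (t + 2) + 1"] Suc.prems(1)[of 0] Suc.prems(2)[of 0]
    by (simp add: add_ac)
qed

section \<open>Evaluating formulas\<close>

lemma poly_mono_nat:
  fixes p :: "nat poly"
  shows "a \<le> b \<Longrightarrow> poly p a \<le> poly p b"
  by (induction p) (auto intro: add_mono mult_mono)

lemma exec1_while':
  assumes "\<sigma> = f 0" "\<sigma>' = f m"
    "\<And>i. i < m \<Longrightarrow> fst (f i) j (snd (f i) j) \<noteq> a"
    "\<And>i. i < m \<Longrightarrow> exec1 c (f i) (f (Suc i)) t"
    "fst (f m) j (snd (f m) j) = a" "m * (t + 2) + 1 \<le> u"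
  shows "exec1 (while j a c) \<sigma> \<sigma>' u"
  using exec1_while[where m = m, OF assms(3-5)] assms(1,2,6) exec_mono by blast

lemma exec1_append':
  "exec1 c \<sigma> \<sigma>' t \<Longrightarrow> exec1 d \<sigma>' \<sigma>'' u \<Longrightarrow> t + u \<le> v \<Longrightarrow> exec1 (c @ d) \<sigma> \<sigma>'' v"
  using exec1_append exec_mono by blast

lemma exec1_ite:
  assumes "T j (h j) = a \<Longrightarrow> exec1 c (T, h) \<sigma> t" "T j (h j) \<noteq> a \<Longrightarrow> exec1 d (T, h) \<sigma> t" "t + 2 \<le> u"
  shows "exec1 (ite j a c d) (T, h) \<sigma> u"
  using exec_ite_True[of T j h a c "{\<sigma>}" t d] exec_ite_False[of T j h a d "{\<sigma>}" t c] assms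
    exec_mono[of "ite j a c d" "(T, h)" "{\<sigma>}" _ u]
  by (cases "T j (h j) = a") auto

lemma exec1_Cons':
  "exec1 [i] \<sigma> \<sigma>' 1 \<Longrightarrow> exec1 c \<sigma>' \<sigma>'' t \<Longrightarrow> Suc t \<le> u \<Longrightarrow> exec1 (i # c) \<sigma> \<sigma>'' u"
  using exec1_Cons exec_mono by blast

lemma exec1_Nil: "\<sigma> = \<sigma>' \<Longrightarrow> exec1 [] \<sigma> \<sigma>' t"
  using exec_Nil by simp

section \<open>Counters and the evaluation of terms\<close>

abbreviation inc :: "nat \<Rightarrow> instr" where "inc j \<equiv> Mv j MRight"
abbreviation dec :: "nat \<Rightarrow> instr" where "dec j \<equiv> Mv j MLeft"

lemma exec_inc: "h' = h(j := h j + 1) \<Longrightarrow> exec1 [inc j] (T, h) (T, h') 1"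
  and exec_dec: "h' = h(j := h j - 1) \<Longrightarrow> exec1 [dec j] (T, h) (T, h') 1"
  using exec_Mv[of j MRight T h] exec_Mv[of j MLeft T h] by simp_all

lemmas exec_moves = exec1_Cons'[OF exec_inc[OF refl]] exec1_Cons'[OF exec_dec[OF refl]] exec1_Nil

text \<open>Tapes 3 and above are counters: cell 0 is marked, and the position of the head is the
  value. Tape 0 holds the input and tape 2 the certificate.\<close>

definition contents :: "nat \<Rightarrow> nat set \<Rightarrow> nat set \<Rightarrow> (nat \<Rightarrow> int \<Rightarrow> nat) \<Rightarrow> bool" where
  "contents n X Y T \<longleftrightarrow>
     (\<forall>i. T 0 (int i) = 0 \<longleftrightarrow> n \<le> i) \<and> (\<forall>i. T 0 (int i) = 2 \<longleftrightarrow> i \<in> X) \<and>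
     (\<forall>i. T 2 (int i) = 2 \<longleftrightarrow> i \<in> Y) \<and> (\<forall>j\<ge>3. \<forall>z. T j z = 1 \<longleftrightarrow> z = 0)"

text \<open>\<open>\<rho>\<close> gives the counter of each variable, \<open>s\<close> is the first
  free counter, and running times will be polynomials in \<open>N\<close>. In the uses below, all
  but finitely many variables share counter 3, which holds 0.\<close>

definition frame ::
    "nat \<Rightarrow> nat set \<Rightarrow> nat set \<Rightarrow> (nat \<Rightarrow> nat) \<Rightarrow> nat \<Rightarrow> (nat \<Rightarrow> nat) \<Rightarrow> nat \<Rightarrow> store \<Rightarrow> bool" where
  "frame n X Y e N \<rho> s = (\<lambda>(T, h). contents n X Y T \<and> h 0 = 0 \<and> h 2 = 0 \<and> (\<forall>j\<ge>s. h j = 0) \<and>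
     3 \<le> s \<and> (\<forall>i. 3 \<le> \<rho> i \<and> \<rho> i < s \<and> h (\<rho> i) = int (e i) \<and> e i \<le> N) \<and> n \<le> N)"

text \<open>The value is added to counter \<open>c\<close> rather than stored there: a sum is then a
  sequence of two programs and a product an iterated sum. Reading a variable or the length moves a
  head, so the distance is also kept in \<open>s\<close> in order to move it back.\<close>

primrec term_code :: "trm \<Rightarrow> (nat \<Rightarrow> nat) \<Rightarrow> nat \<Rightarrow> nat \<Rightarrow> instr list" where
  "term_code (Var i) \<rho> c s =
     while (\<rho> i) 1 [dec (\<rho> i), inc c, inc s] @ while s 1 [dec s, inc (\<rho> i)]"
| "term_code Len \<rho> c s = while 0 0 [inc 0, inc c, inc s] @ while s 1 [dec s, dec 0]"
| "term_code (Const m) \<rho> c s = replicate m (inc c)"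
| "term_code (Add t u) \<rho> c s = term_code t \<rho> c s @ term_code u \<rho> c s"
| "term_code (Mul t u) \<rho> c s =
     term_code t \<rho> s (Suc s) @ while s 1 (dec s # term_code u \<rho> c (Suc s))"

lemma tval_bound:
  "\<exists>q :: nat poly. \<forall>n e N. n \<le> N \<longrightarrow> (\<forall>i. e i \<le> N) \<longrightarrow> tval n e t \<le> poly q N"
proof (induction t)
  case (Var i)
  then show ?case by (intro exI[of _ "[:0, 1:]"]) auto
next
  case Len
  then show ?case by (intro exI[of _ "[:0, 1:]"]) auto
next
  case (Const c)
  then show ?case by (intro exI[of _ "[:c:]"]) auto
next
  case (Add t u)
  then obtain p q :: "nat poly" where
    "\<forall>n e N. n \<le> N \<longrightarrow> (\<forall>i. e i \<le> N) \<longrightarrow> tval n e t \<le> poly p N"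
    "\<forall>n e N. n \<le> N \<longrightarrow> (\<forall>i. e i \<le> N) \<longrightarrow> tval n e u \<le> poly q N" by blast
  then show ?case by (intro exI[of _ "p + q"]) (auto intro!: add_mono)
next
  case (Mul t u)
  then obtain p q :: "nat poly" where
    "\<forall>n e N. n \<le> N \<longrightarrow> (\<forall>i. e i \<le> N) \<longrightarrow> tval n e t \<le> poly p N"
    "\<forall>n e N. n \<le> N \<longrightarrow> (\<forall>i. e i \<le> N) \<longrightarrow> tval n e u \<le> poly q N" by blast
  then show ?case by (intro exI[of _ "p * q"]) (auto intro!: mult_mono)
qed

definition term_code_time :: "trm \<Rightarrow> nat poly \<Rightarrow> bool" where
  "term_code_time t q \<longleftrightarrow> (\<forall>n X Y e N \<rho> s T h c.
     frame n X Y e N \<rho> s (T, h) \<longrightarrow> 3 \<le> c \<longrightarrow> c < s \<longrightarrow> (\<forall>i. \<rho> i \<noteq> c) \<longrightarrow>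
     exec1 (term_code t \<rho> c s) (T, h) (T, h(c := h c + int (tval n e t))) (poly q N))"

lemma term_code_timeD:
  "term_code_time t q \<Longrightarrow> frame n X Y e N \<rho> s (T, h) \<Longrightarrow> 3 \<le> c \<Longrightarrow> c < s \<Longrightarrow> \<forall>i. \<rho> i \<noteq> c \<Longrightarrow>
     exec1 (term_code t \<rho> c s) (T, h) (T, h(c := h c + int (tval n e t))) (poly q N)"
  unfolding term_code_time_def by blast

lemma exec_term_code: "\<exists>q. term_code_time t q"
proof (induction t)
  case (Var i)
  \<comment> \<open>A pass of the first loop makes three moves, a test and a jump, a pass of the
    second one two moves, a test and a jump; hence 9 times \<open>N\<close>, and 2 for the final
    tests.\<close>
  have "exec1 (term_code (Var i) \<rho> c s) (T, h) (T, h(c := h c + int (e i))) (poly [:2, 9:] N)"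
    if f: "frame n X Y e N \<rho> s (T, h)" and c: "3 \<le> c" "c < s" "\<forall>i. \<rho> i \<noteq> c" for n X Y e N \<rho> s T h c
  proof -
    let ?r = "\<rho> i" and ?v = "int (e i)"
    have r: "h ?r = ?v" "?r \<noteq> c" "?r \<noteq> s" "e i \<le> N" "c \<noteq> s" "h s = 0" "s \<ge> 3" "?r \<ge> 3"
      and T: "\<And>j z. j \<ge> 3 \<Longrightarrow> T j z = 1 \<longleftrightarrow> z = 0"
      using f c by (auto simp: frame_def contents_def dest: spec[of _ i])
    show ?thesis unfolding term_code.simps
    proof (rule exec1_append')
      let ?f = "\<lambda>k. (T, h(?r := ?v - int k, c := h c + int k, s := int k))"
      show "exec1 (while ?r 1 [dec ?r, inc c, inc s]) (T, h) (?f (e i)) (N * 5 + 1)"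
        by (rule exec1_while'[of _ ?f _ "e i" _ _ _ 3])
          (use r T in \<open>auto simp: fun_eq_iff intro!: exec_moves\<close>)
      let ?g = "\<lambda>k. (T, h(?r := int k, c := h c + ?v, s := ?v - int k))"
      show "exec1 (while s 1 [dec s, inc ?r]) (?f (e i)) (T, h(c := h c + ?v)) (N * 4 + 1)"
        by (rule exec1_while'[of _ ?g _ "e i" _ _ _ 2])
          (use r T in \<open>auto simp: fun_eq_iff intro!: exec_moves\<close>)
    qed (simp add: algebra_simps)
  qed
  then show ?case unfolding term_code_time_def tval.simps by blast
next
  case Len
  have "exec1 (term_code Len \<rho> c s) (T, h) (T, h(c := h c + int n)) (poly [:2, 9:] N)"
    if f: "frame n X Y e N \<rho> s (T, h)" and c: "3 \<le> c" "c < s" "\<forall>i. \<rho> i \<noteq> c" for n X Y e N \<rho> s T h c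
  proof -
    have r: "h 0 = 0" "n \<le> N" "c \<noteq> s" "h s = 0" "s \<ge> 3"
      and T: "\<And>j z. j \<ge> 3 \<Longrightarrow> T j z = 1 \<longleftrightarrow> z = 0" "\<And>i. T 0 (int i) = 0 \<longleftrightarrow> n \<le> i"
      using f c by (auto simp: frame_def contents_def)
    show ?thesis unfolding term_code.simps
    proof (rule exec1_append')
      let ?f = "\<lambda>k. (T, h(0 := int k, c := h c + int k, s := int k))"
      show "exec1 (while 0 0 [inc 0, inc c, inc s]) (T, h) (?f n) (N * 5 + 1)"
        by (rule exec1_while'[of _ ?f _ n _ _ _ 3])
          (use r T c in \<open>auto simp: fun_eq_iff intro!: exec_moves\<close>)
      let ?g = "\<lambda>k. (T, h(0 := int n - int k, c := h c + int n, s := int n - int k))"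
      show "exec1 (while s 1 [dec s, dec 0]) (?f n) (T, h(c := h c + int n)) (N * 4 + 1)"
        by (rule exec1_while'[of _ ?g _ n _ _ _ 2])
          (use r T c in \<open>auto simp: fun_eq_iff intro!: exec_moves\<close>)
    qed (simp add: algebra_simps)
  qed
  then show ?case unfolding term_code_time_def tval.simps by blast
next
  case (Const m)
  have "exec1 (replicate m (inc c)) (T, h) (T, h(c := h c + int m)) m" for T h c
  proof (induction m arbitrary: h)
    case (Suc m)
    have "exec1 (inc c # replicate m (inc c)) (T, h)
        (T, (h(c := h c + 1))(c := (h(c := h c + 1)) c + int m)) (Suc m)"
      by (rule exec1_Cons[OF exec_inc[OF refl] Suc])
    also have "(T, (h(c := h c + 1))(c := (h(c := h c + 1)) c + int m)) = (T, h(c := h c + int (Suc m)))"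
      by (simp add: fun_eq_iff)
    finally show ?case by (simp only: replicate.simps)
  qed (simp add: exec_Nil)
  moreover have "m = poly [:m:] N" for N :: nat by simp
  ultimately show ?case unfolding term_code_time_def tval.simps term_code.simps by metis
next
  case (Add t u)
  then obtain p q where "term_code_time t p" "term_code_time u q" by blast
  note p = term_code_timeD[OF this(1)] and q = term_code_timeD[OF this(2)]
  have "exec1 (term_code (Add t u) \<rho> c s) (T, h) (T, h(c := h c + int (tval n e (Add t u)))) (poly (p + q) N)"
    if f: "frame n X Y e N \<rho> s (T, h)" and c: "3 \<le> c" "c < s" "\<forall>i. \<rho> i \<noteq> c" for n X Y e N \<rho> s T h c
  proof -
    have "frame n X Y e N \<rho> s (T, h(c := h c + int (tval n e t)))" using f c by (auto simp: frame_def)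
    from exec1_append[OF p[OF f c] q[OF this c]] show ?thesis by (simp add: add_ac)
  qed
  then show ?case unfolding term_code_time_def by blast
next
  case (Mul t u)
  then obtain p q where "term_code_time t p" "term_code_time u q" by blast
  note p = term_code_timeD[OF this(1)] and q = term_code_timeD[OF this(2)]
  obtain b :: "nat poly" where b: "\<And>n e N. n \<le> N \<Longrightarrow> \<forall>i. e i \<le> N \<Longrightarrow> tval n e t \<le> poly b N"
    using tval_bound by blast
  let ?p = "p + (b * (q + [:3:]) + [:1:])"
  have "exec1 (term_code (Mul t u) \<rho> c s) (T, h) (T, h(c := h c + int (tval n e (Mul t u)))) (poly ?p N)"
    if f: "frame n X Y e N \<rho> s (T, h)" and c: "3 \<le> c" "c < s" "\<forall>i. \<rho> i \<noteq> c" for n X Y e N \<rho> s T h c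
  proof -
    let ?v = "tval n e t" and ?w = "tval n e u"
    have h: "h s = 0" "s \<ge> 3" "\<forall>i. \<rho> i \<noteq> s" "frame n X Y e N \<rho> (Suc s) (T, h)"
      and v: "?v \<le> poly b N" using f b[of n N e] by (auto simp: frame_def less_Suc_eq)
    have T: "\<And>j z. j \<ge> 3 \<Longrightarrow> T j z = 1 \<longleftrightarrow> z = 0" using f by (auto simp: frame_def contents_def)
    let ?f = "\<lambda>k. (T, h(s := int ?v - int k, c := h c + int (k * ?w)))"
    have "?f 0 = (T, h(s := h s + int ?v))" using h(1) c(2) by (auto simp: fun_eq_iff)
    with p[OF h(4) h(2) _ h(3)]
    have 1: "exec1 (term_code t \<rho> s (Suc s)) (T, h) (?f 0) (poly p N)" by simp
    have 2: "exec1 (dec s # term_code u \<rho> c (Suc s)) (?f k) (?f (Suc k)) (poly q N + 1)" for k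
    proof -
      let ?h = "h(s := int ?v - int (Suc k), c := h c + int (k * ?w))"
      have fr: "frame n X Y e N \<rho> (Suc s) (T, ?h)" using h(4) c h(3) by (auto simp: frame_def)
      have e: "?h(c := ?h c + int ?w) = snd (?f (Suc k))" by (simp add: algebra_simps)
      have "exec1 (term_code u \<rho> c (Suc s)) (T, ?h) (?f (Suc k)) (poly q N)"
        using q[OF fr c(1) _ c(3)] c(2) unfolding e by simp
      moreover have "exec1 [dec s] (?f k) (T, ?h) 1"
        using c(2) by (intro exec_dec) (auto simp: fun_eq_iff)
      ultimately show ?thesis using exec1_Cons by fastforce
    qed
    have 3: "exec1 (while s 1 (dec s # term_code u \<rho> c (Suc s))) (?f 0) (?f ?v)
        (poly b N * (poly q N + 3) + 1)"
    proof (rule exec1_while'[of _ ?f _ ?v _ _ _ "poly q N + 1"])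
      show "?v * (poly q N + 1 + 2) + 1 \<le> poly b N * (poly q N + 3) + 1"
        by (intro add_right_mono mult_le_mono v) simp
    qed (use 2 T h(2) c(2) in auto)
    have e: "?f ?v = (T, h(c := h c + int (tval n e (Mul t u))))"
      using h(1) c(2) by (auto simp: fun_eq_iff)
    show ?thesis using exec1_append[OF 1 3] unfolding e by simp
  qed
  then show ?case unfolding term_code_time_def by blast
qed

text \<open>The truth value is left in counter \<open>s\<close> as 0 or 1. \<open>Leq\<close> tests
  whether the difference, cut off at 0, vanishes. The lookups drag the head of the tape to the cell
  in question and use \<open>s + 2\<close> to bring it back. For \<open>NEx\<close>, counter
  \<open>s + 1\<close> counts down, \<open>s + 2\<close> is the bound variable, and \<open>s\<close>
  remembers whether the body was ever true.\<close>

primrec formula_code :: "fm \<Rightarrow> (nat \<Rightarrow> nat) \<Rightarrow> nat \<Rightarrow> instr list" where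
  "formula_code (Leq t u) \<rho> s =
     term_code t \<rho> (s + 1) (s + 3) @ term_code u \<rho> (s + 2) (s + 3) @
     while (s + 2) 1 (dec (s + 2) # ite (s + 1) 1 [] [dec (s + 1)]) @
     ite (s + 1) 1 [inc s] [] @ while (s + 1) 1 [dec (s + 1)]"
| "formula_code (InX t) \<rho> s =
     term_code t \<rho> (s + 1) (s + 2) @ while (s + 1) 1 [dec (s + 1), inc (s + 2), inc 0] @
     ite 0 2 [inc s] [] @ while (s + 2) 1 [dec (s + 2), dec 0]"
| "formula_code (InY t) \<rho> s =
     term_code t \<rho> (s + 1) (s + 2) @ while (s + 1) 1 [dec (s + 1), inc (s + 2), inc 2] @
     ite 2 2 [inc s] [] @ while (s + 2) 1 [dec (s + 2), dec 2]"
| "formula_code (Nor f g) \<rho> s =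
     formula_code f \<rho> s @ ite s 1 (formula_code g \<rho> s @ ite s 1 [inc s] [dec s]) [dec s]"
| "formula_code (NEx t f) \<rho> s =
     term_code t \<rho> (s + 1) (s + 3) @
     while (s + 1) 1 (dec (s + 1) # formula_code f (case_nat (s + 2) \<rho>) (s + 3) @
       ite (s + 3) 1 [] (dec (s + 3) # ite s 1 [inc s] []) @ [inc (s + 2)]) @
     while (s + 2) 1 [dec (s + 2)] @ ite s 1 [inc s] [dec s]"

definition formula_code_time :: "fm \<Rightarrow> nat poly \<Rightarrow> bool" where
  "formula_code_time f q \<longleftrightarrow> (\<forall>n X Y e N \<rho> s T h. frame n X Y e N \<rho> s (T, h) \<longrightarrow>
     exec1 (formula_code f \<rho> s) (T, h) (T, h(s := of_bool (sat n X Y e f))) (poly q N))"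

lemma formula_code_timeD:
  "formula_code_time f q \<Longrightarrow> frame n X Y e N \<rho> s (T, h) \<Longrightarrow>
     exec1 (formula_code f \<rho> s) (T, h) (T, h(s := of_bool (sat n X Y e f))) (poly q N)"
  unfolding formula_code_time_def by blast

lemma frameD:
  assumes "frame n X Y e N \<rho> s (T, h)"
  shows "3 \<le> s" "s \<le> j \<Longrightarrow> h j = 0" "h 0 = 0" "h 2 = 0" "n \<le> N" "\<forall>i. e i \<le> N"
    "s \<le> j \<Longrightarrow> \<forall>i. \<rho> i \<noteq> j" "3 \<le> j \<Longrightarrow> T j z = 1 \<longleftrightarrow> z = 0"
    "\<forall>i. T 0 (int i) = 2 \<longleftrightarrow> i \<in> X" "\<forall>i. T 2 (int i) = 2 \<longleftrightarrow> i \<in> Y"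
  using assms by (auto simp: frame_def contents_def) (metis not_le)

lemma frame_upd:
  "frame n X Y e N \<rho> s (T, h) \<Longrightarrow> s \<le> s' \<Longrightarrow> (\<And>j. j < s \<Longrightarrow> h' j = h j) \<Longrightarrow> (\<And>j. s' \<le> j \<Longrightarrow> h' j = 0) \<Longrightarrow>
   frame n X Y e N \<rho> s' (T, h')"
  unfolding frame_def by (auto intro: less_le_trans)

lemma frame_extend:
  assumes f: "frame n X Y e N \<rho> s (T, h)" and "k \<le> K" "s \<le> v" "v < s'" "h' v = int k"
    "\<And>j. j < s \<Longrightarrow> h' j = h j" "\<And>j. s' \<le> j \<Longrightarrow> h' j = 0"
  shows "frame n X Y (case_nat k e) (N + K) (case_nat v \<rho>) s' (T, h')"
proof -
  have "3 \<le> case_nat v \<rho> i \<and> case_nat v \<rho> i < s' \<and> h' (case_nat v \<rho> i) = int (case_nat k e i) \<and>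
      case_nat k e i \<le> N + K" for i
  proof (cases i)
    case (Suc i)
    have "3 \<le> \<rho> i" "\<rho> i < s" "h (\<rho> i) = int (e i)" "e i \<le> N" using f by (auto simp: frame_def)
    then show ?thesis using Suc assms by auto
  qed (use frameD(1)[OF f] assms in auto)
  moreover have "frame n X Y e N \<rho> s' (T, h')"
    by (rule frame_upd[OF f]) (use assms in auto)
  ultimately show ?thesis by (simp add: frame_def)
qed

lemma exec_clear:
  assumes "\<And>z. T c z = 1 \<longleftrightarrow> z = 0" "h c = int m" "m \<le> M" "h' = h(c := 0)"
  shows "exec1 (while c 1 [dec c]) (T, h) (T, h') (M * 3 + 1)"
  by (rule exec1_while'[of _ "\<lambda>k. (T, h(c := int m - int k))" _ m _ _ _ 1])
    (use assms in \<open>auto simp: fun_eq_iff intro!: exec_moves\<close>)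

lemma exec_lookup:
  assumes "\<forall>i. T j (int i) = 2 \<longleftrightarrow> i \<in> Z" "\<forall>j\<ge>3. \<forall>z. T j z = 1 \<longleftrightarrow> z = 0"
    "j < s" "3 \<le> s" "j < 3" "h j = 0" "h s = 0" "h (s + 1) = int m" "h (s + 2) = 0" "m \<le> M"
  shows "exec1 (while (s + 1) 1 [dec (s + 1), inc (s + 2), inc j] @
     ite j 2 [inc s] [] @ while (s + 2) 1 [dec (s + 2), dec j])
     (T, h) (T, h(s := of_bool (m \<in> Z), s + 1 := 0)) (M * 9 + 6)"
proof (rule exec1_append'[OF _ exec1_append'[OF _ _ order_refl]])
  let ?f = "\<lambda>k. (T, h(s + 1 := int m - int k, s + 2 := int k, j := int k))"
  show "exec1 (while (s + 1) 1 [dec (s + 1), inc (s + 2), inc j]) (T, h) (?f m) (M * 5 + 1)"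
    by (rule exec1_while'[of _ ?f _ m _ _ _ 3])
      (use assms in \<open>auto simp: fun_eq_iff intro!: exec_moves\<close>)
  let ?g = "\<lambda>k. (T, h(s := of_bool (m \<in> Z), s + 1 := 0, s + 2 := int m - int k, j := int m - int k))"
  show "exec1 (ite j 2 [inc s] []) (?f m) (?g 0) 3"
    by (rule exec1_ite[where t = 1]) (use assms in \<open>auto simp: fun_eq_iff intro!: exec_moves\<close>)
  show "exec1 (while (s + 2) 1 [dec (s + 2), dec j]) (?g 0)
      (T, h(s := of_bool (m \<in> Z), s + 1 := 0)) (M * 4 + 1)"
    by (rule exec1_while'[of _ ?g _ m _ _ _ 2])
      (use assms in \<open>auto simp: fun_eq_iff intro!: exec_moves\<close>)
qed simp_all

lemma exec_formula_code: "\<exists>q. formula_code_time f q"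
proof (induction f)
  case (Leq t u)
  obtain p q where "term_code_time t p" "term_code_time u q" using exec_term_code by blast
  note p = term_code_timeD[OF this(1)] and q = term_code_timeD[OF this(2)]
  obtain b :: "nat poly" where b: "\<And>n e N. n \<le> N \<Longrightarrow> \<forall>i. e i \<le> N \<Longrightarrow> tval n e t \<le> poly b N"
    using tval_bound by blast
  obtain b' :: "nat poly" where b': "\<And>n e N. n \<le> N \<Longrightarrow> \<forall>i. e i \<le> N \<Longrightarrow> tval n e u \<le> poly b' N"
    using tval_bound by blast
  let ?p = "p + (q + (b' * [:6:] + b * [:3:] + [:6:]))"
  have "exec1 (formula_code (Leq t u) \<rho> s) (T, h) (T, h(s := of_bool (sat n X Y e (Leq t u)))) (poly ?p N)"
    if f: "frame n X Y e N \<rho> s (T, h)" for n X Y e N \<rho> s T h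
  proof -
    let ?v = "tval n e t" and ?w = "tval n e u"
    have v: "?v \<le> poly b N" "?w \<le> poly b' N" and r: "\<forall>i. \<rho> i \<noteq> s + 1" "\<forall>i. \<rho> i \<noteq> s + 2"
      using b[OF frameD(5,6)[OF f]] b'[OF frameD(5,6)[OF f]] frameD(7)[OF f] by simp_all
    note s = frameD(1,2)[OF f] and T = frameD(8)[OF f]
    let ?h1 = "h(s + 1 := int ?v)" and ?h2 = "h(s + 1 := int ?v, s + 2 := int ?w)"
    have f1: "frame n X Y e N \<rho> (s + 3) (T, h)" "frame n X Y e N \<rho> (s + 3) (T, ?h1)"
      by (rule frame_upd[OF f]; use s in simp)+
    have 1: "exec1 (term_code t \<rho> (s + 1) (s + 3)) (T, h) (T, ?h1) (poly p N)"
      using p[OF f1(1) _ _ r(1)] s by simp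
    have 2: "exec1 (term_code u \<rho> (s + 2) (s + 3)) (T, ?h1) (T, ?h2) (poly q N)"
      using q[OF f1(2) _ _ r(2)] s by simp
    let ?f = "\<lambda>k. (T, h(s + 1 := int (?v - k), s + 2 := int ?w - int k))"
    have 3: "exec1 (while (s + 2) 1 (dec (s + 2) # ite (s + 1) 1 [] [dec (s + 1)])) (T, ?h2) (?f ?w)
        (poly b' N * 6 + 1)"
    proof (rule exec1_while'[of _ ?f _ ?w _ _ _ 4])
      fix k assume "k < ?w"
      show "exec1 (dec (s + 2) # ite (s + 1) 1 [] [dec (s + 1)]) (?f k) (?f (Suc k)) 4"
        by (rule exec1_Cons'[OF exec_dec[OF refl]], rule exec1_ite[where t = 1])
          (use T[of "s + 1"] s in \<open>auto simp: fun_eq_iff intro!: exec_moves\<close>)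
    qed (use v T s in auto)
    let ?h4 = "h(s := of_bool (?v \<le> ?w), s + 1 := int (?v - ?w))"
    have 4: "exec1 (ite (s + 1) 1 [inc s] []) (?f ?w) (T, ?h4) 3"
      by (rule exec1_ite[where t = 1])
        (use T[of "s + 1"] s in \<open>auto simp: fun_eq_iff intro!: exec_moves\<close>)
    have 5: "exec1 (while (s + 1) 1 [dec (s + 1)]) (T, ?h4)
        (T, h(s := of_bool (sat n X Y e (Leq t u)))) (poly b N * 3 + 1)"
      by (rule exec_clear[where m = "?v - ?w"])
        (use v s T[of "s + 1"] in \<open>auto simp: fun_eq_iff\<close>)
    show ?thesis unfolding formula_code.simps
      by (rule exec1_append'[OF 1 exec1_append'[OF 2 exec1_append'[OF 3 exec1_append'[OF 4 5]]]];
          (rule order_refl)?) simp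
  qed
  then show ?case unfolding formula_code_time_def by blast
next
  case (InX t)
  obtain p where "term_code_time t p" using exec_term_code by blast
  note p = term_code_timeD[OF this]
  obtain b :: "nat poly" where b: "\<And>n e N. n \<le> N \<Longrightarrow> \<forall>i. e i \<le> N \<Longrightarrow> tval n e t \<le> poly b N"
    using tval_bound by blast
  let ?p = "p + (b * [:9:] + [:6:])"
  have "exec1 (formula_code (InX t) \<rho> s) (T, h) (T, h(s := of_bool (sat n X Y e (InX t)))) (poly ?p N)"
    if f: "frame n X Y e N \<rho> s (T, h)" for n X Y e N \<rho> s T h
  proof -
    let ?v = "tval n e t"
    have v: "?v \<le> poly b N" and r: "\<forall>i. \<rho> i \<noteq> s + 1"
      and T: "\<forall>i. T 0 (int i) = 2 \<longleftrightarrow> i \<in> X" "\<forall>j\<ge>3. \<forall>z. T j z = 1 \<longleftrightarrow> z = 0"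
      using b[OF frameD(5,6)[OF f]] frameD(7-10)[OF f] by simp_all
    note s = frameD(1,2,3,4)[OF f]
    have f1: "frame n X Y e N \<rho> (s + 2) (T, h)" by (rule frame_upd[OF f]) (use s in auto)
    have 1: "exec1 (term_code t \<rho> (s + 1) (s + 2)) (T, h) (T, h(s + 1 := int ?v)) (poly p N)"
      using p[OF f1 _ _ r] s by simp
    have e: "(h(s + 1 := int ?v))(s := of_bool (?v \<in> X), s + 1 := 0) = h(s := of_bool (sat n X Y e (InX t)))"
      using s by (auto simp: fun_eq_iff)
    show ?thesis unfolding formula_code.simps
      by (rule exec1_append'[OF 1 exec_lookup[OF T, of s "h(s + 1 := int ?v)" ?v "poly b N", unfolded e]])
        (use s v in simp_all)
  qed
  then show ?case unfolding formula_code_time_def by blast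
next
  case (InY t)
  obtain p where "term_code_time t p" using exec_term_code by blast
  note p = term_code_timeD[OF this]
  obtain b :: "nat poly" where b: "\<And>n e N. n \<le> N \<Longrightarrow> \<forall>i. e i \<le> N \<Longrightarrow> tval n e t \<le> poly b N"
    using tval_bound by blast
  let ?p = "p + (b * [:9:] + [:6:])"
  have "exec1 (formula_code (InY t) \<rho> s) (T, h) (T, h(s := of_bool (sat n X Y e (InY t)))) (poly ?p N)"
    if f: "frame n X Y e N \<rho> s (T, h)" for n X Y e N \<rho> s T h
  proof -
    let ?v = "tval n e t"
    have v: "?v \<le> poly b N" and r: "\<forall>i. \<rho> i \<noteq> s + 1"
      and T: "\<forall>i. T 2 (int i) = 2 \<longleftrightarrow> i \<in> Y" "\<forall>j\<ge>3. \<forall>z. T j z = 1 \<longleftrightarrow> z = 0"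
      using b[OF frameD(5,6)[OF f]] frameD(7-10)[OF f] by simp_all
    note s = frameD(1,2,3,4)[OF f]
    have f1: "frame n X Y e N \<rho> (s + 2) (T, h)" by (rule frame_upd[OF f]) (use s in auto)
    have 1: "exec1 (term_code t \<rho> (s + 1) (s + 2)) (T, h) (T, h(s + 1 := int ?v)) (poly p N)"
      using p[OF f1 _ _ r] s by simp
    have e: "(h(s + 1 := int ?v))(s := of_bool (?v \<in> Y), s + 1 := 0) = h(s := of_bool (sat n X Y e (InY t)))"
      using s by (auto simp: fun_eq_iff)
    show ?thesis unfolding formula_code.simps
      by (rule exec1_append'[OF 1 exec_lookup[OF T, of s "h(s + 1 := int ?v)" ?v "poly b N", unfolded e]])
        (use s v in simp_all)
  qed
  then show ?case unfolding formula_code_time_def by blast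
next
  case (Nor f g)
  then obtain p q where "formula_code_time f p" "formula_code_time g q" by blast
  note p = formula_code_timeD[OF this(1)] and q = formula_code_timeD[OF this(2)]
  let ?p = "p + (q + [:5:])"
  have "exec1 (formula_code (Nor f g) \<rho> s) (T, h) (T, h(s := of_bool (sat n X Y e (Nor f g)))) (poly ?p N)"
    if f: "frame n X Y e N \<rho> s (T, h)" for n X Y e N \<rho> s T h
  proof -
    have s: "s \<ge> 3" "h s = 0" and T: "\<And>z. T s z = 1 \<longleftrightarrow> z = 0"
      using f by (auto simp: frame_def contents_def)
    let ?h = "h(s := of_bool (sat n X Y e (Nor f g)))"
    have "exec1 (ite s 1 (formula_code g \<rho> s @ ite s 1 [inc s] [dec s]) [dec s])
        (T, h(s := of_bool (sat n X Y e f))) (T, ?h) (poly q N + 5)"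
    proof (rule exec1_ite[where t = "poly q N + 3"])
      assume "T s ((h(s := of_bool (sat n X Y e f))) s) = 1"
      then have n: "\<not> sat n X Y e f" and h: "h(s := of_bool (sat n X Y e f)) = h"
        using T s by (auto simp: fun_eq_iff split: if_splits)
      have "exec1 (ite s 1 [inc s] [dec s]) (T, h(s := of_bool (sat n X Y e g))) (T, ?h) 3"
        by (rule exec1_ite[where t = 1]) (use T s n in \<open>auto simp: fun_eq_iff intro!: exec_moves\<close>)
      from exec1_append[OF q[OF f] this]
      show "exec1 (formula_code g \<rho> s @ ite s 1 [inc s] [dec s])
        (T, h(s := of_bool (sat n X Y e f))) (T, ?h) (poly q N + 3)" unfolding h .
    next
      assume "T s ((h(s := of_bool (sat n X Y e f))) s) \<noteq> 1"
      then show "exec1 [dec s] (T, h(s := of_bool (sat n X Y e f))) (T, ?h) (poly q N + 3)"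
        using T s by (auto simp: fun_eq_iff intro!: exec_moves)
    qed simp
    from exec1_append[OF p[OF f] this] show ?thesis by simp
  qed
  then show ?case unfolding formula_code_time_def by blast
next
  case (NEx t f)
  then obtain q where "formula_code_time f q" by blast
  note q = formula_code_timeD[OF this]
  obtain p where "term_code_time t p" using exec_term_code by blast
  note p = term_code_timeD[OF this]
  obtain b :: "nat poly" where b: "\<And>n e N. n \<le> N \<Longrightarrow> \<forall>i. e i \<le> N \<Longrightarrow> tval n e t \<le> poly b N"
    using tval_bound by blast
  \<comment> \<open>The body has one more variable, whose values are bounded by the value of
    \<open>t\<close>; so its time polynomial is taken at \<open>N + poly b N\<close>.\<close>
  let ?q = "pcompose q ([:0, 1:] + b)"
  let ?p = "p + (b * (?q + [:11:]) + [:1:] + (b * [:3:] + [:1:] + [:3:]))"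
  have "exec1 (formula_code (NEx t f) \<rho> s) (T, h) (T, h(s := of_bool (sat n X Y e (NEx t f)))) (poly ?p N)"
    if f: "frame n X Y e N \<rho> s (T, h)" for n X Y e N \<rho> s T h
  proof -
    let ?v = "tval n e t" and ?S = "\<lambda>k. \<exists>i<k. sat n X Y (case_nat i e) f"
    have v: "?v \<le> poly b N" and r: "\<forall>i. \<rho> i \<noteq> s + 1"
      using b[OF frameD(5,6)[OF f]] frameD(7)[OF f] by simp_all
    note s = frameD(1,2)[OF f] and T = frameD(8)[OF f]
    have f1: "frame n X Y e N \<rho> (s + 3) (T, h)" by (rule frame_upd[OF f]) (use s in auto)
    have 1: "exec1 (term_code t \<rho> (s + 1) (s + 3)) (T, h) (T, h(s + 1 := int ?v)) (poly p N)"
      using p[OF f1 _ _ r] s by simp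
    let ?f = "\<lambda>k. (T, h(s := of_bool (?S k), s + 1 := int ?v - int k, s + 2 := int k))"
    let ?B = "dec (s + 1) # formula_code f (case_nat (s + 2) \<rho>) (s + 3) @
       ite (s + 3) 1 [] (dec (s + 3) # ite s 1 [inc s] []) @ [inc (s + 2)]"
    have 2: "exec1 ?B (?f k) (?f (Suc k)) (poly ?q N + 9)" if "k < ?v" for k
    proof -
      let ?g = "\<lambda>u w m. (T, h(s := of_bool u, s + 1 := int ?v - int (Suc k), s + 2 := int m, s + 3 := of_bool w))"
      let ?sat = "sat n X Y (case_nat k e) f"
      have "frame n X Y (case_nat k e) (N + poly b N) (case_nat (s + 2) \<rho>) (s + 3) (?g (?S k) False k)"
        by (rule frame_extend[OF f]) (use s v that in auto)
      from q[OF this] have "exec1 (formula_code f (case_nat (s + 2) \<rho>) (s + 3)) (?g (?S k) False k) (?g (?S k) ?sat k) (poly ?q N)"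
        by (simp add: poly_pcompose)
      moreover have "exec1 (ite (s + 3) 1 [] (dec (s + 3) # ite s 1 [inc s] [])) (?g (?S k) ?sat k) (?g (?S (Suc k)) False k) 7"
        by (rule exec1_ite[where t = 5])
          (use T[of "s + 3"] T[of s] s in \<open>auto simp: fun_eq_iff less_Suc_eq intro!: exec_moves exec1_ite[where t = 1 and u = 4]\<close>)
      moreover have "exec1 [inc (s + 2)] (?g (?S (Suc k)) False k) (?f (Suc k)) 1"
        using s by (auto simp: fun_eq_iff intro!: exec_moves)
      moreover have "exec1 [dec (s + 1)] (?f k) (?g (?S k) False k) 1"
        using s by (auto simp: fun_eq_iff intro!: exec_moves)
      ultimately have "exec1 ?B (?f k) (?f (Suc k)) (Suc (poly ?q N + (7 + 1)))"
        by (blast intro: exec1_append exec1_Cons)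
      then show ?thesis by (simp add: add_ac)
    qed
    have 3: "exec1 (while (s + 1) 1 ?B) (T, h(s + 1 := int ?v)) (?f ?v) (poly b N * (poly ?q N + 11) + 1)"
    proof (rule exec1_while'[of _ ?f _ ?v _ _ _ "poly ?q N + 9"])
      show "?v * (poly ?q N + 9 + 2) + 1 \<le> poly b N * (poly ?q N + 11) + 1"
        by (intro add_right_mono mult_le_mono v) simp
      show "(T, h(s + 1 := int ?v)) = ?f 0" using s by (auto simp: fun_eq_iff)
    qed (use 2 T[of "s + 1"] s in auto)
    have 4: "exec1 (while (s + 2) 1 [dec (s + 2)]) (?f ?v) (T, h(s := of_bool (?S ?v))) (poly b N * 3 + 1)"
      by (rule exec_clear[where m = "?v"]) (use v s T[of "s + 2"] in \<open>auto simp: fun_eq_iff\<close>)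
    have 5: "exec1 (ite s 1 [inc s] [dec s]) (T, h(s := of_bool (?S ?v)))
        (T, h(s := of_bool (sat n X Y e (NEx t f)))) 3"
      by (rule exec1_ite[where t = 1]) (use T[of s] s in \<open>auto simp: fun_eq_iff intro!: exec_moves\<close>)
    show ?thesis unfolding formula_code.simps
      by (rule exec1_append'[OF 1 exec1_append'[OF 3 exec1_append'[OF 4 5]]]; (rule order_refl)?) simp
  qed
  then show ?case unfolding formula_code_time_def by blast
qed

section \<open>From formulas to Turing machines\<close>

text \<open>A transition writes on every tape; the tapes that an instruction does not concern get
  back the symbol that was read.\<close>

definition write_tape :: "nat \<Rightarrow> nat list \<Rightarrow> nat \<Rightarrow> nat \<Rightarrow> move \<Rightarrow> (nat \<times> move) list" where
  "write_tape k ss j a m = map (\<lambda>i. if i = j then (a, m) else (ss ! i, MStay)) [0..<k]"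

fun itrans :: "nat \<Rightarrow> instr \<Rightarrow> nat \<Rightarrow> nat list \<Rightarrow> (nat \<times> (nat \<times> move) list) set" where
  "itrans k (Mv j m) q ss = {(Suc q, write_tape k ss j (ss ! j) m)}"
| "itrans k (Put j a m) q ss = {(Suc q, write_tape k ss j a m)}"
| "itrans k (Br j a d) q ss =
     {(if ss ! j = a then jump q d else Suc q, write_tape k ss 0 (ss ! 0) MStay)}"
| "itrans k (Jmp d) q ss = {(jump q d, write_tape k ss 0 (ss ! 0) MStay)}"
| "itrans k (Flip d) q ss = {(Suc q, write_tape k ss 0 (ss ! 0) MStay),
     (jump q d, write_tape k ss 0 (ss ! 0) MStay)}"

text \<open>Only the symbols 0, 1, 2 may be read, which keeps the set of transitions finite.
  Addresses beyond the code have no transitions; accepting and query states will be placed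
  there.\<close>

definition machine :: "nat \<Rightarrow> instr list \<Rightarrow> nat \<Rightarrow> (nat \<times> nat \<times> nat) option \<Rightarrow> tm" where
  "machine k p acc qr = \<lparr>tapes = k,
     trans = {(q, ss, q', as). q < length p \<and> length ss = k \<and> set ss \<subseteq> {..2} \<and>
       (q', as) \<in> itrans k (p ! q) q ss},
     start = 0, accept = acc, query = qr\<rparr>"

fun instr_ok :: "nat \<Rightarrow> instr \<Rightarrow> bool" where
  "instr_ok k (Mv j m) \<longleftrightarrow> j < k"
| "instr_ok k (Put j a m) \<longleftrightarrow> j < k \<and> a \<le> 2"
| "instr_ok k (Br j a d) \<longleftrightarrow> j < k"
| "instr_ok k (Jmp d) \<longleftrightarrow> True"
| "instr_ok k (Flip d) \<longleftrightarrow> True"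

fun conf :: "nat \<Rightarrow> nat \<times> store \<Rightarrow> config" where
  "conf k (q, T, h) = (q, map (\<lambda>i. (T i, h i)) [0..<k])"

lemma map_read_conf: "map read (map (\<lambda>i. (T i, h i)) [0..<k]) = map (\<lambda>i. T i (h i)) [0..<k]"
  by simp

lemma act_write_tape:
  assumes "j < k"
  shows "map2 act (write_tape k (map (\<lambda>i. T i (h i)) [0..<k]) j a m) (map (\<lambda>i. (T i, h i)) [0..<k])
    = map (\<lambda>i. ((T(j := (T j)(h j := a))) i, (h(j := h j + shift m)) i)) [0..<k]"
  by (rule nth_equalityI) (use assms in \<open>auto simp: write_tape_def\<close>)

lemma step_machine:
  assumes p: "\<forall>i\<in>set p. instr_ok k i" "2 \<le> k" and T: "\<forall>i z. T i z \<le> 2"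
    and q: "q < length p" "\<And>y n. qr \<noteq> Some (q, y, n)"
  shows "step (machine k p acc qr) B (conf k (q, T, h)) c \<longleftrightarrow>
    (\<exists>s'. istep p (q, T, h) s' \<and> c = conf k s')"
proof -
  let ?ts = "map (\<lambda>i. (T i, h i)) [0..<k]" and ?ss = "map (\<lambda>i. T i (h i)) [0..<k]"
  have "step (machine k p acc qr) B (conf k (q, T, h)) c \<longleftrightarrow>
      (\<exists>q' as. (q', as) \<in> itrans k (p ! q) q ?ss \<and> c = (q', map2 act as ?ts))"
  proof -
    have "read ` (\<lambda>i. (T i, h i)) ` {0..<k} \<subseteq> {..2}" using T by auto
    then show ?thesis using q
      by (auto simp: step.simps machine_def map_read_conf simp del: map_map map2_map_map)
  qed
  also have "\<dots> \<longleftrightarrow> (\<exists>s'. istep p (q, T, h) s' \<and> c = conf k s')"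
  proof -
    have ok: "instr_ok k (p ! q)" using p(1) q(1) by simp
    have stay: "map2 act (write_tape k ?ss 0 (?ss ! 0) MStay) ?ts = ?ts"
      using p(2) by (subst act_write_tape) auto
    show ?thesis
    proof (cases "p ! q")
      case (Mv j m)
      then show ?thesis using ok q(1) act_write_tape[of j k T h "T j (h j)" m]
        by (auto simp: istep_def simp del: map_map map2_map_map)
    next
      case (Put j a m)
      then show ?thesis using ok q(1) act_write_tape[of j k T h a m]
        by (auto simp: istep_def simp del: map_map map2_map_map)
    next
      case (Br j a d)
      then show ?thesis using ok q(1) stay
        by (auto simp: istep_def simp del: map_map map2_map_map)
    next
      case (Jmp d)
      then show ?thesis using ok q(1) stay
        by (auto simp: istep_def simp del: map_map map2_map_map)
    next
      case (Flip d)
      then show ?thesis using ok q(1) stay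
        by (simp add: istep_def ex_disj_distrib conj_disj_distribR del: map_map map2_map_map)
    qed
  qed
  finally show ?thesis .
qed

lemma istep_symbols:
  assumes "\<forall>i\<in>set p. instr_ok k i" "\<forall>i z. T i z \<le> 2" "istep p (q, T, h) (q', T', h')"
  shows "\<forall>i z. T' i z \<le> 2"
proof -
  have "instr_ok k (p ! q)" using assms by (auto simp: istep_def)
  then show ?thesis using assms(2,3) by (cases "p ! q") (auto simp: istep_def split: if_splits)
qed

lemma wf_machine:
  assumes p: "\<forall>i\<in>set p. instr_ok k i" "2 \<le> k" and "length p \<le> acc"
    "\<And>q y n. qr = Some (q, y, n) \<Longrightarrow> length p \<le> q \<and> q \<noteq> acc"
  shows "wf_tm (machine k p acc qr)"
proof -
  let ?S = "{ss. set ss \<subseteq> {..2::nat} \<and> length ss = k}"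
  have fi: "finite (itrans k i q ss)" for i q ss by (cases i) auto
  have l: "(q', as) \<in> itrans k i q ss \<Longrightarrow> length as = k" for i q ss q' as
    by (cases i) (auto simp: write_tape_def)
  have "trans (machine k p acc qr) =
      (\<Union>q\<in>{..<length p}. \<Union>ss\<in>?S. (\<lambda>(q', as). (q, ss, q', as)) ` itrans k (p ! q) q ss)"
    by (auto simp: machine_def)
  moreover have "finite ?S" by (rule finite_lists_length_eq) simp
  ultimately have "finite (trans (machine k p acc qr))" using fi by simp
  then show ?thesis using assms l unfolding wf_tm_def
    by (auto simp: machine_def)
qed

lemma deterministic_machine:
  assumes "\<And>d. Flip d \<notin> set p" shows "deterministic (machine k p acc qr)"
proof -
  have "a = b" if "q < length p" "a \<in> itrans k (p ! q) q ss" "b \<in> itrans k (p ! q) q ss" for q ss a b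
    using assms that nth_mem[OF that(1)] by (cases "p ! q") auto
  then show ?thesis unfolding deterministic_def machine_def by fastforce
qed

lemma machine_simps [simp]:
  "tapes (machine k p acc qr) = k" "start (machine k p acc qr) = 0"
  "accept (machine k p acc qr) = acc" "query (machine k p acc qr) = qr"
  by (simp_all add: machine_def)

section \<open>Initial stores, guessing a certificate, writing a word\<close>

definition ones :: "bool list \<Rightarrow> nat set" where
  "ones x = {i. i < length x \<and> x ! i}"

definition home :: "nat \<Rightarrow> int" where
  "home = (\<lambda>_. 0)"

lemma home_apply [simp]: "home j = 0"
  by (simp add: home_def)

text \<open>The counters that the machine does not have are marked from the beginning.\<close>

definition init_store :: "nat \<Rightarrow> bool list \<Rightarrow> store" where
  "init_store k x = (\<lambda>i z. if i = 0 then fst (input_tape x) z else if k \<le> i \<and> z = 0 then 1 else 0, home)"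

definition marked_store :: "bool list \<Rightarrow> store" where
  "marked_store x = (\<lambda>i z. if i = 0 then fst (input_tape x) z else if 3 \<le> i \<and> z = 0 then 1 else 0, home)"

definition init_code :: "nat \<Rightarrow> instr list" where
  "init_code k = map (\<lambda>j. Put j 1 MStay) [3..<k]"

lemma conf_init:
  assumes "2 \<le> k" shows "conf k (0, init_store k x) = init (machine k p acc qr) x"
  using assms
  by (auto simp: init_store_def init_def input_tape_def fun_eq_iff nth_Cons split: nat.split
      intro!: nth_equalityI)

lemma exec_init_code:
  assumes "3 \<le> k" shows "exec1 (init_code k) (init_store k x) (marked_store x) k"
proof -
  \<comment> \<open>\<open>U l\<close> is the contents once the counters below \<open>l\<close> are
    marked. Those from \<open>k\<close> on exist only in the store and count as marked
    throughout.\<close>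
  define U where "U = (\<lambda>l i z. if i = 0 then fst (input_tape x) z else
    if (3 \<le> i \<and> i < l \<or> k \<le> i) \<and> z = 0 then 1 else (0::nat))"
  define S where "S l = (U l, home)" for l
  have "exec1 (map (\<lambda>j. Put j 1 MStay) [3..<l]) (S 3) (S l) l" if "3 \<le> l" "l \<le> k" for l
    using that
  proof (induction l rule: dec_induct)
    case base
    show ?case using exec1_Nil by simp
  next
    case (step l)
    have "(U l)(l := (U l l)(0 := 1)) = U (Suc l)" using step by (auto simp: fun_eq_iff U_def)
    then have "exec1 [Put l 1 MStay] (S l) (S (Suc l)) 1"
      using exec_Put[of l 1 MStay "U l" home] by (simp add: fun_upd_idem S_def)
    from exec1_append[OF _ this] show ?case using step by fastforce
  qed
  moreover have "S 3 = init_store k x" "S k = marked_store x"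
    using assms by (auto simp: S_def U_def init_store_def marked_store_def fun_eq_iff)
  ultimately show ?thesis using assms unfolding init_code_def by (metis order_refl)
qed

lemma istep_located:
  "located p a (i # c) \<Longrightarrow> istep p (a, \<sigma>) s' \<longleftrightarrow> s' \<in> isem i a \<sigma>"
  using located_Cons(2)[of p a i c] by (simp add: istep_def)

lemma exec1_then: "exec1 c \<sigma> \<sigma>' t \<Longrightarrow> exec d \<sigma>' R u \<Longrightarrow> exec (c @ d) \<sigma> R (t + u)"
  using exec_append[of c \<sigma> "{\<sigma>'}" t d "\<lambda>_. R" u] by simp

lemma exec_Put':
  "T' = T(j := (T j)(h j := a)) \<Longrightarrow> h' = h(j := h j + shift m) \<Longrightarrow> 1 \<le> t \<Longrightarrow>
    exec1 [Put j a m] (T, h) (T', h') t"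
  using exec_Put exec_mono by blast

definition guess_bit :: "instr list" where
  "guess_bit = [Flip 3, Put 2 1 MRight, Jmp 2, Put 2 2 MRight]"

lemma exec_guess_bit:
  "exec guess_bit (T, h) (range (\<lambda>b. (T(2 := (T 2)(h 2 := bit_symbol b)), h(2 := h 2 + 1)))) 3"
  (is "exec _ _ ?R _")
  unfolding exec_def
proof (intro allI impI)
  fix p a assume l: "located p a guess_bit"
  let ?s = "\<lambda>b. (a + 4, T(2 := (T 2)(h 2 := bit_symbol b)), h(2 := h 2 + 1))"
  note l0 = l[unfolded guess_bit_def]
  note l1 = located_Cons(1)[OF l0]
  note l2 = located_Cons(1)[OF l1]
  note l3 = located_Cons(1)[OF l2]
  have 0: "istep p (a, T, h) s' \<longleftrightarrow> s' = (Suc a, T, h) \<or> s' = (Suc (Suc (Suc a)), T, h)" for s'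
    using istep_located[OF l0] by (auto simp: nat_add_distrib)
  have 1: "istep p (Suc a, T, h) s' \<longleftrightarrow> s' = (Suc (Suc a), snd (?s False))" for s'
    using istep_located[OF l1] by (auto simp: bit_symbol_def)
  have 2: "istep p (Suc (Suc a), \<sigma>) s' \<longleftrightarrow> s' = (a + 4, \<sigma>)" for s' \<sigma>
    using istep_located[OF l2, of \<sigma> s'] by (auto simp: nat_add_distrib)
  have 3: "istep p (Suc (Suc (Suc a)), T, h) s' \<longleftrightarrow> s' = ?s True" for s'
    using istep_located[OF l3] by (auto simp: bit_symbol_def)
  have len: "length guess_bit = 4" by (simp add: guess_bit_def)
  have R: "Pair (a + length guess_bit) ` ?R = {?s False, ?s True}"
    by (auto simp: len UNIV_bool)
  have "hits (istep p) {?s False, ?s True} 2 s'" if "istep p (a, T, h) s'" for s'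
    using that[unfolded 0]
  proof
    assume s': "s' = (Suc a, T, h)"
    have "hits (istep p) {?s False, ?s True} (Suc 0) (Suc (Suc a), snd (?s False))"
      by (rule hits_first[of "istep p", OF 2 hits.stop]) simp
    from hits_first[of "istep p", OF 1 this] show ?thesis by (simp add: s' numeral_2_eq_2)
  next
    assume s': "s' = (Suc (Suc (Suc a)), T, h)"
    show ?thesis unfolding s' by (rule hits_mono[OF hits_first[of "istep p", OF 3 hits.stop, of _ 0]]) auto
  qed
  then have "hits (istep p) {?s False, ?s True} (Suc 2) (a, T, h)"
    using hits.go[of "istep p" "(a, T, h)" "(Suc a, T, h)" "{?s False, ?s True}" 2] 0 by blast
  then have "hits (istep p) {?s False, ?s True} 3 (a, T, h)" by simp
  moreover have "(istep p)\<^sup>*\<^sup>* (a, T, h) (?s False)"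
    using rtranclp_first[of "istep p", OF 1 rtranclp_first[of "istep p", OF 2 rtranclp.rtrancl_refl]] 0
    by (auto intro: converse_rtranclp_into_rtranclp)
  moreover have "(istep p)\<^sup>*\<^sup>* (a, T, h) (?s True)"
    using rtranclp_first[of "istep p", OF 3 rtranclp.rtrancl_refl] 0
    by (auto intro: converse_rtranclp_into_rtranclp)
  ultimately show "hits (istep p) (Pair (a + length guess_bit) ` ?R) 3 (a, T, h) \<and>
      (\<forall>\<sigma>'\<in>?R. (istep p)\<^sup>*\<^sup>* (a, T, h) (a + length guess_bit, \<sigma>'))"
    unfolding R by (simp add: len UNIV_bool)
qed

definition tape_of :: "nat \<Rightarrow> nat set \<Rightarrow> int \<Rightarrow> nat" where
  "tape_of m S = (\<lambda>z. if 0 \<le> z \<and> z < int m then bit_symbol (nat z \<in> S) else 0)"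

text \<open>Counter 4 holds the number of bits still to be guessed and counter 5 the number of those
  already written, which finally brings the head of tape 2 back to cell 0. Counter 3 stays 0 and
  stands for all free variables.\<close>

definition guess_code :: "trm \<Rightarrow> instr list" where
  "guess_code t = term_code t (\<lambda>_. 3) 4 6 @ while 4 1 (dec 4 # guess_bit @ [inc 5]) @
     while 5 1 [dec 5, dec 2]"

lemma tape_of_Suc: "(tape_of m S)(int m := bit_symbol b) = tape_of (Suc m) (if b then insert m S else S - {m})"
  by (auto simp: tape_of_def fun_eq_iff bit_symbol_def)

definition guess_loop_state :: "(nat \<Rightarrow> int \<Rightarrow> nat) \<Rightarrow> nat \<Rightarrow> nat \<Rightarrow> nat set \<Rightarrow> store" where
  "guess_loop_state T m i Y = (T(2 := tape_of i Y), home(4 := int (m - i), 5 := int i, 2 := int i))"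

text \<open>Induction on the number of missing bits: the sets that agree with \<open>Y\<close> below
  \<open>i\<close> are split according to whether they contain \<open>i\<close>.\<close>

lemma exec_guess_loop:
  assumes T: "\<And>j z. 3 \<le> j \<Longrightarrow> T j z = 1 \<longleftrightarrow> z = 0"
  shows "i \<le> m \<Longrightarrow> Y \<subseteq> {..<i} \<Longrightarrow>
    exec (while 4 1 (dec 4 # guess_bit @ [inc 5])) (guess_loop_state T m i Y)
      (guess_loop_state T m m ` {Y'. Y' \<subseteq> {..<m} \<and> Y' \<inter> {..<i} = Y}) ((m - i) * 7 + 1)"
proof (induction i arbitrary: Y rule: inc_induct)
  case base
  have "guess_loop_state T m m ` {Y'. Y' \<subseteq> {..<m} \<and> Y' \<inter> {..<m} = Y} = {guess_loop_state T m m Y}"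
    using base by (auto simp: Int_absorb2 intro!: exI[of _ Y])
  moreover have "exec1 (while 4 1 (dec 4 # guess_bit @ [inc 5]))
      (guess_loop_state T m m Y) (guess_loop_state T m m Y) 1"
    unfolding guess_loop_state_def by (rule exec_while_False) (use T in auto)
  ultimately show ?case by simp
next
  case (step i)
  let ?h = "\<lambda>i. home(4 := int (m - i), 5 := int i, 2 := int i)"
  let ?Y = "\<lambda>b. if b then insert i Y else Y"
  let ?f = "\<lambda>b. guess_loop_state T m (Suc i) (?Y b)"
  let ?R = "\<lambda>Y. guess_loop_state T m m ` {Y'. Y' \<subseteq> {..<m} \<and> Y' \<inter> {..<Suc i} = Y}"
  let ?h' = "(?h i)(4 := int (m - Suc i))"
  let ?g = "\<lambda>b. (T(2 := (tape_of i Y)(int i := bit_symbol b)), ?h'(2 := int i + 1))"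
  have "Y - {i} = Y" using step.prems by auto
  then have t: "(tape_of i Y)(int i := bit_symbol b) = tape_of (Suc i) (?Y b)" for b
    by (simp add: tape_of_Suc)
  have 1: "exec1 [dec 4] (guess_loop_state T m i Y) (T(2 := tape_of i Y), ?h') 1"
    unfolding guess_loop_state_def
    using step(2) by (intro exec_dec) (auto simp: fun_eq_iff)
  have 2: "exec guess_bit (T(2 := tape_of i Y), ?h') (range ?g) 3"
    using exec_guess_bit[of "T(2 := tape_of i Y)" ?h'] by (simp add: add_ac)
  have 3: "exec1 [inc 5] (?g b) (?f b) 1" for b
    unfolding t guess_loop_state_def by (intro exec_inc) (auto simp: fun_eq_iff)
  have "exec ([dec 4] @ guess_bit @ [inc 5]) (guess_loop_state T m i Y)
      (\<Union>b. {?f b}) (1 + (3 + 1))"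
    by (rule exec1_then[OF 1 exec_append_image[OF 2 3]])
  then have "exec (dec 4 # guess_bit @ [inc 5]) (guess_loop_state T m i Y) (range ?f) (1 + (3 + 1))"
    by (simp add: UNION_singleton_eq_range)
  then have "exec (while 4 1 (dec 4 # guess_bit @ [inc 5])) (guess_loop_state T m i Y)
      (\<Union>b. ?R (?Y b)) (1 + (3 + 1) + 2 + ((m - Suc i) * 7 + 1))"
    unfolding guess_loop_state_def[of T m i]
  proof (rule exec_while_image[rotated])
    fix b
    show "exec (while 4 1 (dec 4 # guess_bit @ [inc 5])) (?f b) (?R (?Y b)) ((m - Suc i) * 7 + 1)"
      by (rule step.IH) (use step.prems in auto)
  qed (use T step(2) in auto)
  moreover have "(\<Union>b. ?R (?Y b)) = guess_loop_state T m m ` {Y'. Y' \<subseteq> {..<m} \<and> Y' \<inter> {..<i} = Y}"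
  proof -
    have e: "Y' \<inter> {..<i} = Y \<longleftrightarrow> (\<exists>b. Y' \<inter> {..<Suc i} = ?Y b)" for Y'
    proof
      assume "Y' \<inter> {..<i} = Y"
      then have "Y' \<inter> {..<Suc i} = ?Y (i \<in> Y')" by (auto simp: less_Suc_eq)
      then show "\<exists>b. Y' \<inter> {..<Suc i} = ?Y b" by blast
    next
      assume "\<exists>b. Y' \<inter> {..<Suc i} = ?Y b"
      then obtain b where b: "Y' \<inter> {..<Suc i} = ?Y b" by blast
      have "Y' \<inter> {..<i} = Y' \<inter> {..<Suc i} \<inter> {..<i}" by auto
      also have "\<dots> = Y" unfolding b using step.prems by auto
      finally show "Y' \<inter> {..<i} = Y" .
    qed
    have "{Y'. Y' \<subseteq> {..<m} \<and> Y' \<inter> {..<i} = Y} =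
        (\<Union>b. {Y'. Y' \<subseteq> {..<m} \<and> Y' \<inter> {..<Suc i} = ?Y b})" unfolding e by blast
    then show ?thesis by (simp only: image_UN)
  qed
  moreover have "1 + (3 + 1) + 2 + ((m - Suc i) * 7 + 1) = (m - i) * 7 + 1" using step(2) by simp
  ultimately show ?case by (simp only:)
qed

lemma frame_marked:
  assumes "T 0 = fst (input_tape x)" "T 2 = tape_of m Y" "Y \<subseteq> {..<m}"
    "\<And>j z. 3 \<le> j \<Longrightarrow> T j z = 1 \<longleftrightarrow> z = 0"
  shows "frame (length x) (ones x) Y (\<lambda>_. 0) (length x) (\<lambda>_. 3) 6 (T, home)"
  using assms
  by (auto simp: frame_def contents_def input_tape_def ones_def tape_of_def bit_symbol_def)

lemma exec_guess_code:
  assumes "term_code_time t q" "frame n X Y (\<lambda>_. 0) n (\<lambda>_. 3) 6 (T, home)" "T 2 = tape_of 0 {}"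
    "m = tval n (\<lambda>_. 0) t"
  shows "exec (guess_code t) (T, home) ((\<lambda>Y. (T(2 := tape_of m Y), home)) ` Pow {..<m})
    (poly q n + (m * 7 + 1 + (m * 4 + 1)))"
proof -
  let ?f = "\<lambda>Y. (T(2 := tape_of m Y), home(5 := int m, 2 := int m))"
  have T: "\<And>j z. 3 \<le> j \<Longrightarrow> T j z = 1 \<longleftrightarrow> z = 0" by (rule frameD(8)[OF assms(2)])
  have 1: "exec1 (term_code t (\<lambda>_. 3) 4 6) (T, home) (T, home(4 := int m)) (poly q n)"
    using term_code_timeD[OF assms(1,2), of 4] assms(4) by simp
  have "guess_loop_state T m 0 {} = (T, home(4 := int m))" "guess_loop_state T m m = ?f"
    using assms(3) by (auto simp: fun_eq_iff guess_loop_state_def)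
  then have "exec (while 4 1 (dec 4 # guess_bit @ [inc 5])) (T, home(4 := int m))
      (?f ` Pow {..<m}) (m * 7 + 1)"
    using exec_guess_loop[of T 0 m "{}", OF T] by (simp add: Pow_def)
  moreover have "exec1 (while 5 1 [dec 5, dec 2]) (?f Y) (T(2 := tape_of m Y), home) (m * 4 + 1)" for Y
    by (rule exec1_while'[of _ "\<lambda>i. (T(2 := tape_of m Y), home(5 := int m - int i, 2 := int m - int i))"
          _ m _ _ _ 2])
      (use T in \<open>auto simp: fun_eq_iff intro!: exec_moves\<close>)
  ultimately have "exec (while 4 1 (dec 4 # guess_bit @ [inc 5]) @ while 5 1 [dec 5, dec 2])
      (T, home(4 := int m)) (\<Union>Y\<in>Pow {..<m}. {(T(2 := tape_of m Y), home)})
      (m * 7 + 1 + (m * 4 + 1))"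
    by (rule exec_append_image)
  from exec1_then[OF 1 this] show ?thesis unfolding guess_code_def by (simp add: UNION_singleton_eq_range)
qed

text \<open>Counter 5 is the index of the bit and at the same time variable 0 of \<open>f\<close>.
  The head of tape 1 may stay behind the last bit because \<open>tape_word\<close> starts at cell 0
  wherever the head is.\<close>

definition gen_code :: "trm \<Rightarrow> fm \<Rightarrow> instr list" where
  "gen_code t f = term_code t (\<lambda>_. 3) 4 6 @
     while 4 1 (dec 4 # formula_code f (case_nat 5 (\<lambda>_. 3)) 6 @
       ite 6 1 [Put 1 1 MRight] [Put 1 2 MRight, dec 6] @ [inc 5])"

lemma exec_gen_code:
  assumes "term_code_time t q" "formula_code_time f r"
    "frame n X Y (\<lambda>_. 0) n (\<lambda>_. 3) 6 (T, home)" "T 1 = tape_of 0 {}"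
    "m = tval n (\<lambda>_. 0) t"
  shows "exec1 (gen_code t f) (T, home)
    (T(1 := tape_of m {i. sat n X Y (case_nat i (\<lambda>_. 0)) f}), home(1 := int m, 5 := int m))
    (poly q n + (m * (poly r (n + m) + 8) + 1))"
proof -
  let ?S = "{i. sat n X Y (case_nat i (\<lambda>_. 0)) f}"
  have T: "\<And>j z. 3 \<le> j \<Longrightarrow> T j z = 1 \<longleftrightarrow> z = 0" by (rule frameD(8)[OF assms(3)])
  have 1: "exec1 (term_code t (\<lambda>_. 3) 4 6) (T, home) (T, home(4 := int m)) (poly q n)"
    using term_code_timeD[OF assms(1,3), of 4] assms(5) by simp
  let ?B = "dec 4 # formula_code f (case_nat 5 (\<lambda>_. 3)) 6 @
       ite 6 1 [Put 1 1 MRight] [Put 1 2 MRight, dec 6] @ [inc 5]"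
  let ?f = "\<lambda>i. (T(1 := tape_of i ?S), home(4 := int m - int i, 1 := int i, 5 := int i))"
  have 2: "exec1 ?B (?f i) (?f (Suc i)) (poly r (n + m) + 6)" if "i < m" for i
  proof -
    let ?g = "\<lambda>b l. (T(1 := tape_of l ?S),
      home(4 := int m - int (Suc i), 1 := int l, 5 := int i, 6 := of_bool b))"
    have "frame n X Y (\<lambda>_. 0) n (\<lambda>_. 3) 6 (T(1 := tape_of i ?S), home)"
      using assms(3) by (simp add: frame_def contents_def)
    then have "frame n X Y (case_nat i (\<lambda>_. 0)) (n + m) (case_nat 5 (\<lambda>_. 3)) 6 (?g False i)"
      using that by (auto simp: frame_def contents_def split: nat.split)
    from formula_code_timeD[OF assms(2) this]
    have "exec1 (formula_code f (case_nat 5 (\<lambda>_. 3)) 6) (?g False i) (?g (i \<in> ?S) i) (poly r (n + m))"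
      by simp
    moreover have "exec1 (ite 6 1 [Put 1 1 MRight] [Put 1 2 MRight, dec 6]) (?g (i \<in> ?S) i) (?g False (Suc i)) 4"
    proof (rule exec1_ite[where t = 2])
      let ?T = "T(1 := tape_of i ?S)"
      let ?h = "\<lambda>b. home(4 := int m - int (Suc i), 1 := int i, 5 := int i, 6 := of_bool b :: int)"
      have t: "(tape_of i ?S)(int i := bit_symbol (i \<in> ?S)) = tape_of (Suc i) ?S"
        by (auto simp: tape_of_def fun_eq_iff)
      assume 6: "?T 6 (?h (i \<in> ?S) 6) = 1"
      then have b: "i \<notin> ?S" using T[of 6] by (auto split: if_splits)
      have "?T(1 := (?T 1)(?h (i \<in> ?S) 1 := 1)) = T(1 := tape_of (Suc i) ?S)"
        unfolding t[symmetric] using b by (simp add: bit_symbol_def)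
      then show "exec1 [Put 1 1 MRight] (?g (i \<in> ?S) i) (?g False (Suc i)) 2"
        by (intro exec_Put') (use b in \<open>auto simp: fun_eq_iff\<close>)
    next
      let ?T = "T(1 := tape_of i ?S)"
      let ?h = "\<lambda>b. home(4 := int m - int (Suc i), 1 := int i, 5 := int i, 6 := of_bool b :: int)"
      have t: "(tape_of i ?S)(int i := bit_symbol (i \<in> ?S)) = tape_of (Suc i) ?S"
        by (auto simp: tape_of_def fun_eq_iff)
      assume 6: "?T 6 (?h (i \<in> ?S) 6) \<noteq> 1"
      then have b: "i \<in> ?S" using T[of 6] by (auto split: if_splits)
      have "?T(1 := (?T 1)(?h (i \<in> ?S) 1 := 2)) = T(1 := tape_of (Suc i) ?S)"
        unfolding t[symmetric] using b by (simp add: bit_symbol_def)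
      then have "exec1 [Put 1 2 MRight] (?g (i \<in> ?S) i) (?g True (Suc i)) 1"
        by (intro exec_Put') (use b in \<open>auto simp: fun_eq_iff\<close>)
      moreover have "exec1 [dec 6] (?g True (Suc i)) (?g False (Suc i)) 1"
        by (intro exec_dec) (auto simp: fun_eq_iff)
      ultimately show "exec1 [Put 1 2 MRight, dec 6] (?g (i \<in> ?S) i) (?g False (Suc i)) 2"
        using exec1_Cons by (metis numeral_2_eq_2 One_nat_def)
    qed simp
    moreover have "exec1 [inc 5] (?g False (Suc i)) (?f (Suc i)) 1"
      by (intro exec_inc) (auto simp: fun_eq_iff)
    moreover have "exec1 [dec 4] (?f i) (?g False i) 1"
      by (intro exec_dec) (auto simp: fun_eq_iff)
    ultimately have "exec1 ?B (?f i) (?f (Suc i)) (Suc (poly r (n + m) + (4 + 1)))"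
      by (blast intro: exec1_append exec1_Cons)
    moreover have "Suc (poly r (n + m) + (4 + 1)) = poly r (n + m) + 6" by simp
    ultimately show ?thesis by (simp only:)
  qed
  have "exec1 (while 4 1 ?B) (T, home(4 := int m))
    (T(1 := tape_of m ?S), home(1 := int m, 5 := int m)) (m * (poly r (n + m) + 8) + 1)"
    by (rule exec1_while'[of _ ?f _ m _ _ _ "poly r (n + m) + 6"])
      (use 2 T assms(4) in \<open>auto simp: fun_eq_iff tape_of_def\<close>)
  from exec1_append[OF 1 this] show ?thesis unfolding gen_code_def .
qed

section \<open>From complete programs to machines\<close>

definition code_ok :: "instr list \<Rightarrow> bool" where
  "code_ok c \<longleftrightarrow> (\<exists>k. \<forall>i\<in>set c. instr_ok k i)"

lemma instr_ok_mono: "instr_ok k i \<Longrightarrow> k \<le> k' \<Longrightarrow> instr_ok k' i"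
  by (cases i) auto

lemma code_ok_Nil [simp]: "code_ok []"
  by (simp add: code_ok_def)

lemma code_ok_append [simp]: "code_ok (c @ d) \<longleftrightarrow> code_ok c \<and> code_ok d"
proof
  assume "code_ok c \<and> code_ok d"
  then obtain k l where "\<forall>i\<in>set c. instr_ok k i" "\<forall>i\<in>set d. instr_ok l i"
    by (auto simp: code_ok_def)
  then have "\<forall>i\<in>set (c @ d). instr_ok (max k l) i"
    using instr_ok_mono by (metis Un_iff max.cobounded1 max.cobounded2 set_append)
  then show "code_ok (c @ d)" unfolding code_ok_def by blast
qed (auto simp: code_ok_def)

lemma code_ok_Cons: "code_ok (i # c) \<longleftrightarrow> code_ok [i] \<and> code_ok c"
  using code_ok_append[of "[i]" c] by simp

lemma code_ok_single [simp]: "code_ok [Mv j m]" "code_ok [Br j a d]" "code_ok [Jmp d]" "code_ok [Flip d]"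
  "code_ok [Put j a m] \<longleftrightarrow> a \<le> 2"
  by (auto simp: code_ok_def)

lemma code_ok_ite [simp]: "code_ok (ite j a c d) \<longleftrightarrow> code_ok c \<and> code_ok d"
  unfolding ite_def by (subst code_ok_Cons) (auto simp: code_ok_Cons[of _ c])

lemma code_ok_while [simp]: "code_ok (while j a c) \<longleftrightarrow> code_ok c"
  unfolding while_def by (subst code_ok_Cons) auto

lemma code_ok_term_code [simp]: "code_ok (term_code t \<rho> c s)"
proof (induction t arbitrary: c s)
  case (Const m)
  have "code_ok (replicate m (inc c))" by (induction m) (simp, subst replicate_Suc, subst code_ok_Cons, simp)
  then show ?case by simp
qed (auto simp: code_ok_Cons[of _ "_ # _"] code_ok_Cons[of _ "term_code _ _ _ _"])

lemma code_ok_formula_code [simp]: "code_ok (formula_code f \<rho> s)"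
  by (induction f arbitrary: \<rho> s)
    (auto simp: code_ok_Cons[of _ "_ # _"] code_ok_Cons[of _ "_ @ _"] code_ok_Cons[of _ "ite _ _ _ _"])

lemma code_ok_guess_code [simp]: "code_ok (guess_code t)"
  by (auto simp: guess_code_def guess_bit_def code_ok_Cons[of _ "_ # _"] code_ok_Cons[of _ "_ @ _"])

lemma code_ok_gen_code [simp]: "code_ok (gen_code t f)"
  by (auto simp: gen_code_def code_ok_Cons[of _ "_ # _"] code_ok_Cons[of _ "_ @ _"])

lemma flip_free_term_code: "Flip d \<notin> set (term_code t \<rho> c s)"
  by (induction t arbitrary: c s) (auto simp: while_def)

lemma flip_free_formula_code: "Flip d \<notin> set (formula_code f \<rho> s)"
  by (induction f arbitrary: \<rho> s) (auto simp: while_def ite_def flip_free_term_code)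

lemma flip_free_gen_code: "Flip d \<notin> set (gen_code t f)"
  by (auto simp: gen_code_def while_def ite_def flip_free_term_code flip_free_formula_code)

text \<open>The invariant behind the simulation is that only the symbols 0, 1, 2 are on the tapes,
  since the machine can read no others.\<close>

lemma machine_run:
  assumes p: "\<forall>i\<in>set p. instr_ok k i" "2 \<le> k" and qr: "\<And>q y n. qr = Some (q, y, n) \<Longrightarrow> length p \<le> q"
  shows "hits (istep p) R t (0, init_store k x) \<Longrightarrow>
      hits (step (machine k p acc qr) B) (conf k ` R) t (init (machine k p acc qr) x)"
    and "(istep p)\<^sup>*\<^sup>* (0, init_store k x) s \<Longrightarrow>
      (step (machine k p acc qr) B)\<^sup>*\<^sup>* (init (machine k p acc qr) x) (conf k s)"
proof -
  define I :: "nat \<times> store \<Rightarrow> bool" where "I = (\<lambda>(q, T, h). \<forall>i z. T i z \<le> 2)"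
  have I0: "I (0, init_store k x)"
    by (auto simp: I_def init_store_def input_tape_def bit_symbol_def)
  have I: "I s \<Longrightarrow> istep p s s' \<Longrightarrow> I s'" for s s'
    unfolding I_def using istep_symbols[OF p(1)] by (cases s, cases s') blast
  have st: "step (machine k p acc qr) B (conf k s) c \<longleftrightarrow> (\<exists>s'. istep p s s' \<and> c = conf k s')"
    if "I s" "istep p s s0" for s s0 c
  proof (cases s)
    case (fields q T h)
    then have q: "q < length p" using that(2) by (simp add: istep_def)
    then have "qr \<noteq> Some (q, y, n)" for y n using qr[of q y n] by auto
    then show ?thesis unfolding fields
      using that(1)[unfolded fields I_def] q by (intro step_machine[OF p]) simp_all
  qed
  show "hits (istep p) R t (0, init_store k x) \<Longrightarrow>
      hits (step (machine k p acc qr) B) (conf k ` R) t (init (machine k p acc qr) x)"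
    using hits_simulate[where I = I and r = "istep p" and g = "conf k", OF _ I0 I st] conf_init[OF p(2), of x p acc qr] by simp
  show "(istep p)\<^sup>*\<^sup>* (0, init_store k x) s \<Longrightarrow>
      (step (machine k p acc qr) B)\<^sup>*\<^sup>* (init (machine k p acc qr) x) (conf k s)"
    unfolding conf_init[OF p(2), of x p acc qr, symmetric]
    by (erule rtranclp_simulate[where I = I, OF _ I0 I]) (use st in blast)+
qed

text \<open>The number of tapes is fixed only when the code is complete: the three tapes for input,
  query and certificate, and every counter that the code mentions.\<close>

lemma machine_code:
  assumes "code_ok c"
  obtains k where "3 \<le> k" "\<forall>i\<in>set (init_code k @ c). instr_ok k i"
proof -
  obtain k0 where k0: "\<forall>i\<in>set c. instr_ok k0 i" using assms by (auto simp: code_ok_def)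
  let ?k = "max 3 k0"
  have "instr_ok ?k i" if "i \<in> set (init_code ?k @ c)" for i
    using that k0 instr_ok_mono[of k0 i ?k] by (auto simp: init_code_def)
  then show ?thesis using that[of ?k] by auto
qed

lemma located_self: "located p 0 p" "located (p @ d) 0 p" "located (c @ p) (length c) p"
  by (auto simp: located_def intro: exI[of _ "[]"])

lemma exec_from_start:
  assumes "exec c \<sigma> R t" "located p 0 c"
  shows "hits (istep p) (Pair (length c) ` R) t (0, \<sigma>)"
    "\<sigma>' \<in> R \<Longrightarrow> (istep p)\<^sup>*\<^sup>* (0, \<sigma>) (length c, \<sigma>')"
  using assms(1)[unfolded exec_def, rule_format, OF assms(2)] by auto

lemma tape_word_tape_of: "tape_word (tape_of m S, z) = map (\<lambda>i. i \<in> S) [0..<m]"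
proof -
  have r: "range bit_symbol = {1, 2}" by (auto simp: bit_symbol_def UNIV_bool)
  have "(LEAST i. tape_of m S (int i) \<notin> range bit_symbol) = m"
    unfolding r by (rule Least_equality) (auto simp: tape_of_def bit_symbol_def not_less[symmetric] split: if_splits)
  then show ?thesis by (auto simp: tape_of_def bit_symbol_def)
qed

lemma poly_timeI:
  fixes q :: "nat poly"
  assumes "\<And>x. hits (step M B) (R x) (poly q (length x)) (init M x)"
    "\<And>x c c'. c \<in> R x \<Longrightarrow> \<not> step M B c c'"
  shows "poly_time M B"
  unfolding poly_time_def
proof (intro exI[of _ q] allI impI)
  fix x n c assume "(step M B ^^ n) (init M x) c"
  then show "n \<le> poly q (length x)" using hits_bound(1)[OF assms(1), of x n c] assms(2) by blast
qed

text \<open>An accepting configuration has no successor, so a run that ends in one must have ended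
  in \<open>R\<close>.\<close>

lemma accepts_iff_hits:
  assumes "wf_tm M" "hits (step M B) R t (init M x)" "\<And>c c'. c \<in> R \<Longrightarrow> \<not> step M B c c'"
    "\<And>c. c \<in> R \<Longrightarrow> (step M B)\<^sup>*\<^sup>* (init M x) c"
  shows "accepts M B x \<longleftrightarrow> (\<exists>c\<in>R. fst c = accept M)"
proof
  assume "accepts M B x"
  then obtain c where c: "(step M B)\<^sup>*\<^sup>* (init M x) c" "fst c = accept M" by (auto simp: accepts_def)
  have "\<not> step M B c c'" for c'
    using assms(1) c(2) by (auto simp: wf_tm_def elim!: step.cases)
  moreover obtain n where "(step M B ^^ n) (init M x) c" using c(1) by (metis rtranclp_power)
  ultimately show "\<exists>c\<in>R. fst c = accept M" using hits_bound(2)[OF assms(2,3)] c(2) by blast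
next
  assume "\<exists>c\<in>R. fst c = accept M"
  then show "accepts M B x" using assms(4) unfolding accepts_def by blast
qed

lemma no_step_machine:
  assumes "length p \<le> fst c" "\<And>q y n. qr = Some (q, y, n) \<Longrightarrow> fst c \<noteq> q"
  shows "\<not> step (machine k p acc qr) B c c'"
  using assms by (auto simp: machine_def elim!: step.cases)

lemma FP_I:
  fixes l :: "nat poly"
  assumes "definable P"
    "\<And>x. f x = map (\<lambda>i. P (length x) (ones x) {} (case_nat i (\<lambda>_. 0))) [0..<poly l (length x)]"
  shows "f \<in> FP"
proof -
  obtain F where F: "P = (\<lambda>n X Y e. sat n X Y e F)" using assms(1) by (rule definableE)
  obtain t where t: "\<And>n e. tval n e t = poly l n" using poly_is_term by blast
  obtain q where q: "term_code_time t q" using exec_term_code by blast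
  obtain r where r: "formula_code_time F r" using exec_formula_code by blast
  obtain k where k: "3 \<le> k" "\<forall>i\<in>set (init_code k @ gen_code t F). instr_ok k i"
    using machine_code[of "gen_code t F"] by auto
  let ?p = "init_code k @ gen_code t F"
  \<comment> \<open>Running off the end of the code is acceptance.\<close>
  let ?M = "machine k ?p (length ?p) None"
  let ?s = "\<lambda>x. ((fst (marked_store x))(1 := tape_of (poly l (length x))
      {i. sat (length x) (ones x) {} (case_nat i (\<lambda>_. 0)) F}),
    home(1 := int (poly l (length x)), 5 := int (poly l (length x))))"
  let ?t = "[:k:] + (q + (l * (pcompose r ([:0, 1:] + l) + [:8:]) + [:1:]))"
  have ex: "exec1 ?p (init_store k x) (?s x) (poly ?t (length x))" for x
  proof -
    have "frame (length x) (ones x) {} (\<lambda>_. 0) (length x) (\<lambda>_. 3) 6 (fst (marked_store x), home)"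
      by (rule frame_marked[of _ _ 0]) (auto simp: marked_store_def tape_of_def fun_eq_iff)
    moreover have "fst (marked_store x) 1 = tape_of 0 {}"
      by (auto simp: marked_store_def tape_of_def fun_eq_iff)
    ultimately have "exec1 (gen_code t F) (fst (marked_store x), home) (?s x)
        (poly q (length x) + (poly l (length x) * (poly r (length x + poly l (length x)) + 8) + 1))"
      by (rule exec_gen_code[OF q r]) (simp add: t)
    then have "exec1 (gen_code t F) (marked_store x) (?s x)
        (poly q (length x) + (poly l (length x) * (poly r (length x + poly l (length x)) + 8) + 1))"
      by (simp add: marked_store_def)
    from exec1_append[OF exec_init_code[OF k(1)] this] show ?thesis by (simp add: poly_pcompose add_ac)
  qed
  have run: "hits (istep ?p) {(length ?p, ?s x)} (poly ?t (length x)) (0, init_store k x)"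
    "(istep ?p)\<^sup>*\<^sup>* (0, init_store k x) (length ?p, ?s x)" for x
    using exec_from_start[OF ex located_self(1)] by (simp_all del: length_append)
  have k2: "2 \<le> k" using k(1) by simp
  have wf: "wf_tm ?M" by (rule wf_machine[OF k(2) k2]) auto
  have det: "deterministic ?M"
    by (rule deterministic_machine) (auto simp: init_code_def flip_free_gen_code)
  have halt: "\<not> step ?M {} c c'" if "c \<in> conf k ` {(length ?p, ?s x)}" for x c c'
    using that by (intro no_step_machine) auto
  have pt: "poly_time ?M {}"
    by (rule poly_timeI[OF machine_run(1)[OF k(2) k2 _ run(1)] halt]) simp
  have "snd (conf k (length ?p, ?s x)) ! 1 = (tape_of (poly l (length x))
      {i. sat (length x) (ones x) {} (case_nat i (\<lambda>_. 0)) F}, int (poly l (length x)))" for x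
    using k(1) by simp
  then have "tape_word (snd (conf k (length ?p, ?s x)) ! 1) = f x" for x
    unfolding assms(2) F by (simp only: tape_word_tape_of mem_Collect_eq)
  then have "\<exists>c. (step ?M {})\<^sup>*\<^sup>* (init ?M x) c \<and> fst c = accept ?M \<and> tape_word (snd c ! 1) = f x" for x
    using machine_run(2)[OF k(2) k2 _ run(2), of None "length ?p" "{}" x] k(1)
    by (intro exI[of _ "conf k (length ?p, ?s x)"]) (simp del: tape_word.simps)
  then show ?thesis using wf det pt unfolding FP_def by auto
qed

lemma NP_I:
  fixes l :: "nat poly"
  assumes "definable P"
    "\<And>x. x \<in> L \<longleftrightarrow> (\<exists>Y\<subseteq>{..<poly l (length x)}. P (length x) (ones x) Y (\<lambda>_. 0))"
  shows "L \<in> NP"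
proof -
  obtain F where F: "P = (\<lambda>n X Y e. sat n X Y e F)" using assms(1) by (rule definableE)
  obtain t where t: "\<And>n e. tval n e t = poly l n" using poly_is_term by blast
  obtain q where q: "term_code_time t q" using exec_term_code by blast
  obtain r where r: "formula_code_time F r" using exec_formula_code by blast
  let ?c = "guess_code t @ formula_code F (\<lambda>_. 3) 6"
  obtain k where k: "3 \<le> k" "\<forall>i\<in>set (init_code k @ ?c @ [Br 6 1 2]). instr_ok k i"
    using machine_code[of "?c @ [Br 6 1 2]"] by auto
  let ?p' = "init_code k @ ?c"
  \<comment> \<open>The truth value is in counter 6. Reading the mark there means falsehood and
    leads one address beyond the accepting state, where the run is stuck; otherwise the run falls
    into the accepting state.\<close>
  let ?p = "init_code k @ ?c @ [Br 6 1 2]"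
  let ?M = "machine k ?p (length ?p) None"
  let ?T = "\<lambda>x Y. (fst (marked_store x))(2 := tape_of (poly l (length x)) Y)"
  let ?S = "\<lambda>x Y. sat (length x) (ones x) Y (\<lambda>_. 0) F"
  let ?s = "\<lambda>x Y. (?T x Y, home(6 := of_bool (?S x Y)))"
  let ?Y = "\<lambda>x. Pow {..<poly l (length x)}"
  let ?t = "[:k:] + (q + (l * [:7:] + [:1:] + (l * [:4:] + [:1:])) + r)"
  have ex: "exec ?p' (init_store k x) (?s x ` ?Y x) (poly ?t (length x))" for x
  proof -
    have "frame (length x) (ones x) {} (\<lambda>_. 0) (length x) (\<lambda>_. 3) 6 (fst (marked_store x), home)"
      by (rule frame_marked[of _ _ 0]) (auto simp: marked_store_def tape_of_def fun_eq_iff)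
    moreover have "fst (marked_store x) 2 = tape_of 0 {}"
      by (auto simp: marked_store_def tape_of_def fun_eq_iff)
    ultimately have 1: "exec (guess_code t) (fst (marked_store x), home) ((\<lambda>Y. (?T x Y, home)) ` ?Y x)
        (poly q (length x) + (poly l (length x) * 7 + 1 + (poly l (length x) * 4 + 1)))"
      by (rule exec_guess_code[OF q]) (simp add: t)
    have 2: "exec1 (formula_code F (\<lambda>_. 3) 6) (?T x Y, home) (?s x Y) (poly r (length x))"
      if "Y \<in> ?Y x" for Y
      by (rule formula_code_timeD[OF r], rule frame_marked)
        (use that in \<open>auto simp: marked_store_def\<close>)
    have "exec ?c (marked_store x) (?s x ` ?Y x)
        (poly q (length x) + (poly l (length x) * 7 + 1 + (poly l (length x) * 4 + 1)) + poly r (length x))"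
      using exec_append_image[OF 1 2] by (simp add: UNION_singleton_eq_range marked_store_def)
    from exec1_then[OF exec_init_code[OF k(1)] this] show ?thesis by (simp add: add_ac mult_ac)
  qed
  let ?e = "\<lambda>x Y. (length ?p + (if ?S x Y then 0 else 1), ?s x Y)"
  have st: "istep ?p (length ?p', ?s x Y) s' \<longleftrightarrow> s' = ?e x Y" for x Y s'
    by (auto simp: istep_def nth_append marked_store_def nat_add_distrib)
  have run: "hits (istep ?p) (?e x ` ?Y x) (poly (?t + [:1:]) (length x)) (0, init_store k x)"
    "Y \<in> ?Y x \<Longrightarrow> (istep ?p)\<^sup>*\<^sup>* (0, init_store k x) (?e x Y)" for x Y
  proof -
    have l: "located ?p 0 ?p'" using located_self(2)[of ?p' "[Br 6 1 2]"] by simp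
    have 1: "hits (istep ?p) (Pair (length ?p') ` ?s x ` ?Y x) (poly ?t (length x)) (0, init_store k x)"
      and 2: "\<And>Y. Y \<in> ?Y x \<Longrightarrow> (istep ?p)\<^sup>*\<^sup>* (0, init_store k x) (length ?p', ?s x Y)"
      using exec_from_start[OF ex l] by (simp_all del: length_append)
    have "hits (istep ?p) (?e x ` ?Y x) (poly ?t (length x) + Suc 0) (0, init_store k x)"
    proof (rule hits_trans[OF 1])
      fix s assume "s \<in> Pair (length ?p') ` ?s x ` ?Y x"
      then obtain Y where Y: "Y \<in> ?Y x" "s = (length ?p', ?s x Y)" by blast
      show "hits (istep ?p) (?e x ` ?Y x) (Suc 0) s"
        unfolding Y(2) by (rule hits_first[of "istep ?p", OF st hits.stop]) (use Y(1) in blast)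
    qed
    then show "hits (istep ?p) (?e x ` ?Y x) (poly (?t + [:1:]) (length x)) (0, init_store k x)" by simp
    assume Y: "Y \<in> ?Y x"
    have "istep ?p (length ?p', ?s x Y) (?e x Y)" unfolding st by (rule refl)
    with 2[OF Y] show "(istep ?p)\<^sup>*\<^sup>* (0, init_store k x) (?e x Y)"
      by (rule rtranclp.rtrancl_into_rtrancl)
  qed
  have k2: "2 \<le> k" using k(1) by simp
  have wf: "wf_tm ?M" by (rule wf_machine[OF k(2) k2]) auto
  let ?R = "\<lambda>x. conf k ` ?e x ` ?Y x"
  have h: "hits (step ?M {}) (?R x) (poly (?t + [:1:]) (length x)) (init ?M x)" for x
    by (rule machine_run(1)[OF k(2) k2 _ run(1)]) simp
  have halt: "\<not> step ?M {} c c'" if "c \<in> ?R x" for x c c'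
    using that by (intro no_step_machine) (auto split: if_splits)
  have pt: "poly_time ?M {}" by (rule poly_timeI[OF h halt])
  have "accepts ?M {} x \<longleftrightarrow> (\<exists>c\<in>?R x. fst c = accept ?M)" for x
  proof (rule accepts_iff_hits[OF wf h halt])
    fix c assume "c \<in> ?R x"
    then obtain Y where Y: "Y \<in> ?Y x" "c = conf k (?e x Y)" by blast
    show "(step ?M {})\<^sup>*\<^sup>* (init ?M x) c"
      unfolding Y(2) by (rule machine_run(2)[OF k(2) k2 _ run(2)[OF Y(1)]]) simp
  qed
  then have "accepts ?M {} x \<longleftrightarrow> x \<in> L" for x
    unfolding assms(2) F by (auto split: if_splits)
  then have "L = {x. accepts ?M {} x}" by blast
  then show ?thesis using wf pt unfolding NP_def by (auto intro!: exI[of _ ?M])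
qed

text \<open>A single query at the very end suffices: the oracle looks for a counterexample to the
  guessed certificate, and the accepting state is the one that follows a negative answer.\<close>

lemma NP_oracle_I:
  fixes l r :: "nat poly"
  assumes "definable P"
    "\<And>x. x \<in> L \<longleftrightarrow> (\<exists>Y\<subseteq>{..<poly l (length x)}.
      map (\<lambda>i. P (length x) (ones x) Y (case_nat i (\<lambda>_. 0))) [0..<poly r (length x)] \<notin> B)"
  shows "L \<in> NP_oracle B"
proof -
  obtain F where F: "P = (\<lambda>n X Y e. sat n X Y e F)" using assms(1) by (rule definableE)
  obtain t where t: "\<And>n e. tval n e t = poly l n" using poly_is_term by blast
  obtain u where u: "\<And>n e. tval n e u = poly r n" using poly_is_term by blast
  obtain q where q: "term_code_time t q" using exec_term_code by blast
  obtain q' where q': "term_code_time u q'" using exec_term_code by blast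
  obtain f where f: "formula_code_time F f" using exec_formula_code by blast
  let ?c = "guess_code t @ gen_code u F"
  obtain k where k: "3 \<le> k" "\<forall>i\<in>set (init_code k @ ?c). instr_ok k i"
    using machine_code[of ?c] by auto
  let ?p = "init_code k @ ?c"
  let ?L = "length ?p"
  let ?qr = "Some (?L, ?L + 1, ?L + 2)"
  let ?M = "machine k ?p (?L + 2) ?qr"
  let ?T = "\<lambda>x Y. (fst (marked_store x))(2 := tape_of (poly l (length x)) Y)"
  let ?S = "\<lambda>x Y. {i. sat (length x) (ones x) Y (case_nat i (\<lambda>_. 0)) F}"
  let ?s = "\<lambda>x Y. ((?T x Y)(1 := tape_of (poly r (length x)) (?S x Y)),
    home(1 := int (poly r (length x)), 5 := int (poly r (length x))))"
  let ?Y = "\<lambda>x. Pow {..<poly l (length x)}"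
  let ?t = "[:k:] + (q + (l * [:7:] + [:1:] + (l * [:4:] + [:1:])) +
    (q' + (r * (pcompose f ([:0, 1:] + r) + [:8:]) + [:1:])))"
  have ex: "exec ?p (init_store k x) (?s x ` ?Y x) (poly ?t (length x))" for x
  proof -
    have "frame (length x) (ones x) {} (\<lambda>_. 0) (length x) (\<lambda>_. 3) 6 (fst (marked_store x), home)"
      by (rule frame_marked[of _ _ 0]) (auto simp: marked_store_def tape_of_def fun_eq_iff)
    moreover have "fst (marked_store x) 2 = tape_of 0 {}"
      by (auto simp: marked_store_def tape_of_def fun_eq_iff)
    ultimately have 1: "exec (guess_code t) (fst (marked_store x), home) ((\<lambda>Y. (?T x Y, home)) ` ?Y x)
        (poly q (length x) + (poly l (length x) * 7 + 1 + (poly l (length x) * 4 + 1)))"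
      by (rule exec_guess_code[OF q]) (simp add: t)
    have 2: "exec1 (gen_code u F) (?T x Y, home) (?s x Y)
        (poly q' (length x) + (poly r (length x) * (poly f (length x + poly r (length x)) + 8) + 1))"
      if Y: "Y \<in> ?Y x" for Y
    proof (rule exec_gen_code[OF q' f])
      show "frame (length x) (ones x) Y (\<lambda>_. 0) (length x) (\<lambda>_. 3) 6 (?T x Y, home)"
        by (rule frame_marked) (use Y in \<open>auto simp: marked_store_def\<close>)
      show "?T x Y 1 = tape_of 0 {}" by (auto simp: marked_store_def tape_of_def fun_eq_iff)
      show "poly r (length x) = tval (length x) (\<lambda>_. 0) u" by (simp add: u)
    qed
    have "exec ?c (marked_store x) (?s x ` ?Y x)
        (poly q (length x) + (poly l (length x) * 7 + 1 + (poly l (length x) * 4 + 1)) +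
        (poly q' (length x) + (poly r (length x) * (poly f (length x + poly r (length x)) + 8) + 1)))"
      using exec_append_image[OF 1 2] by (simp add: UNION_singleton_eq_range marked_store_def)
    from exec1_then[OF exec_init_code[OF k(1)] this] show ?thesis
      by (simp add: add_ac mult_ac poly_pcompose)
  qed
  have run: "hits (istep ?p) (Pair ?L ` ?s x ` ?Y x) (poly ?t (length x)) (0, init_store k x)"
    "Y \<in> ?Y x \<Longrightarrow> (istep ?p)\<^sup>*\<^sup>* (0, init_store k x) (?L, ?s x Y)" for x Y
    using exec_from_start[OF ex[of x] located_self(1)] by (simp_all del: length_append)
  have k2: "2 \<le> k" using k(1) by simp
  have wf: "wf_tm ?M" by (rule wf_machine[OF k(2) k2]) (auto simp del: length_append)
  let ?w = "\<lambda>x Y. map (\<lambda>i. i \<in> ?S x Y) [0..<poly r (length x)]"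
  let ?e = "\<lambda>x Y. (if ?w x Y \<in> B then ?L + 1 else ?L + 2, ?s x Y)"
  have st: "step ?M B (conf k (?L, ?s x Y)) c \<longleftrightarrow> c = conf k (?e x Y)" for x Y c
  proof -
    have "snd (conf k (?L, ?s x Y)) ! 1 = (tape_of (poly r (length x)) (?S x Y), int (poly r (length x)))"
      using k(1) by simp
    then have w: "tape_word (snd (conf k (?L, ?s x Y)) ! 1) = ?w x Y" by (simp only: tape_word_tape_of)
    have "step ?M B (?L, ts) c \<longleftrightarrow> c = (if tape_word (ts ! 1) \<in> B then ?L + 1 else ?L + 2, ts)" for ts
      by (auto simp: step.simps machine_def simp del: length_append)
    from this[of "snd (conf k (?L, ?s x Y))"] show ?thesis unfolding w by simp
  qed
  let ?R = "\<lambda>x. conf k ` ?e x ` ?Y x"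
  have h: "hits (step ?M B) (?R x) (poly (?t + [:1:]) (length x)) (init ?M x)" for x
  proof -
    have "hits (step ?M B) (?R x) (poly ?t (length x) + Suc 0) (init ?M x)"
    proof (rule hits_trans[OF machine_run(1)[OF k(2) k2 _ run(1)]])
      fix c assume "c \<in> conf k ` Pair ?L ` ?s x ` ?Y x"
      then obtain Y where Y: "Y \<in> ?Y x" "c = conf k (?L, ?s x Y)" by blast
      show "hits (step ?M B) (?R x) (Suc 0) c"
        unfolding Y(2) by (rule hits_first[of "step ?M B", OF st hits.stop]) (use Y(1) in blast)
    qed simp
    then show ?thesis by simp
  qed
  have halt: "\<not> step ?M B c c'" if "c \<in> ?R x" for x c c'
    using that by (intro no_step_machine) (auto simp del: length_append split: if_splits)
  have pt: "poly_time ?M B" by (rule poly_timeI[OF h halt])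
  have "accepts ?M B x \<longleftrightarrow> (\<exists>c\<in>?R x. fst c = accept ?M)" for x
  proof (rule accepts_iff_hits[OF wf h halt])
    fix c assume "c \<in> ?R x"
    then obtain Y where Y: "Y \<in> ?Y x" "c = conf k (?e x Y)" by blast
    have "(step ?M B)\<^sup>*\<^sup>* (init ?M x) (conf k (?L, ?s x Y))"
      by (rule machine_run(2)[OF k(2) k2 _ run(2)[OF Y(1)]]) simp
    moreover have "step ?M B (conf k (?L, ?s x Y)) c" unfolding st Y(2) by (rule refl)
    ultimately show "(step ?M B)\<^sup>*\<^sup>* (init ?M x) c" by (rule rtranclp.rtrancl_into_rtrancl)
  qed
  then have "accepts ?M B x \<longleftrightarrow> x \<in> L" for x
    unfolding assms(2) F by (auto split: if_splits)
  then have "L = {x. accepts ?M B x}" by blast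
  then show ?thesis using wf pt unfolding NP_oracle_def by (auto intro!: exI[of _ ?M])
qed

section \<open>Logical forms of NP and the second level\<close>

definition sigma1 :: "language \<Rightarrow> bool" where
  "sigma1 L \<longleftrightarrow> (\<exists>P (l :: nat poly). definable P \<and> (\<forall>x. x \<in> L \<longleftrightarrow>
     (\<exists>Y\<subseteq>{..<poly l (length x)}. P (length x) (ones x) Y (\<lambda>_. 0))))"

text \<open>Formulas know only one certificate, so the existential and the universal one occupy
  consecutive intervals of positions.\<close>

definition sigma2 :: "language \<Rightarrow> bool" where
  "sigma2 L \<longleftrightarrow> (\<exists>P (l :: nat poly) (m :: nat poly). definable P \<and> (\<forall>x. x \<in> L \<longleftrightarrow>
     (\<exists>Y\<subseteq>{..<poly l (length x)}. \<forall>Z\<subseteq>{poly l (length x)..<poly m (length x)}.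
        P (length x) (ones x) (Y \<union> Z) (\<lambda>_. 0))))"

lemma sigma1_imp_NP: "sigma1 L \<Longrightarrow> L \<in> NP"
  unfolding sigma1_def using NP_I by blast

text \<open>The oracle receives the input followed by the guessed certificate; their lengths are
  determined by the length of the query because \<open>n + poly l n\<close> is injective in \<open>n\<close>.\<close>

lemma sigma2_imp_Sigma2p:
  assumes "sigma2 L" shows "L \<in> Sigma2p"
proof -
  obtain P and l m :: "nat poly" where P: "definable P" and L: "\<And>x. x \<in> L \<longleftrightarrow>
     (\<exists>Y\<subseteq>{..<poly l (length x)}. \<forall>Z\<subseteq>{poly l (length x)..<poly m (length x)}.
        P (length x) (ones x) (Y \<union> Z) (\<lambda>_. 0))"
    using assms unfolding sigma2_def by blast
  define Q :: pred where "Q = (\<lambda>k W V e. \<exists>n<k + 1. k = n + poly l n \<and>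
    \<not> P n {i. i < n \<and> i \<in> W}
      {i. i < poly l n \<and> n + i \<in> W \<or> poly l n \<le> i \<and> i < poly m n \<and> i \<in> V} (\<lambda>_. 0))"
  define B where "B = {w. \<exists>V\<subseteq>{..<poly m (length w)}. Q (length w) (ones w) V (\<lambda>_. 0)}"
  have "definable Q" unfolding Q_def
    by (intro definable_intros definable_comp[OF P])
  then have B: "B \<in> NP" by (rule NP_I[of _ _ m]) (simp add: B_def)
  define R :: pred where "R = (\<lambda>n X Y e. if e 0 < n then e 0 \<in> X else e 0 - n \<in> Y)"
  have R: "definable R" unfolding R_def by (intro definable_intros)
  let ?w = "\<lambda>x Y. map (\<lambda>i. R (length x) (ones x) Y (case_nat i (\<lambda>_. 0)))
    [0..<poly ([:0, 1:] + l) (length x)]"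
  have w: "?w x Y \<in> B \<longleftrightarrow> \<not> (\<forall>Z\<subseteq>{poly l (length x)..<poly m (length x)}.
      P (length x) (ones x) (Y \<union> Z) (\<lambda>_. 0))" if Y: "Y \<subseteq> {..<poly l (length x)}" for x Y
  proof -
    let ?n = "length x"
    have len: "length (?w x Y) = ?n + poly l ?n" by simp
    have uniq: "n = ?n" if "?n + poly l ?n = n + poly l n" for n
      using that poly_mono_nat[of n ?n l] poly_mono_nat[of ?n n l] by (cases "n \<le> ?n") auto
    have X: "{i. i < ?n \<and> i \<in> ones (?w x Y)} = ones x"
      by (auto simp: ones_def R_def)
    have Y': "{i. i < poly l ?n \<and> ?n + i \<in> ones (?w x Y) \<or> poly l ?n \<le> i \<and> i < poly m ?n \<and> i \<in> V} =
      Y \<union> (V \<inter> {poly l ?n..<poly m ?n})" for V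
      using Y by (auto simp: ones_def R_def)
    have Q: "Q (length (?w x Y)) (ones (?w x Y)) V (\<lambda>_. 0) \<longleftrightarrow>
        \<not> P ?n (ones x) (Y \<union> (V \<inter> {poly l ?n..<poly m ?n})) (\<lambda>_. 0)" for V
    proof
      assume "Q (length (?w x Y)) (ones (?w x Y)) V (\<lambda>_. 0)"
      then obtain n where n: "?n + poly l ?n = n + poly l n"
        "\<not> P n {i. i < n \<and> i \<in> ones (?w x Y)}
          {i. i < poly l n \<and> n + i \<in> ones (?w x Y) \<or> poly l n \<le> i \<and> i < poly m n \<and> i \<in> V} (\<lambda>_. 0)"
        unfolding Q_def len by blast
      show "\<not> P ?n (ones x) (Y \<union> (V \<inter> {poly l ?n..<poly m ?n})) (\<lambda>_. 0)"
        using n(2) unfolding uniq[OF n(1)] X Y' .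
    next
      assume "\<not> P ?n (ones x) (Y \<union> (V \<inter> {poly l ?n..<poly m ?n})) (\<lambda>_. 0)"
      then show "Q (length (?w x Y)) (ones (?w x Y)) V (\<lambda>_. 0)"
        unfolding Q_def len by (intro exI[of _ ?n]) (simp only: X Y', simp)
    qed
    \<comment> \<open>The certificate of the oracle may be as long as \<open>poly m\<close> of the
      length of the query, which is at least \<open>poly m ?n\<close>; the surplus positions are cut
      off by the intersection.\<close>
    have "poly m ?n \<le> poly m (length (?w x Y))" unfolding len by (rule poly_mono_nat) simp
    then have "?w x Y \<in> B \<longleftrightarrow> (\<exists>Z\<subseteq>{poly l ?n..<poly m ?n}. \<not> P ?n (ones x) (Y \<union> Z) (\<lambda>_. 0))"
      unfolding B_def mem_Collect_eq Q
    proof (intro iffI; elim exE conjE)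
      fix Z assume "Z \<subseteq> {poly l ?n..<poly m ?n}" "\<not> P ?n (ones x) (Y \<union> Z) (\<lambda>_. 0)"
        "poly m ?n \<le> poly m (length (?w x Y))"
      then show "\<exists>V\<subseteq>{..<poly m (length (?w x Y))}.
          \<not> P ?n (ones x) (Y \<union> (V \<inter> {poly l ?n..<poly m ?n})) (\<lambda>_. 0)"
        by (intro exI[of _ Z]) (auto simp: Int_absorb2)
    qed blast
    then show ?thesis by blast
  qed
  have "L \<in> NP_oracle B"
  proof (rule NP_oracle_I[OF R, of _ l "[:0, 1:] + l"])
    show "x \<in> L \<longleftrightarrow> (\<exists>Y\<subseteq>{..<poly l (length x)}. ?w x Y \<notin> B)" for x
      unfolding L using w[of _ x] by blast
  qed
  then show ?thesis using B unfolding Sigma2p_def by blast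
qed

section \<open>From Turing machines to formulas\<close>

text \<open>A configuration within distance \<open>T\<close> of the origin is described by a relation between keys
  and positions; cell \<open>z\<close> of a tape has position \<open>z + T\<close>. The key \<open>Answer\<close> holds a guess of
  the answer of the oracle.\<close>

datatype key = State nat | Head nat | Cell nat nat | Answer

type_synonym snapshot = "key \<Rightarrow> nat \<Rightarrow> bool"

primrec moved :: "move \<Rightarrow> nat \<Rightarrow> nat \<Rightarrow> bool" where
  "moved MLeft y z \<longleftrightarrow> y = Suc z"
| "moved MStay y z \<longleftrightarrow> y = z"
| "moved MRight y z \<longleftrightarrow> Suc y = z"

text \<open>A constant oracle answers every query with \<open>b\<close>; one for each step makes it
  possible to describe a run with guessed answers by the ordinary step relation.\<close>

definition guessed_oracle :: "bool \<Rightarrow> bool list set" where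
  "guessed_oracle b = (if b then UNIV else {})"

fun snapshot_of :: "nat \<Rightarrow> bool \<Rightarrow> config \<Rightarrow> snapshot" where
  "snapshot_of T b (q, ts) (State p) z \<longleftrightarrow> p = q"
| "snapshot_of T b (q, ts) (Head j) z \<longleftrightarrow> int z = snd (ts ! j) + int T"
| "snapshot_of T b (q, ts) (Cell j s) z \<longleftrightarrow> fst (ts ! j) (int z - int T) = s"
| "snapshot_of T b (q, ts) Answer z \<longleftrightarrow> b"

definition word_length :: "nat \<Rightarrow> snapshot \<Rightarrow> nat \<Rightarrow> bool" where
  "word_length T D w \<longleftrightarrow> (\<forall>i<w. D (Cell 1 1) (T + i) \<or> D (Cell 1 2) (T + i)) \<and>
     \<not> (D (Cell 1 1) (T + w) \<or> D (Cell 1 2) (T + w))"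

fun key_code :: "key \<Rightarrow> nat" where
  "key_code (State q) = prod_encode (0, q)"
| "key_code (Head j) = prod_encode (1, j)"
| "key_code (Cell j s) = prod_encode (2, prod_encode (j, s))"
| "key_code Answer = prod_encode (3, 0)"

lemma key_code_inj: "key_code \<kappa> = key_code \<kappa>' \<longleftrightarrow> \<kappa> = \<kappa>'"
  by (cases \<kappa>; cases \<kappa>') (auto simp: prod_encode_eq)

lemma block_eq:
  fixes a b i j E :: nat
  assumes "i < E" "j < E" shows "a * E + i = b * E + j \<longleftrightarrow> a = b \<and> i = j"
proof
  assume e: "a * E + i = b * E + j"
  have "a = (a * E + i) div E" "b = (b * E + j) div E" using assms by auto
  then have "a = b" using e by metis
  then show "a = b \<and> i = j" using e by simp
qed simp

lemma block_less:
  fixes a A i E :: nat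
  assumes "a < A" "i < E" shows "a * E + i < A * E"
proof -
  have "a * E + i < Suc a * E" using assms(2) by simp
  also have "\<dots> \<le> A * E" using assms(1) by (intro mult_le_mono1) simp
  finally show ?thesis .
qed

lemma definable_moved:
  "definable_fun f \<Longrightarrow> definable_fun g \<Longrightarrow> definable (\<lambda>n X Y e. moved m (f n X Y e) (g n X Y e))"
  by (cases m) (simp_all, (intro definable_intros; assumption)+)

lemma finite_set_option: "finite (set_option x)"
  by (cases x) auto

text \<open>\<open>Q\<close> bounds the states and \<open>S\<close> the tape symbols that can occur,
  so that conditions on all of them are finite conjunctions.\<close>

locale tableau =
  fixes M :: tm and Q S :: nat
  assumes wf: "wf_tm M"
    and start_less: "start M < Q" and accept_less: "accept M < Q"
    and trans_bound: "\<And>q ss q' as. (q, ss, q', as) \<in> trans M \<Longrightarrow>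
      q < Q \<and> q' < Q \<and> (\<forall>s\<in>set ss. s \<le> S) \<and> (\<forall>a\<in>set as. fst a \<le> S)"
    and query_bound: "\<And>q y n. query M = Some (q, y, n) \<Longrightarrow> q < Q \<and> y < Q \<and> n < Q"
    and symbols: "2 \<le> S"
begin

section \<open>Configurations and steps as conditions on snapshots\<close>

definition matches :: "nat \<Rightarrow> snapshot \<Rightarrow> config \<Rightarrow> bool" where
  "matches T D = (\<lambda>(q, ts). q < Q \<and> length ts = tapes M \<and> (\<forall>p\<in>{..<Q}. D (State p) 0 \<longleftrightarrow> p = q) \<and>
     (\<forall>j\<in>{..<tapes M}. \<forall>z<2 * T + 1. (D (Head j) z \<longleftrightarrow> int z = snd (ts ! j) + int T) \<and>
        (\<forall>s\<in>{..S}. D (Cell j s) z \<longleftrightarrow> fst (ts ! j) (int z - int T) = s)))"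

text \<open>This holds for a configuration reached in \<open>t\<close> steps and keeps the heads
  inside the window. By the last clause tape 1 is blank from cell \<open>t\<close> on, so the word
  of a query ends inside the window, too.\<close>

definition near :: "nat \<Rightarrow> config \<Rightarrow> bool" where
  "near t c \<longleftrightarrow> (\<forall>j<tapes M. \<bar>snd (snd c ! j)\<bar> \<le> int t \<and> (\<forall>z. fst (snd c ! j) z \<le> S)) \<and>
     (\<forall>z. int t \<le> z \<longrightarrow> fst (snd c ! 1) z = 0)"

definition fires :: "nat \<Rightarrow> snapshot \<Rightarrow> nat \<Rightarrow> nat list \<Rightarrow> bool" where
  "fires T D q ss \<longleftrightarrow> D (State q) 0 \<and>
     (\<forall>j\<in>{..<tapes M}. \<exists>z<2 * T + 1. D (Head j) z \<and> D (Cell j (ss ! j)) z)"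

definition updates :: "nat \<Rightarrow> snapshot \<Rightarrow> snapshot \<Rightarrow> nat \<Rightarrow> (nat \<times> move) list \<Rightarrow> bool" where
  "updates T D D' q' as \<longleftrightarrow> (\<forall>p\<in>{..<Q}. D' (State p) 0 \<longleftrightarrow> p = q') \<and>
     (\<forall>j\<in>{..<tapes M}. \<forall>z<2 * T + 1.
        (D' (Head j) z \<longleftrightarrow> (\<exists>y<2 * T + 1. D (Head j) y \<and> moved (snd (as ! j)) y z)) \<and>
        (\<forall>s\<in>{..S}. D' (Cell j s) z \<longleftrightarrow> (if D (Head j) z then s = fst (as ! j) else D (Cell j s) z)))"

definition queries :: "nat \<Rightarrow> bool \<Rightarrow> snapshot \<Rightarrow> snapshot \<Rightarrow> nat \<Rightarrow> nat \<Rightarrow> nat \<Rightarrow> bool" where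
  "queries T b D D' q y n \<longleftrightarrow> D (State q) 0 \<and>
     (\<forall>p\<in>{..<Q}. D' (State p) 0 \<longleftrightarrow> (if b then p = y else p = n)) \<and>
     (\<forall>j\<in>{..<tapes M}. \<forall>z<2 * T + 1. (D' (Head j) z \<longleftrightarrow> D (Head j) z) \<and>
        (\<forall>s\<in>{..S}. D' (Cell j s) z \<longleftrightarrow> D (Cell j s) z))"

definition step_ok :: "nat \<Rightarrow> bool \<Rightarrow> snapshot \<Rightarrow> snapshot \<Rightarrow> bool" where
  "step_ok T b D D' \<longleftrightarrow> (\<exists>(q, ss, q', as)\<in>trans M. fires T D q ss \<and> updates T D D' q' as) \<or>
     (\<exists>(q, y, n)\<in>set_option (query M). queries T b D D' q y n)"

definition init_ok :: "nat \<Rightarrow> nat \<Rightarrow> nat set \<Rightarrow> snapshot \<Rightarrow> bool" where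
  "init_ok T n X D \<longleftrightarrow> (\<forall>p\<in>{..<Q}. D (State p) 0 \<longleftrightarrow> p = start M) \<and>
     (\<forall>j\<in>{..<tapes M}. \<forall>z<2 * T + 1. (D (Head j) z \<longleftrightarrow> z = T) \<and>
        (\<forall>s\<in>{..S}. D (Cell j s) z \<longleftrightarrow>
           (if j = 0 \<and> T \<le> z \<and> z < T + n then s = (if z - T \<in> X then 2 else 1) else s = 0)))"

lemma fires_iff:
  assumes "matches T D (q0, ts)" "near t (q0, ts)" "t \<le> T" "(q, ss, q', as) \<in> trans M"
  shows "fires T D q ss \<longleftrightarrow> q = q0 \<and> ss = map read ts"
proof -
  have len: "length ss = tapes M" "length ts = tapes M" and q: "q < Q"
    and ss: "\<And>j. j < tapes M \<Longrightarrow> ss ! j \<le> S"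
    using wf trans_bound[OF assms(4)] assms(1,4) by (auto simp: wf_tm_def matches_def)
  have "(\<exists>z<2 * T + 1. D (Head j) z \<and> D (Cell j (ss ! j)) z) \<longleftrightarrow> ss ! j = read (ts ! j)"
    if j: "j < tapes M" for j
  proof -
    have b: "\<bar>snd (ts ! j)\<bar> \<le> int T" using assms(2,3) j by (force simp: near_def)
    have D: "D (Head j) z \<longleftrightarrow> int z = snd (ts ! j) + int T"
      "D (Cell j (ss ! j)) z \<longleftrightarrow> fst (ts ! j) (int z - int T) = ss ! j" if "z < 2 * T + 1" for z
      using assms(1) j that ss[OF j] by (auto simp: matches_def)
    have r: "read (ts ! j) = fst (ts ! j) (snd (ts ! j))" by (cases "ts ! j") auto
    show ?thesis
    proof
      assume "\<exists>z<2 * T + 1. D (Head j) z \<and> D (Cell j (ss ! j)) z"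
      then show "ss ! j = read (ts ! j)" using D unfolding r by auto
    next
      assume "ss ! j = read (ts ! j)"
      then show "\<exists>z<2 * T + 1. D (Head j) z \<and> D (Cell j (ss ! j)) z"
        using D[of "nat (snd (ts ! j) + int T)"] b unfolding r
        by (intro exI[of _ "nat (snd (ts ! j) + int T)"]) auto
    qed
  qed
  moreover have "D (State q) 0 \<longleftrightarrow> q = q0" using assms(1) q by (auto simp: matches_def)
  ultimately show ?thesis unfolding fires_def using len by (auto simp: list_eq_iff_nth_eq)
qed

lemma updates_iff:
  assumes "matches T D (q, ts)" "near t (q, ts)" "t < T" "length as = tapes M" "q' < Q"
  shows "updates T D D' q' as \<longleftrightarrow> matches T D' (q', map2 act as ts)"
proof -
  have len: "length ts = tapes M" using assms(1) by (auto simp: matches_def)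
  have act: "map2 act as ts ! j = ((fst (ts ! j))(snd (ts ! j) := fst (as ! j)),
      snd (ts ! j) + shift (snd (as ! j)))" if "j < tapes M" for j
    using that len assms(4) by (cases "as ! j"; cases "ts ! j") auto
  have head: "(\<exists>y<2 * T + 1. D (Head j) y \<and> moved m y z) \<longleftrightarrow> int z = snd (ts ! j) + shift m + int T"
    if j: "j < tapes M" for j z m
  proof -
    have b: "\<bar>snd (ts ! j)\<bar> < int T" using assms(2,3) j by (force simp: near_def)
    have D: "D (Head j) y \<longleftrightarrow> int y = snd (ts ! j) + int T" if "y < 2 * T + 1" for y
      using assms(1) j that by (auto simp: matches_def)
    have mv: "moved m y z \<longleftrightarrow> int z = int y + shift m" for y by (cases m) auto
    show ?thesis
    proof
      assume "\<exists>y<2 * T + 1. D (Head j) y \<and> moved m y z"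
      then show "int z = snd (ts ! j) + shift m + int T" using D mv by auto
    next
      assume "int z = snd (ts ! j) + shift m + int T"
      then show "\<exists>y<2 * T + 1. D (Head j) y \<and> moved m y z"
        using D[of "nat (snd (ts ! j) + int T)"] b mv[of "nat (snd (ts ! j) + int T)"]
        by (intro exI[of _ "nat (snd (ts ! j) + int T)"]) auto
    qed
  qed
  have cell: "(if D (Head j) z then s = fst (as ! j) else D (Cell j s) z) \<longleftrightarrow>
      ((fst (ts ! j))(snd (ts ! j) := fst (as ! j))) (int z - int T) = s"
    if "j < tapes M" "z < 2 * T + 1" "s \<le> S" for j z s
  proof -
    have "D (Head j) z \<longleftrightarrow> int z = snd (ts ! j) + int T"
      "D (Cell j s) z \<longleftrightarrow> fst (ts ! j) (int z - int T) = s"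
      using assms(1) that by (auto simp: matches_def)
    then show ?thesis by auto
  qed
  show ?thesis unfolding updates_def matches_def using len assms(4,5) act head cell by simp
qed

lemma queries_iff:
  assumes "matches T D (q0, ts)" "query M = Some (q, y, n)"
  shows "queries T b D D' q y n \<longleftrightarrow> q = q0 \<and> matches T D' (if b then y else n, ts)"
  using assms query_bound[OF assms(2)] unfolding queries_def matches_def by auto

lemma step_ok_iff:
  assumes "matches T D c" "near t c" "t < T"
  shows "step_ok T b D D' \<longleftrightarrow> (\<exists>c'. step M (guessed_oracle b) c c' \<and> matches T D' c')"
proof -
  obtain q0 ts where c: "c = (q0, ts)" by (cases c)
  have len: "length as = tapes M \<and> q' < Q" if "(q, ss, q', as) \<in> trans M" for q ss q' as
    using wf that trans_bound[OF that] by (auto simp: wf_tm_def)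
  have "(\<exists>(q, ss, q', as)\<in>trans M. fires T D q ss \<and> updates T D D' q' as) \<longleftrightarrow>
      (\<exists>q' as. (q0, map read ts, q', as) \<in> trans M \<and> matches T D' (q', map2 act as ts))" (is "?A \<longleftrightarrow> ?B")
  proof
    assume ?A
    then obtain q ss q' as where tr: "(q, ss, q', as) \<in> trans M" "fires T D q ss" "updates T D D' q' as"
      by blast
    then show ?B
      using fires_iff[of T D q0 ts t, OF _ _ _ tr(1)] updates_iff[of T D q0 ts t as q' D'] len[OF tr(1)] assms c
      by auto
  next
    assume ?B
    then obtain q' as where tr: "(q0, map read ts, q', as) \<in> trans M" "matches T D' (q', map2 act as ts)"
      by blast
    then show ?A
      using fires_iff[of T D q0 ts t, OF _ _ _ tr(1)] updates_iff[of T D q0 ts t as q' D'] len[OF tr(1)] assms c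
      by (intro bexI[OF _ tr(1)]) simp
  qed
  moreover have "(\<exists>(q, y, n)\<in>set_option (query M). queries T b D D' q y n) \<longleftrightarrow>
      (\<exists>y n. query M = Some (q0, y, n) \<and> matches T D' (if b then y else n, ts))"
    using queries_iff[of T D q0 ts _ _ _ b D'] assms(1) c by fastforce
  ultimately show ?thesis
    unfolding step_ok_def c step.simps guessed_oracle_def by auto
qed

lemma length_step: "step M B c c' \<Longrightarrow> length (snd c) = tapes M \<Longrightarrow> length (snd c') = tapes M"
  using wf by (auto simp: wf_tm_def elim!: step.cases)

lemma near_step:
  assumes "near t c" "length (snd c) = tapes M" "step M B c c'"
  shows "near (Suc t) c'"
  using assms(3)
proof cases
  case (trans q ts q' as)
  have len: "length ts = tapes M" "length as = tapes M" "2 \<le> tapes M"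
    and S: "\<And>j. j < tapes M \<Longrightarrow> fst (as ! j) \<le> S"
    using wf trans(3) trans_bound[OF trans(3)] assms(2) trans(1) by (auto simp: wf_tm_def)
  have act: "map2 act as ts ! j = ((fst (ts ! j))(snd (ts ! j) := fst (as ! j)),
      snd (ts ! j) + shift (snd (as ! j)))" if "j < tapes M" for j
    using that len by (cases "as ! j"; cases "ts ! j") auto
  have sh: "\<bar>h + shift m\<bar> \<le> 1 + int t" if "\<bar>h\<bar> \<le> int t" for h m using that by (cases m) auto
  have c: "\<bar>snd (ts ! j)\<bar> \<le> int t" "fst (ts ! j) z \<le> S" if "j < tapes M" for j z
    using assms(1) trans(1) that by (auto simp: near_def)
  have "fst (ts ! 1) z = 0" if "int t \<le> z" for z using assms(1) trans(1) that by (auto simp: near_def)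
  moreover have "snd (ts ! 1) \<le> int t" using c(1)[of 1] len(3) by simp
  ultimately show ?thesis using trans(2) c len(3) S sh act by (auto simp: near_def)
next
  case (query q y n ts)
  then show ?thesis using assms(1) by (force simp: near_def)
qed

lemma matches_snapshot:
  assumes "fst c < Q" "length (snd c) = tapes M" shows "matches T (snapshot_of T b c) c"
  using assms by (cases c) (auto simp: matches_def)

lemma fst_step: "step M B c c' \<Longrightarrow> fst c' < Q"
  using trans_bound query_bound by (auto elim!: step.cases)

lemma init_simps: "length (snd (init M x)) = tapes M" "fst (init M x) < Q" "near 0 (init M x)"
  using wf start_less symbols
  by (auto simp: init_def wf_tm_def near_def input_tape_def nth_Cons bit_symbol_def split: nat.split)

lemma init_ok_iff: "init_ok T (length x) (ones x) D \<longleftrightarrow> matches T D (init M x)"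
proof -
  have "0 < tapes M" using wf by (auto simp: wf_tm_def)
  then have tape: "snd (init M x) ! j = (if j = 0 then input_tape x else input_tape [])"
    "length (snd (init M x)) = tapes M" if "j < tapes M" for j
    using that by (auto simp: init_def nth_Cons split: nat.split)
  have head: "z = T \<longleftrightarrow> int z = snd (snd (init M x) ! j) + int T" if "j < tapes M" for j z
    using tape[OF that] by (simp add: input_tape_def)
  have cell: "(if j = 0 \<and> T \<le> z \<and> z < T + length x then s = (if z - T \<in> ones x then 2 else 1) else s = 0)
      \<longleftrightarrow> fst (snd (init M x) ! j) (int z - int T) = s" if "j < tapes M" for j z s
  proof -
    have "nat (int z - int T) = z - T" by simp
    then show ?thesis using tape[OF that]
      by (auto simp: input_tape_def ones_def bit_symbol_def)
  qed
  obtain ts where ts: "init M x = (start M, ts)" by (simp add: init_def)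
  show ?thesis
    unfolding init_ok_def matches_def using start_less tape(2)[OF \<open>0 < tapes M\<close>] head cell
    unfolding ts by simp
qed

lemma run_sound:
  assumes "init_ok T (length x) (ones x) (C 0)" "m \<le> T"
    "\<And>t. t < m \<Longrightarrow> step_ok T (b t) (C t) (C (Suc t))"
  shows "\<exists>cs. cs 0 = init M x \<and> (\<forall>t<m. step M (guessed_oracle (b t)) (cs t) (cs (Suc t))) \<and>
    (\<forall>t\<le>m. matches T (C t) (cs t) \<and> near t (cs t))"
  using assms
proof (induction m)
  case 0
  then show ?case using init_ok_iff init_simps by (intro exI[of _ "\<lambda>_. init M x"]) auto
next
  case (Suc m)
  then obtain cs where cs: "cs 0 = init M x" "\<forall>t<m. step M (guessed_oracle (b t)) (cs t) (cs (Suc t))"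
    "\<forall>t\<le>m. matches T (C t) (cs t) \<and> near t (cs t)" by auto
  then obtain c' where c': "step M (guessed_oracle (b m)) (cs m) c'" "matches T (C (Suc m)) c'"
    using step_ok_iff[of T "C m" "cs m" m "b m" "C (Suc m)"] Suc.prems(2) Suc.prems(3)[of m] by auto
  have "matches T (C m) (cs m)" using cs(3) by blast
  then have "length (snd (cs m)) = tapes M" by (auto simp: matches_def)
  then have "near (Suc m) c'" using near_step c'(1) cs(3) by blast
  then show ?case using cs c'
    by (intro exI[of _ "cs(Suc m := c')"]) (auto simp: less_Suc_eq le_Suc_eq)
qed

lemma run_complete:
  assumes "cs 0 = init M x" "\<And>t. t < m \<Longrightarrow> step M (B t) (cs t) (cs (Suc t))" "t \<le> m"
  shows "length (snd (cs t)) = tapes M \<and> fst (cs t) < Q \<and> near t (cs t)"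
  using assms(3)
proof (induction t)
  case 0
  then show ?case using init_simps assms(1) by simp
next
  case (Suc t)
  then have t: "length (snd (cs t)) = tapes M" "near t (cs t)" "step M (B t) (cs t) (cs (Suc t))"
    using assms(2)[of t] by simp_all
  show ?case using length_step[OF t(3,1)] fst_step[OF t(3)] near_step[OF t(2,1,3)] by blast
qed

lemma word_of_snapshot:
  assumes "matches T D c" "near t c" "t \<le> T"
  shows "length (tape_word (snd c ! 1)) \<le> T"
    and "w \<le> T \<Longrightarrow> word_length T D w \<longleftrightarrow> w = length (tape_word (snd c ! 1))"
    and "i < length (tape_word (snd c ! 1)) \<Longrightarrow> D (Cell 1 2) (T + i) \<longleftrightarrow> tape_word (snd c ! 1) ! i"
proof -
  obtain f h where f: "snd c ! 1 = (f, h)" by fastforce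
  have r: "range bit_symbol = {1, 2}" by (auto simp: bit_symbol_def UNIV_bool)
  let ?P = "\<lambda>i. f (int i) \<notin> {1, 2}"
  have len: "length (tape_word (snd c ! 1)) = (LEAST i. ?P i)" by (simp add: f r del: One_nat_def)
  have PT: "?P T" using assms(2,3) f by (simp add: near_def)
  then show le: "length (tape_word (snd c ! 1)) \<le> T" unfolding len by (rule Least_le)
  have "1 < tapes M" using wf by (auto simp: wf_tm_def)
  then have D: "D (Cell 1 s) (T + i) \<longleftrightarrow> f (int i) = s" if "i \<le> T" "s \<le> 2" for i s
    using assms(1) that symbols f by (auto simp: matches_def split: prod.splits)
  have "word_length T D w \<longleftrightarrow> (\<forall>i<w. \<not> ?P i) \<and> ?P w" if "w \<le> T" for w
    using that D unfolding word_length_def by auto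
  also have "(\<forall>i<w. \<not> ?P i) \<and> ?P w \<longleftrightarrow> w = (LEAST i. ?P i)" for w
    using LeastI[of ?P, OF PT] not_less_Least[of _ ?P] by (metis (no_types, lifting) linorder_neqE_nat)
  finally show "w \<le> T \<Longrightarrow> word_length T D w \<longleftrightarrow> w = length (tape_word (snd c ! 1))" unfolding len .
  show "i < length (tape_word (snd c ! 1)) \<Longrightarrow> D (Cell 1 2) (T + i) \<longleftrightarrow> tape_word (snd c ! 1) ! i"
    using D[of i 2] le by (simp add: f bit_symbol_def del: One_nat_def)
qed

section \<open>The tableau as a set of numbers\<close>

definition used_keys :: "key set" where
  "used_keys = State ` {..<Q} \<union> Head ` {..<tapes M} \<union>
     (\<lambda>(j, s). Cell j s) ` ({..<tapes M} \<times> {..S}) \<union> {Answer}"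

definition num_keys :: nat where
  "num_keys = Suc (Max (key_code ` used_keys))"

lemma key_code_less: "\<kappa> \<in> used_keys \<Longrightarrow> key_code \<kappa> < num_keys"
proof -
  have "finite used_keys" by (auto simp: used_keys_def)
  then show "\<kappa> \<in> used_keys \<Longrightarrow> key_code \<kappa> < num_keys"
    by (auto simp: num_keys_def less_Suc_eq_le)
qed

lemma matches_agree:
  assumes "\<And>\<kappa> z. \<kappa> \<in> used_keys \<Longrightarrow> z < 2 * T + 1 \<Longrightarrow> D \<kappa> z \<longleftrightarrow> D' \<kappa> z" "matches T D c"
  shows "matches T D' c"
proof -
  have "p < Q \<Longrightarrow> State p \<in> used_keys" "j < tapes M \<Longrightarrow> Head j \<in> used_keys"
    "j < tapes M \<Longrightarrow> s \<le> S \<Longrightarrow> Cell j s \<in> used_keys" for p j s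
    by (auto simp: used_keys_def)
  then show ?thesis using assms symbols unfolding matches_def by (auto split: prod.splits)
qed

text \<open>Time, key and position are the digits of a position in the certificate, in mixed radix
  with the bases \<open>num_keys\<close> and \<open>2 * poly p n + 1\<close>.\<close>

definition snap :: "nat poly \<Rightarrow> nat \<Rightarrow> nat set \<Rightarrow> nat \<Rightarrow> snapshot" where
  "snap p n Y t \<kappa> z \<longleftrightarrow> (t * num_keys + key_code \<kappa>) * (2 * poly p n + 1) + z \<in> Y"

definition table_size :: "nat poly \<Rightarrow> nat poly" where
  "table_size p = (p + 1) * [:num_keys:] * ([:2:] * p + 1)"

definition table :: "nat poly \<Rightarrow> nat \<Rightarrow> nat \<Rightarrow> (nat \<Rightarrow> snapshot) \<Rightarrow> nat set" where
  "table p n m C = {(t * num_keys + key_code \<kappa>) * (2 * poly p n + 1) + z |t \<kappa> z.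
     t \<le> m \<and> \<kappa> \<in> used_keys \<and> z < 2 * poly p n + 1 \<and> C t \<kappa> z}"

lemma poly_table_size: "poly (table_size p) n = (poly p n + 1) * num_keys * (2 * poly p n + 1)"
  by (simp only: table_size_def poly_mult poly_add poly_1 poly_pCons poly_0 mult_zero_right add_0_right)

lemma snap_index_less:
  assumes "t \<le> poly p n" "\<kappa> \<in> used_keys" "z < 2 * poly p n + 1"
  shows "(t * num_keys + key_code \<kappa>) * (2 * poly p n + 1) + z < poly (table_size p) n"
  using block_less[OF block_less[of t "poly p n + 1" "key_code \<kappa>" num_keys] assms(3)]
    key_code_less[OF assms(2)] assms(1) by (simp add: poly_table_size del: mult_Suc_right mult_Suc)

lemma table_subset: "m \<le> poly p n \<Longrightarrow> table p n m C \<subseteq> {..<poly (table_size p) n}"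
  using snap_index_less by (auto simp: table_def simp del: add_2_eq_Suc' mult_Suc_right)

text \<open>\<open>U\<close> is the part of the certificate behind the table. The rows after
  \<open>m\<close> are empty; in particular they contain no state.\<close>

lemma snap_table:
  assumes "U \<inter> {..<poly (table_size p) n} = {}" "\<kappa> \<in> used_keys" "z < 2 * poly p n + 1" "t \<le> poly p n"
  shows "snap p n (table p n m C \<union> U) t \<kappa> z \<longleftrightarrow> t \<le> m \<and> C t \<kappa> z"
proof -
  let ?i = "\<lambda>t \<kappa> z. (t * num_keys + key_code \<kappa>) * (2 * poly p n + 1) + z"
  have "?i t \<kappa> z \<notin> U" using snap_index_less[OF assms(4,2,3)] assms(1) by auto
  moreover have inj: "?i t \<kappa> z = ?i t' \<kappa>' z' \<longleftrightarrow> t = t' \<and> \<kappa> = \<kappa>' \<and> z = z'"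
    if "\<kappa>' \<in> used_keys" "z' < 2 * poly p n + 1" for t' \<kappa>' z'
    unfolding block_eq[OF assms(3) that(2)]
      block_eq[OF key_code_less[OF assms(2)] key_code_less[OF that(1)]] key_code_inj by blast
  have "?i t \<kappa> z \<in> table p n m C \<longleftrightarrow> t \<le> m \<and> C t \<kappa> z"
  proof
    assume "?i t \<kappa> z \<in> table p n m C"
    then obtain t' \<kappa>' z' where *: "?i t \<kappa> z = ?i t' \<kappa>' z'" "t' \<le> m" "\<kappa>' \<in> used_keys"
      "z' < 2 * poly p n + 1" "C t' \<kappa>' z'" unfolding table_def mem_Collect_eq by (elim exE conjE)
    show "t \<le> m \<and> C t \<kappa> z" using *(2,5) *(1)[unfolded inj[OF *(3,4)]] by simp
  next
    assume "t \<le> m \<and> C t \<kappa> z"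
    then show "?i t \<kappa> z \<in> table p n m C" unfolding table_def mem_Collect_eq
      using assms(2,3) by (intro exI[of _ t] exI[of _ \<kappa>] exI[of _ z]) simp
  qed
  ultimately show ?thesis unfolding snap_def by blast
qed

definition run_ok :: "nat poly \<Rightarrow> nat \<Rightarrow> nat set \<Rightarrow> nat set \<Rightarrow> nat \<Rightarrow> bool" where
  "run_ok p n X Y m \<longleftrightarrow> init_ok (poly p n) n X (snap p n Y 0) \<and>
     (\<forall>t<m. step_ok (poly p n) (snap p n Y t Answer 0) (snap p n Y t) (snap p n Y (Suc t))) \<and>
     snap p n Y m (State (accept M)) 0"

lemma run_ok_sound:
  assumes "run_ok p (length x) (ones x) Y m" "m \<le> poly p (length x)"
  obtains cs where "cs 0 = init M x" "fst (cs m) = accept M"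
    "\<And>t. t < m \<Longrightarrow> step M (guessed_oracle (snap p (length x) Y t Answer 0)) (cs t) (cs (Suc t))"
    "\<And>t. t \<le> m \<Longrightarrow> matches (poly p (length x)) (snap p (length x) Y t) (cs t)"
    "\<And>t. t \<le> m \<Longrightarrow> near t (cs t)"
proof -
  obtain cs where cs: "cs 0 = init M x"
    "\<forall>t<m. step M (guessed_oracle (snap p (length x) Y t Answer 0)) (cs t) (cs (Suc t))"
    "\<forall>t\<le>m. matches (poly p (length x)) (snap p (length x) Y t) (cs t) \<and> near t (cs t)"
    using run_sound[of "poly p (length x)" x "snap p (length x) Y" m "\<lambda>t. snap p (length x) Y t Answer 0"] assms
    unfolding run_ok_def by blast
  have "matches (poly p (length x)) (snap p (length x) Y m) (cs m)" using cs(3) by blast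
  then have "fst (cs m) = accept M" using assms(1) accept_less by (auto simp: run_ok_def matches_def)
  then show ?thesis using that cs by blast
qed

lemma run_ok_complete:
  assumes "cs 0 = init M x" "\<forall>t<m. step M (guessed_oracle (b t)) (cs t) (cs (Suc t))"
    "fst (cs m) = accept M" "m \<le> poly p (length x)"
    "U \<inter> {..<poly (table_size p) (length x)} = {}"
  defines "Y \<equiv> table p (length x) m (\<lambda>t. snapshot_of (poly p (length x)) (b t) (cs t)) \<union> U"
  shows "run_ok p (length x) (ones x) Y m"
    "t \<le> m \<Longrightarrow> matches (poly p (length x)) (snap p (length x) Y t) (cs t)"
    "t \<le> m \<Longrightarrow> near t (cs t)"
    "t \<le> m \<Longrightarrow> snap p (length x) Y t Answer 0 \<longleftrightarrow> b t"
proof -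
  let ?n = "length x" and ?T = "poly p (length x)"
  have cs: "length (snd (cs t)) = tapes M" "fst (cs t) < Q" "near t (cs t)" if "t \<le> m" for t
    using run_complete[of cs x m "\<lambda>t. guessed_oracle (b t)", OF assms(1) _ that] assms(2) by auto
  then show "t \<le> m \<Longrightarrow> near t (cs t)" by blast
  have sn: "snap p ?n Y t \<kappa> z \<longleftrightarrow> snapshot_of ?T (b t) (cs t) \<kappa> z"
    if "t \<le> m" "\<kappa> \<in> used_keys" "z < 2 * ?T + 1" for t \<kappa> z
    unfolding Y_def using snap_table[OF assms(5) that(2,3)] that(1) assms(4) by simp
  show m: "t \<le> m \<Longrightarrow> matches ?T (snap p ?n Y t) (cs t)" for t
    by (rule matches_agree[OF _ matches_snapshot[where b = "b t"]]) (use sn cs in auto)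
  show b: "t \<le> m \<Longrightarrow> snap p ?n Y t Answer 0 \<longleftrightarrow> b t" for t
    using sn[of t Answer 0] by (cases "cs t") (auto simp: used_keys_def)
  have "init_ok ?T ?n (ones x) (snap p ?n Y 0)" using init_ok_iff m[of 0] assms(1) by simp
  moreover have "step_ok ?T (snap p ?n Y t Answer 0) (snap p ?n Y t) (snap p ?n Y (Suc t))" if "t < m" for t
  proof -
    have t: "t \<le> m" "Suc t \<le> m" "t < ?T" using that assms(4) by auto
    show ?thesis unfolding step_ok_iff[OF m[OF t(1)] cs(3)[OF t(1)] t(3)] b[OF t(1)]
      using assms(2) that m[OF t(2)] by blast
  qed
  moreover have "snap p ?n Y m (State (accept M)) 0"
    using m[of m] assms(3) accept_less by (auto simp: matches_def)
  ultimately show "run_ok p ?n (ones x) Y m" unfolding run_ok_def by blast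
qed

lemma definable_step_ok:
  "definable (\<lambda>n X Y e. step_ok (poly p n) (snap p n Y (e 0) Answer 0) (snap p n Y (e 0)) (snap p n Y (Suc (e 0))))"
proof -
  have "definable (\<lambda>n X Y e. fires (poly p n) (snap p n Y (e 0)) q ss)" for q ss
    unfolding fires_def snap_def by (intro definable_intros finite_lessThan)
  moreover have "definable (\<lambda>n X Y e. updates (poly p n) (snap p n Y (e 0)) (snap p n Y (Suc (e 0))) q as)" for q as
    unfolding updates_def snap_def by (intro definable_intros definable_moved finite_lessThan finite_atMost)
  moreover have "definable (\<lambda>n X Y e. queries (poly p n) (snap p n Y (e 0) Answer 0) (snap p n Y (e 0))
      (snap p n Y (Suc (e 0))) q y no)" for q y no
    unfolding queries_def snap_def by (intro definable_intros finite_lessThan finite_atMost)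
  moreover have "finite (trans M)" using wf by (auto simp: wf_tm_def)
  ultimately show ?thesis unfolding step_ok_def case_prod_unfold
    by (intro definable_disj definable_Bex_const definable_conj) (simp_all add: finite_set_option)
qed

lemma definable_run_ok:
  "definable (\<lambda>n X Y e. run_ok p n X Y (e 0))"
proof -
  have "definable (\<lambda>n X Y e. init_ok (poly p n) n X (snap p n Y 0))"
    unfolding init_ok_def snap_def by (intro definable_intros finite_lessThan finite_atMost)
  moreover have "definable (\<lambda>n X Y e. snap p n Y (e 0) (State (accept M)) 0)"
    unfolding snap_def by (intro definable_intros)
  ultimately show ?thesis unfolding run_ok_def
    by (intro definable_conj definable_all definable_step_ok definable_fun_var)
qed

end

lemma tableau_exists:
  assumes "wf_tm M" obtains Q S where "tableau M Q S"
proof -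
  have fin: "finite (trans M)" using assms by (auto simp: wf_tm_def)
  define Qs where "Qs = {start M, accept M} \<union> fst ` trans M \<union> (\<lambda>(q, ss, q', as). q') ` trans M \<union>
    (\<Union>(q, y, n)\<in>set_option (query M). {q, y, n})"
  define Ss where "Ss = {2} \<union> (\<Union>(q, ss, q', as)\<in>trans M. set ss \<union> fst ` set as)"
  have "finite Qs" "finite Ss" using fin by (auto simp: Qs_def Ss_def finite_set_option)
  then obtain Q S where "\<forall>q\<in>Qs. q < Q" and "\<forall>s\<in>Ss. s \<le> S"
    unfolding finite_nat_set_iff_bounded[of Qs] finite_nat_set_iff_bounded_le[of Ss] by (elim exE)
  note Q = bspec[OF this(1)] and S = bspec[OF this(2)]
  have "tableau M Q S"
  proof
    show "wf_tm M" by fact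
    show "start M < Q" "accept M < Q" "2 \<le> S" by (rule Q S; simp add: Qs_def Ss_def)+
    fix q ss q' as assume tr: "(q, ss, q', as) \<in> trans M"
    then have "q \<in> Qs" "q' \<in> Qs" "set ss \<subseteq> Ss" "fst ` set as \<subseteq> Ss"
      unfolding Qs_def Ss_def by force+
    then show "q < Q \<and> q' < Q \<and> (\<forall>s\<in>set ss. s \<le> S) \<and> (\<forall>a\<in>set as. fst a \<le> S)"
      using Q S by blast
  next
    fix q y n assume "query M = Some (q, y, n)"
    then show "q < Q \<and> y < Q \<and> n < Q" using Q by (auto simp: Qs_def)
  qed
  then show ?thesis by (rule that)
qed

lemma accepts_iff_run:
  "accepts M B x \<longleftrightarrow> (\<exists>m cs. cs 0 = init M x \<and> (\<forall>t<m. step M B (cs t) (cs (Suc t))) \<and> fst (cs m) = accept M)"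
  unfolding accepts_def rtranclp_power relpowp_fun_conv by metis

lemma NP_imp_sigma1:
  assumes "L \<in> NP" shows "sigma1 L"
proof -
  obtain M where M: "wf_tm M" "query M = None" "poly_time M {}" "L = {x. accepts M {} x}"
    using assms unfolding NP_def by blast
  obtain p :: "nat poly" where p: "\<And>x n c. (step M {} ^^ n) (init M x) c \<Longrightarrow> n \<le> poly p (length x)"
    using M(3) unfolding poly_time_def by blast
  obtain Q S where "tableau M Q S" using tableau_exists[OF M(1)] .
  then interpret tableau M Q S .
  \<comment> \<open>Without a query state a step is the same under every oracle, so any guessed
    answers describe a genuine run.\<close>
  have st: "step M B c c' \<longleftrightarrow> step M {} c c'" for B c c' using M(2) by (auto simp: step.simps)
  define P :: pred where "P = (\<lambda>n X Y e. \<exists>m<poly p n + 1. run_ok p n X Y m)"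
  have "definable P" unfolding P_def by (intro definable_intros definable_run_ok)
  moreover have "x \<in> L \<longleftrightarrow> (\<exists>Y\<subseteq>{..<poly (table_size p) (length x)}. P (length x) (ones x) Y (\<lambda>_. 0))" for x
  proof
    assume "x \<in> L"
    then obtain m cs where cs: "cs 0 = init M x" "\<And>t. t < m \<Longrightarrow> step M {} (cs t) (cs (Suc t))"
      "fst (cs m) = accept M" unfolding M(4) mem_Collect_eq accepts_iff_run by blast
    then have "(step M {} ^^ m) (init M x) (cs m)" unfolding relpowp_fun_conv by metis
    then have m: "m \<le> poly p (length x)" by (rule p)
    have cs': "\<forall>t<m. step M (guessed_oracle False) (cs t) (cs (Suc t))"
      using cs(2) by (simp add: guessed_oracle_def)
    show "\<exists>Y\<subseteq>{..<poly (table_size p) (length x)}. P (length x) (ones x) Y (\<lambda>_. 0)"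
      using run_ok_complete(1)[of cs x m "\<lambda>_. False" p "{}", OF cs(1) cs' cs(3) m] m table_subset[OF m]
      unfolding P_def by (metis Int_empty_left Un_empty_right less_Suc_eq_le Suc_eq_plus1)
  next
    assume "\<exists>Y\<subseteq>{..<poly (table_size p) (length x)}. P (length x) (ones x) Y (\<lambda>_. 0)"
    then obtain Y m where "run_ok p (length x) (ones x) Y m" "m \<le> poly p (length x)"
      unfolding P_def by auto
    then show "x \<in> L" unfolding M(4) mem_Collect_eq accepts_iff_run
      by (rule run_ok_sound) (use st in blast)
  qed
  ultimately show ?thesis unfolding sigma1_def by blast
qed

section \<open>Runs with guessed answers of the oracle\<close>

lemma step_guessed_oracle:
  "step M B c c' \<longleftrightarrow> step M (guessed_oracle (tape_word (snd c ! 1) \<in> B)) c c'"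
  by (cases c) (auto simp: step.simps guessed_oracle_def)

lemma step_guess_correct:
  assumes "step M (guessed_oracle b) c c'"
    "\<And>q y n. query M = Some (q, y, n) \<Longrightarrow> fst c = q \<Longrightarrow> b \<longleftrightarrow> tape_word (snd c ! 1) \<in> B"
  shows "step M B c c'"
  using assms by (cases c) (fastforce simp: step.simps guessed_oracle_def)

context tableau
begin

definition asks :: "snapshot \<Rightarrow> bool" where
  "asks D \<longleftrightarrow> (\<exists>a\<in>set_option (query M). D (State (fst a)) 0)"

text \<open>\<open>base\<close> is where the witness for the query in row \<open>t\<close> begins: a
  block of its own for a positive answer, the common universal block for a negative one. The
  quantifier over \<open>w\<close> finds the length of the query.\<close>

definition certified :: "pred \<Rightarrow> nat poly \<Rightarrow> nat poly \<Rightarrow> nat \<Rightarrow> nat set \<Rightarrow> nat \<Rightarrow> nat \<Rightarrow> bool" where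
  "certified P l p n Y t base \<longleftrightarrow> (\<exists>w<poly p n + 1. word_length (poly p n) (snap p n Y t) w \<and>
     P w {i. i < w \<and> snap p n Y t (Cell 1 2) (poly p n + i)} {i. i < poly l w \<and> base + i \<in> Y} (\<lambda>_. 0))"

lemma asks_iff:
  assumes "matches T D c"
  shows "asks D \<longleftrightarrow> (\<exists>q y n. query M = Some (q, y, n) \<and> fst c = q)"
proof -
  have "D (State q) 0 \<longleftrightarrow> fst c = q" if "query M = Some (q, y, n)" for q y n
    using assms query_bound[OF that] by (auto simp: matches_def)
  then show ?thesis unfolding asks_def by fastforce
qed

lemma certified_iff:
  assumes "matches (poly p n) (snap p n Y t) c" "near t c" "t \<le> poly p n"
  defines "w \<equiv> tape_word (snd c ! 1)"
  shows "certified P l p n Y t base \<longleftrightarrow>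
    P (length w) (ones w) {i. i < poly l (length w) \<and> base + i \<in> Y} (\<lambda>_. 0)"
proof -
  note word = word_of_snapshot[OF assms(1-3), folded w_def]
  have ones: "{i. i < length w \<and> snap p n Y t (Cell 1 2) (poly p n + i)} = ones w"
    using word(3) by (auto simp: ones_def)
  show ?thesis
  proof
    assume "certified P l p n Y t base"
    then obtain u where u: "u < poly p n + 1" "word_length (poly p n) (snap p n Y t) u"
      "P u {i. i < u \<and> snap p n Y t (Cell 1 2) (poly p n + i)} {i. i < poly l u \<and> base + i \<in> Y} (\<lambda>_. 0)"
      unfolding certified_def by blast
    have "u = length w" using word(2)[of u] u(1,2) by simp
    then show "P (length w) (ones w) {i. i < poly l (length w) \<and> base + i \<in> Y} (\<lambda>_. 0)"
      using u(3) ones by simp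
  next
    assume "P (length w) (ones w) {i. i < poly l (length w) \<and> base + i \<in> Y} (\<lambda>_. 0)"
    then show "certified P l p n Y t base" unfolding certified_def
      using word(1) word(2)[of "length w"] ones by (intro exI[of _ "length w"]) simp
  qed
qed

lemma definable_certified:
  assumes "definable P" "definable_fun base"
  shows "definable (\<lambda>n X Y e. certified P l p n Y (e 0) (base n X Y e))"
proof -
  have "definable (\<lambda>n X Y e. certified P l p n Y (e 1) (e 0))"
    unfolding certified_def word_length_def snap_def
    by (intro definable_intros definable_comp[OF assms(1)])
  from definable_subst2[where Q = "\<lambda>n X Y e t b. certified P l p n Y t b", OF this definable_fun_var assms(2)]
  show ?thesis .
qed

lemma definable_asks: "definable (\<lambda>n X Y e. asks (snap p n Y (e 0)))"
  unfolding asks_def snap_def by (intro definable_intros finite_set_option)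

end

text \<open>The certificate consists of a run in which the answers of the oracle are guessed, and of a
  witness for every positive answer; a single universally quantified witness refutes all negative
  answers.\<close>

lemma Sigma2p_imp_sigma2:
  assumes "L \<in> Sigma2p" shows "sigma2 L"
proof -
  obtain B where B: "B \<in> NP" "L \<in> NP_oracle B" using assms unfolding Sigma2p_def by blast
  obtain M where M: "wf_tm M" "poly_time M B" "L = {x. accepts M B x}"
    using B(2) unfolding NP_oracle_def by blast
  obtain P and l :: "nat poly" where P: "definable P" and
    PB: "\<And>w. w \<in> B \<longleftrightarrow> (\<exists>V\<subseteq>{..<poly l (length w)}. P (length w) (ones w) V (\<lambda>_. 0))"
    using NP_imp_sigma1[OF B(1)] unfolding sigma1_def by blast
  obtain p :: "nat poly" where p: "\<And>x n c. (step M B ^^ n) (init M x) c \<Longrightarrow> n \<le> poly p (length x)"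
    using M(2) unfolding poly_time_def by blast
  obtain Q S where "tableau M Q S" using tableau_exists[OF M(1)] .
  then interpret tableau M Q S .
  \<comment> \<open>Queries have length at most \<open>poly p n\<close>, so \<open>E\<close> bounds
    the length of the witnesses of the oracle language.\<close>
  define E where "E = pcompose l p"
  define l1 where "l1 = table_size p + p * E"
  \<comment> \<open>Behind the table, every time step owns a block of length \<open>poly E n\<close>
    for its witness.\<close>
  define base where "base n t = poly (table_size p) n + t * poly E n" for n t
  define R where "R n X Y \<longleftrightarrow> (\<exists>m<poly p n + 1. run_ok p n X Y m \<and>
      (\<forall>t<m. asks (snap p n Y t) \<and> snap p n Y t Answer 0 \<longrightarrow> certified P l p n Y t (base n t)))" for n X Y
  \<comment> \<open>All rows have to be covered because the number \<open>m\<close> of steps is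
    known only inside \<open>R\<close>. In the certificate constructed below the rows after
    \<open>m\<close> are empty and ask nothing.\<close>
  define N where "N n Y \<longleftrightarrow> (\<forall>t<poly p n. asks (snap p n Y t) \<and> \<not> snap p n Y t Answer 0 \<longrightarrow>
      \<not> certified P l p n Y t (poly l1 n))" for n Y
  have def: "definable (\<lambda>n X Y e. R n X Y \<and> N n Y)"
  proof -
    have sn: "definable (\<lambda>n X Y e. snap p n Y (e 0) Answer 0)"
      unfolding snap_def by (intro definable_intros)
    show ?thesis unfolding R_def N_def base_def
      by (intro definable_conj definable_ex definable_all definable_imp definable_not definable_run_ok
          definable_asks definable_certified[OF P] sn definable_fun_add definable_fun_mult
          definable_fun_poly definable_fun_len definable_fun_var definable_fun_const)
  qed
  have E: "poly l (length w) \<le> poly E n" if "length w \<le> poly p n" for w :: "bool list" and n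
    using that by (simp add: E_def poly_pcompose poly_mono_nat)
  have l1: "base n t + i < poly l1 n" if "t < poly p n" "i < poly E n" for n t i
    using block_less[OF that] by (simp add: base_def l1_def)
  have "x \<in> L \<longleftrightarrow> (\<exists>Y\<subseteq>{..<poly l1 (length x)}. \<forall>Z\<subseteq>{poly l1 (length x)..<poly (l1 + E) (length x)}.
     R (length x) (ones x) (Y \<union> Z) \<and> N (length x) (Y \<union> Z))" for x
  proof
    let ?n = "length x"
    let ?T = "poly p ?n"
    assume "x \<in> L"
    then obtain m cs where cs: "cs 0 = init M x" "\<And>t. t < m \<Longrightarrow> step M B (cs t) (cs (Suc t))"
      "fst (cs m) = accept M" unfolding M(3) mem_Collect_eq accepts_iff_run by blast
    then have "(step M B ^^ m) (init M x) (cs m)" unfolding relpowp_fun_conv by metis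
    then have m: "m \<le> ?T" by (rule p)
    define w where "w t = tape_word (snd (cs t) ! 1)" for t
    define b where "b t \<longleftrightarrow> w t \<in> B" for t
    define C where "C t = snapshot_of ?T (b t) (cs t)" for t
    have cs': "\<forall>t<m. step M (guessed_oracle (b t)) (cs t) (cs (Suc t))"
      using cs(2) step_guessed_oracle unfolding b_def w_def by blast
    have "\<forall>t. \<exists>V. b t \<longrightarrow> V \<subseteq> {..<poly l (length (w t))} \<and> P (length (w t)) (ones (w t)) V (\<lambda>_. 0)"
      using PB unfolding b_def by blast
    then obtain V where
      "\<forall>t. b t \<longrightarrow> V t \<subseteq> {..<poly l (length (w t))} \<and> P (length (w t)) (ones (w t)) (V t) (\<lambda>_. 0)"
      by (rule choice[THEN exE])
    note V = this[rule_format]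
    let ?W = "{base ?n t + i |t i. t < m \<and> b t \<and> i \<in> V t \<and> i < poly E ?n}"
    let ?Y = "table p ?n m C \<union> ?W"
    show "\<exists>Y\<subseteq>{..<poly l1 ?n}. \<forall>Z\<subseteq>{poly l1 ?n..<poly (l1 + E) ?n}.
        R ?n (ones x) (Y \<union> Z) \<and> N ?n (Y \<union> Z)"
    proof (intro exI[of _ ?Y] conjI allI impI)
      have ts: "poly (table_size p) ?n \<le> poly l1 ?n" by (simp add: l1_def)
      show "?Y \<subseteq> {..<poly l1 ?n}" using table_subset[OF m, of C] ts l1 m by fastforce
      fix Z assume Z: "Z \<subseteq> {poly l1 ?n..<poly (l1 + E) ?n}"
      let ?U = "?W \<union> Z"
      have U: "?U \<inter> {..<poly (table_size p) ?n} = {}" using Z ts by (auto simp: base_def)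
      have Y: "?Y \<union> Z = table p ?n m C \<union> ?U" by (simp only: Un_assoc)
      note run = run_ok_complete[OF cs(1) cs' cs(3) m U, folded C_def]
      have len: "length (w t) \<le> ?T" if "t \<le> m" for t
        unfolding w_def using word_of_snapshot(1)[OF run(2,3)[OF that]] that m by simp
      have cert: "certified P l p ?n (table p ?n m C \<union> ?U) t bs \<longleftrightarrow> P (length (w t)) (ones (w t))
          {i. i < poly l (length (w t)) \<and> bs + i \<in> table p ?n m C \<union> ?U} (\<lambda>_. 0)" if "t \<le> m" for t bs
        unfolding w_def using certified_iff[OF run(2,3)[OF that]] that m by simp
      have yes: "certified P l p ?n (table p ?n m C \<union> ?U) t (base ?n t)" if "t < m" "b t" for t
      proof -
        have "base ?n t + i \<in> table p ?n m C \<union> ?U \<longleftrightarrow> i \<in> V t" if i: "i < poly l (length (w t))" for i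
        proof -
          have iE: "i < poly E ?n" using i E[OF len[of t]] \<open>t < m\<close> by simp
          have "base ?n t + i \<notin> table p ?n m C" using table_subset[OF m, of C] by (auto simp: base_def)
          moreover have "base ?n t + i \<notin> Z" using l1[of t ?n i] iE Z \<open>t < m\<close> m by fastforce
          moreover have eq: "base ?n t + i = base ?n t' + i' \<longleftrightarrow> t = t' \<and> i = i'" if "i' < poly E ?n" for t' i'
            using block_eq[OF iE that, of t t'] by (simp add: base_def)
          have "base ?n t + i \<in> ?W \<longleftrightarrow> i \<in> V t"
          proof
            assume "base ?n t + i \<in> ?W"
            then obtain t' i' where i': "base ?n t + i = base ?n t' + i'" "i' \<in> V t'" "i' < poly E ?n"
              unfolding mem_Collect_eq by (elim exE conjE)
            show "i \<in> V t" using i'(2) i'(1)[unfolded eq[OF i'(3)]] by simp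
          next
            assume "i \<in> V t"
            then show "base ?n t + i \<in> ?W" unfolding mem_Collect_eq
              using iE \<open>t < m\<close> \<open>b t\<close> by (intro exI[of _ t] exI[of _ i]) simp
          qed
          ultimately show ?thesis by blast
        qed
        then have "{i. i < poly l (length (w t)) \<and> base ?n t + i \<in> table p ?n m C \<union> ?U} = V t"
          using V[OF that(2)] by blast
        then show ?thesis using cert[of t] V[OF that(2)] that(1) by simp
      qed
      show "R ?n (ones x) (?Y \<union> Z)" unfolding Y R_def
        using m run(1,4) yes by (intro exI[of _ m]) auto
      show "N ?n (?Y \<union> Z)" unfolding Y N_def
      proof (intro allI impI)
        fix t assume t: "t < ?T" "asks (snap p ?n (table p ?n m C \<union> ?U) t) \<and>
          \<not> snap p ?n (table p ?n m C \<union> ?U) t Answer 0"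
        \<comment> \<open>A row that asks contains the query state, but the rows after
          \<open>m\<close> are empty.\<close>
        have "t \<le> m"
        proof (rule ccontr)
          assume "\<not> t \<le> m"
          then have "\<not> snap p ?n (table p ?n m C \<union> ?U) t (State q) 0" if "q < Q" for q
            using snap_table[OF U, of "State q" 0 t m C] t(1) that by (simp add: used_keys_def)
          then show False using t(2) query_bound by (fastforce simp: asks_def)
        qed
        let ?V = "{i. i < poly l (length (w t)) \<and> poly l1 ?n + i \<in> table p ?n m C \<union> ?U}"
        have "\<not> b t" using run(4)[OF \<open>t \<le> m\<close>] t(2) by blast
        moreover have "?V \<subseteq> {..<poly l (length (w t))}" by blast
        ultimately have "\<not> P (length (w t)) (ones (w t)) ?V (\<lambda>_. 0)" unfolding b_def PB by blast
        then show "\<not> certified P l p ?n (table p ?n m C \<union> ?U) t (poly l1 ?n)"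
          unfolding cert[OF \<open>t \<le> m\<close>] .
      qed
    qed
  next
    let ?n = "length x"
    let ?T = "poly p ?n"
    assume "\<exists>Y\<subseteq>{..<poly l1 ?n}. \<forall>Z\<subseteq>{poly l1 ?n..<poly (l1 + E) ?n}.
        R ?n (ones x) (Y \<union> Z) \<and> N ?n (Y \<union> Z)"
    then obtain Y where Y: "Y \<subseteq> {..<poly l1 ?n}"
      "\<And>Z. Z \<subseteq> {poly l1 ?n..<poly (l1 + E) ?n} \<Longrightarrow> R ?n (ones x) (Y \<union> Z) \<and> N ?n (Y \<union> Z)" by blast
    have "R ?n (ones x) Y" using Y(2)[of "{}"] by simp
    then obtain m where m: "m < ?T + 1" "run_ok p ?n (ones x) Y m" and
      yes: "\<forall>t<m. asks (snap p ?n Y t) \<and> snap p ?n Y t Answer 0 \<longrightarrow>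
        certified P l p ?n Y t (base ?n t)" unfolding R_def by blast
    then have m: "m \<le> ?T" "run_ok p ?n (ones x) Y m" by simp_all
    obtain cs where cs: "cs 0 = init M x" "fst (cs m) = accept M"
      "\<And>t. t < m \<Longrightarrow> step M (guessed_oracle (snap p ?n Y t Answer 0)) (cs t) (cs (Suc t))"
      "\<And>t. t \<le> m \<Longrightarrow> matches ?T (snap p ?n Y t) (cs t)" "\<And>t. t \<le> m \<Longrightarrow> near t (cs t)"
      using run_ok_sound[OF m(2,1)] by metis
    have "step M B (cs t) (cs (Suc t))" if t: "t < m" for t
    proof (rule step_guess_correct[OF cs(3)[OF t]])
      fix q y no assume q: "query M = Some (q, y, no)" "fst (cs t) = q"
      let ?w = "tape_word (snd (cs t) ! 1)"
      have tm: "t \<le> m" "t \<le> ?T" "t < ?T" using t m(1) by auto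
      have ask: "asks (snap p ?n Y t)" using asks_iff[OF cs(4)[OF tm(1)]] q by blast
      have len: "length ?w \<le> ?T" using word_of_snapshot(1)[OF cs(4,5)[OF tm(1)] tm(2)] .
      show "snap p ?n Y t Answer 0 \<longleftrightarrow> ?w \<in> B"
      proof
        assume "snap p ?n Y t Answer 0"
        then have "certified P l p ?n Y t (base ?n t)" using yes t ask by blast
        then have "P (length ?w) (ones ?w) {i. i < poly l (length ?w) \<and> base ?n t + i \<in> Y} (\<lambda>_. 0)"
          using certified_iff[OF cs(4,5)[OF tm(1)] tm(2)] by blast
        then show "?w \<in> B" unfolding PB
          by (intro exI[of _ "{i. i < poly l (length ?w) \<and> base ?n t + i \<in> Y}"]) auto
      next
        assume "?w \<in> B"
        then obtain V where V: "V \<subseteq> {..<poly l (length ?w)}" "P (length ?w) (ones ?w) V (\<lambda>_. 0)"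
          unfolding PB by blast
        \<comment> \<open>Were the answer guessed as negative, this copy of the witness in the
          universal block would violate \<open>N\<close>. The table lies below that block and is the
          same with and without it.\<close>
        let ?Z = "(+) (poly l1 ?n) ` V"
        have "?Z \<subseteq> {poly l1 ?n..<poly (l1 + E) ?n}" using V(1) E[OF len] by auto
        then have N: "N ?n (Y \<union> ?Z)" using Y(2) by blast
        have sn: "snap p ?n (Y \<union> ?Z) t \<kappa> z \<longleftrightarrow> snap p ?n Y t \<kappa> z" if "\<kappa> \<in> used_keys" "z < 2 * ?T + 1" for \<kappa> z
        proof -
          have "(t * num_keys + key_code \<kappa>) * (2 * ?T + 1) + z < poly l1 ?n"
            using snap_index_less[OF tm(2) that] by (simp add: l1_def del: mult_Suc_right)
          then have "(t * num_keys + key_code \<kappa>) * (2 * ?T + 1) + z \<notin> ?Z" by auto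
          then show ?thesis unfolding snap_def by blast
        qed
        have mt: "matches ?T (snap p ?n (Y \<union> ?Z) t) (cs t)"
          by (rule matches_agree[OF _ cs(4)[OF tm(1)]]) (use sn in blast)
        have "{i. i < poly l (length ?w) \<and> poly l1 ?n + i \<in> Y \<union> ?Z} = V" using V(1) Y(1) by auto
        then have "certified P l p ?n (Y \<union> ?Z) t (poly l1 ?n)"
          using certified_iff[OF mt cs(5)[OF tm(1)] tm(2)] V(2) by simp
        moreover have "asks (snap p ?n (Y \<union> ?Z) t)" using asks_iff[OF mt] q by blast
        ultimately have "snap p ?n (Y \<union> ?Z) t Answer 0" using N tm(3) unfolding N_def by blast
        then show "snap p ?n Y t Answer 0" using sn[of Answer 0] by (simp add: used_keys_def)
      qed
    qed
    then show "x \<in> L" unfolding M(3) mem_Collect_eq accepts_iff_run using cs(1,2) by blast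
  qed
  then show ?thesis using def unfolding sigma2_def by blast
qed

section \<open>Extensions of finite argumentation frameworks\<close>

lemma complete_ext_in_iff:
  "complete_ext F E \<Longrightarrow> a \<in> args F \<Longrightarrow> a \<in> E \<longleftrightarrow> (\<forall>b. (b, a) \<in> atts F \<longrightarrow> b \<in> defeated F E)"
  by (auto simp: complete_ext_def acceptable_def)

lemma complete_ext_disjoint: "complete_ext F E \<Longrightarrow> a \<in> E \<Longrightarrow> a \<notin> defeated F E"
  by (auto simp: complete_ext_def admissible_def conflict_free_def)

lemma complete_ext_subset: "complete_ext F E \<Longrightarrow> E \<subseteq> args F"
  by (auto simp: complete_ext_def admissible_def conflict_free_def)

text \<open>Only attacks from \<open>E\<close> on \<open>a\<close> are excluded by hypothesis. If
  \<open>a\<close> attacked a member of \<open>E\<close>, then \<open>E\<close> would defend that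
  member by attacking \<open>a\<close>. The argument \<open>a\<close> may take part in its own
  defence.\<close>

lemma admissible_insert:
  assumes "admissible F E" "a \<in> args F" "(a, a) \<notin> atts F"
    "\<And>b. (b, a) \<in> atts F \<Longrightarrow> b \<in> defeated F (insert a E)" "\<And>b. b \<in> E \<Longrightarrow> (b, a) \<notin> atts F"
  shows "admissible F (insert a E)"
proof -
  have def: "defeated F E \<subseteq> defeated F (insert a E)" by (auto simp: defeated_def)
  have cf: "E \<subseteq> args F" "E \<inter> defeated F E = {}" "E \<subseteq> acceptable F E"
    using assms(1) by (auto simp: admissible_def conflict_free_def)
  have "(a, c) \<notin> atts F" if c: "c \<in> E" for c
  proof
    assume "(a, c) \<in> atts F"
    then have "a \<in> defeated F E" using cf(3) c by (auto simp: acceptable_def)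
    then show False using assms(5) by (auto simp: defeated_def)
  qed
  then have "insert a E \<inter> defeated F (insert a E) = {}"
    using cf assms(3,5) by (auto simp: defeated_def)
  moreover have "acceptable F E \<subseteq> acceptable F (insert a E)" using def by (auto simp: acceptable_def)
  moreover have "a \<in> acceptable F (insert a E)" using assms(2,4) by (auto simp: acceptable_def)
  ultimately show ?thesis using cf assms(2) by (auto simp: admissible_def conflict_free_def)
qed

text \<open>By Dung's fundamental lemma, an acceptable argument can be added to an admissible set.\<close>

lemma maximal_admissible_complete:
  assumes "admissible F E" "\<And>T. admissible F T \<Longrightarrow> E \<subseteq> T \<Longrightarrow> T = E"
  shows "complete_ext F E"
proof -
  have cf: "E \<inter> defeated F E = {}" using assms(1) by (auto simp: admissible_def conflict_free_def)
  have "a \<in> E" if a: "a \<in> acceptable F E" for a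
  proof -
    have b: "b \<in> defeated F E" if "(b, a) \<in> atts F" for b using a that by (auto simp: acceptable_def)
    have "admissible F (insert a E)"
    proof (rule admissible_insert[OF assms(1)])
      show "a \<in> args F" using a by (simp add: acceptable_def)
      have "a \<notin> defeated F E" using b cf by (auto simp: defeated_def)
      then show "(a, a) \<notin> atts F" using b by blast
    qed (use b cf in \<open>auto simp: defeated_def\<close>)
    then show ?thesis using assms(2) by blast
  qed
  then show ?thesis using assms(1) by (auto simp: complete_ext_def admissible_def)
qed

lemma admissible_extends_to_preferred:
  assumes "finite_af F" "admissible F S"
  shows "\<exists>E. preferred_ext F E \<and> S \<subseteq> E"
proof -
  let ?A = "{E. admissible F E \<and> S \<subseteq> E}"
  have "?A \<subseteq> Pow (args F)" by (auto simp: admissible_def conflict_free_def)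
  then have "finite ?A" using assms(1) by (auto simp: finite_af_def intro: finite_subset)
  then obtain E where "E \<in> ?A" "\<forall>T\<in>?A. E \<subseteq> T \<longrightarrow> E = T"
    using finite_has_maximal2[of ?A S] assms(2) by blast
  then have E: "admissible F E" "S \<subseteq> E" "\<And>T. T \<in> ?A \<Longrightarrow> E \<subseteq> T \<Longrightarrow> T = E" by blast+
  have "complete_ext F E" by (rule maximal_admissible_complete[OF E(1)]) (use E in blast)
  moreover have "T = E" if "complete_ext F T" "E \<subset> T" for T
    by (rule E(3)) (use that E(2) in \<open>auto simp: complete_ext_def\<close>)
  ultimately have "preferred_ext F E" unfolding preferred_ext_def by blast
  then show ?thesis using E(2) by blast
qed

text \<open>The hypothesis describes a kernel of the attack graph. Everything outside it is attacked
  from within, so no proper superset is free of conflicts.\<close>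

lemma stable_extI:
  assumes "finite_af F" "E \<subseteq> args F" "\<And>a. a \<in> args F \<Longrightarrow> a \<in> E \<longleftrightarrow> a \<notin> defeated F E"
  shows "stable_ext F E"
proof -
  have "b \<in> args F" if "(b, a) \<in> atts F" for a b using that assms(1) by (auto simp: finite_af_def)
  then have "acceptable F E = E" using assms(2,3) by (fastforce simp: acceptable_def defeated_def)
  then have c: "complete_ext F E"
    using assms(2,3) by (auto simp: complete_ext_def admissible_def conflict_free_def)
  have "\<not> (complete_ext F T \<and> E \<subset> T)" for T
    using assms(3) complete_ext_subset[of F T] complete_ext_disjoint[of F T] by (fastforce simp: defeated_def)
  then show ?thesis using c assms(2,3) by (auto simp: stable_ext_def preferred_ext_def defeated_def)
qed

lemma extension_complete: "extension \<sigma> F E \<Longrightarrow> complete_ext F E"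
  by (cases \<sigma>) (auto simp: stable_ext_def semi_stable_ext_def preferred_ext_def)

lemma labelling_of_simps:
  assumes "a \<in> args F"
  shows "labelling_of F E a = In \<longleftrightarrow> a \<in> E"
    "a \<notin> E \<Longrightarrow> labelling_of F E a = Out \<longleftrightarrow> a \<in> defeated F E"
  using assms by (auto simp: labelling_of_def)

section \<open>Invariance under renaming of arguments\<close>

definition map_af :: "('a \<Rightarrow> 'b) \<Rightarrow> 'a af \<Rightarrow> 'b af" where
  "map_af f F = \<lparr>args = f ` args F, atts = map_prod f f ` atts F\<rparr>"

text \<open>The instance is analysed over a datatype of arguments, whereas inputs have arguments
  \<open>{..<n}\<close>; the semantics has to be carried over.\<close>

locale af_isomorphism =
  fixes f :: "'a \<Rightarrow> 'b" and F :: "'a af"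
  assumes fin: "finite_af F" and inj: "inj_on f (args F)"
begin

lemma finite_map: "finite_af (map_af f F)"
  using fin by (auto simp: finite_af_def map_af_def)

lemma in_image: "E \<subseteq> args F \<Longrightarrow> a \<in> args F \<Longrightarrow> f a \<in> f ` E \<longleftrightarrow> a \<in> E"
  using inj by (auto simp: inj_on_def)

lemma atts_map:
  assumes "a \<in> args F"
  shows "(c, f a) \<in> atts (map_af f F) \<longleftrightarrow> (\<exists>b\<in>args F. c = f b \<and> (b, a) \<in> atts F)"
proof
  assume "(c, f a) \<in> atts (map_af f F)"
  then obtain b a' where ba: "(b, a') \<in> atts F" "c = f b" "f a = f a'" by (auto simp: map_af_def)
  then have "b \<in> args F" "a' \<in> args F" using fin by (auto simp: finite_af_def)
  then show "\<exists>b\<in>args F. c = f b \<and> (b, a) \<in> atts F" using ba inj assms by (metis inj_onD)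
qed (force simp: map_af_def)

lemma args_map: "args (map_af f F) = f ` args F"
  by (simp add: map_af_def)

lemma defeated_map:
  assumes "E \<subseteq> args F" shows "defeated (map_af f F) (f ` E) = f ` defeated F E"
proof -
  have "(\<exists>b\<in>f ` E. (b, f a) \<in> atts (map_af f F)) \<longleftrightarrow> (\<exists>b\<in>E. (b, a) \<in> atts F)" if "a \<in> args F" for a
  proof -
    have "(\<exists>b\<in>S. (b, f a) \<in> atts (map_af f F)) \<longleftrightarrow> (\<exists>b\<in>args F. f b \<in> S \<and> (b, a) \<in> atts F)" for S
      unfolding atts_map[OF that] by blast
    then have "(\<exists>b\<in>f ` E. (b, f a) \<in> atts (map_af f F)) \<longleftrightarrow> (\<exists>b\<in>args F. f b \<in> f ` E \<and> (b, a) \<in> atts F)" .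
    also have "\<dots> \<longleftrightarrow> (\<exists>b\<in>E. (b, a) \<in> atts F)" using assms in_image[OF assms] by auto
    finally show ?thesis .
  qed
  moreover have "defeated (map_af f F) (f ` E) =
      f ` {a \<in> args F. \<exists>b\<in>f ` E. (b, f a) \<in> atts (map_af f F)}"
    unfolding defeated_def args_map by blast
  ultimately show ?thesis unfolding defeated_def by (simp cong: conj_cong)
qed

lemma acceptable_map:
  assumes "E \<subseteq> args F" shows "acceptable (map_af f F) (f ` E) = f ` acceptable F E"
proof -
  have "defeated F E \<subseteq> args F" by (auto simp: defeated_def)
  then have d: "f b \<in> f ` defeated F E \<longleftrightarrow> b \<in> defeated F E" if "b \<in> args F" for b
    using in_image that by blast
  have "b \<in> args F" if "(b, a) \<in> atts F" for a b using that fin by (auto simp: finite_af_def)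
  then have "(\<forall>b. (b, f a) \<in> atts (map_af f F) \<longrightarrow> b \<in> f ` defeated F E) \<longleftrightarrow>
      (\<forall>b. (b, a) \<in> atts F \<longrightarrow> b \<in> defeated F E)" if "a \<in> args F" for a
    unfolding atts_map[OF that] using d by blast
  moreover have "args (map_af f F) = f ` args F" by (simp add: map_af_def)
  ultimately show ?thesis by (auto simp: acceptable_def defeated_map[OF assms])
qed

lemma image_cmp:
  assumes "A \<subseteq> args F" "B \<subseteq> args F"
  shows "f ` A \<subset> f ` B \<longleftrightarrow> A \<subset> B" "f ` A \<subseteq> f ` B \<longleftrightarrow> A \<subseteq> B" "f ` A = f ` B \<longleftrightarrow> A = B"
    "f ` A \<inter> f ` B = {} \<longleftrightarrow> A \<inter> B = {}"
proof -
  show s: "f ` A \<subseteq> f ` B \<longleftrightarrow> A \<subseteq> B"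
  proof
    assume sub: "f ` A \<subseteq> f ` B"
    show "A \<subseteq> B"
    proof
      fix a assume a: "a \<in> A"
      then have "f a \<in> f ` B" using sub by (rule subsetD[OF _ imageI, rotated])
      then show "a \<in> B" using in_image[OF assms(2), of a] assms(1) a by auto
    qed
  qed (rule image_mono)
  show e: "f ` A = f ` B \<longleftrightarrow> A = B" using inj_on_image_eq_iff[OF inj assms] .
  show "f ` A \<subset> f ` B \<longleftrightarrow> A \<subset> B" by (simp only: psubset_eq s e)
  show "f ` A \<inter> f ` B = {} \<longleftrightarrow> A \<inter> B = {}" using inj_on_image_Int[OF inj assms] by auto
qed

lemma defeated_subset: "defeated F E \<subseteq> args F"
  by (auto simp: defeated_def)

lemma acceptable_subset: "acceptable F E \<subseteq> args F"
  by (auto simp: acceptable_def)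

lemma complete_ext_map:
  assumes "E \<subseteq> args F" shows "complete_ext (map_af f F) (f ` E) \<longleftrightarrow> complete_ext F E"
  unfolding complete_ext_def admissible_def conflict_free_def acceptable_map[OF assms] defeated_map[OF assms]
    image_cmp[OF assms acceptable_subset] image_cmp[OF assms defeated_subset]
  using assms by (auto simp: map_af_def)

text \<open>Maximality quantifies over all sets of renamed arguments. The complete ones among them
  are images, so the quantifier can be pulled back.\<close>

lemma ex_complete_map:
  "(\<exists>T. complete_ext (map_af f F) T \<and> P T) \<longleftrightarrow> (\<exists>T. complete_ext F T \<and> P (f ` T))"
proof
  assume "\<exists>T. complete_ext (map_af f F) T \<and> P T"
  then obtain T where T: "complete_ext (map_af f F) T" "P T" by blast
  then have "T \<subseteq> f ` args F" using complete_ext_subset by (fastforce simp: map_af_def)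
  then obtain T' where "T' \<subseteq> args F" "T = f ` T'" by (metis subset_image_iff)
  then show "\<exists>T. complete_ext F T \<and> P (f ` T)" using T complete_ext_map by blast
qed (use complete_ext_map complete_ext_subset in blast)

lemma preferred_ext_map:
  assumes "E \<subseteq> args F" shows "preferred_ext (map_af f F) (f ` E) \<longleftrightarrow> preferred_ext F E"
proof -
  have "complete_ext F T \<and> f ` E \<subset> f ` T \<longleftrightarrow> complete_ext F T \<and> E \<subset> T" for T
    using image_cmp(1)[OF assms complete_ext_subset, of T] by blast
  then show ?thesis
    unfolding preferred_ext_def complete_ext_map[OF assms] ex_complete_map by simp
qed

lemma extension_map:
  assumes "E \<subseteq> args F" shows "extension \<sigma> (map_af f F) (f ` E) \<longleftrightarrow> extension \<sigma> F E"
proof -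
  have r: "f ` A \<union> defeated (map_af f F) (f ` A) = f ` (A \<union> defeated F A)" "A \<union> defeated F A \<subseteq> args F"
    if "A \<subseteq> args F" for A
    by (simp add: defeated_map[OF that] image_Un) (use that in \<open>auto simp: defeated_def\<close>)
  have "stable_ext (map_af f F) (f ` E) \<longleftrightarrow> stable_ext F E"
    unfolding stable_ext_def preferred_ext_map[OF assms] r(1)[OF assms]
    using image_cmp(3)[OF r(2)[OF assms], of "args F"] by (simp add: map_af_def)
  moreover have "semi_stable_ext (map_af f F) (f ` E) \<longleftrightarrow> semi_stable_ext F E"
  proof -
    let ?P = "\<lambda>T. f ` E \<union> defeated (map_af f F) (f ` E) \<subset> T \<union> defeated (map_af f F) T"
    have "(\<exists>T. preferred_ext (map_af f F) T \<and> ?P T) \<longleftrightarrow>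
        (\<exists>T. complete_ext (map_af f F) T \<and> (preferred_ext (map_af f F) T \<and> ?P T))"
      by (auto simp: preferred_ext_def)
    also have "\<dots> \<longleftrightarrow> (\<exists>T. complete_ext F T \<and> (preferred_ext (map_af f F) (f ` T) \<and> ?P (f ` T)))"
      by (rule ex_complete_map)
    also have "\<dots> \<longleftrightarrow> (\<exists>T. preferred_ext F T \<and> E \<union> defeated F E \<subset> T \<union> defeated F T)"
    proof (rule ex_cong1)
      fix T
      show "complete_ext F T \<and> (preferred_ext (map_af f F) (f ` T) \<and> ?P (f ` T)) \<longleftrightarrow>
          preferred_ext F T \<and> E \<union> defeated F E \<subset> T \<union> defeated F T"
      proof (cases "complete_ext F T")
        case True
        note T = complete_ext_subset[OF True]
        show ?thesis
          unfolding r(1)[OF assms] r(1)[OF T] image_cmp(1)[OF r(2)[OF assms] r(2)[OF T]] preferred_ext_map[OF T]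
          using True by blast
      qed (simp add: preferred_ext_def)
    qed
    finally show ?thesis unfolding semi_stable_ext_def preferred_ext_map[OF assms] by blast
  qed
  ultimately show ?thesis
    by (cases \<sigma>) (simp_all add: complete_ext_map[OF assms] preferred_ext_map[OF assms])
qed

lemma labelling_map:
  assumes "E \<subseteq> args F" "a \<in> args F"
  shows "labelling_of (map_af f F) (f ` E) (f a) = labelling_of F E a"
  using in_image[OF assms] in_image[OF defeated_subset assms(2), of E] assms(2)
  unfolding labelling_of_def defeated_map[OF assms(1)] args_map by simp

lemma distance_map:
  assumes "E \<subseteq> args F" "E' \<subseteq> args F"
  shows "distance (map_af f F) (labelling_of (map_af f F) (f ` E)) (labelling_of (map_af f F) (f ` E')) =
    distance F (labelling_of F E) (labelling_of F E')"
proof -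
  have "{a \<in> args (map_af f F). labelling_of (map_af f F) (f ` E) a \<noteq> labelling_of (map_af f F) (f ` E') a} =
      f ` {a \<in> args F. labelling_of F E a \<noteq> labelling_of F E' a}"
    using labelling_map[OF assms(1)] labelling_map[OF assms(2)] by (auto simp: map_af_def)
  moreover have "inj_on f {a \<in> args F. labelling_of F E a \<noteq> labelling_of F E' a}"
    using inj by (auto intro: inj_on_subset)
  ultimately show ?thesis by (simp add: distance_def card_image)
qed

lemma labellings_map:
  "labellings \<sigma> (map_af f F) = (\<lambda>E. labelling_of (map_af f F) (f ` E)) ` {E. extension \<sigma> F E}"
proof -
  have "(\<exists>T. extension \<sigma> (map_af f F) T \<and> P T) \<longleftrightarrow> (\<exists>E. extension \<sigma> F E \<and> P (f ` E))" for P
  proof -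
    have "(\<exists>T. extension \<sigma> (map_af f F) T \<and> P T) \<longleftrightarrow>
        (\<exists>T. complete_ext (map_af f F) T \<and> (extension \<sigma> (map_af f F) T \<and> P T))"
      using extension_complete by blast
    also have "\<dots> \<longleftrightarrow> (\<exists>E. complete_ext F E \<and> (extension \<sigma> (map_af f F) (f ` E) \<and> P (f ` E)))"
      by (rule ex_complete_map)
    also have "\<dots> \<longleftrightarrow> (\<exists>E. extension \<sigma> F E \<and> P (f ` E))"
    proof (rule ex_cong1)
      fix E show "complete_ext F E \<and> (extension \<sigma> (map_af f F) (f ` E) \<and> P (f ` E)) \<longleftrightarrow> extension \<sigma> F E \<and> P (f ` E)"
        using extension_map[OF complete_ext_subset, of E \<sigma>] extension_complete[of \<sigma> F E] by blast
    qed
    finally show ?thesis .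
  qed
  from this[of "\<lambda>T. L = labelling_of (map_af f F) T" for L] show ?thesis
    unfolding labellings_def by auto
qed

lemma counterfactuals_map:
  assumes "extension \<sigma> F E" "extension \<sigma> F E'" "g \<in> args F"
  shows "labelling_of (map_af f F) (f ` E') \<in> counterfactuals \<sigma> (map_af f F) (f g) (labelling_of (map_af f F) (f ` E)) \<longleftrightarrow>
    labelling_of F E g \<noteq> labelling_of F E' g \<and>
    \<not> (\<exists>T. extension \<sigma> F T \<and> labelling_of F E g \<noteq> labelling_of F T g \<and>
      distance F (labelling_of F E) (labelling_of F T) < distance F (labelling_of F E) (labelling_of F E'))"
proof -
  have sub: "extension \<sigma> F T \<Longrightarrow> T \<subseteq> args F" for T
    using extension_complete complete_ext_subset by blast
  note E = sub[OF assms(1)] and E' = sub[OF assms(2)]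
  let ?lab = "\<lambda>T. labelling_of (map_af f F) (f ` T)"
  have "?lab E' \<in> labellings \<sigma> (map_af f F)" unfolding labellings_map using assms(2) by blast
  moreover have "(\<exists>L\<in>labellings \<sigma> (map_af f F). P L) \<longleftrightarrow> (\<exists>T. extension \<sigma> F T \<and> P (?lab T))" for P
    unfolding labellings_map by blast
  moreover have "extension \<sigma> F T \<and> ?lab E (f g) \<noteq> ?lab T (f g) \<and>
      distance (map_af f F) (?lab E) (?lab T) < distance (map_af f F) (?lab E) (?lab E') \<longleftrightarrow>
    extension \<sigma> F T \<and> labelling_of F E g \<noteq> labelling_of F T g \<and>
      distance F (labelling_of F E) (labelling_of F T) < distance F (labelling_of F E) (labelling_of F E')" for T
    using labelling_map[OF sub assms(3), of T] labelling_map[OF E assms(3)] distance_map[OF E sub, of T]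
      distance_map[OF E E'] by auto
  ultimately show ?thesis
    unfolding counterfactuals_def mem_Collect_eq labelling_map[OF E assms(3)] labelling_map[OF E' assms(3)]
    by simp
qed

end

section \<open>Evaluating a formula in an argumentation framework\<close>

text \<open>Extensions are in one of three modes. Modes 0 and 1 switch everything off and yield the two
  labellings of the instance; in mode 2 the literals are free and the gates evaluate the formula.
  Gates are subformulas with an environment, coded as a number in base \<open>K\<close>. The argument
  \<open>NoMode i\<close> records in the range of an extension that its mode is \<open>i\<close>, and \<open>Copy\<close> records its
  literals; the arguments \<open>Pad\<close> make mode 1 distant from mode 0.

  For complete and stable semantics, \<open>Block\<close> prevents mode 2 unless the formula is true. For
  preferred and semi-stable semantics, \<open>Block\<close> attacks itself and the literals from \<open>l\<close> on; they can
  be accepted only if the formula is true, and then \<open>Goal\<close> is defeated. So \<open>Goal\<close> survives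
  in mode 2 iff some choice of the first \<open>l\<close> literals cannot be extended to a model.\<close>

datatype arg = Mode nat | NoMode nat | Goal | Block | Lit bool nat | Copy bool nat | Gate fm nat | Pad nat

primrec subs :: "fm \<Rightarrow> fm list" where
  "subs (Leq s t) = [Leq s t]"
| "subs (InX t) = [InX t]"
| "subs (InY t) = [InY t]"
| "subs (Nor f g) = Nor f g # subs f @ subs g"
| "subs (NEx t f) = NEx t f # subs f"

definition nodes :: "fm \<Rightarrow> fm list" where
  "nodes f = remdups (subs f)"

lemma subs_self: "f \<in> set (subs f)"
  by (cases f) auto

lemma subs_trans: "f \<in> set (subs g) \<Longrightarrow> g \<in> set (subs h) \<Longrightarrow> f \<in> set (subs h)"
  by (induction h) auto

text \<open>These are the semantics in which maximality provides a second quantifier.\<close>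

definition quantified :: "semantics \<Rightarrow> bool" where
  "quantified \<sigma> \<longleftrightarrow> \<sigma> \<in> {PR, SST}"

text \<open>Of the \<open>m\<close> certificate bits the first \<open>l\<close> form the first
  certificate. \<open>W\<close> bounds both the indices of literals and the codes of environments,
  and \<open>K\<close> is the base of these codes. \<open>C\<close> counts the arguments other than
  pads: six for the modes and their recorders, \<open>Goal\<close> and \<open>Block\<close>, four
  families of \<open>W\<close> literals and copies, and \<open>W\<close> gates for each
  subformula.\<close>

locale cf_reduction =
  fixes \<sigma> :: semantics and n :: nat and X :: "nat set" and \<phi> :: fm and l m W K C :: nat
  assumes W: "0 < W" "l \<le> m" "m \<le> W"
    and C: "C = 8 + (4 + length (nodes \<phi>)) * W"
begin

abbreviation q :: bool where
  "q \<equiv> quantified \<sigma>"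

definition env :: "nat \<Rightarrow> nat \<Rightarrow> nat" where
  "env c = (\<lambda>j. c div K ^ j mod K)"

text \<open>A gate is accepted when all its inputs are defeated. A false atom is attacked by
  \<open>Mode 2\<close>, which is accepted whenever the gates are switched on. A certificate bit
  acts through its negative literal; positions from \<open>m\<close> on count as 0.\<close>

fun gate_input :: "fm \<Rightarrow> nat \<Rightarrow> arg \<Rightarrow> bool" where
  "gate_input (Leq s t) c a \<longleftrightarrow> a = Mode 2 \<and> \<not> tval n (env c) s \<le> tval n (env c) t"
| "gate_input (InX t) c a \<longleftrightarrow> a = Mode 2 \<and> tval n (env c) t \<notin> X"
| "gate_input (InY t) c a \<longleftrightarrow> (if tval n (env c) t < m then a = Lit False (tval n (env c) t) else a = Mode 2)"
| "gate_input (Nor f g) c a \<longleftrightarrow> a = Gate f c \<or> a = Gate g c"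
| "gate_input (NEx t f) c a \<longleftrightarrow> (\<exists>i<tval n (env c) t. a = Gate f (i + K * c))"

fun attacks :: "arg \<Rightarrow> arg \<Rightarrow> bool" where
  "attacks a (Mode i) \<longleftrightarrow> (\<exists>j<3. j \<noteq> i \<and> a = Mode j) \<or> \<not> q \<and> i = 2 \<and> a = Block"
| "attacks a (NoMode i) \<longleftrightarrow> a = Mode i \<or> q \<and> a = NoMode i"
| "attacks a Goal \<longleftrightarrow> a = Mode 0 \<or> q \<and> a = Gate \<phi> 0"
| "attacks a Block \<longleftrightarrow> a = Mode 0 \<or> a = Mode 1 \<or> a = Gate \<phi> 0 \<or> q \<and> a = Block"
| "attacks a (Lit s v) \<longleftrightarrow> a = Mode 0 \<or> a = Mode 1 \<or> a = Lit (\<not> s) v \<or> q \<and> l \<le> v \<and> a = Block"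
| "attacks a (Copy s v) \<longleftrightarrow> a = Mode 0 \<or> a = Mode 1 \<or> a = Lit s v \<or> q \<and> a = Copy s v"
| "attacks a (Gate f c) \<longleftrightarrow> a = Mode 0 \<or> a = Mode 1 \<or> gate_input f c a"
| "attacks a (Pad i) \<longleftrightarrow> a = Mode 0 \<or> a = Mode 2"

fun is_arg :: "arg \<Rightarrow> bool" where
  "is_arg (Mode i) \<longleftrightarrow> i < 3"
| "is_arg (NoMode i) \<longleftrightarrow> i < 3"
| "is_arg Goal \<longleftrightarrow> True"
| "is_arg Block \<longleftrightarrow> True"
| "is_arg (Lit s v) \<longleftrightarrow> v < W"
| "is_arg (Copy s v) \<longleftrightarrow> v < W"
| "is_arg (Gate f c) \<longleftrightarrow> f \<in> set (subs \<phi>) \<and> c < W"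
| "is_arg (Pad i) \<longleftrightarrow> i < C"

definition F :: "arg af" where
  "F = \<lparr>args = Collect is_arg, atts = {(a, b). is_arg a \<and> is_arg b \<and> attacks a b}\<rparr>"

definition core :: "arg set" where
  "core = Mode ` {..<3} \<union> NoMode ` {..<3} \<union> {Goal, Block} \<union> Lit True ` {..<W} \<union> Lit False ` {..<W} \<union>
     Copy True ` {..<W} \<union> Copy False ` {..<W} \<union> case_prod Gate ` (set (subs \<phi>) \<times> {..<W})"

lemma args_F: "args F = Collect is_arg" and atts_F: "(a, b) \<in> atts F \<longleftrightarrow> is_arg a \<and> is_arg b \<and> attacks a b"
  by (simp_all add: F_def)

lemma is_arg_split: "Collect is_arg = core \<union> Pad ` {..<C}"
proof (intro set_eqI)
  fix a show "a \<in> Collect is_arg \<longleftrightarrow> a \<in> core \<union> Pad ` {..<C}"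
  proof (cases a)
    case (Lit s v)
    then show ?thesis by (cases s) (auto simp: core_def)
  next
    case (Copy s v)
    then show ?thesis by (cases s) (auto simp: core_def)
  qed (auto simp: core_def)
qed

lemma card_core: "finite core" "card core \<le> C"
proof -
  show "finite core" by (auto simp: core_def)
  have un: "card A \<le> a \<Longrightarrow> card B \<le> b \<Longrightarrow> card (A \<union> B) \<le> a + b" for A B :: "arg set" and a b
    using card_Un_le[of A B] by linarith
  have im: "card (f ` {..<k}) \<le> k" for f :: "nat \<Rightarrow> arg" and k
    using card_image_le[of "{..<k}" f] by simp
  have "card (case_prod Gate ` (set (subs \<phi>) \<times> {..<W})) \<le> card (set (subs \<phi>) \<times> {..<W})"
    by (rule card_image_le[OF finite_cartesian_product[OF finite_set finite_lessThan]])
  also have "\<dots> = length (nodes \<phi>) * W" by (simp add: nodes_def length_remdups_card_conv)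
  finally have gates: "card (case_prod Gate ` (set (subs \<phi>) \<times> {..<W})) \<le> length (nodes \<phi>) * W" .
  have two: "card {Goal, Block} \<le> 2" by simp
  have "card core \<le> 3 + 3 + 2 + W + W + W + W + length (nodes \<phi>) * W"
    unfolding core_def
    by (rule un[OF un[OF un[OF un[OF un[OF un[OF un[OF im im] two] im] im] im] im] gates])
  then show "card core \<le> C" by (simp add: C algebra_simps)
qed

lemma finite_F: "finite_af F"
proof -
  have "finite (args F)" using card_core(1) by (simp add: args_F is_arg_split)
  then show ?thesis by (auto simp: finite_af_def F_def)
qed

lemma in_iff: "complete_ext F T \<Longrightarrow> is_arg a \<Longrightarrow> a \<in> T \<longleftrightarrow> (\<forall>b. is_arg b \<longrightarrow> attacks b a \<longrightarrow> b \<in> defeated F T)"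
  using complete_ext_in_iff[of F T a] by (auto simp: args_F atts_F)

lemma def_iff: "T \<subseteq> Collect is_arg \<Longrightarrow> a \<in> defeated F T \<longleftrightarrow> is_arg a \<and> (\<exists>b\<in>T. attacks b a)"
  by (auto simp: defeated_def args_F atts_F)

lemma complete_is_arg: "complete_ext F T \<Longrightarrow> T \<subseteq> Collect is_arg"
  using complete_ext_subset[of F T] by (simp add: args_F)

lemma attack_defeats: "complete_ext F T \<Longrightarrow> b \<in> T \<Longrightarrow> is_arg a \<Longrightarrow> attacks b a \<Longrightarrow> a \<in> defeated F T \<and> a \<notin> T"
  using def_iff[OF complete_is_arg, of T a] complete_ext_disjoint[of F T a] by auto

lemma attacker_defeated: "complete_ext F T \<Longrightarrow> a \<in> T \<Longrightarrow> is_arg b \<Longrightarrow> attacks b a \<Longrightarrow> b \<in> defeated F T"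
  using in_iff[of T a] complete_is_arg[of T] by blast

lemma self_attack: "complete_ext F T \<Longrightarrow> attacks a a \<Longrightarrow> a \<notin> T"
  using attack_defeats[of T a a] complete_is_arg[of T] by auto

section \<open>The extensions of modes 0 and 1\<close>

definition E0 :: "arg set" where
  "E0 = insert (Mode 0) (if q then {} else {NoMode 1, NoMode 2})"

definition E1 :: "arg set" where
  "E1 = {Mode 1, Goal} \<union> Pad ` {..<C} \<union> (if q then {} else {NoMode 0, NoMode 2})"

lemma in_E0: "a \<in> E0 \<longleftrightarrow> a = Mode 0 \<or> \<not> q \<and> (a = NoMode 1 \<or> a = NoMode 2)"
  by (auto simp: E0_def)

lemma in_E1: "a \<in> E1 \<longleftrightarrow> a = Mode 1 \<or> a = Goal \<or> (\<exists>i<C. a = Pad i) \<or> \<not> q \<and> (a = NoMode 0 \<or> a = NoMode 2)"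
  by (auto simp: E1_def)

lemma mode0_attacks: "is_arg a \<Longrightarrow> a \<notin> {Mode 0, NoMode 1, NoMode 2} \<Longrightarrow> attacks (Mode 0) a"
  by (cases a) (auto simp: less_Suc_eq numeral_3_eq_3)

lemma mode1_attacks: "is_arg a \<Longrightarrow> a \<notin> {Mode 1, NoMode 0, NoMode 2, Goal} \<Longrightarrow> a \<notin> range Pad \<Longrightarrow> attacks (Mode 1) a"
  by (cases a) (auto simp: less_Suc_eq numeral_3_eq_3)

lemma is_arg_modes [simp]: "is_arg (Mode 2)" "is_arg (Mode (Suc 0))"
  "is_arg (NoMode 0)" "is_arg (NoMode 1)" "is_arg (NoMode 2)" "is_arg (NoMode (Suc 0))"
  by auto

lemma NoMode_in_iff:
  assumes "complete_ext F T" "i < 3"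
  shows "NoMode i \<in> T \<longleftrightarrow> \<not> q \<and> Mode i \<in> defeated F T"
proof (cases q)
  case True
  then show ?thesis using self_attack[OF assms(1), of "NoMode i"] by simp
next
  case False
  then show ?thesis using in_iff[OF assms(1), of "NoMode i"] assms(2) by auto
qed

text \<open>\<open>Mode 0\<close> attacks everything except itself and two recorders, and these are
  determined by the defeat of their modes.\<close>

lemma mode0:
  assumes T: "complete_ext F T" "Mode 0 \<in> T" shows "T = E0"
proof -
  have d: "a \<in> defeated F T \<and> a \<notin> T" if "is_arg a" "a \<notin> {Mode 0, NoMode 1, NoMode 2}" for a
    using attack_defeats[OF T that(1) mode0_attacks[OF that]] .
  have "NoMode 1 \<in> T \<longleftrightarrow> \<not> q" "NoMode 2 \<in> T \<longleftrightarrow> \<not> q"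
    using NoMode_in_iff[OF T(1), of 1] NoMode_in_iff[OF T(1), of 2] d[of "Mode 1"] d[of "Mode 2"] by auto
  then show ?thesis using d complete_is_arg[OF T(1)] T(2) by (auto simp: E0_def)
qed

lemma mode1:
  assumes T: "complete_ext F T" "Mode 1 \<in> T" shows "T = E1"
proof -
  have d: "a \<in> defeated F T \<and> a \<notin> T" if "is_arg a" "a \<notin> {Mode 1, NoMode 0, NoMode 2, Goal}" "a \<notin> range Pad" for a
    using attack_defeats[OF T that(1) mode1_attacks[OF that]] .
  have "NoMode 0 \<in> T \<longleftrightarrow> \<not> q" "NoMode 2 \<in> T \<longleftrightarrow> \<not> q"
    using NoMode_in_iff[OF T(1), of 0] NoMode_in_iff[OF T(1), of 2] d[of "Mode 0"] d[of "Mode 2"] by auto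
  moreover have "Goal \<in> T" using in_iff[OF T(1), of Goal] d[of "Mode 0"] d by auto
  moreover have "Pad i \<in> T \<longleftrightarrow> i < C" for i
    using in_iff[OF T(1), of "Pad i"] d[of "Mode 0"] d[of "Mode 2"] complete_is_arg[OF T(1)] by auto
  moreover have "x \<in> {Mode 1, NoMode 0, NoMode 2, Goal} \<or> (\<exists>i. x = Pad i)" if "x \<in> T" for x
    using d[of x] complete_is_arg[OF T(1)] that by blast
  ultimately show ?thesis using T(2) unfolding E1_def
    by (intro subset_antisym subsetI) (force split: if_splits)+
qed

text \<open>The attackers of \<open>Mode 0\<close> and \<open>Mode 1\<close> are modes, which are
  attacked back. So either mode alone is admissible, and the preferred extension around it is the
  only complete one with that mode.\<close>

lemma preferred_E0: "preferred_ext F E0" and preferred_E1: "preferred_ext F E1"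
proof -
  have "admissible F {Mode i}" if "i < 2" for i
  proof -
    have "\<not> attacks (Mode i) (Mode i)" by auto
    moreover have "attacks (Mode i) b" if "attacks b (Mode i)" "is_arg b" for b
      using that \<open>i < 2\<close> by auto
    ultimately show ?thesis using \<open>i < 2\<close>
      by (auto simp: admissible_def conflict_free_def acceptable_def defeated_def args_F atts_F)
  qed
  then have "\<exists>E. preferred_ext F E \<and> {Mode i} \<subseteq> E" if "i < 2" for i
    using admissible_extends_to_preferred[OF finite_F] that by blast
  from this[of 0] this[of 1] show "preferred_ext F E0" "preferred_ext F E1"
    using mode0 mode1 by (auto simp: preferred_ext_def)
qed

lemma defeated_E0: "defeated F E0 = Collect is_arg - {Mode 0, NoMode 1, NoMode 2}"
proof -
  have sub: "E0 \<subseteq> Collect is_arg" by (auto simp: E0_def)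
  have "a \<notin> defeated F E0" if "a \<in> {Mode 0, NoMode 1, NoMode 2}" for a
    using that unfolding def_iff[OF sub] unfolding E0_def by (auto split: if_splits)
  moreover have "Mode 0 \<in> E0" by (simp add: E0_def)
  ultimately show ?thesis using mode0_attacks def_iff[OF sub] by blast
qed

lemma defeated_E1: "defeated F E1 = Collect is_arg - ({Mode 1, NoMode 0, NoMode 2, Goal} \<union> range Pad)"
proof -
  have sub: "E1 \<subseteq> Collect is_arg" by (auto simp: E1_def)
  have "a \<notin> defeated F E1" if "a \<in> {Mode 1, NoMode 0, NoMode 2, Goal} \<union> range Pad" for a
    using that unfolding def_iff[OF sub] unfolding E1_def by (auto split: if_splits)
  moreover have "Mode 1 \<in> E1" by (simp add: E1_def)
  ultimately show ?thesis using mode1_attacks def_iff[OF sub] by blast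
qed

text \<open>This is what the circuit computes, not yet the truth value of the formula: gates with a
  code from \<open>W\<close> on do not exist, and the environment consists of digits. With suitable
  \<open>K\<close> and \<open>W\<close> the two agree, see \<open>gate_value_sat\<close>.\<close>

primrec gate_value :: "fm \<Rightarrow> nat set \<Rightarrow> nat \<Rightarrow> bool" where
  "gate_value (Leq s t) S c \<longleftrightarrow> tval n (env c) s \<le> tval n (env c) t"
| "gate_value (InX t) S c \<longleftrightarrow> tval n (env c) t \<in> X"
| "gate_value (InY t) S c \<longleftrightarrow> tval n (env c) t < m \<and> tval n (env c) t \<in> S"
| "gate_value (Nor f g) S c \<longleftrightarrow> \<not> gate_value f S c \<and> \<not> gate_value g S c"
| "gate_value (NEx t f) S c \<longleftrightarrow> \<not> (\<exists>i<tval n (env c) t. i + K * c < W \<and> gate_value f S (i + K * c))"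

lemma subs_parts:
  "Nor f g \<in> set (subs \<phi>) \<Longrightarrow> f \<in> set (subs \<phi>) \<and> g \<in> set (subs \<phi>)"
  "NEx t f \<in> set (subs \<phi>) \<Longrightarrow> f \<in> set (subs \<phi>)"
  using subs_trans[of f "Nor f g" \<phi>] subs_trans[of g "Nor f g" \<phi>] subs_trans[of f "NEx t f" \<phi>] subs_self
  by auto

text \<open>Three-valued evaluation: literals and gates may be undecided in \<open>T\<close>, but a
  decided gate has its value under every \<open>S\<close> that is compatible with the accepted
  literals.\<close>

lemma gate_sound:
  assumes T: "complete_ext F T" "Mode 2 \<in> T"
    and S: "\<forall>v. (Lit True v \<in> T \<longrightarrow> v \<in> S) \<and> (Lit False v \<in> T \<longrightarrow> v \<notin> S)"
  shows "f \<in> set (subs \<phi>) \<Longrightarrow> c < W \<Longrightarrow>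
    (Gate f c \<in> T \<longrightarrow> gate_value f S c) \<and> (Gate f c \<in> defeated F T \<longrightarrow> \<not> gate_value f S c)"
proof -
  have m: "Mode 0 \<notin> T" "Mode 1 \<notin> T" "Mode 2 \<notin> defeated F T"
    using attack_defeats[OF T, of "Mode 0"] attack_defeats[OF T, of "Mode 1"] complete_ext_disjoint[OF T] by auto
  have gin: "b \<in> defeated F T" if "Gate f c \<in> T" "is_arg b" "gate_input f c b" for f c b
    using in_iff[OF T(1), of "Gate f c"] complete_is_arg[OF T(1)] that by auto
  have gdef: "\<exists>b\<in>T. gate_input f c b" if "Gate f c \<in> defeated F T" for f c
    using that m unfolding def_iff[OF complete_is_arg[OF T(1)]] by auto
  \<comment> \<open>Modes 0 and 1 are not accepted and \<open>Block\<close>, where it attacks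
    literals, attacks itself; so only the opposite literal can have defeated this one.\<close>
  have lit: "Lit True v \<in> T" if "Lit False v \<in> defeated F T" for v
    using that m self_attack[OF T(1), of Block] unfolding def_iff[OF complete_is_arg[OF T(1)]] by auto
  show "f \<in> set (subs \<phi>) \<Longrightarrow> c < W \<Longrightarrow> ?thesis"
  proof (induction f arbitrary: c)
    case (Leq s t)
    show ?case using gin[of "Leq s t" c "Mode 2"] gdef[of "Leq s t" c] m(3) by auto
  next
    case (InX t)
    show ?case using gin[of "InX t" c "Mode 2"] gdef[of "InX t" c] m(3) by auto
  next
    case (InY t)
    let ?v = "tval n (env c) t"
    show ?case
    proof (cases "?v < m")
      case True
      then have "is_arg (Lit False ?v)" using W by simp
      then have "Gate (InY t) c \<in> T \<Longrightarrow> Lit False ?v \<in> defeated F T"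
        using gin[of "InY t" c "Lit False ?v"] True by simp
      moreover have "Gate (InY t) c \<in> defeated F T \<Longrightarrow> Lit False ?v \<in> T"
        using gdef[of "InY t" c] True by auto
      ultimately show ?thesis using lit S True by auto
    next
      case False
      then show ?thesis using gin[of "InY t" c "Mode 2"] m(3) by auto
    qed
  next
    case (Nor f g)
    have "is_arg (Gate f c)" "is_arg (Gate g c)" using subs_parts(1)[OF Nor.prems(1)] Nor.prems(2) by auto
    then show ?case
      using Nor subs_parts(1)[OF Nor.prems(1)] gin[of "Nor f g" c] gdef[of "Nor f g" c] by auto
  next
    case (NEx t f)
    have f: "f \<in> set (subs \<phi>)" using subs_parts(2)[OF NEx.prems(1)] .
    show ?case
    proof (intro conjI impI)
      assume g: "Gate (NEx t f) c \<in> T"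
      have "\<not> gate_value f S (i + K * c)" if "i < tval n (env c) t" "i + K * c < W" for i
        using gin[OF g, of "Gate f (i + K * c)"] NEx.IH[OF f that(2)] that f by auto
      then show "gate_value (NEx t f) S c" by auto
    next
      assume "Gate (NEx t f) c \<in> defeated F T"
      then obtain i where i: "i < tval n (env c) t" "Gate f (i + K * c) \<in> T" using gdef by force
      then have "i + K * c < W" using complete_is_arg[OF T(1)] by auto
      then show "\<not> gate_value (NEx t f) S c" using i NEx.IH[OF f] by auto
    qed
  qed
qed

fun selected :: "nat set \<Rightarrow> arg \<Rightarrow> bool" where
  "selected S (Mode i) \<longleftrightarrow> i = 2"
| "selected S (NoMode i) \<longleftrightarrow> \<not> q \<and> i \<noteq> 2"
| "selected S Goal \<longleftrightarrow> \<not> q"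
| "selected S Block \<longleftrightarrow> False"
| "selected S (Lit s v) \<longleftrightarrow> s = (v \<in> S)"
| "selected S (Copy s v) \<longleftrightarrow> \<not> q \<and> s \<noteq> (v \<in> S)"
| "selected S (Gate f c) \<longleftrightarrow> gate_value f S c"
| "selected S (Pad i) \<longleftrightarrow> False"

definition E2 :: "nat set \<Rightarrow> arg set" where
  "E2 S = {a. is_arg a \<and> selected S a}"

lemma in_E2: "a \<in> E2 S \<longleftrightarrow> is_arg a \<and> selected S a"
  by (simp add: E2_def)

lemma gate_input_E2:
  assumes "f \<in> set (subs \<phi>)" "c < W"
  shows "(\<exists>b\<in>E2 S. gate_input f c b) \<longleftrightarrow> \<not> gate_value f S c"
proof (cases f)
  case (Nor g h)
  have "(\<exists>b\<in>E2 S. gate_input f c b) \<longleftrightarrow> Gate g c \<in> E2 S \<or> Gate h c \<in> E2 S" unfolding Nor by auto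
  then show ?thesis using subs_parts(1)[of g h] assms Nor by (auto simp: in_E2)
next
  case (NEx t g)
  have "(\<exists>b\<in>E2 S. gate_input f c b) \<longleftrightarrow> (\<exists>i<tval n (env c) t. Gate g (i + K * c) \<in> E2 S)"
    unfolding NEx by auto
  then show ?thesis using subs_parts(2)[of t g] assms NEx by (auto simp: in_E2)
next
  case (InY t)
  let ?v = "tval n (env c) t"
  have "(\<exists>b\<in>E2 S. gate_input f c b) \<longleftrightarrow> (if ?v < m then Lit False ?v \<in> E2 S else Mode 2 \<in> E2 S)"
    unfolding InY by simp
  then show ?thesis using W InY by (simp add: in_E2)
qed (auto simp: in_E2)

lemma gate_input_kind: "gate_input f c a \<Longrightarrow> a = Mode 2 \<or> (\<exists>s v. a = Lit s v) \<or> (\<exists>g d. a = Gate g d)"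
  by (cases f) (auto split: if_splits)

text \<open>A true root defeats \<open>Block\<close>, after which every argument is either selected
  or attacked by a selected one. The exceptions are recorders that attack themselves.\<close>

lemma kernel_E2:
  assumes "is_arg a" "gate_value \<phi> S 0" "q \<Longrightarrow> a \<notin> range NoMode \<and> (\<forall>s v. a \<noteq> Copy s v)"
  shows "a \<in> E2 S \<longleftrightarrow> \<not> (\<exists>b\<in>E2 S. attacks b a)"
proof -
  have m: "Mode i \<in> E2 S \<longleftrightarrow> i = 2" "Gate \<phi> 0 \<in> E2 S" "Block \<notin> E2 S" for i
    using assms(2) subs_self W(1) by (auto simp: in_E2)
  have l: "Lit s v \<in> E2 S \<longleftrightarrow> v < W \<and> s = (v \<in> S)" for s v by (simp add: in_E2)
  show ?thesis
  proof (cases a)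
    case (Gate f c)
    have "(\<exists>b\<in>E2 S. attacks b a) \<longleftrightarrow> (\<exists>b\<in>E2 S. gate_input f c b)"
      using m(1)[of 0] m(1)[of 1] Gate by auto
    then show ?thesis using assms(1) Gate gate_input_E2[of f c S] by (simp add: in_E2)
  next
    case (Mode i)
    have "(\<exists>b\<in>E2 S. attacks b a) \<longleftrightarrow> (\<exists>j<3. j \<noteq> i \<and> Mode j \<in> E2 S)" using m(3) Mode by auto
    then show ?thesis using m(1) Mode by auto
  next
    case Block
    then have "attacks (Gate \<phi> 0) a" by simp
    then show ?thesis using m(2,3) Block by blast
  next
    case Goal
    have "(\<exists>b\<in>E2 S. attacks b a) \<longleftrightarrow> Mode 0 \<in> E2 S \<or> q \<and> Gate \<phi> 0 \<in> E2 S"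
      unfolding Goal by (simp add: bex_disj_distrib)
    then show ?thesis using Goal m(1)[of 0] m(2) by (simp add: in_E2)
  next
    case (Lit s v)
    have "(\<exists>b\<in>E2 S. attacks b a) \<longleftrightarrow> Mode 0 \<in> E2 S \<or> Mode 1 \<in> E2 S \<or> Lit (\<not> s) v \<in> E2 S \<or>
        q \<and> l \<le> v \<and> Block \<in> E2 S"
      unfolding Lit by (simp add: bex_disj_distrib)
    then show ?thesis unfolding Lit using assms(1) Lit m(1)[of 0] m(1)[of 1] m(3) l by auto
  next
    case (Copy s v)
    then have nq: "\<not> q" using assms(3) by blast
    have "(\<exists>b\<in>E2 S. attacks b a) \<longleftrightarrow> Lit s v \<in> E2 S" using m(1)[of 0] m(1)[of 1] Copy nq by auto
    then show ?thesis using assms(1) l Copy nq by (auto simp: in_E2)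
  next
    case (NoMode i)
    then have nq: "\<not> q" using assms(3) by blast
    have "(\<exists>b\<in>E2 S. attacks b a) \<longleftrightarrow> Mode i \<in> E2 S" using NoMode nq by auto
    then show ?thesis using assms(1) m(1) NoMode nq by (auto simp: in_E2)
  next
    case (Pad i)
    then have "attacks (Mode 2) a" "a \<notin> E2 S" by (simp_all add: in_E2)
    then show ?thesis using m(1)[of 2] by blast
  qed
qed

lemma E2_subset: "E2 S \<subseteq> Collect is_arg"
  by (auto simp: E2_def)

lemma stable_E2:
  assumes "\<not> q" "gate_value \<phi> S 0" shows "stable_ext F (E2 S)"
proof (rule stable_extI[OF finite_F])
  fix a assume "a \<in> args F"
  then show "a \<in> E2 S \<longleftrightarrow> a \<notin> defeated F (E2 S)"
    using kernel_E2[of a S] assms unfolding def_iff[OF E2_subset] args_F by blast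
qed (simp add: args_F E2_subset)

text \<open>The recorders, which \<open>kernel_E2\<close> leaves out, attack nothing but themselves,
  so no selected argument needs a defence against them.\<close>

lemma admissible_E2:
  assumes q "gate_value \<phi> S 0" shows "admissible F (E2 S)"
proof -
  have nq: "a \<notin> range NoMode \<and> (\<forall>s v. a \<noteq> Copy s v)" if "attacks a b" "b \<in> E2 S" for a b
  proof (cases a)
    case (NoMode i)
    then show ?thesis using that assms(1) by (cases b) (auto simp: in_E2 dest: gate_input_kind)
  next
    case (Copy s v)
    then show ?thesis using that assms(1) by (cases b) (auto simp: in_E2 dest: gate_input_kind)
  qed auto
  have k: "a \<in> E2 S \<longleftrightarrow> \<not> (\<exists>b\<in>E2 S. attacks b a)"
    if "is_arg a" "a \<notin> range NoMode \<and> (\<forall>s v. a \<noteq> Copy s v)" for a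
    by (rule kernel_E2[OF that(1) assms(2)]) (use that in auto)
  have n: "a \<notin> range NoMode \<and> (\<forall>s v. a \<noteq> Copy s v)" if "a \<in> E2 S" for a
    using that assms(1) by (cases a) (auto simp: in_E2)
  have "a \<notin> defeated F (E2 S)" if "a \<in> E2 S" for a
    using k[of a] n[OF that] that E2_subset by (auto simp: def_iff[OF E2_subset])
  moreover have "b \<in> defeated F (E2 S)" if "a \<in> E2 S" "is_arg b" "attacks b a" for a b
    using k[OF that(2) nq[OF that(3,1)]] k[of a] n[OF that(1)] that E2_subset
    by (auto simp: def_iff[OF E2_subset])
  moreover have "is_arg a" if "a \<in> E2 S" for a using that by (simp add: in_E2)
  ultimately show ?thesis
    by (auto simp: admissible_def conflict_free_def acceptable_def args_F atts_F)
qed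

lemma Mode2_cases:
  assumes T: "complete_ext F T" "Mode 2 \<in> T"
  shows "Mode 0 \<notin> T" "Mode 1 \<notin> T" "Pad i \<notin> T" "i < C \<Longrightarrow> Pad i \<in> defeated F T"
proof -
  show "Mode 0 \<notin> T" "Mode 1 \<notin> T"
    using attack_defeats[OF T, of "Mode 0"] attack_defeats[OF T, of "Mode 1"] by auto
  show "i < C \<Longrightarrow> Pad i \<in> defeated F T" using attack_defeats[OF T, of "Pad i"] by simp
  show "Pad i \<notin> T" using attack_defeats[OF T, of "Pad i"] complete_is_arg[OF T(1)] by auto
qed

lemma Goal_defeated_iff:
  assumes "complete_ext F T"
  shows "Goal \<in> defeated F T \<longleftrightarrow> Mode 0 \<in> T \<or> q \<and> Gate \<phi> 0 \<in> T"
  unfolding def_iff[OF complete_is_arg[OF assms]] by auto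

definition true_lits :: "arg set \<Rightarrow> nat set" where
  "true_lits T = {v. Lit True v \<in> T}"

lemma true_lits_consistent:
  assumes "complete_ext F T"
  shows "\<forall>v. (Lit True v \<in> T \<longrightarrow> v \<in> true_lits T) \<and> (Lit False v \<in> T \<longrightarrow> v \<notin> true_lits T)"
  using attack_defeats[OF assms, of "Lit False v" "Lit True v" for v] complete_is_arg[OF assms]
  by (auto simp: true_lits_def)

lemma root_sound:
  assumes "complete_ext F T" "Mode 2 \<in> T" "Gate \<phi> 0 \<in> T"
  shows "gate_value \<phi> (true_lits T) 0"
  using gate_sound[OF assms(1,2) true_lits_consistent[OF assms(1)] subs_self W(1)] assms(3) by blast

text \<open>\<open>Block\<close> attacks \<open>Mode 2\<close>, and in mode 2 only the root gate can
  defeat it.\<close>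

lemma mode2_unquantified:
  assumes "\<not> q"
  shows "(\<exists>T. extension \<sigma> F T \<and> Mode 2 \<in> T \<and> Goal \<notin> defeated F T) \<longleftrightarrow> (\<exists>S. gate_value \<phi> S 0)"
proof
  assume "\<exists>T. extension \<sigma> F T \<and> Mode 2 \<in> T \<and> Goal \<notin> defeated F T"
  then obtain T where T: "complete_ext F T" "Mode 2 \<in> T" using extension_complete by blast
  have "Block \<in> defeated F T" using attacker_defeated[OF T, of Block] assms by simp
  then have "Gate \<phi> 0 \<in> T"
    unfolding def_iff[OF complete_is_arg[OF T(1)]] using Mode2_cases[OF T] assms by auto
  then show "\<exists>S. gate_value \<phi> S 0" using root_sound[OF T] by blast
next
  assume "\<exists>S. gate_value \<phi> S 0"
  then obtain S where "stable_ext F (E2 S)" using stable_E2[OF assms] by blast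
  then have E: "extension \<sigma> F (E2 S)"
    using assms by (cases \<sigma>) (auto simp: quantified_def stable_ext_def preferred_ext_def)
  have "Mode 2 \<in> E2 S" "Mode 0 \<notin> E2 S" by (auto simp: in_E2)
  then show "\<exists>T. extension \<sigma> F T \<and> Mode 2 \<in> T \<and> Goal \<notin> defeated F T"
    using E Goal_defeated_iff[OF extension_complete[OF E]] assms by blast
qed

text \<open>If no mode is accepted, \<open>Mode 0\<close> is not defeated and blocks everything
  except recorders, which attack themselves. The extension is then empty, and \<open>E0\<close> is
  larger.\<close>

lemma preferred_mode:
  assumes q "preferred_ext F T" shows "Mode 0 \<in> T \<or> Mode 1 \<in> T \<or> Mode 2 \<in> T"
proof (rule ccontr)
  assume none: "\<not> ?thesis"
  have T: "complete_ext F T" using assms(2) by (simp add: preferred_ext_def)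
  have "Mode 0 \<notin> defeated F T"
    using none unfolding def_iff[OF complete_is_arg[OF T]] by (auto simp: less_Suc_eq numeral_3_eq_3 numeral_2_eq_2)
  then have "a \<notin> T" if "attacks (Mode 0) a" for a
    using in_iff[OF T, of a] complete_is_arg[OF T] that by auto
  moreover have "NoMode i \<notin> T" for i using self_attack[OF T, of "NoMode i"] assms(1) by simp
  ultimately have "T = {}" using mode0_attacks complete_is_arg[OF T] none by blast
  moreover have "complete_ext F E0" using preferred_E0 by (simp add: preferred_ext_def)
  ultimately show False using assms(2) by (auto simp: preferred_ext_def E0_def)
qed

text \<open>While the root is not accepted, \<open>Block\<close> is undefeated and no literal from
  \<open>l\<close> on is accepted. If \<open>S\<close> made the formula true, all of
  \<open>T\<close> would be contained in the admissible set \<open>E2 S\<close>, which also has the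
  root; this contradicts maximality.\<close>

lemma mode2_quantified_sound:
  assumes q "preferred_ext F T" "Mode 2 \<in> T" "Goal \<notin> defeated F T"
    and S: "S \<inter> {..<l} = true_lits T \<inter> {..<l}"
  shows "\<not> gate_value \<phi> S 0"
proof
  assume v: "gate_value \<phi> S 0"
  have c: "complete_ext F T" using assms(2) by (simp add: preferred_ext_def)
  note m = Mode2_cases[OF c assms(3)]
  have root: "Gate \<phi> 0 \<notin> T" using assms(1,4) Goal_defeated_iff[OF c] by blast
  have block: "Block \<notin> T" using self_attack[OF c, of Block] assms(1) by simp
  have "Block \<notin> defeated F T"
    unfolding def_iff[OF complete_is_arg[OF c]] using m root block by auto
  then have lit: "u < l" if "Lit s u \<in> T" for s u
    using attacker_defeated[OF c that, of Block] assms(1) by (auto simp: not_le[symmetric])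
  have cons: "\<forall>u. (Lit True u \<in> T \<longrightarrow> u \<in> S) \<and> (Lit False u \<in> T \<longrightarrow> u \<notin> S)"
    using lit true_lits_consistent[OF c] S by blast
  note gate = gate_sound[OF c assms(3) cons]
  have "T \<subseteq> E2 S"
  proof
    fix a assume a: "a \<in> T"
    then have arg: "is_arg a" using complete_is_arg[OF c] by blast
    have nself: "\<not> attacks a a" using self_attack[OF c] a by blast
    have "selected S a"
    proof (cases a)
      case (Mode i)
      then show ?thesis using a m arg by (cases "i = 0 \<or> i = 1") auto
    next
      case Goal
      have "Gate \<phi> 0 \<in> defeated F T" using attacker_defeated[OF c a, of "Gate \<phi> 0"] Goal subs_self W(1) assms(1) by auto
      then show ?thesis using gate[OF subs_self W(1)] v by blast
    next
      case (Lit s u)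
      then show ?thesis using cons a by (cases s) auto
    next
      case (Gate f d)
      then show ?thesis using gate[of f d] arg a by auto
    next
      case (Pad i)
      then show ?thesis using m(3) a by blast
    qed (use nself assms(1) a block in auto)
    then show "a \<in> E2 S" using arg by (simp add: in_E2)
  qed
  moreover have "Gate \<phi> 0 \<in> E2 S" using v subs_self W(1) by (simp add: in_E2)
  moreover obtain E where "preferred_ext F E" "E2 S \<subseteq> E"
    using admissible_extends_to_preferred[OF finite_F admissible_E2[OF assms(1) v]] by blast
  ultimately have "complete_ext F E" "T \<subset> E" using root by (auto simp: preferred_ext_def)
  then show False using assms(2) by (auto simp: preferred_ext_def)
qed

text \<open>For the converse, the first literals are fixed according to \<open>S0\<close>. A
  semi-stable extension around them is obtained by maximising the range among the preferred
  supersets only; it remains to show that no preferred extension elsewhere has a larger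
  range.\<close>

lemma mode2_quantified:
  assumes q
  shows "(\<exists>T. extension \<sigma> F T \<and> Mode 2 \<in> T \<and> Goal \<notin> defeated F T) \<longleftrightarrow>
    (\<exists>S0\<subseteq>{..<l}. \<forall>S. S \<inter> {..<l} = S0 \<longrightarrow> \<not> gate_value \<phi> S 0)"
proof
  assume "\<exists>T. extension \<sigma> F T \<and> Mode 2 \<in> T \<and> Goal \<notin> defeated F T"
  then obtain T where T: "extension \<sigma> F T" "Mode 2 \<in> T" "Goal \<notin> defeated F T" by blast
  have "preferred_ext F T" using T(1) assms by (cases \<sigma>) (auto simp: quantified_def semi_stable_ext_def)
  then show "\<exists>S0\<subseteq>{..<l}. \<forall>S. S \<inter> {..<l} = S0 \<longrightarrow> \<not> gate_value \<phi> S 0"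
    using mode2_quantified_sound[OF assms _ T(2,3)] by (intro exI[of _ "true_lits T \<inter> {..<l}"]) auto
next
  assume "\<exists>S0\<subseteq>{..<l}. \<forall>S. S \<inter> {..<l} = S0 \<longrightarrow> \<not> gate_value \<phi> S 0"
  then obtain S0 where S0: "S0 \<subseteq> {..<l}" "\<And>S. S \<inter> {..<l} = S0 \<Longrightarrow> \<not> gate_value \<phi> S 0" by blast
  define base where "base = insert (Mode 2) ((\<lambda>v. Lit (v \<in> S0) v) ` {..<l})"
  have sub: "base \<subseteq> Collect is_arg" using W by (auto simp: base_def)
  have "admissible F base"
  proof -
    have "a \<notin> defeated F base" if "a \<in> base" for a
      using that unfolding def_iff[OF sub] by (auto simp: base_def)
    moreover have "b \<in> defeated F base" if "a \<in> base" "is_arg b" "attacks b a" for a b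
    proof -
      have "b \<in> {Mode 0, Mode 1} \<or> (\<exists>v<l. b = Lit (v \<notin> S0) v)"
        using that assms by (auto simp: base_def less_Suc_eq numeral_3_eq_3 numeral_2_eq_2)
      then show ?thesis unfolding def_iff[OF sub] using that(2) by (auto simp: base_def)
    qed
    ultimately show ?thesis using sub
      by (auto simp: admissible_def conflict_free_def acceptable_def args_F atts_F)
  qed
  let ?P = "{T. preferred_ext F T \<and> base \<subseteq> T}"
  let ?r = "\<lambda>T. T \<union> defeated F T"
  have "?P \<noteq> {}" using admissible_extends_to_preferred[OF finite_F \<open>admissible F base\<close>] by blast
  moreover have "finite ?P"
  proof (rule finite_subset)
    show "?P \<subseteq> Pow (args F)" using complete_ext_subset by (auto simp: preferred_ext_def)
    show "finite (Pow (args F))" using finite_F by (simp add: finite_af_def)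
  qed
  \<comment> \<open>\<open>T\<close> is preferred and contains \<open>base\<close>, and its range is
    maximal among all such sets.\<close>
  ultimately obtain T where T: "T \<in> ?P" "\<And>T'. T' \<in> ?P \<Longrightarrow> \<not> ?r T \<subset> ?r T'"
    using finite_has_maximal[of "?r ` ?P"] by (auto simp: psubset_eq)
  then have pr: "preferred_ext F T" and c: "complete_ext F T" and base: "base \<subseteq> T"
    by (auto simp: preferred_ext_def)
  have m2: "Mode 2 \<in> T" using base by (auto simp: base_def)
  have "\<not> ?r T \<subset> ?r T'" if T': "preferred_ext F T'" for T'
  proof
    assume less: "?r T \<subset> ?r T'"
    have c': "complete_ext F T'" using T' by (simp add: preferred_ext_def)
    \<comment> \<open>A self-attacking argument in the range of \<open>T\<close> is also in that of
      \<open>T'\<close>; as it is not accepted there, \<open>T'\<close> contains another attacker of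
      it. For \<open>NoMode 2\<close> and the copies this brings \<open>Mode 2\<close> and the
      literals of \<open>base\<close> into \<open>T'\<close>.\<close>
    have copied: "\<exists>b\<in>T'. attacks b a \<and> b \<noteq> a" if "b \<in> T" "attacks b a" "is_arg a" "attacks a a" for a b
    proof -
      have "a \<in> ?r T'" using attack_defeats[OF c that(1,3,2)] less by blast
      moreover have "a \<notin> T'" using self_attack[OF c' that(4)] .
      ultimately show ?thesis using def_iff[OF complete_is_arg[OF c']] by blast
    qed
    have m2': "Mode 2 \<in> T'" using copied[OF m2, of "NoMode 2"] assms by auto
    have "Lit (v \<in> S0) v \<in> T'" if "v < l" for v
    proof -
      have "Lit (v \<in> S0) v \<in> T" using base that by (auto simp: base_def)
      then obtain b where "b \<in> T'" "attacks b (Copy (v \<in> S0) v)" "b \<noteq> Copy (v \<in> S0) v"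
        using copied[of "Lit (v \<in> S0) v" "Copy (v \<in> S0) v"] \<open>v < l\<close> W assms by auto
      then show ?thesis using Mode2_cases(1,2)[OF c' m2'] by auto
    qed
    then have "base \<subseteq> T'" using m2' by (auto simp: base_def)
    then show False using T(2)[of T'] T' less by blast
  qed
  then have "semi_stable_ext F T" using pr by (auto simp: semi_stable_ext_def)
  then have "extension \<sigma> F T" using assms pr by (cases \<sigma>) (auto simp: quantified_def)
  moreover have "Gate \<phi> 0 \<notin> T"
  proof
    assume "Gate \<phi> 0 \<in> T"
    then have "gate_value \<phi> (true_lits T) 0" using root_sound[OF c m2] by blast
    moreover have "v \<in> true_lits T \<longleftrightarrow> v \<in> S0" if "v < l" for v
    proof -
      have "Lit (v \<in> S0) v \<in> T" using base that by (auto simp: base_def)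
      then show ?thesis using true_lits_consistent[OF c] by (cases "v \<in> S0") auto
    qed
    then have "true_lits T \<inter> {..<l} = S0" using S0(1) by auto
    ultimately show False using S0(2) by blast
  qed
  ultimately show "\<exists>T. extension \<sigma> F T \<and> Mode 2 \<in> T \<and> Goal \<notin> defeated F T"
    using Goal_defeated_iff[OF c] Mode2_cases(1)[OF c m2] m2 by blast
qed

section \<open>Distances from the first labelling\<close>

definition differences :: "arg set \<Rightarrow> arg set" where
  "differences T = {a. is_arg a \<and> labelling_of F E0 a \<noteq> labelling_of F T a}"

lemma distance_differences: "distance F (labelling_of F E0) (labelling_of F T) = card (differences T)"
  by (simp add: distance_def differences_def args_F)

lemma finite_differences: "finite (differences T)"
proof (rule finite_subset)
  show "differences T \<subseteq> args F" by (auto simp: differences_def args_F)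
qed (use finite_F in \<open>simp add: finite_af_def\<close>)

lemma label_simps:
  assumes "is_arg a"
  shows "labelling_of F T a = (if a \<in> T then In else if a \<in> defeated F T then Out else Und)"
  using assms by (simp add: labelling_of_def args_F)

lemma label_E0:
  assumes "is_arg a"
  shows "labelling_of F E0 a = (if a \<in> E0 then In else if a \<in> {NoMode 1, NoMode 2} then Und else Out)"
  using assms by (auto simp: label_simps[OF assms] defeated_E0 in_E0)

lemma label_E1:
  assumes "is_arg a"
  shows "labelling_of F E1 a = (if a \<in> E1 then In else if a \<in> {NoMode 0, NoMode 2} then Und else Out)"
  using assms by (auto simp: label_simps[OF assms] defeated_E1 in_E1)

lemma card_pads: "card (A \<union> Pad ` {..<C}) = card A + C" if "finite A" "A \<inter> range Pad = {}"
proof -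
  have "card (Pad ` {..<C}) = C" by (subst card_image) (auto simp: inj_on_def)
  moreover have "A \<inter> Pad ` {..<C} = {}" using that(2) by blast
  ultimately show ?thesis using that by (simp add: card_Un_disjoint)
qed

text \<open>The \<open>C\<close> pads and \<open>Goal\<close> are defeated in \<open>E0\<close> and
  accepted in \<open>E1\<close>.\<close>

lemma distance_E1_lower: "C < distance F (labelling_of F E0) (labelling_of F E1)"
proof -
  have "{Goal} \<union> Pad ` {..<C} \<subseteq> differences E1"
    by (auto simp: differences_def label_E0 label_E1 in_E0 in_E1)
  from card_mono[OF finite_differences this] show ?thesis
    using card_pads[of "{Goal}"] by (auto simp: distance_differences image_iff)
qed

text \<open>In mode 2 the pads are defeated, as they are in \<open>E0\<close>, so only the at most
  \<open>C\<close> arguments of \<open>core\<close> can differ.\<close>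

lemma distance_mode2:
  assumes "complete_ext F T" "Mode 2 \<in> T"
  shows "distance F (labelling_of F E0) (labelling_of F T) \<le> C"
proof -
  have "Pad i \<notin> differences T" for i
    using Mode2_cases(3,4)[OF assms, of i]
    by (auto simp: differences_def label_E0 label_simps[of "Pad i" T] in_E0)
  moreover have "differences T \<subseteq> core \<union> Pad ` {..<C}"
    using is_arg_split by (auto simp: differences_def)
  ultimately have "differences T \<subseteq> core" by blast
  then show ?thesis
    using card_mono[OF card_core(1), of "differences T"] card_core(2) by (simp add: distance_differences)
qed

text \<open>\<open>E1\<close> differs from \<open>E0\<close> at no more than the pads and five other
  arguments. Without an accepted mode, the pads cannot be defeated, and there are again five further
  differences.\<close>

lemma distance_no_mode:
  assumes "\<not> q" "complete_ext F T" "Mode 0 \<notin> T" "Mode 1 \<notin> T" "Mode 2 \<notin> T"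
  shows "distance F (labelling_of F E0) (labelling_of F E1) \<le> distance F (labelling_of F E0) (labelling_of F T)"
proof -
  note def = def_iff[OF complete_is_arg[OF assms(2)]]
  have "differences E1 \<subseteq> {Mode 0, Mode 1, NoMode 0, NoMode 1, Goal} \<union> Pad ` {..<C}"
    using assms(1) by (auto simp: differences_def label_E0 label_E1 in_E0 in_E1 split: if_splits)
  then have "card (differences E1) \<le> card ({Mode 0, Mode 1, NoMode 0, NoMode 1, Goal} \<union> Pad ` {..<C})"
    by (intro card_mono) auto
  also have "\<dots> = 5 + C" by (subst card_pads) auto
  finally have 1: "card (differences E1) \<le> 5 + C" .
  have m0: "Mode 0 \<notin> defeated F T"
    unfolding def using assms(3-5) by (auto simp: less_Suc_eq numeral_3_eq_3 numeral_2_eq_2)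
  \<comment> \<open>If modes 1 and 2 were both defeated, \<open>Mode 0\<close> would be accepted.
    The undefeated one and its recorder take the places of \<open>Mode 1\<close> and
    \<open>NoMode 1\<close> in the comparison.\<close>
  have "\<exists>i\<in>{1, 2}. Mode i \<notin> defeated F T"
    using in_iff[OF assms(2), of "Mode 0"] assms(3) by (auto simp: less_Suc_eq numeral_3_eq_3 numeral_2_eq_2)
  then obtain i where i: "i \<in> {1, 2}" "Mode i \<notin> defeated F T" by blast
  have iT: "Mode i \<notin> T" "is_arg (Mode i)" "is_arg (NoMode i)" using i assms by auto
  have nm: "NoMode i \<notin> T" using NoMode_in_iff[OF assms(2), of i] i by auto
  have nm0: "NoMode 0 \<notin> defeated F T" "Goal \<notin> defeated F T" "Pad j \<notin> defeated F T" for j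
    unfolding def using assms by auto
  have "{Mode 0, Mode i, NoMode 0, NoMode i, Goal} \<union> Pad ` {..<C} \<subseteq> differences T"
    using iT i m0 nm nm0 assms(1,3) unfolding differences_def
    by (auto simp: label_E0 label_simps[where T = T] in_E0 split: if_splits)
  then have "card ({Mode 0, Mode i, NoMode 0, NoMode i, Goal} \<union> Pad ` {..<C}) \<le> card (differences T)"
    by (rule card_mono[OF finite_differences])
  also have "card ({Mode 0, Mode i, NoMode 0, NoMode i, Goal} \<union> Pad ` {..<C}) = 5 + C"
    using i(1) by (subst card_pads) auto
  finally show ?thesis using 1 by (simp add: distance_differences)
qed

text \<open>In the semi-stable case, a larger range would contain the self-attacking
  \<open>NoMode i\<close>, hence its extension contains \<open>Mode i\<close>; but a complete
  extension with that mode is unique.\<close>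

lemma extension_E0: "extension \<sigma> F E0" and extension_E1: "extension \<sigma> F E1"
proof -
  have st: "stable_ext F E0" "stable_ext F E1" if "\<not> q"
    using that preferred_E0 preferred_E1 unfolding stable_ext_def defeated_E0 defeated_E1 args_F
    by (auto simp: in_E0 in_E1)
  have sst: "semi_stable_ext F E" if q "preferred_ext F E" "Mode i \<in> E" "i < 2" for E i
  proof -
    have "\<not> E \<union> defeated F E \<subset> T \<union> defeated F T" if T: "preferred_ext F T" for T
    proof
      assume less: "E \<union> defeated F E \<subset> T \<union> defeated F T"
      have c: "complete_ext F T" "complete_ext F E" using T \<open>preferred_ext F E\<close> by (auto simp: preferred_ext_def)
      have "NoMode i \<in> defeated F E"
        using attack_defeats[OF c(2) \<open>Mode i \<in> E\<close>, of "NoMode i"] \<open>i < 2\<close> by auto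
      moreover have "NoMode i \<notin> T" using self_attack[OF c(1), of "NoMode i"] \<open>q\<close> by simp
      ultimately have "NoMode i \<in> defeated F T" using less by blast
      then have "Mode i \<in> T" using \<open>NoMode i \<notin> T\<close> unfolding def_iff[OF complete_is_arg[OF c(1)]] by auto
      then have "T = E"
        using mode0[OF c(1)] mode0[OF c(2)] mode1[OF c(1)] mode1[OF c(2)] \<open>Mode i \<in> E\<close> \<open>i < 2\<close>
        by (cases "i = 0") (simp_all add: less_2_cases_iff)
      then show False using less by blast
    qed
    then show ?thesis using that(2) by (auto simp: semi_stable_ext_def)
  qed
  have "Mode 0 \<in> E0" "Mode 1 \<in> E1" by (auto simp: E0_def E1_def)
  then show "extension \<sigma> F E0" "extension \<sigma> F E1"
    using st sst[OF _ preferred_E0, of 0] sst[OF _ preferred_E1, of 1] preferred_E0 preferred_E1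
    by (cases \<sigma>; auto simp: quantified_def preferred_ext_def)+
qed

text \<open>\<open>Goal\<close> is out in \<open>E0\<close>. An extension in which it is not out and
  that is not in mode 2 is either \<open>E1\<close> itself or, only when \<open>q\<close> fails, one
  without a mode; neither is closer than \<open>E1\<close>.\<close>

lemma counterfactual_iff:
  "labelling_of F E0 Goal \<noteq> labelling_of F E1 Goal \<and>
    \<not> (\<exists>T. extension \<sigma> F T \<and> labelling_of F E0 Goal \<noteq> labelling_of F T Goal \<and>
      distance F (labelling_of F E0) (labelling_of F T) < distance F (labelling_of F E0) (labelling_of F E1)) \<longleftrightarrow>
   \<not> (\<exists>T. extension \<sigma> F T \<and> Mode 2 \<in> T \<and> Goal \<notin> defeated F T)"
proof -
  have g: "labelling_of F E0 Goal = Out" by (auto simp: label_E0 in_E0)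
  have gT: "labelling_of F T Goal \<noteq> Out \<longleftrightarrow> Goal \<notin> defeated F T" if "complete_ext F T" for T
    using complete_ext_disjoint[OF that, of Goal] by (auto simp: label_simps)
  have "labelling_of F E1 Goal = In" by (auto simp: label_E1 in_E1)
  moreover have "(labelling_of F T Goal \<noteq> Out \<and>
      distance F (labelling_of F E0) (labelling_of F T) < distance F (labelling_of F E0) (labelling_of F E1)) \<longleftrightarrow>
      Mode 2 \<in> T \<and> Goal \<notin> defeated F T" if T: "extension \<sigma> F T" for T
  proof -
    have c: "complete_ext F T" using extension_complete[OF T] .
    have pr: "preferred_ext F T" if q
      using T that by (cases \<sigma>) (auto simp: quantified_def semi_stable_ext_def)
    show ?thesis
    proof (cases "Mode 2 \<in> T")
      case True
      then show ?thesis using distance_mode2[OF c True] distance_E1_lower gT[OF c] by auto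
    next
      case False
      have "\<not> distance F (labelling_of F E0) (labelling_of F T) < distance F (labelling_of F E0) (labelling_of F E1)"
        if nd: "Goal \<notin> defeated F T"
      proof (cases "Mode 1 \<in> T")
        case True
        then show ?thesis using mode1[OF c] by simp
      next
        case m1: False
        have m0: "Mode 0 \<notin> T" using nd Goal_defeated_iff[OF c] by blast
        then have "\<not> q" using preferred_mode[OF _ pr] m1 False by blast
        then show ?thesis using distance_no_mode[OF _ c m0 m1 False] by simp
      qed
      then show ?thesis using False gT[OF c] by blast
    qed
  qed
  ultimately show ?thesis unfolding g by (metis label.distinct(1))
qed

end

text \<open>The number of digits that the quantifiers on a path through the formula add to the code
  of an environment.\<close>

primrec qdepth :: "fm \<Rightarrow> nat" where
  "qdepth (Leq s t) = 0"
| "qdepth (InX t) = 0"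
| "qdepth (InY t) = 0"
| "qdepth (Nor f g) = max (qdepth f) (qdepth g)"
| "qdepth (NEx t f) = Suc (qdepth f)"

text \<open>\<open>qbound n f B\<close> bounds the values of all bound variables if the free variables are at most
  \<open>B\<close>.\<close>

primrec qbound :: "nat \<Rightarrow> fm \<Rightarrow> nat \<Rightarrow> nat" where
  "qbound n (Leq s t) B = 0"
| "qbound n (InX t) B = 0"
| "qbound n (InY t) B = 0"
| "qbound n (Nor f g) B = qbound n f B + qbound n g B"
| "qbound n (NEx t f) B = tval n (\<lambda>_. B) t + qbound n f (B + tval n (\<lambda>_. B) t)"

lemma tval_mono: "(\<And>i. e i \<le> e' i) \<Longrightarrow> tval n e t \<le> tval n e' t"
  by (induction t) (auto intro: add_mono mult_mono)

lemma tval_poly: "\<exists>p :: nat poly. \<forall>n. tval n (\<lambda>_. poly b n) t = poly p n"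
proof (induction t)
  case (Add s t)
  then obtain p r where "\<forall>n. tval n (\<lambda>_. poly b n) s = poly p n" "\<forall>n. tval n (\<lambda>_. poly b n) t = poly r n"
    by blast
  then show ?case by (intro exI[of _ "p + r"]) simp
next
  case (Mul s t)
  then obtain p r where "\<forall>n. tval n (\<lambda>_. poly b n) s = poly p n" "\<forall>n. tval n (\<lambda>_. poly b n) t = poly r n"
    by blast
  then show ?case by (intro exI[of _ "p * r"]) simp
next
  case Len
  then show ?case by (intro exI[of _ "[:0, 1:]"]) simp
next
  case (Const c)
  then show ?case by (intro exI[of _ "[:c:]"]) simp
qed auto

lemma qbound_poly: "\<exists>p :: nat poly. \<forall>n. qbound n f (poly b n) = poly p n"
proof (induction f arbitrary: b)
  case (Nor f g)
  obtain p r where "\<forall>n. qbound n f (poly b n) = poly p n" "\<forall>n. qbound n g (poly b n) = poly r n"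
    using Nor by blast
  then show ?case by (intro exI[of _ "p + r"]) simp
next
  case (NEx t f)
  obtain p where p: "\<forall>n. tval n (\<lambda>_. poly b n) t = poly p n" using tval_poly by blast
  obtain r where "\<forall>n. qbound n f (poly (b + p) n) = poly r n" using NEx by blast
  then show ?case using p by (intro exI[of _ "p + r"]) simp
qed (auto intro: exI[of _ 0])

context cf_reduction
begin

lemma env_child: "i < K \<Longrightarrow> env (i + K * c) = case_nat i (env c)"
proof
  fix j assume i: "i < K"
  show "env (i + K * c) j = case_nat i (env c) j"
  proof (cases j)
    case (Suc k)
    have "(i + K * c) div K ^ Suc k = (i + K * c) div K div K ^ k" by (simp add: div_mult2_eq)
    also have "(i + K * c) div K = c" using i by simp
    finally show ?thesis using Suc by (simp add: env_def)
  qed (use i in \<open>simp add: env_def\<close>)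
qed

text \<open>\<open>r\<close> counts the quantifiers above \<open>f\<close>. Each of them appends a
  digit, which is below \<open>K\<close> by the choice of \<open>qbound\<close>; so all codes stay
  below \<open>W\<close> and no gate that is needed is missing.\<close>

lemma gate_value_sat:
  assumes "\<forall>j. env c j \<le> B" "qbound n f B < K" "c < K ^ r" "K ^ (r + qdepth f) \<le> W"
  shows "gate_value f S c \<longleftrightarrow> sat n X (S \<inter> {..<m}) (env c) f"
  using assms
proof (induction f arbitrary: c B r)
  case (Nor f g)
  have "K \<ge> 1" using Nor.prems(2) by simp
  then have "K ^ (r + qdepth f) \<le> W" "K ^ (r + qdepth g) \<le> W"
    using Nor.prems(4) power_increasing[of "r + qdepth f" "r + qdepth (Nor f g)" K]
      power_increasing[of "r + qdepth g" "r + qdepth (Nor f g)" K] by auto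
  then show ?case using Nor.IH[OF Nor.prems(1) _ Nor.prems(3)] Nor.prems(2) by auto
next
  case (NEx t f)
  let ?b = "tval n (\<lambda>_. B) t"
  have tb: "tval n (env c) t \<le> ?b" using NEx.prems(1) by (intro tval_mono) blast
  have "gate_value f S (i + K * c) \<longleftrightarrow> sat n X (S \<inter> {..<m}) (case_nat i (env c)) f" and "i + K * c < W"
    if i: "i < tval n (env c) t" for i
  proof -
    have iK: "i < K" using i tb NEx.prems(2) by simp
    have "i + K * c < K * Suc c" using iK by simp
    also have "\<dots> \<le> K * K ^ r" using NEx.prems(3) by (intro mult_le_mono2) simp
    finally have c: "i + K * c < K ^ Suc r" by simp
    have "\<forall>j. env (i + K * c) j \<le> B + ?b"
      using NEx.prems(1) i tb by (auto simp: env_child[OF iK] trans_le_add1 split: nat.split)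
    then have "gate_value f S (i + K * c) \<longleftrightarrow> sat n X (S \<inter> {..<m}) (env (i + K * c)) f"
      using NEx.prems c by (intro NEx.IH[of _ _ "Suc r"]) auto
    then show "gate_value f S (i + K * c) \<longleftrightarrow> sat n X (S \<inter> {..<m}) (case_nat i (env c)) f"
      by (simp add: env_child[OF iK])
    have "K ^ Suc r \<le> K ^ (r + qdepth (NEx t f))"
      using NEx.prems(2) by (intro power_increasing) auto
    then show "i + K * c < W" using c NEx.prems(4) by linarith
  qed
  then show ?case by auto
qed auto

lemma root_value:
  assumes "qbound n \<phi> 0 < K" "K ^ qdepth \<phi> \<le> W"
  shows "gate_value \<phi> S 0 \<longleftrightarrow> sat n X (S \<inter> {..<m}) (\<lambda>_. 0) \<phi>"
proof -
  have "env 0 = (\<lambda>_. 0)" by (simp add: env_def)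
  then show ?thesis using gate_value_sat[of 0 0 \<phi> 0 S] assms by simp
qed

end

section \<open>Numbering the arguments\<close>

definition node_index :: "fm \<Rightarrow> fm \<Rightarrow> nat" where
  "node_index \<phi> f = length (takeWhile (\<lambda>g. g \<noteq> f) (nodes \<phi>))"

lemma node_index:
  assumes "f \<in> set (subs \<phi>)"
  shows "node_index \<phi> f < length (nodes \<phi>)" "nodes \<phi> ! node_index \<phi> f = f"
proof -
  have f: "f \<in> set (nodes \<phi>)" using assms by (simp add: nodes_def)
  have "takeWhile (\<lambda>g. g \<noteq> f) (nodes \<phi>) \<noteq> nodes \<phi>" using f by (auto simp: takeWhile_eq_all_conv)
  then show "node_index \<phi> f < length (nodes \<phi>)"
    unfolding node_index_def by (metis length_takeWhile_le nat_less_le takeWhile_eq_take take_all order_refl)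
  then show "nodes \<phi> ! node_index \<phi> f = f" unfolding node_index_def using nth_length_takeWhile by blast
qed

lemma node_index_nth:
  assumes "k < length (nodes \<phi>)" shows "node_index \<phi> (nodes \<phi> ! k) = k"
proof -
  have "nodes \<phi> ! k \<in> set (subs \<phi>)" using nth_mem[OF assms] by (simp add: nodes_def)
  from node_index[OF this] show ?thesis
    using assms nth_eq_iff_index_eq[of "nodes \<phi>"] by (simp add: nodes_def)
qed

text \<open>After eight single arguments come blocks of length \<open>W\<close>: two of literals,
  two of copies, then one for each subformula. Such a numbering is plain arithmetic, so that the
  attack matrix becomes definable.\<close>

definition block_num :: "nat \<Rightarrow> nat \<Rightarrow> nat \<Rightarrow> nat" where
  "block_num W k v = 8 + k * W + v"

fun arg_num :: "fm \<Rightarrow> nat \<Rightarrow> nat \<Rightarrow> arg \<Rightarrow> nat" where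
  "arg_num \<phi> W C (Mode i) = i"
| "arg_num \<phi> W C (NoMode i) = 3 + i"
| "arg_num \<phi> W C Goal = 6"
| "arg_num \<phi> W C Block = 7"
| "arg_num \<phi> W C (Lit s v) = block_num W (if s then 0 else 1) v"
| "arg_num \<phi> W C (Copy s v) = block_num W (if s then 2 else 3) v"
| "arg_num \<phi> W C (Gate f c) = block_num W (4 + node_index \<phi> f) c"
| "arg_num \<phi> W C (Pad i) = C + i"

definition num_arg :: "fm \<Rightarrow> nat \<Rightarrow> nat \<Rightarrow> nat \<Rightarrow> arg" where
  "num_arg \<phi> W C a = (if a < 3 then Mode a else if a < 6 then NoMode (a - 3)
     else if a = 6 then Goal else if a = 7 then Block else if C \<le> a then Pad (a - C)
     else let k = (a - 8) div W; v = (a - 8) mod W in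
       if k = 0 then Lit True v else if k = 1 then Lit False v
       else if k = 2 then Copy True v else if k = 3 then Copy False v else Gate (nodes \<phi> ! (k - 4)) v)"

context cf_reduction
begin

abbreviation num :: "arg \<Rightarrow> nat" where "num \<equiv> arg_num \<phi> W C"

lemma num_arg_block:
  assumes "k < 4 + length (nodes \<phi>)" "v < W"
  shows "num_arg \<phi> W C (block_num W k v) = (if k = 0 then Lit True v else if k = 1 then Lit False v
       else if k = 2 then Copy True v else if k = 3 then Copy False v else Gate (nodes \<phi> ! (k - 4)) v)"
    and "block_num W k v < C"
proof -
  show less: "block_num W k v < C" using block_less[OF assms] by (simp add: C block_num_def)
  have "(block_num W k v - 8) div W = k" "(block_num W k v - 8) mod W = v"
    using assms(2) by (simp_all add: block_num_def)
  moreover have "8 \<le> block_num W k v" by (simp add: block_num_def)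
  ultimately show "num_arg \<phi> W C (block_num W k v) = (if k = 0 then Lit True v else if k = 1 then Lit False v
       else if k = 2 then Copy True v else if k = 3 then Copy False v else Gate (nodes \<phi> ! (k - 4)) v)"
    using less unfolding num_arg_def Let_def by auto
qed

lemma C_ge: "8 \<le> C" by (simp add: C)

lemma num_inverse: "is_arg a \<Longrightarrow> num_arg \<phi> W C (num a) = a \<and> num a < 2 * C"
proof (cases a)
  case (Lit s v)
  assume "is_arg a"
  then show ?thesis using Lit num_arg_block[of "if s then 0 else 1" v] by (cases s) auto
next
  case (Copy s v)
  assume "is_arg a"
  then show ?thesis using Copy num_arg_block[of "if s then 2 else 3" v] by (cases s) auto
next
  case (Gate f c)
  assume "is_arg a"
  then show ?thesis using Gate num_arg_block[of "4 + node_index \<phi> f" c] node_index[of f \<phi>] by auto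
qed (use C_ge in \<open>auto simp: num_arg_def\<close>)

lemma num_arg_inverse: "a < 2 * C \<Longrightarrow> is_arg (num_arg \<phi> W C a) \<and> num (num_arg \<phi> W C a) = a"
proof (cases "8 \<le> a \<and> a < C")
  case True
  let ?k = "(a - 8) div W" and ?v = "(a - 8) mod W"
  have v: "?v < W" using W(1) by simp
  have "a - 8 < (4 + length (nodes \<phi>)) * W" using True C by linarith
  then have k: "?k < 4 + length (nodes \<phi>)" by (rule less_mult_imp_div_less)
  have a: "a = block_num W ?k ?v" using True unfolding block_num_def
    by (metis add.assoc div_mult_mod_eq le_add_diff_inverse)
  have "is_arg (num_arg \<phi> W C (block_num W ?k ?v)) \<and> num (num_arg \<phi> W C (block_num W ?k ?v)) = block_num W ?k ?v"
  proof (cases "4 \<le> ?k")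
    case True
    then have "nodes \<phi> ! (?k - 4) \<in> set (nodes \<phi>)" "?k - 4 < length (nodes \<phi>)" using k by auto
    then show ?thesis unfolding num_arg_block(1)[OF k v] using True v node_index_nth[of "?k - 4" \<phi>]
      by (auto simp: nodes_def)
  next
    case False
    then have "?k = 0 \<or> ?k = 1 \<or> ?k = 2 \<or> ?k = 3" by auto
    then show ?thesis unfolding num_arg_block(1)[OF k v] using v by auto
  qed
  then show ?thesis using a by simp
next
  case False
  assume "a < 2 * C"
  then show ?thesis using False C_ge by (auto simp: num_arg_def)
qed

lemma bij_num: "bij_betw num (Collect is_arg) {..<2 * C}"
  by (rule bij_betw_byWitness[where f' = "num_arg \<phi> W C"])
    (use num_inverse num_arg_inverse in auto)

lemma num_eq_iff: "is_arg a \<Longrightarrow> is_arg b \<Longrightarrow> num a = num b \<longleftrightarrow> a = b"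
  using num_inverse by metis

sublocale numbered: af_isomorphism num F
  by unfold_locales (use finite_F bij_num in \<open>auto simp: args_F bij_betw_def\<close>)

lemma args_numbered: "args (map_af num F) = {..<2 * C}"
  using bij_num by (simp add: map_af_def args_F bij_betw_def)

end

text \<open>The relation \<open>gate_input\<close> on numbers instead of arguments; the test
  \<open>i + K * c < W\<close> replaces the requirement that the attacker be an argument.\<close>

primrec num_gate_input :: "fm \<Rightarrow> nat \<Rightarrow> nat set \<Rightarrow> nat \<Rightarrow> nat \<Rightarrow> nat \<Rightarrow> fm \<Rightarrow> nat \<Rightarrow> nat \<Rightarrow> bool" where
  "num_gate_input \<phi> n X m W K (Leq s t) c a \<longleftrightarrow>
     a = 2 \<and> \<not> tval n (\<lambda>j. c div K ^ j mod K) s \<le> tval n (\<lambda>j. c div K ^ j mod K) t"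
| "num_gate_input \<phi> n X m W K (InX t) c a \<longleftrightarrow> a = 2 \<and> tval n (\<lambda>j. c div K ^ j mod K) t \<notin> X"
| "num_gate_input \<phi> n X m W K (InY t) c a \<longleftrightarrow>
     (if tval n (\<lambda>j. c div K ^ j mod K) t < m then a = block_num W 1 (tval n (\<lambda>j. c div K ^ j mod K) t)
      else a = 2)"
| "num_gate_input \<phi> n X m W K (Nor f g) c a \<longleftrightarrow>
     a = block_num W (4 + node_index \<phi> f) c \<or> a = block_num W (4 + node_index \<phi> g) c"
| "num_gate_input \<phi> n X m W K (NEx t f) c a \<longleftrightarrow> (\<exists>i<tval n (\<lambda>j. c div K ^ j mod K) t.
     i + K * c < W \<and> a = block_num W (4 + node_index \<phi> f) (i + K * c))"

definition num_attacks ::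
    "bool \<Rightarrow> fm \<Rightarrow> nat \<Rightarrow> nat set \<Rightarrow> nat \<Rightarrow> nat \<Rightarrow> nat \<Rightarrow> nat \<Rightarrow> nat \<Rightarrow> nat \<Rightarrow> nat \<Rightarrow> bool" where
  "num_attacks q \<phi> n X l m W K C a b \<longleftrightarrow>
     (\<exists>i\<in>{..<3}. b = i \<and> ((\<exists>j\<in>{..<3}. j \<noteq> i \<and> a = j) \<or> (\<not> q \<and> i = 2) \<and> a = 7)) \<or>
     (\<exists>i\<in>{..<3}. b = 3 + i \<and> (a = i \<or> q \<and> a = 3 + i)) \<or>
     b = 6 \<and> (a = 0 \<or> q \<and> a = block_num W (4 + node_index \<phi> \<phi>) 0) \<or>
     b = 7 \<and> (a = 0 \<or> a = 1 \<or> a = block_num W (4 + node_index \<phi> \<phi>) 0 \<or> q \<and> a = 7) \<or>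
     (\<exists>s\<in>{True, False}. \<exists>v<W. b = block_num W (if s then 0 else 1) v \<and>
        (a = 0 \<or> a = 1 \<or> a = block_num W (if s then 1 else 0) v \<or> q \<and> l \<le> v \<and> a = 7)) \<or>
     (\<exists>s\<in>{True, False}. \<exists>v<W. b = block_num W (if s then 2 else 3) v \<and>
        (a = 0 \<or> a = 1 \<or> a = block_num W (if s then 0 else 1) v \<or>
         q \<and> a = block_num W (if s then 2 else 3) v)) \<or>
     (\<exists>f\<in>set (subs \<phi>). \<exists>c<W. b = block_num W (4 + node_index \<phi> f) c \<and>
        (a = 0 \<or> a = 1 \<or> num_gate_input \<phi> n X m W K f c a)) \<or>
     (\<exists>i<C. b = C + i \<and> (a = 0 \<or> a = 2))"

context cf_reduction
begin

lemma ex_arg_iff: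
  "(\<exists>v. is_arg v \<and> P v) \<longleftrightarrow> (\<exists>i\<in>{..<3}. P (Mode i)) \<or> (\<exists>i\<in>{..<3}. P (NoMode i)) \<or> P Goal \<or> P Block \<or>
     (\<exists>s\<in>{True, False}. \<exists>v<W. P (Lit s v)) \<or> (\<exists>s\<in>{True, False}. \<exists>v<W. P (Copy s v)) \<or>
     (\<exists>f\<in>set (subs \<phi>). \<exists>c<W. P (Gate f c)) \<or> (\<exists>i<C. P (Pad i))"
proof
  assume "\<exists>v. is_arg v \<and> P v"
  then obtain v where v: "is_arg v" "P v" by blast
  show "(\<exists>i\<in>{..<3}. P (Mode i)) \<or> (\<exists>i\<in>{..<3}. P (NoMode i)) \<or> P Goal \<or> P Block \<or>
     (\<exists>s\<in>{True, False}. \<exists>v<W. P (Lit s v)) \<or> (\<exists>s\<in>{True, False}. \<exists>v<W. P (Copy s v)) \<or>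
     (\<exists>f\<in>set (subs \<phi>). \<exists>c<W. P (Gate f c)) \<or> (\<exists>i<C. P (Pad i))"
  proof (cases v)
    case (Lit s v)
    then show ?thesis using v by (cases s) auto
  next
    case (Copy s v)
    then show ?thesis using v by (cases s) auto
  qed (use v in auto)
qed (elim disjE bexE exE conjE; force)

lemma attacker_nums:
  assumes "is_arg v"
  shows "(\<exists>u. is_arg u \<and> attacks u v \<and> a = num u) \<longleftrightarrow> (case v of
     Mode i \<Rightarrow> (\<exists>j\<in>{..<3}. j \<noteq> i \<and> a = j) \<or> (\<not> q \<and> i = 2) \<and> a = 7
   | NoMode i \<Rightarrow> a = i \<or> q \<and> a = 3 + i
   | Goal \<Rightarrow> a = 0 \<or> q \<and> a = block_num W (4 + node_index \<phi> \<phi>) 0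
   | Block \<Rightarrow> a = 0 \<or> a = 1 \<or> a = block_num W (4 + node_index \<phi> \<phi>) 0 \<or> q \<and> a = 7
   | Lit s v \<Rightarrow> a = 0 \<or> a = 1 \<or> a = block_num W (if s then 1 else 0) v \<or> q \<and> l \<le> v \<and> a = 7
   | Copy s v \<Rightarrow> a = 0 \<or> a = 1 \<or> a = block_num W (if s then 0 else 1) v \<or>
       q \<and> a = block_num W (if s then 2 else 3) v
   | Gate f c \<Rightarrow> a = 0 \<or> a = 1 \<or> num_gate_input \<phi> n X m W K f c a
   | Pad i \<Rightarrow> a = 0 \<or> a = 2)"
proof -
  have one: "(\<exists>u. is_arg u \<and> u = w \<and> a = num u) \<longleftrightarrow> is_arg w \<and> a = num w" for w by blast
  have disj: "(\<exists>u. is_arg u \<and> (P u \<or> Q u) \<and> a = num u) \<longleftrightarrow>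
      (\<exists>u. is_arg u \<and> P u \<and> a = num u) \<or> (\<exists>u. is_arg u \<and> Q u \<and> a = num u)" for P Q by blast
  have cond: "(\<exists>u. is_arg u \<and> (c \<and> P u) \<and> a = num u) \<longleftrightarrow> c \<and> (\<exists>u. is_arg u \<and> P u \<and> a = num u)"
    for c P by blast
  have args: "is_arg Goal" "is_arg Block" "is_arg (Gate \<phi> 0)" using subs_self W(1) by auto
  show ?thesis
  proof (cases v)
    case (Gate f c)
    have gi: "(\<exists>u. is_arg u \<and> gate_input f c u \<and> a = num u) \<longleftrightarrow> num_gate_input \<phi> n X m W K f c a"
    proof (cases f)
      case (InY t)
      then show ?thesis using W by (auto simp: env_def)
    next
      case (Nor g h)
      have "(\<exists>u. is_arg u \<and> gate_input f c u \<and> a = num u) \<longleftrightarrow>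
          is_arg (Gate g c) \<and> a = num (Gate g c) \<or> is_arg (Gate h c) \<and> a = num (Gate h c)"
        unfolding Nor gate_input.simps by blast
      then show ?thesis using subs_parts(1)[of g h] assms Gate Nor by simp
    next
      case (NEx t g)
      have "(\<exists>u. is_arg u \<and> gate_input f c u \<and> a = num u) \<longleftrightarrow>
          (\<exists>i<tval n (env c) t. is_arg (Gate g (i + K * c)) \<and> a = num (Gate g (i + K * c)))"
        unfolding NEx gate_input.simps by blast
      then show ?thesis using subs_parts(2)[of t g] assms Gate NEx by (simp add: env_def)
    qed (auto simp: env_def)
    have "(\<exists>u. is_arg u \<and> attacks u v \<and> a = num u) \<longleftrightarrow> (\<exists>u. is_arg u \<and> u = Mode 0 \<and> a = num u) \<or>
        (\<exists>u. is_arg u \<and> u = Mode 1 \<and> a = num u) \<or> (\<exists>u. is_arg u \<and> gate_input f c u \<and> a = num u)"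
      unfolding Gate attacks.simps by blast
    then show ?thesis unfolding one gi Gate by simp
  next
    case (Mode i)
    have "(\<exists>u. is_arg u \<and> attacks u v \<and> a = num u) \<longleftrightarrow>
        (\<exists>j<3. j \<noteq> i \<and> is_arg (Mode j) \<and> a = num (Mode j)) \<or> \<not> q \<and> i = 2 \<and> is_arg Block \<and> a = num Block"
      unfolding Mode attacks.simps by blast
    then show ?thesis using Mode by auto
  next
    case (NoMode i)
    then show ?thesis using assms unfolding NoMode attacks.simps disj cond one by simp
  next
    case Goal
    then show ?thesis using args unfolding Goal attacks.simps disj cond one by simp
  next
    case Block
    then show ?thesis using args unfolding Block attacks.simps disj cond one by simp
  next
    case (Lit s v)
    then show ?thesis using assms args unfolding Lit attacks.simps disj cond one by simp
  next
    case (Copy s v)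
    then show ?thesis using assms unfolding Copy attacks.simps disj cond one by simp
  next
    case (Pad i)
    then show ?thesis unfolding Pad attacks.simps disj cond one by simp
  qed
qed

lemma num_attacks_iff: "(a, b) \<in> atts (map_af num F) \<longleftrightarrow> num_attacks q \<phi> n X l m W K C a b"
proof -
  have "(a, b) \<in> atts (map_af num F) \<longleftrightarrow>
      (\<exists>v. is_arg v \<and> (b = num v \<and> (\<exists>u. is_arg u \<and> attacks u v \<and> a = num u)))"
    by (auto simp: map_af_def F_def)
  also have "\<dots> \<longleftrightarrow> num_attacks q \<phi> n X l m W K C a b"
    by (simp only: attacker_nums cong: conj_cong)
      (simp only: ex_arg_iff num_attacks_def arg.case arg_num.simps)
  finally show ?thesis .
qed

end

lemma definable_num_gate_input:
  assumes "definable_fun (\<lambda>n X Y e. m n)" "definable_fun (\<lambda>n X Y e. W n)" "definable_fun (\<lambda>n X Y e. K n)"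
    "definable_fun c" "definable_fun a"
  shows "definable (\<lambda>n X Y e. num_gate_input \<phi> n X (m n) (W n) (K n) f (c n X Y e) (a n X Y e))"
proof (rule definable_subst2[OF _ assms(4,5)])
  show "definable (\<lambda>n X Y e. num_gate_input \<phi> n X (m n) (W n) (K n) f (e 1) (e 0))"
    by (cases f; simp only: num_gate_input.simps block_num_def;
      intro definable_intros definable_fun_tval assms(1-3))
qed

lemma definable_num_attacks:
  assumes "definable_fun (\<lambda>n X Y e. l n)" "definable_fun (\<lambda>n X Y e. m n)" "definable_fun (\<lambda>n X Y e. W n)"
    "definable_fun (\<lambda>n X Y e. K n)" "definable_fun (\<lambda>n X Y e. C n)" "definable_fun a" "definable_fun b"
  shows "definable (\<lambda>n X Y e. num_attacks q \<phi> n X (l n) (m n) (W n) (K n) (C n) (a n X Y e) (b n X Y e))"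
proof (rule definable_subst2[OF _ assms(6,7)])
  show "definable (\<lambda>n X Y e. num_attacks q \<phi> n X (l n) (m n) (W n) (K n) (C n) (e 1) (e 0))"
    unfolding num_attacks_def block_num_def
    by (intro definable_intros definable_num_gate_input assms(1-5)) auto
qed

section \<open>Encoded inputs\<close>

lemma map_upt_add: "map f [0..<a + b] = map f [0..<a] @ map (\<lambda>i. f (a + i)) [0..<b]"
proof -
  have "[0..<a + b] = [0..<a] @ [a..<a + b]" by (rule upt_add_eq_append) simp
  moreover have "[a..<a + b] = map (\<lambda>i. a + i) [0..<b]"
    using map_add_upt[of a b] by (simp add: add.commute)
  ultimately show ?thesis by (simp add: comp_def)
qed

lemma concat_map_upt:
  "concat (map (\<lambda>a. map (f a) [0..<k]) [0..<N]) = map (\<lambda>i. f (i div k) (i mod k)) [0..<N * k]"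
proof (induction N)
  case (Suc N)
  have "map (\<lambda>i. f ((N * k + i) div k) ((N * k + i) mod k)) [0..<k] = map (f N) [0..<k]"
    by (rule map_cong) auto
  moreover have "Suc N * k = N * k + k" by simp
  ultimately show ?case using Suc by (simp only: map_upt_add) simp
qed simp

text \<open>The encoding as a function of the position, which is the form that formulas can produce
  and inspect. \<open>I\<close> and \<open>U\<close> are the accepted and the defeated arguments of
  the first labelling, \<open>I'\<close> and \<open>U'\<close> those of the second.\<close>

definition input_bit :: "nat \<Rightarrow> (nat \<Rightarrow> nat \<Rightarrow> bool) \<Rightarrow> (nat \<Rightarrow> bool) \<Rightarrow>
    (nat \<Rightarrow> bool) \<Rightarrow> (nat \<Rightarrow> bool) \<Rightarrow> (nat \<Rightarrow> bool) \<Rightarrow> (nat \<Rightarrow> bool) \<Rightarrow> nat \<Rightarrow> bool" where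
  "input_bit N A G I U I' U' i =
     (if i < N + 1 then i < N
      else if i < N + 1 + N * N then A ((i - (N + 1)) div N) ((i - (N + 1)) mod N)
      else if i < N + 1 + N * N + N then G (i - (N + 1 + N * N))
      else if i < N + 1 + N * N + N + N * 2 then
        (if (i - (N + 1 + N * N + N)) mod 2 = 0 then I ((i - (N + 1 + N * N + N)) div 2)
         else U ((i - (N + 1 + N * N + N)) div 2))
      else if (i - (N + 1 + N * N + N + N * 2)) mod 2 = 0 then I' ((i - (N + 1 + N * N + N + N * 2)) div 2)
      else U' ((i - (N + 1 + N * N + N + N * 2)) div 2))"

lemma label_bits_concat:
  assumes "\<forall>a<N. (L a = In \<longleftrightarrow> I a) \<and> (L a = Out \<longleftrightarrow> U a)"
  shows "concat (map (\<lambda>a. label_bits (L a)) [0..<N]) =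
    map (\<lambda>i. if i mod 2 = 0 then I (i div 2) else U (i div 2)) [0..<N * 2]"
proof -
  have bits: "label_bits l = [l = In, l = Out]" for l by (cases l) auto
  have two: "[0..<2] = [0, Suc 0]" by (simp add: numeral_2_eq_2)
  have "map (\<lambda>a. label_bits (L a)) [0..<N] =
      map (\<lambda>a. map (\<lambda>i. if i = 0 then I a else U a) [0..<2]) [0..<N]"
    by (rule map_cong) (use assms in \<open>auto simp: bits two\<close>)
  then show ?thesis by (simp only: concat_map_upt)
qed

lemma encode_eq:
  assumes "args F = {..<N}" "\<forall>a<N. \<forall>b<N. (a, b) \<in> atts F \<longleftrightarrow> A a b" "\<forall>a<N. a = g \<longleftrightarrow> G a"
    "\<forall>a<N. (L a = In \<longleftrightarrow> I a) \<and> (L a = Out \<longleftrightarrow> U a)"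
    "\<forall>a<N. (L' a = In \<longleftrightarrow> I' a) \<and> (L' a = Out \<longleftrightarrow> U' a)"
  shows "encode (F, g, L, L') = map (input_bit N A G I U I' U') [0..<N + 1 + N * N + N + N * 2 + N * 2]"
proof -
  have unary: "map (input_bit N A G I U I' U') [0..<N + 1] = replicate N True @ [False]"
  proof -
    have "map (input_bit N A G I U I' U') [0..<N] = map (\<lambda>_. True) [0..<N]"
      by (rule map_cong) (auto simp: input_bit_def)
    then show ?thesis by (simp add: map_replicate_const input_bit_def)
  qed
  have matrix: "map (\<lambda>i. input_bit N A G I U I' U' (N + 1 + i)) [0..<N * N] =
      concat (map (\<lambda>a. map (\<lambda>b. (a, b) \<in> atts F) [0..<N]) [0..<N])"
    unfolding concat_map_upt
  proof (rule map_cong[OF refl])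
    fix i assume "i \<in> set [0..<N * N]"
    then have i: "i < N * N" by simp
    then have "i div N < N" "i mod N < N" by (auto simp: less_mult_imp_div_less) (cases N; simp)
    then show "input_bit N A G I U I' U' (N + 1 + i) = ((i div N, i mod N) \<in> atts F)"
      using assms(2) i by (simp add: input_bit_def)
  qed
  have goal: "map (\<lambda>i. input_bit N A G I U I' U' (N + 1 + N * N + i)) [0..<N] = map (\<lambda>a. a = g) [0..<N]"
    by (rule map_cong) (use assms(3) in \<open>auto simp: input_bit_def\<close>)
  have l1: "map (\<lambda>i. input_bit N A G I U I' U' (N + 1 + N * N + N + i)) [0..<N * 2] =
      concat (map (\<lambda>a. label_bits (L a)) [0..<N])"
    unfolding label_bits_concat[OF assms(4)] by (rule map_cong) (auto simp: input_bit_def)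
  have l2: "map (\<lambda>i. input_bit N A G I U I' U' (N + 1 + N * N + N + N * 2 + i)) [0..<N * 2] =
      concat (map (\<lambda>a. label_bits (L' a)) [0..<N])"
    unfolding label_bits_concat[OF assms(5)] by (rule map_cong) (auto simp: input_bit_def)
  have "encode (F, g, L, L') = (replicate N True @ [False]) @
      concat (map (\<lambda>a. map (\<lambda>b. (a, b) \<in> atts F) [0..<N]) [0..<N]) @ map (\<lambda>a. a = g) [0..<N] @
      concat (map (\<lambda>a. label_bits (L a)) [0..<N]) @ concat (map (\<lambda>a. label_bits (L' a)) [0..<N])"
    by (simp add: assms(1) Let_def)
  then show ?thesis
    by (simp only: map_upt_add[of _ _ "N * 2"] map_upt_add[of _ "N + 1 + N * N" N]
        map_upt_add[of _ "N + 1" "N * N"] unary matrix goal l1 l2 append_assoc)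
qed

section \<open>Hardness\<close>

context cf_reduction
begin

lemma num_ge_C: "is_arg a \<Longrightarrow> C \<le> num a \<longleftrightarrow> (\<exists>i<C. a = Pad i)"
proof (cases a)
  case (Lit s v)
  assume "is_arg a"
  then show ?thesis using Lit num_arg_block(2)[of "if s then 0 else 1" v] by auto
next
  case (Copy s v)
  assume "is_arg a"
  then show ?thesis using Copy num_arg_block(2)[of "if s then 2 else 3" v] by auto
next
  case (Gate f c)
  assume "is_arg a"
  then show ?thesis using Gate num_arg_block(2)[of "4 + node_index \<phi> f" c] node_index[of f \<phi>] by auto
qed (use C_ge in auto)

lemma num_small:
  assumes "is_arg a"
  shows "num a = 0 \<longleftrightarrow> a = Mode 0" "num a = 1 \<longleftrightarrow> a = Mode 1" "num a = 3 \<longleftrightarrow> a = NoMode 0"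
    "num a = 4 \<longleftrightarrow> a = NoMode 1" "num a = 5 \<longleftrightarrow> a = NoMode 2" "num a = 6 \<longleftrightarrow> a = Goal"
  using num_eq_iff[OF assms, of "Mode 0"] num_eq_iff[OF assms, of "Mode 1"]
    num_eq_iff[OF assms, of "NoMode 0"] num_eq_iff[OF assms, of "NoMode 1"]
    num_eq_iff[OF assms, of "NoMode 2"] num_eq_iff[OF assms, of Goal] by auto

abbreviation G :: "nat af" where "G \<equiv> map_af num F"
abbreviation L0 :: "nat \<Rightarrow> label" where "L0 \<equiv> labelling_of G (num ` E0)"
abbreviation L1 :: "nat \<Rightarrow> label" where "L1 \<equiv> labelling_of G (num ` E1)"

lemma E_args: "E0 \<subseteq> args F" "E1 \<subseteq> args F"
  by (auto simp: args_F in_E0 in_E1)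

lemma num_labels:
  assumes "a < 2 * C"
  shows "L0 a = In \<longleftrightarrow> a = 0 \<or> \<not> q \<and> (a = 4 \<or> a = 5)"
    "L0 a = Out \<longleftrightarrow> \<not> (a = 0 \<or> a = 4 \<or> a = 5)"
    "L1 a = In \<longleftrightarrow> a = 1 \<or> a = 6 \<or> C \<le> a \<or> \<not> q \<and> (a = 3 \<or> a = 5)"
    "L1 a = Out \<longleftrightarrow> \<not> (a = 1 \<or> a = 6 \<or> C \<le> a \<or> a = 3 \<or> a = 5)"
proof -
  obtain b where b: "is_arg b" "a = num b" using num_arg_inverse[OF assms] by metis
  then have bF: "b \<in> args F" by (simp add: args_F)
  have "L0 a = labelling_of F E0 b" "L1 a = labelling_of F E1 b"
    using numbered.labelling_map[OF E_args(1) bF] numbered.labelling_map[OF E_args(2) bF] b(2) by auto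
  then show "L0 a = In \<longleftrightarrow> a = 0 \<or> \<not> q \<and> (a = 4 \<or> a = 5)"
    "L0 a = Out \<longleftrightarrow> \<not> (a = 0 \<or> a = 4 \<or> a = 5)"
    "L1 a = In \<longleftrightarrow> a = 1 \<or> a = 6 \<or> C \<le> a \<or> \<not> q \<and> (a = 3 \<or> a = 5)"
    "L1 a = Out \<longleftrightarrow> \<not> (a = 1 \<or> a = 6 \<or> C \<le> a \<or> a = 3 \<or> a = 5)"
    unfolding b(2) num_small[OF b(1)] num_ge_C[OF b(1)]
    by (auto simp: label_E0[OF b(1)] label_E1[OF b(1)] in_E0 in_E1)
qed

definition instance_bit :: "nat \<Rightarrow> bool" where
  "instance_bit = input_bit (2 * C) (num_attacks q \<phi> n X l m W K C) (\<lambda>a. a = 6)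
     (\<lambda>a. a = 0 \<or> \<not> q \<and> (a = 4 \<or> a = 5)) (\<lambda>a. \<not> (a = 0 \<or> a = 4 \<or> a = 5))
     (\<lambda>a. a = 1 \<or> a = 6 \<or> C \<le> a \<or> \<not> q \<and> (a = 3 \<or> a = 5))
     (\<lambda>a. \<not> (a = 1 \<or> a = 6 \<or> C \<le> a \<or> a = 3 \<or> a = 5))"

lemma encode_instance:
  "encode (G, 6, L0, L1) = map instance_bit
     [0..<2 * C + 1 + 2 * C * (2 * C) + 2 * C + 2 * C * 2 + 2 * C * 2]"
  unfolding instance_bit_def
  by (rule encode_eq) (auto simp: args_numbered num_attacks_iff num_labels)

lemma instance_input: "(G, 6, L0, L1) \<in> cf_inputs \<sigma>"
proof -
  have "6 \<in> args G" using C_ge by (simp add: args_numbered)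
  moreover have "L1 \<in> labellings \<sigma> G" "L0 \<in> labellings \<sigma> G"
    unfolding numbered.labellings_map using extension_E0 extension_E1 by auto
  moreover have "L1 \<in> args G \<rightarrow>\<^sub>E UNIV" by (auto simp: labelling_of_def)
  ultimately show ?thesis
    using numbered.finite_map args_numbered unfolding cf_inputs_def by auto
qed

text \<open>Yes-instances are words, so injectivity of the encoding is needed to exclude that the
  same word comes from another input.\<close>

lemma instance_iff:
  "encode (G, 6, L0, L1) \<in> snd (CF_VE \<sigma>) \<longleftrightarrow>
    \<not> (\<exists>T. extension \<sigma> F T \<and> Mode 2 \<in> T \<and> Goal \<notin> defeated F T)"
proof -
  have "encode (G, 6, L0, L1) \<in> snd (CF_VE \<sigma>) \<longleftrightarrow> L1 \<in> counterfactuals \<sigma> G 6 L0"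
  proof
    assume "encode (G, 6, L0, L1) \<in> snd (CF_VE \<sigma>)"
    then obtain F' g L L' where F': "encode (F', g, L, L') = encode (G, 6, L0, L1)"
      "(F', g, L, L') \<in> cf_inputs \<sigma>" "L' \<in> counterfactuals \<sigma> F' g L"
      unfolding CF_VE_def snd_conv by (auto elim!: imageE simp del: encode.simps)
    from inj_onD[OF inj_on_encode F'(1) F'(2) instance_input] F'(3)
    show "L1 \<in> counterfactuals \<sigma> G 6 L0" by blast
  next
    assume "L1 \<in> counterfactuals \<sigma> G 6 L0"
    then show "encode (G, 6, L0, L1) \<in> snd (CF_VE \<sigma>)"
      using instance_input unfolding CF_VE_def snd_conv by (intro imageI) simp
  qed
  also have "\<dots> \<longleftrightarrow> \<not> (\<exists>T. extension \<sigma> F T \<and> Mode 2 \<in> T \<and> Goal \<notin> defeated F T)"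
    using numbered.counterfactuals_map[OF extension_E0 extension_E1, of Goal] counterfactual_iff
    by (simp add: args_F)
  finally show ?thesis .
qed

end

lemma reduction_in_FP:
  fixes l m :: "nat poly"
  assumes "\<And>n. poly l n \<le> poly m n"
  shows "\<exists>f\<in>FP. \<forall>x. f x \<in> fst (CF_VE \<sigma>) \<and>
    (\<not> quantified \<sigma> \<longrightarrow> (f x \<in> snd (CF_VE \<sigma>) \<longleftrightarrow>
      \<not> (\<exists>Y\<subseteq>{..<poly m (length x)}. sat (length x) (ones x) Y (\<lambda>_. 0) \<phi>))) \<and>
    (quantified \<sigma> \<longrightarrow> (f x \<in> snd (CF_VE \<sigma>) \<longleftrightarrow>
      \<not> (\<exists>Y\<subseteq>{..<poly l (length x)}. \<forall>Z\<subseteq>{poly l (length x)..<poly m (length x)}.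
        \<not> sat (length x) (ones x) (Y \<union> Z) (\<lambda>_. 0) \<phi>)))"
proof -
  obtain p where p: "\<And>n. qbound n \<phi> 0 = poly p n" using qbound_poly[of \<phi> 0] by auto
  \<comment> \<open>The root has the environment 0, so \<open>k\<close> exceeds all values of bound
    variables. The width \<open>w\<close> leaves room for all codes of environments and for
    \<open>m\<close> literals, \<open>c\<close> is the constant \<open>C\<close>, and
    \<open>N\<close> the number of arguments with the pads.\<close>
  define k w c N where "k = p + 1" and "w = k ^ qdepth \<phi> + m"
    and "c = [:8:] + [:4 + length (nodes \<phi>):] * w" and "N = [:2:] * c"
  define s where "s = N + 1 + N * N + N + N * [:2:] + N * [:2:]"
  define P :: pred where "P = (\<lambda>n X Y e. input_bit (2 * poly c n)
     (num_attacks (quantified \<sigma>) \<phi> n X (poly l n) (poly m n) (poly w n) (poly k n) (poly c n)) (\<lambda>a. a = 6)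
     (\<lambda>a. a = 0 \<or> \<not> quantified \<sigma> \<and> (a = 4 \<or> a = 5)) (\<lambda>a. \<not> (a = 0 \<or> a = 4 \<or> a = 5))
     (\<lambda>a. a = 1 \<or> a = 6 \<or> poly c n \<le> a \<or> \<not> quantified \<sigma> \<and> (a = 3 \<or> a = 5))
     (\<lambda>a. \<not> (a = 1 \<or> a = 6 \<or> poly c n \<le> a \<or> a = 3 \<or> a = 5)) (e 0))"
  define f where "f x = map (\<lambda>i. P (length x) (ones x) {} (case_nat i (\<lambda>_. 0))) [0..<poly s (length x)]" for x
  have "definable P" unfolding P_def input_bit_def
    by (intro definable_intros definable_num_attacks)
  then have "f \<in> FP" by (rule FP_I[of _ _ s]) (simp add: f_def)
  moreover have "f x \<in> fst (CF_VE \<sigma>) \<and>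
    (\<not> quantified \<sigma> \<longrightarrow> (f x \<in> snd (CF_VE \<sigma>) \<longleftrightarrow>
      \<not> (\<exists>Y\<subseteq>{..<poly m (length x)}. sat (length x) (ones x) Y (\<lambda>_. 0) \<phi>))) \<and>
    (quantified \<sigma> \<longrightarrow> (f x \<in> snd (CF_VE \<sigma>) \<longleftrightarrow>
      \<not> (\<exists>Y\<subseteq>{..<poly l (length x)}. \<forall>Z\<subseteq>{poly l (length x)..<poly m (length x)}.
        \<not> sat (length x) (ones x) (Y \<union> Z) (\<lambda>_. 0) \<phi>)))" for x
  proof -
    let ?n = "length x" let ?l = "poly l ?n" and ?m = "poly m ?n"
    have K: "poly k ?n = qbound ?n \<phi> 0 + 1" by (simp add: k_def p)
    have w: "poly w ?n = poly k ?n ^ qdepth \<phi> + ?m" by (simp add: w_def)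
    interpret cf_reduction \<sigma> ?n "ones x" \<phi> ?l ?m "poly w ?n" "poly k ?n" "poly c ?n"
      by unfold_locales (use assms in \<open>auto simp: w K c_def\<close>)
    have f: "f x = encode (G, 6, L0, L1)"
      unfolding encode_instance f_def by (simp add: P_def instance_bit_def s_def N_def mult.assoc)
    have root: "gate_value \<phi> S 0 \<longleftrightarrow> sat ?n (ones x) (S \<inter> {..<?m}) (\<lambda>_. 0) \<phi>" for S
      by (rule root_value) (simp_all only: K w le_add1 less_add_one)
    have "f x \<in> fst (CF_VE \<sigma>)" using instance_input unfolding f CF_VE_def fst_conv by (rule imageI)
    moreover have "f x \<in> snd (CF_VE \<sigma>) \<longleftrightarrow>
        \<not> (\<exists>Y\<subseteq>{..<?m}. sat ?n (ones x) Y (\<lambda>_. 0) \<phi>)" if "\<not> quantified \<sigma>"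
    proof -
      have "(\<exists>S. sat ?n (ones x) (S \<inter> {..<?m}) (\<lambda>_. 0) \<phi>) \<longleftrightarrow> (\<exists>Y\<subseteq>{..<?m}. sat ?n (ones x) Y (\<lambda>_. 0) \<phi>)"
        by (metis Int_lower2 inf.absorb1)
      then show ?thesis unfolding f instance_iff mode2_unquantified[OF that] root by simp
    qed
    moreover have "f x \<in> snd (CF_VE \<sigma>) \<longleftrightarrow> \<not> (\<exists>Y\<subseteq>{..<?l}. \<forall>Z\<subseteq>{?l..<?m}.
        \<not> sat ?n (ones x) (Y \<union> Z) (\<lambda>_. 0) \<phi>)" if "quantified \<sigma>"
    proof -
      have AB: "(\<forall>S. S \<inter> {..<?l} = Y \<longrightarrow> \<not> sat ?n (ones x) (S \<inter> {..<?m}) (\<lambda>_. 0) \<phi>) \<longleftrightarrow>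
          (\<forall>Z\<subseteq>{?l..<?m}. \<not> sat ?n (ones x) (Y \<union> Z) (\<lambda>_. 0) \<phi>)" (is "?A \<longleftrightarrow> ?B") if Y: "Y \<subseteq> {..<?l}" for Y
      proof
        assume A: ?A
        show ?B
        proof (intro allI impI)
          fix Z assume Z: "Z \<subseteq> {?l..<?m}"
          then have "(Y \<union> Z) \<inter> {..<?l} = Y" "(Y \<union> Z) \<inter> {..<?m} = Y \<union> Z" using Y assms[of ?n] by force+
          then show "\<not> sat ?n (ones x) (Y \<union> Z) (\<lambda>_. 0) \<phi>" using A by metis
        qed
      next
        assume B: ?B
        show ?A
        proof (intro allI impI)
          fix S assume "S \<inter> {..<?l} = Y"
          then have "S \<inter> {..<?m} = Y \<union> S \<inter> {?l..<?m}" using assms[of ?n] by force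
          moreover have "S \<inter> {?l..<?m} \<subseteq> {?l..<?m}" by blast
          ultimately show "\<not> sat ?n (ones x) (S \<inter> {..<?m}) (\<lambda>_. 0) \<phi>" using B by metis
        qed
      qed
      then show ?thesis unfolding f instance_iff mode2_quantified[OF that] root by (simp only: AB cong: conj_cong)
    qed
    ultimately show ?thesis by blast
  qed
  ultimately show ?thesis by blast
qed

lemma coNP_hard:
  assumes "L \<in> coNP" "\<not> quantified \<sigma>"
  shows "\<exists>f\<in>FP. \<forall>x. f x \<in> fst (CF_VE \<sigma>) \<and> (x \<in> L \<longleftrightarrow> f x \<in> snd (CF_VE \<sigma>))"
proof -
  have "sigma1 (- L)" using assms(1) NP_imp_sigma1 by (simp add: coNP_def co_def)
  then obtain P and m :: "nat poly" where P: "definable P" and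
    L: "\<forall>x. x \<in> - L \<longleftrightarrow> (\<exists>Y\<subseteq>{..<poly m (length x)}. P (length x) (ones x) Y (\<lambda>_. 0))"
    unfolding sigma1_def by blast
  obtain \<phi> where \<phi>: "P = (\<lambda>n X Y e. sat n X Y e \<phi>)" using P by (rule definableE)
  have iff: "x \<in> L \<longleftrightarrow> \<not> (\<exists>Y\<subseteq>{..<poly m (length x)}. sat (length x) (ones x) Y (\<lambda>_. 0) \<phi>)" for x
    using L[rule_format, of x] unfolding \<phi> Compl_iff by blast
  from reduction_in_FP[of m m \<sigma> \<phi>] obtain f where f: "f \<in> FP" "\<And>x. f x \<in> fst (CF_VE \<sigma>)"
    "\<And>x. f x \<in> snd (CF_VE \<sigma>) \<longleftrightarrow> \<not> (\<exists>Y\<subseteq>{..<poly m (length x)}. sat (length x) (ones x) Y (\<lambda>_. 0) \<phi>)"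
    using assms(2) by auto
  show ?thesis by (rule bexI[OF _ f(1)]) (simp only: f(2,3) iff simp_thms)
qed

lemma Pi2p_hard:
  assumes "L \<in> Pi2p" "quantified \<sigma>"
  shows "\<exists>f\<in>FP. \<forall>x. f x \<in> fst (CF_VE \<sigma>) \<and> (x \<in> L \<longleftrightarrow> f x \<in> snd (CF_VE \<sigma>))"
proof -
  have "sigma2 (- L)" using assms(1) Sigma2p_imp_sigma2 by (simp add: Pi2p_def co_def)
  then obtain P and l m :: "nat poly" where P: "definable P" and
    L: "\<forall>x. x \<in> - L \<longleftrightarrow> (\<exists>Y\<subseteq>{..<poly l (length x)}. \<forall>Z\<subseteq>{poly l (length x)..<poly m (length x)}.
      P (length x) (ones x) (Y \<union> Z) (\<lambda>_. 0))"
    unfolding sigma2_def by blast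
  \<comment> \<open>The reduction produces a yes-instance iff every first certificate can be
    completed to a model, hence the negation. It also wants \<open>l\<close> to be at most
    \<open>m\<close>; so \<open>l + m\<close> is used as the upper end, and the certificate is cut
    back to the positions that \<open>P\<close> expects.\<close>
  define Q :: pred where "Q = (\<lambda>n X Y e. \<not> P n {i. i \<in> X} {i. i \<in> Y \<and> (i < poly l n \<or> i < poly m n)} (\<lambda>_. 0))"
  have "definable Q" unfolding Q_def by (intro definable_intros definable_comp[OF P])
  then obtain \<phi> where \<phi>: "Q = (\<lambda>n X Y e. sat n X Y e \<phi>)" by (rule definableE)
  let ?l = "\<lambda>x. poly l (length x)" and ?m = "\<lambda>x. poly m (length x)"
  have AB: "(\<forall>Z\<subseteq>{?l x..<?m x}. P (length x) (ones x) (Y \<union> Z) (\<lambda>_. 0)) \<longleftrightarrow>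
      (\<forall>Z\<subseteq>{?l x..<?l x + ?m x}. \<not> Q (length x) (ones x) (Y \<union> Z) (\<lambda>_. 0))" (is "?A \<longleftrightarrow> ?B")
    if Y: "Y \<subseteq> {..<?l x}" for x Y
  proof
    assume A: ?A
    show ?B
    proof (intro allI impI)
      fix Z assume "Z \<subseteq> {?l x..<?l x + ?m x}"
      then have "{i. i \<in> Y \<union> Z \<and> (i < ?l x \<or> i < ?m x)} = Y \<union> Z \<inter> {?l x..<?m x}" using Y by force
      moreover have "Z \<inter> {?l x..<?m x} \<subseteq> {?l x..<?m x}" by blast
      ultimately show "\<not> Q (length x) (ones x) (Y \<union> Z) (\<lambda>_. 0)" using A by (simp add: Q_def)
    qed
  next
    assume B: ?B
    show ?A
    proof (intro allI impI)
      fix Z assume Z: "Z \<subseteq> {?l x..<?m x}"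
      then have e: "{i. i \<in> Y \<union> Z \<and> (i < ?l x \<or> i < ?m x)} = Y \<union> Z" using Y by force
      have "Z \<subseteq> {?l x..<?l x + ?m x}" using Z by force
      then have "\<not> Q (length x) (ones x) (Y \<union> Z) (\<lambda>_. 0)" using B by blast
      then show "P (length x) (ones x) (Y \<union> Z) (\<lambda>_. 0)" by (simp add: Q_def e del: Un_iff)
    qed
  qed
  have "x \<notin> L \<longleftrightarrow> (\<exists>Y\<subseteq>{..<?l x}. \<forall>Z\<subseteq>{?l x..<?l x + ?m x}. \<not> Q (length x) (ones x) (Y \<union> Z) (\<lambda>_. 0))" for x
    using L[rule_format, of x] by (simp only: AB Compl_iff cong: conj_cong)
  then have iff: "x \<in> L \<longleftrightarrow> \<not> (\<exists>Y\<subseteq>{..<?l x}. \<forall>Z\<subseteq>{?l x..<poly (l + m) (length x)}.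
      \<not> sat (length x) (ones x) (Y \<union> Z) (\<lambda>_. 0) \<phi>)" for x
    unfolding \<phi> poly_add by (metis (no_types))
  from reduction_in_FP[of l "l + m" \<sigma> \<phi>] obtain f where f: "f \<in> FP" "\<And>x. f x \<in> fst (CF_VE \<sigma>)"
    "\<And>x. f x \<in> snd (CF_VE \<sigma>) \<longleftrightarrow> \<not> (\<exists>Y\<subseteq>{..<?l x}. \<forall>Z\<subseteq>{?l x..<poly (l + m) (length x)}.
      \<not> sat (length x) (ones x) (Y \<union> Z) (\<lambda>_. 0) \<phi>)"
    using assms(2) by auto
  show ?thesis by (rule bexI[OF _ f(1)]) (simp only: f(2,3) iff simp_thms)
qed

section \<open>Membership\<close>

text \<open>The part of being a \<open>\<sigma>\<close>-extension that can be checked without a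
  rival; the rest is the absence of a \<open>better\<close> one.\<close>

definition base_ext :: "semantics \<Rightarrow> 'a af \<Rightarrow> 'a set \<Rightarrow> bool" where
  "base_ext \<sigma> F S \<longleftrightarrow> complete_ext F S \<and> (\<sigma> = ST \<longrightarrow> S \<union> defeated F S = args F)"

definition better :: "semantics \<Rightarrow> 'a af \<Rightarrow> 'a set \<Rightarrow> 'a set \<Rightarrow> bool" where
  "better \<sigma> F S T \<longleftrightarrow> complete_ext F T \<and>
     (\<sigma> = PR \<and> S \<subset> T \<or> \<sigma> = SST \<and> S \<union> defeated F S \<subset> T \<union> defeated F T)"

text \<open>A new element of \<open>T\<close> is not defeated by \<open>S\<close>, because
  \<open>T\<close> defeats everything that \<open>S\<close> defeats and is free of
  conflicts.\<close>

lemma range_strict_mono: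
  assumes "complete_ext F T" "S \<subset> T"
  shows "S \<union> defeated F S \<subset> T \<union> defeated F T"
proof -
  obtain t where t: "t \<in> T" "t \<notin> S" using assms(2) by blast
  have d: "defeated F S \<subseteq> defeated F T" using assms(2) by (auto simp: defeated_def)
  then have "t \<notin> defeated F S" using complete_ext_disjoint[OF assms(1) t(1)] by blast
  then show ?thesis using t d assms(2) by blast
qed

text \<open>Larger sets have larger ranges. So a complete extension with range everything is
  maximal, and a range-maximal complete extension is preferred; conversely, any complete rival can
  be enlarged to a preferred one. Hence all comparisons can be made among complete extensions, which
  are easy to recognise.\<close>

lemma extension_iff:
  assumes "finite_af F"
  shows "extension \<sigma> F S \<longleftrightarrow> base_ext \<sigma> F S \<and> \<not> (\<exists>T. better \<sigma> F S T)"
proof (cases \<sigma>)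
  case ST
  have "\<not> S \<subset> T" if "complete_ext F T" "S \<union> defeated F S = args F" for T
    using range_strict_mono[OF that(1), of S] complete_ext_subset[OF that(1)] that(2)
    by (auto simp: defeated_def)
  then show ?thesis
    by (auto simp: ST stable_ext_def preferred_ext_def base_ext_def better_def)
next
  case SST
  define wider where "wider S T \<longleftrightarrow> S \<union> defeated F S \<subset> T \<union> defeated F T" for S T
  have "\<And>T. complete_ext F T \<Longrightarrow> S \<subset> T \<Longrightarrow> wider S T" unfolding wider_def by (rule range_strict_mono)
  then have pr: "preferred_ext F S" if "complete_ext F S" "\<not> (\<exists>T. complete_ext F T \<and> wider S T)"
    using that unfolding preferred_ext_def by blast
  have ex: "\<exists>T'. preferred_ext F T' \<and> wider S T'" if T: "complete_ext F T" "wider S T" for T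
  proof -
    obtain T' where T': "preferred_ext F T'" "T \<subseteq> T'"
      using admissible_extends_to_preferred[OF assms, of T] T(1) by (auto simp: complete_ext_def)
    then have "T \<union> defeated F T \<subseteq> T' \<union> defeated F T'" by (auto simp: defeated_def)
    then have "wider S T'" using T(2) unfolding wider_def by (rule less_le_trans[rotated])
    then show ?thesis using T'(1) by blast
  qed
  have "semi_stable_ext F S \<longleftrightarrow> complete_ext F S \<and> \<not> (\<exists>T. complete_ext F T \<and> wider S T)"
    using pr ex preferred_ext_def[of F] unfolding semi_stable_ext_def wider_def[symmetric] by metis
  then show ?thesis by (simp add: SST base_ext_def better_def wider_def)
qed (auto simp: preferred_ext_def base_ext_def better_def)

definition differs :: "'a af \<Rightarrow> 'a set \<Rightarrow> 'a set \<Rightarrow> 'a set" where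
  "differs F S T = {a \<in> args F. (a \<in> S) \<noteq> (a \<in> T) \<or> (a \<in> defeated F S) \<noteq> (a \<in> defeated F T)}"

lemma labelling_differs:
  assumes "complete_ext F S" "complete_ext F T" "a \<in> args F"
  shows "labelling_of F S a \<noteq> labelling_of F T a \<longleftrightarrow> a \<in> differs F S T"
  using complete_ext_disjoint[OF assms(1), of a] complete_ext_disjoint[OF assms(2), of a] assms(3)
  by (auto simp: labelling_of_def differs_def)

lemma distance_differs:
  assumes "complete_ext F S" "complete_ext F T"
  shows "distance F (labelling_of F S) (labelling_of F T) = card (differs F S T)"
proof -
  have "{a \<in> args F. labelling_of F S a \<noteq> labelling_of F T a} = differs F S T"
    using labelling_differs[OF assms] by (auto simp: differs_def)
  then show ?thesis by (simp add: distance_def)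
qed

lemma counterfactuals_differs:
  assumes "g \<in> args F" "extension \<sigma> F S" "extension \<sigma> F S'"
  shows "labelling_of F S' \<in> counterfactuals \<sigma> F g (labelling_of F S) \<longleftrightarrow>
    g \<in> differs F S S' \<and>
    \<not> (\<exists>T. extension \<sigma> F T \<and> g \<in> differs F S T \<and> card (differs F S T) < card (differs F S S'))"
proof -
  note c = extension_complete[OF assms(2)] extension_complete[OF assms(3)]
  have "labelling_of F S' \<in> labellings \<sigma> F" using assms(3) by (auto simp: labellings_def)
  moreover have "(labelling_of F S g \<noteq> labelling_of F T g \<and> distance F (labelling_of F S) (labelling_of F T) <
      distance F (labelling_of F S) (labelling_of F S')) \<longleftrightarrow>
      g \<in> differs F S T \<and> card (differs F S T) < card (differs F S S')" if "extension \<sigma> F T" for T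
    using labelling_differs[OF c(1) extension_complete[OF that] assms(1)]
      distance_differs[OF c(1) extension_complete[OF that]] distance_differs[OF c] by simp
  then have "(\<exists>L\<in>labellings \<sigma> F. labelling_of F S g \<noteq> L g \<and> distance F (labelling_of F S) L <
      distance F (labelling_of F S) (labelling_of F S')) \<longleftrightarrow>
      (\<exists>T. extension \<sigma> F T \<and> g \<in> differs F S T \<and> card (differs F S T) < card (differs F S S'))"
    unfolding labellings_def by blast
  ultimately show ?thesis using labelling_differs[OF c assms(1)]
    unfolding counterfactuals_def mem_Collect_eq by argo
qed

section \<open>Decoding an input\<close>

definition input_length :: "nat \<Rightarrow> nat" where
  "input_length N = N + 1 + N * N + N + N * 2 + N * 2"

text \<open>The minimum exists for every length, which gives a total function with a bounded
  arithmetic graph; lengths of no encoding are rejected by \<open>well_formed\<close>.\<close>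

definition num_args :: "nat \<Rightarrow> nat" where
  "num_args n = (LEAST N. n \<le> input_length N)"

lemma input_length_strict: "M < N \<Longrightarrow> input_length M < input_length N"
  using mult_le_mono[of M N M N] by (simp add: input_length_def)

lemma num_args_length: "num_args (input_length N) = N"
  unfolding num_args_def
  by (rule Least_equality) (use input_length_strict in \<open>auto simp: not_less[symmetric]\<close>)

lemma num_args_eq: "N = num_args n \<longleftrightarrow> n \<le> input_length N \<and> (\<forall>M<N. \<not> n \<le> input_length M)"
proof -
  have "n \<le> input_length n" by (simp add: input_length_def)
  then have "n \<le> input_length (num_args n)" unfolding num_args_def by (rule LeastI)
  moreover have "\<not> n \<le> input_length M" if "M < num_args n" for M
    using that not_less_Least unfolding num_args_def by blast
  ultimately show ?thesis by (metis linorder_neqE_nat)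
qed

lemma num_args_le: "num_args n \<le> n"
  unfolding num_args_def by (rule Least_le) (simp add: input_length_def)

definition input_af :: "nat \<Rightarrow> nat set \<Rightarrow> nat af" where
  "input_af n X = \<lparr>args = {..<num_args n},
     atts = {(a, b). a < num_args n \<and> b < num_args n \<and> num_args n + 1 + a * num_args n + b \<in> X}\<rparr>"

definition is_goal :: "nat \<Rightarrow> nat set \<Rightarrow> nat \<Rightarrow> bool" where
  "is_goal n X a \<longleftrightarrow> num_args n + 1 + num_args n * num_args n + a \<in> X"

definition label_pos :: "nat \<Rightarrow> nat \<Rightarrow> nat" where
  "label_pos n k = num_args n + 1 + num_args n * num_args n + num_args n + k * (num_args n * 2)"

definition in_set :: "nat \<Rightarrow> nat set \<Rightarrow> nat \<Rightarrow> nat set" where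
  "in_set n X k = {a. a < num_args n \<and> label_pos n k + a * 2 \<in> X}"

definition out_set :: "nat \<Rightarrow> nat set \<Rightarrow> nat \<Rightarrow> nat set" where
  "out_set n X k = {a. a < num_args n \<and> label_pos n k + (a * 2 + 1) \<in> X}"

text \<open>The label bits are left out here: they are compared with an extension and its defeated
  set, which are disjoint, so bits that denote no label fail then.\<close>

definition well_formed :: "nat \<Rightarrow> nat set \<Rightarrow> bool" where
  "well_formed n X \<longleftrightarrow> n = input_length (num_args n) \<and> (\<forall>i<num_args n. i \<in> X) \<and> num_args n \<notin> X \<and>
     (\<exists>g<num_args n. \<forall>a<num_args n. is_goal n X a \<longleftrightarrow> a = g)"

lemma input_bit_at:
  fixes N :: nat and A :: "nat \<Rightarrow> nat \<Rightarrow> bool" and G I U I' U' :: "nat \<Rightarrow> bool"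
  defines "beta \<equiv> input_bit N A G I U I' U'"
  shows "i < N \<Longrightarrow> beta i" "\<not> beta N"
    "a < N \<Longrightarrow> b < N \<Longrightarrow> beta (N + 1 + a * N + b) = A a b"
    "a < N \<Longrightarrow> beta (N + 1 + N * N + a) = G a"
    "a < N \<Longrightarrow> beta (N + 1 + N * N + N + a * 2) = I a"
    "a < N \<Longrightarrow> beta (N + 1 + N * N + N + (a * 2 + 1)) = U a"
    "a < N \<Longrightarrow> beta (N + 1 + N * N + N + N * 2 + a * 2) = I' a"
    "a < N \<Longrightarrow> beta (N + 1 + N * N + N + N * 2 + (a * 2 + 1)) = U' a"
proof -
  have "Suc (a * 2) mod 2 = 1" by presburger
  then show "a < N \<Longrightarrow> beta (N + 1 + N * N + N + (a * 2 + 1)) = U a"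
    "a < N \<Longrightarrow> beta (N + 1 + N * N + N + N * 2 + (a * 2 + 1)) = U' a"
    by (simp_all add: beta_def input_bit_def)
  show "beta (N + 1 + a * N + b) = A a b" if "a < N" "b < N"
  proof -
    have "a * N + b < N * N" using block_less[OF that] by simp
    moreover have "N + 1 + a * N + b - (N + 1) = a * N + b" by simp
    ultimately show ?thesis using that unfolding beta_def input_bit_def by simp
  qed
qed (simp_all add: beta_def input_bit_def)

lemma ones_map: "ones (map f [0..<n]) = {i. i < n \<and> f i}"
  by (auto simp: ones_def)

lemma input_decode:
  assumes "length x = input_length N" "\<forall>i<N. i \<in> ones x" "N \<notin> ones x"
  shows "x = map (input_bit N (\<lambda>a b. N + 1 + a * N + b \<in> ones x) (\<lambda>a. N + 1 + N * N + a \<in> ones x)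
     (\<lambda>a. N + 1 + N * N + N + a * 2 \<in> ones x) (\<lambda>a. N + 1 + N * N + N + (a * 2 + 1) \<in> ones x)
     (\<lambda>a. N + 1 + N * N + N + N * 2 + a * 2 \<in> ones x)
     (\<lambda>a. N + 1 + N * N + N + N * 2 + (a * 2 + 1) \<in> ones x)) [0..<input_length N]"
    (is "x = map ?b _")
proof (rule nth_equalityI)
  fix i assume i: "i < length x"
  have parity: "j div 2 * 2 = j" if "j mod 2 = 0" for j :: nat using that by auto
  have parity': "j div 2 * 2 + 1 = j" if "j mod 2 \<noteq> 0" for j :: nat using that by presburger
  have "?b i \<longleftrightarrow> i \<in> ones x"
  proof -
    consider "i < N" | "i = N" | "N + 1 \<le> i" "i < N + 1 + N * N" | "N + 1 + N * N \<le> i" "i < N + 1 + N * N + N"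
      | "N + 1 + N * N + N \<le> i" "i < N + 1 + N * N + N + N * 2" | "N + 1 + N * N + N + N * 2 \<le> i" by linarith
    then show ?thesis
    proof cases
      case 3
      have "N + 1 + (i - (N + 1)) div N * N + (i - (N + 1)) mod N = i"
        using div_mult_mod_eq[of "i - (N + 1)" N] 3(1) by linarith
      then show ?thesis using 3 by (simp add: input_bit_def)
    next
      case 5
      define p where "p = N + 1 + N * N + N"
      have i: "\<not> i < N + 1" "\<not> i < N + 1 + N * N" "\<not> i < p" "i < p + N * 2" "p \<le> i"
        using 5 by (simp_all add: p_def)
      show ?thesis unfolding input_bit_def p_def[symmetric] if_not_P[OF i(1)] if_not_P[OF i(2)] if_not_P[OF i(3)] if_P[OF i(4)]
        using parity[of "i - p"] parity'[of "i - p"] le_add_diff_inverse[OF i(5)]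
        by (cases "(i - p) mod 2 = 0") (simp_all only: if_True if_False simp_thms)
    next
      case 6
      define p where "p = N + 1 + N * N + N + N * 2"
      have i: "\<not> i < N + 1" "\<not> i < N + 1 + N * N" "\<not> i < N + 1 + N * N + N" "\<not> i < p" "p \<le> i"
        using 6 by (simp_all add: p_def)
      show ?thesis unfolding input_bit_def p_def[symmetric] if_not_P[OF i(1)] if_not_P[OF i(2)] if_not_P[OF i(3)] if_not_P[OF i(4)]
        using parity[of "i - p"] parity'[of "i - p"] le_add_diff_inverse[OF i(5)]
        by (cases "(i - p) mod 2 = 0") (simp_all only: if_True if_False simp_thms)
    qed (use assms(2,3) in \<open>auto simp: input_bit_def\<close>)
  qed
  then show "x ! i = map ?b [0..<input_length N] ! i" using i assms(1) by (simp add: ones_def)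
qed (use assms(1) in simp)

text \<open>Membership concerns words without any promise, so it has to be checked as well that the
  first labelling is a \<open>\<sigma>\<close>-labelling; for the second one this is part of being a
  counterfactual.\<close>

lemma yes_instance_iff:
  "x \<in> snd (CF_VE \<sigma>) \<longleftrightarrow> (let n = length x; X = ones x; F = input_af n X in
     well_formed n X \<and>
     (\<forall>k\<in>{0, 1}. extension \<sigma> F (in_set n X k) \<and> out_set n X k = defeated F (in_set n X k)) \<and>
     (\<exists>g<num_args n. is_goal n X g \<and> g \<in> differs F (in_set n X 0) (in_set n X 1) \<and>
       \<not> (\<exists>T. extension \<sigma> F T \<and> g \<in> differs F (in_set n X 0) T \<and>
          card (differs F (in_set n X 0) T) < card (differs F (in_set n X 0) (in_set n X 1)))))"
    (is "_ \<longleftrightarrow> ?R")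
proof
  assume "x \<in> snd (CF_VE \<sigma>)"
  then obtain F g L L' where x: "x = encode (F, g, L, L')" and cf: "(F, g, L, L') \<in> cf_inputs \<sigma>"
    and L': "L' \<in> counterfactuals \<sigma> F g L"
    unfolding CF_VE_def snd_conv by (auto elim!: imageE simp del: encode.simps)
  obtain N where F: "finite_af F" "args F = {..<N}" and g: "g < N" and "L \<in> labellings \<sigma> F"
    using cf unfolding cf_inputs_def by auto
  then obtain S where S: "L = labelling_of F S" "extension \<sigma> F S" by (auto simp: labellings_def)
  obtain S' where S': "L' = labelling_of F S'" "extension \<sigma> F S'"
    using L' by (auto simp: counterfactuals_def labellings_def)
  define beta where "beta = input_bit N (\<lambda>a b. (a, b) \<in> atts F) (\<lambda>a. a = g) (\<lambda>a. a \<in> S) (\<lambda>a. a \<in> defeated F S)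
     (\<lambda>a. a \<in> S') (\<lambda>a. a \<in> defeated F S')"
  have lab: "(labelling_of F T a = In \<longleftrightarrow> a \<in> T) \<and> (labelling_of F T a = Out \<longleftrightarrow> a \<in> defeated F T)"
    if "extension \<sigma> F T" "a < N" for T a
    using complete_ext_disjoint[OF extension_complete[OF that(1)], of a] labelling_of_simps[of a F T]
      that(2) F(2) by (cases "a \<in> T") auto
  have "x = map beta [0..<input_length N]"
    unfolding x beta_def input_length_def by (rule encode_eq[OF F(2)]) (use lab S S' in auto)
  then have len: "length x = input_length N" and ones: "ones x = {i. i < input_length N \<and> beta i}"
    by (simp_all add: ones_map)
  have n: "num_args (length x) = N" by (simp add: len num_args_length)
  have A: "N + 1 + a * N + b \<in> ones x \<longleftrightarrow> (a, b) \<in> atts F" if "a < N" "b < N" for a b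
    using input_bit_at(3)[OF that] block_less[OF that] by (simp add: ones beta_def input_length_def)
  have G: "N + 1 + N * N + a \<in> ones x \<longleftrightarrow> a = g"
    and I: "N + 1 + N * N + N + a * 2 \<in> ones x \<longleftrightarrow> a \<in> S"
    and U: "N + 1 + N * N + N + (a * 2 + 1) \<in> ones x \<longleftrightarrow> a \<in> defeated F S"
    and I': "N + 1 + N * N + N + N * 2 + a * 2 \<in> ones x \<longleftrightarrow> a \<in> S'"
    and U': "N + 1 + N * N + N + N * 2 + (a * 2 + 1) \<in> ones x \<longleftrightarrow> a \<in> defeated F S'" if "a < N" for a
    using input_bit_at(4-8)[OF that] that unfolding ones beta_def by (simp_all add: input_length_def)
  have un: "i < N \<Longrightarrow> i \<in> ones x" "N \<notin> ones x" for i
    using input_bit_at(1,2) unfolding ones beta_def by (simp_all add: input_length_def)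
  have sub: "T \<subseteq> {..<N}" "defeated F T \<subseteq> {..<N}" if "extension \<sigma> F T" for T
    using complete_ext_subset[OF extension_complete[OF that]] F(2) by (auto simp: defeated_def)
  have "atts F = {(a, b). a < N \<and> b < N \<and> N + 1 + a * N + b \<in> ones x}"
    using A F by (auto simp: finite_af_def)
  then have dec: "input_af (length x) (ones x) = F" using F(2) by (simp add: input_af_def n)
  have sets: "in_set (length x) (ones x) 0 = S" "in_set (length x) (ones x) 1 = S'"
    "out_set (length x) (ones x) 0 = defeated F S" "out_set (length x) (ones x) 1 = defeated F S'"
    using I U I' U' sub[OF S(2)] sub[OF S'(2)] by (auto simp: in_set_def out_set_def label_pos_def n)
  have goal: "is_goal (length x) (ones x) a \<longleftrightarrow> a = g" if "a < N" for a
    using G[OF that] by (simp add: is_goal_def n)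
  have "well_formed (length x) (ones x)"
    unfolding well_formed_def n using un goal g len by auto
  moreover have "g \<in> args F" using g F(2) by simp
  moreover have "\<forall>k\<in>{0, 1}. extension \<sigma> F (in_set (length x) (ones x) k) \<and>
      out_set (length x) (ones x) k = defeated F (in_set (length x) (ones x) k)"
    by (simp only: ball_simps sets S(2) S'(2) simp_thms)
  ultimately show ?R
    using counterfactuals_differs[OF \<open>g \<in> args F\<close> S(2) S'(2)] L' S(1) S'(1) goal[OF g] g
    unfolding Let_def dec n sets by blast
next
  assume R: ?R
  define n X N F where "n = length x" and "X = ones x" and "N = num_args n" and "F = input_af n X"
  define S where "S k = in_set n X k" for k
  have wf: "well_formed n X" and ext: "extension \<sigma> F (S 0)" "extension \<sigma> F (S 1)"
    and out: "out_set n X 0 = defeated F (S 0)" "out_set n X 1 = defeated F (S 1)"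
    using R by (simp_all add: Let_def n_def X_def F_def S_def)
  obtain g where g: "g < N" "is_goal n X g" "g \<in> differs F (S 0) (S 1)"
    "\<not> (\<exists>T. extension \<sigma> F T \<and> g \<in> differs F (S 0) T \<and> card (differs F (S 0) T) < card (differs F (S 0) (S 1)))"
    using R unfolding Let_def n_def[symmetric] X_def[symmetric] F_def[symmetric] N_def[symmetric] S_def[symmetric]
    by blast
  have goal: "a = g \<longleftrightarrow> is_goal n X a" if "a < N" for a
    using wf g(1,2) that unfolding well_formed_def N_def by metis
  have F: "finite_af F" "args F = {..<N}" by (auto simp: F_def input_af_def finite_af_def N_def)
  have cf: "labelling_of F (S 1) \<in> counterfactuals \<sigma> F g (labelling_of F (S 0))"
    using counterfactuals_differs[OF _ ext, of g] g F(2) by simp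
  have inp: "(F, g, labelling_of F (S 0), labelling_of F (S 1)) \<in> cf_inputs \<sigma>"
    using F g(1) ext by (auto simp: cf_inputs_def labellings_def labelling_of_def)
  have lab: "(labelling_of F T a = In \<longleftrightarrow> a \<in> T) \<and> (labelling_of F T a = Out \<longleftrightarrow> a \<in> defeated F T)"
    if "extension \<sigma> F T" "a < N" for T a
    using complete_ext_disjoint[OF extension_complete[OF that(1)], of a] labelling_of_simps[of a F T]
      that(2) F(2) by (cases "a \<in> T") auto
  have in_S: "a \<in> S k \<longleftrightarrow> label_pos n k + a * 2 \<in> X" if "a < N" for a k
    using that by (simp add: S_def in_set_def N_def)
  have out_S: "a \<in> defeated F (S 0) \<longleftrightarrow> label_pos n 0 + (a * 2 + 1) \<in> X"
    "a \<in> defeated F (S 1) \<longleftrightarrow> label_pos n 1 + (a * 2 + 1) \<in> X" if "a < N" for a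
    using that unfolding out[symmetric] by (simp_all add: out_set_def N_def)
  have pos: "label_pos n 0 = N + 1 + N * N + N" "label_pos n 1 = N + 1 + N * N + N + N * 2"
    by (simp_all add: label_pos_def N_def)
  have "encode (F, g, labelling_of F (S 0), labelling_of F (S 1)) = map (input_bit N
      (\<lambda>a b. N + 1 + a * N + b \<in> X) (\<lambda>a. N + 1 + N * N + a \<in> X)
      (\<lambda>a. N + 1 + N * N + N + a * 2 \<in> X) (\<lambda>a. N + 1 + N * N + N + (a * 2 + 1) \<in> X)
      (\<lambda>a. N + 1 + N * N + N + N * 2 + a * 2 \<in> X)
      (\<lambda>a. N + 1 + N * N + N + N * 2 + (a * 2 + 1) \<in> X)) [0..<input_length N]"
    unfolding input_length_def
  proof (rule encode_eq[OF F(2)])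
    show "\<forall>a<N. \<forall>b<N. (a, b) \<in> atts F \<longleftrightarrow> N + 1 + a * N + b \<in> X"
      by (simp add: F_def input_af_def N_def)
    show "\<forall>a<N. a = g \<longleftrightarrow> N + 1 + N * N + a \<in> X" using goal by (simp add: is_goal_def N_def)
  qed (intro allI impI, simp only: lab[OF ext(1)] lab[OF ext(2)] in_S out_S pos simp_thms)+
  also have "\<dots> = x"
    using input_decode[of x N] wf by (simp add: well_formed_def N_def n_def X_def)
  finally have enc: "encode (F, g, labelling_of F (S 0), labelling_of F (S 1)) = x" .
  have "encode (F, g, labelling_of F (S 0), labelling_of F (S 1)) \<in>
      encode ` {(F, g, L, L') \<in> cf_inputs \<sigma>. L' \<in> counterfactuals \<sigma> F g L}"
    using cf inp by (intro imageI) simp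
  then show "x \<in> snd (CF_VE \<sigma>)" by (simp only: enc CF_VE_def snd_conv)
qed

text \<open>The strict inequality between cardinalities is certified by an injection that misses an
  element; pairs \<open>(a, b)\<close> are coded as \<open>N + a * N + b\<close>.\<close>

definition smaller :: "nat \<Rightarrow> nat set \<Rightarrow> nat set \<Rightarrow> nat set \<Rightarrow> bool" where
  "smaller N M A B \<longleftrightarrow> (\<forall>a<N. a \<in> A \<longrightarrow> (\<exists>b<N. b \<in> B \<and> N + a * N + b \<in> M)) \<and>
     (\<forall>a<N. \<forall>a'<N. \<forall>b<N. a \<in> A \<and> a' \<in> A \<and> N + a * N + b \<in> M \<and> N + a' * N + b \<in> M \<longrightarrow> a = a') \<and>
     (\<exists>b<N. b \<in> B \<and> (\<forall>a<N. a \<in> A \<longrightarrow> N + a * N + b \<notin> M))"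

lemma smaller_sound:
  assumes "smaller N M A B" "A \<subseteq> {..<N}" "B \<subseteq> {..<N}"
  shows "card A < card B"
proof -
  note m = assms(1)[unfolded smaller_def]
  have lt: "a \<in> A \<Longrightarrow> a < N" "c \<in> B \<Longrightarrow> c < N" for a c using assms(2,3) by auto
  have "\<forall>a\<in>A. \<exists>b. b \<in> B \<and> N + a * N + b \<in> M" using m[THEN conjunct1] lt(1) by blast
  then obtain f where f: "\<And>a. a \<in> A \<Longrightarrow> f a \<in> B \<and> N + a * N + f a \<in> M" by metis
  obtain b where b: "b \<in> B" "\<And>a. a \<in> A \<Longrightarrow> N + a * N + b \<notin> M"
    using m[THEN conjunct2, THEN conjunct2] lt(1) by blast
  note inj = m[THEN conjunct2, THEN conjunct1, rule_format]
  have "a = a'" if "a \<in> A" "a' \<in> A" "f a = f a'" for a a'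
    by (rule inj[of a a' "f a"]) (use f[OF that(1)] f[OF that(2)] that lt in auto)
  then have "inj_on f A" by (auto simp: inj_on_def)
  moreover have "f ` A \<subseteq> B - {b}" using f b(2) by blast
  moreover have fin: "finite B" using assms(3) finite_subset by blast
  ultimately have "card A \<le> card (B - {b})" by (metis card_inj_on_le finite_Diff)
  also have "\<dots> < card B" using fin b(1) by (rule card_Diff1_less)
  finally show ?thesis .
qed

text \<open>The codes of pairs start at \<open>N\<close>, so the same certificate can hold any set
  of arguments below.\<close>

lemma smaller_complete:
  assumes "card A < card B" "A \<subseteq> {..<N}" "B \<subseteq> {..<N}"
  shows "\<exists>M\<subseteq>{N..<N + N * N}. \<forall>T\<subseteq>{..<N}. smaller N (T \<union> M) A B"
proof -
  have fin: "finite A" "finite B" using assms(2,3) finite_subset by blast+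
  have "B \<noteq> {}" using assms(1) by auto
  then obtain b where b: "b \<in> B" by blast
  have "card A \<le> card (B - {b})" using assms(1) b fin by simp
  then obtain f where f: "f ` A \<subseteq> B - {b}" "inj_on f A"
    using fin by (meson card_le_inj finite_Diff)
  let ?M = "(\<lambda>a. N + a * N + f a) ` A"
  have less: "a < N" "f a < N" if "a \<in> A" for a using that f(1) assms(2,3) by auto
  have code: "N + a * N + c \<in> T \<union> ?M \<longleftrightarrow> a \<in> A \<and> c = f a" if "T \<subseteq> {..<N}" "c < N" for T a c
  proof -
    have "N + a * N + c \<notin> T" using that(1) by auto
    moreover have "N + a * N + c = N + a' * N + f a' \<longleftrightarrow> a = a' \<and> c = f a'" if "a' \<in> A" for a'
      using block_eq[of c N "f a'" a a'] less(2)[OF that] \<open>c < N\<close> by (metis add.assoc add_left_cancel)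
    ultimately show ?thesis by blast
  qed
  have "?M \<subseteq> {N..<N + N * N}" using block_less[of _ N "f _" N] less by (auto simp: add.assoc)
  moreover have "smaller N (T \<union> ?M) A B" if T: "T \<subseteq> {..<N}" for T
  proof -
    have "\<exists>c<N. c \<in> B \<and> N + a * N + c \<in> T \<union> ?M" if "a \<in> A" for a
      using code[OF T less(2)[OF that], of a] less(2)[OF that] f(1) that by blast
    moreover have "a = a'" if "c < N" "N + a * N + c \<in> T \<union> ?M" "N + a' * N + c \<in> T \<union> ?M" for a a' c
      using that(2,3) unfolding code[OF T that(1)] using f(2) by (auto dest: inj_onD)
    moreover have "N + a * N + b \<notin> T \<union> ?M" for a
      using code[OF T, of b a] b assms(3) f(1) by auto
    ultimately show ?thesis unfolding smaller_def using b assms(3) by blast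
  qed
  ultimately show ?thesis by blast
qed

text \<open>\<open>M\<close> codes both a set \<open>T\<close> of arguments, which shows that a given labelling is not a
  \<open>\<sigma>\<close>-labelling or belongs to a closer \<open>\<sigma>\<close>-labelling, and the injection comparing the distances;
  \<open>W\<close> is a rival of \<open>T\<close>.\<close>

definition cf_refuted :: "semantics \<Rightarrow> nat \<Rightarrow> nat set \<Rightarrow> nat set \<Rightarrow> nat set \<Rightarrow> bool" where
  "cf_refuted \<sigma> n X M W \<longleftrightarrow> (let F = input_af n X; T = {a. a < num_args n \<and> a \<in> M} in
     \<not> well_formed n X \<or>
     (\<exists>k\<in>{0, 1}. \<not> base_ext \<sigma> F (in_set n X k) \<or> out_set n X k \<noteq> defeated F (in_set n X k) \<or>
        better \<sigma> F (in_set n X k) T) \<or>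
     \<not> (\<exists>g<num_args n. is_goal n X g \<and> g \<in> differs F (in_set n X 0) (in_set n X 1)) \<or>
     (\<exists>g<num_args n. is_goal n X g \<and> g \<in> differs F (in_set n X 0) T) \<and> base_ext \<sigma> F T \<and>
       smaller (num_args n) M (differs F (in_set n X 0) T) (differs F (in_set n X 0) (in_set n X 1)) \<and>
       \<not> better \<sigma> F T W)"

lemma input_af_simps: "finite_af (input_af n X)" "args (input_af n X) = {..<num_args n}"
  by (auto simp: input_af_def finite_af_def)

lemma no_instance_iff:
  "x \<notin> snd (CF_VE \<sigma>) \<longleftrightarrow> (\<exists>M\<subseteq>{..<length x}. \<forall>W\<subseteq>{..<num_args (length x)}. cf_refuted \<sigma> (length x) (ones x) M W)"
proof -
  define n X N F where "n = length x" and "X = ones x" and "N = num_args n" and "F = input_af n X"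
  define S where "S k = in_set n X k" for k
  define U where "U k = out_set n X k" for k
  note defs = Let_def n_def[symmetric] X_def[symmetric] F_def[symmetric] N_def[symmetric] S_def[symmetric]
    U_def[symmetric]
  define T where "T M = {a. a < N \<and> a \<in> M}" for M
  have F: "finite_af F" "args F = {..<N}" by (simp_all add: F_def N_def input_af_simps)
  have ext: "extension \<sigma> F E \<longleftrightarrow> base_ext \<sigma> F E \<and> \<not> (\<exists>T. better \<sigma> F E T)" for E
    by (rule extension_iff[OF F(1)])
  have sub: "E \<subseteq> {..<N}" if "better \<sigma> F D E \<or> base_ext \<sigma> F E" for D E
    using that complete_ext_subset[of F E] by (auto simp: F(2) better_def base_ext_def)
  have TT: "T E = E" if "E \<subseteq> {..<N}" for E using that by (auto simp: T_def)
  have dsub: "differs F D E \<subseteq> {..<N}" for D E by (auto simp: differs_def F(2))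
  define good where "good \<longleftrightarrow> (\<forall>k\<in>{0, 1}. extension \<sigma> F (S k) \<and> U k = defeated F (S k))"
  have yes: "x \<in> snd (CF_VE \<sigma>) \<longleftrightarrow> well_formed n X \<and> good \<and>
     (\<exists>g<N. is_goal n X g \<and> g \<in> differs F (S 0) (S 1) \<and> \<not> (\<exists>T. extension \<sigma> F T \<and> g \<in> differs F (S 0) T \<and>
          card (differs F (S 0) T) < card (differs F (S 0) (S 1))))"
    unfolding yes_instance_iff defs good_def ..
  have ref: "cf_refuted \<sigma> n X M W \<longleftrightarrow> \<not> well_formed n X \<or>
     (\<exists>k\<in>{0, 1}. \<not> base_ext \<sigma> F (S k) \<or> U k \<noteq> defeated F (S k) \<or> better \<sigma> F (S k) (T M)) \<or>
     \<not> (\<exists>g<N. is_goal n X g \<and> g \<in> differs F (S 0) (S 1)) \<or>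
     (\<exists>g<N. is_goal n X g \<and> g \<in> differs F (S 0) (T M)) \<and> base_ext \<sigma> F (T M) \<and>
       smaller N M (differs F (S 0) (T M)) (differs F (S 0) (S 1)) \<and> \<not> better \<sigma> F (T M) W" for M W
    unfolding cf_refuted_def defs T_def ..
  show ?thesis unfolding defs
  proof
    assume no: "x \<notin> snd (CF_VE \<sigma>)"
    show "\<exists>M\<subseteq>{..<n}. \<forall>W\<subseteq>{..<N}. cf_refuted \<sigma> n X M W"
    proof (cases "well_formed n X")
      case wf: True
      \<comment> \<open>The attack matrix makes the input long enough for a set of arguments and the
        codes of an injection.\<close>
      then have n: "N + N * N \<le> n" unfolding well_formed_def N_def input_length_def by linarith
      obtain g where g: "g < N" "\<And>a. a < N \<Longrightarrow> is_goal n X a \<longleftrightarrow> a = g"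
        using wf unfolding well_formed_def N_def by blast
      show ?thesis
      proof (cases good)
        case False
        then obtain k where k: "k \<in> {0, 1}" "\<not> base_ext \<sigma> F (S k) \<or> U k \<noteq> defeated F (S k) \<or> (\<exists>E. better \<sigma> F (S k) E)"
          unfolding good_def ext by blast
        then obtain E where E: "E \<subseteq> {..<N}" "\<not> base_ext \<sigma> F (S k) \<or> U k \<noteq> defeated F (S k) \<or> better \<sigma> F (S k) E"
          using sub[of "S k"] by (metis empty_subsetI)
        have "cf_refuted \<sigma> n X E W" for W unfolding ref TT[OF E(1)] using k(1) E(2) by blast
        moreover have "E \<subseteq> {..<n}" using E(1) n by force
        ultimately show ?thesis by blast
      next
        case True
        show ?thesis
        proof (cases "g \<in> differs F (S 0) (S 1)")
          case False
          then have "cf_refuted \<sigma> n X {} W" for W unfolding ref using g by blast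
          then show ?thesis by blast
        next
          case d: True
          then obtain E where E: "extension \<sigma> F E" "g \<in> differs F (S 0) E"
            "card (differs F (S 0) E) < card (differs F (S 0) (S 1))"
            using no wf True g unfolding yes by blast
          have EN: "E \<subseteq> {..<N}" using sub E(1) unfolding ext by blast
          obtain M where M: "M \<subseteq> {N..<N + N * N}"
            "smaller N (E \<union> M) (differs F (S 0) E) (differs F (S 0) (S 1))"
            using smaller_complete[OF E(3) dsub dsub] EN by blast
          have "T (E \<union> M) = E" using M(1) EN by (auto simp: T_def)
          then have "cf_refuted \<sigma> n X (E \<union> M) W" for W
            unfolding ref using E M(2) g unfolding ext by metis
          moreover have "E \<union> M \<subseteq> {..<n}" using EN M(1) n by force
          ultimately show ?thesis by blast
        qed
      qed
    qed (use ref in blast)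
  next
    assume "\<exists>M\<subseteq>{..<n}. \<forall>W\<subseteq>{..<N}. cf_refuted \<sigma> n X M W"
    then obtain M where M: "\<And>W. W \<subseteq> {..<N} \<Longrightarrow> cf_refuted \<sigma> n X M W" by blast
    show "x \<notin> snd (CF_VE \<sigma>)"
    proof
      assume "x \<in> snd (CF_VE \<sigma>)"
      then obtain g where wf: "well_formed n X" and good: good and g: "g < N" "is_goal n X g"
        "g \<in> differs F (S 0) (S 1)" "\<And>T. extension \<sigma> F T \<Longrightarrow> g \<in> differs F (S 0) T \<Longrightarrow>
          \<not> card (differs F (S 0) T) < card (differs F (S 0) (S 1))"
        unfolding yes by blast
      have "\<not> (\<exists>k\<in>{0, 1}. \<not> base_ext \<sigma> F (S k) \<or> U k \<noteq> defeated F (S k) \<or> better \<sigma> F (S k) (T M))"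
        using good unfolding good_def ext by blast
      \<comment> \<open>The other disjuncts do not involve the rival and are false for a
        yes-instance, so the last one holds for every rival at once.\<close>
      then have last: "(\<exists>g<N. is_goal n X g \<and> g \<in> differs F (S 0) (T M)) \<and> base_ext \<sigma> F (T M) \<and>
        smaller N M (differs F (S 0) (T M)) (differs F (S 0) (S 1)) \<and> \<not> better \<sigma> F (T M) W" if "W \<subseteq> {..<N}" for W
        using M[OF that] wf g unfolding ref by blast
      have "a = g" if "a < N" "is_goal n X a" for a
        using wf g(1,2) that unfolding well_formed_def N_def by metis
      then have "g \<in> differs F (S 0) (T M)" using last[of "{}"] by blast
      moreover have "extension \<sigma> F (T M)" using last sub unfolding ext by blast
      moreover have "card (differs F (S 0) (T M)) < card (differs F (S 0) (S 1))"
        using smaller_sound[OF _ dsub dsub] last[of "{}"] by blast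
      ultimately show False using g(4) by blast
    qed
  qed
qed

section \<open>Definability of the refutation\<close>

definition definable_set :: "(nat \<Rightarrow> nat set \<Rightarrow> nat set \<Rightarrow> nat set) \<Rightarrow> bool" where
  "definable_set S \<longleftrightarrow> (\<forall>n X Y. S n X Y \<subseteq> {..<num_args n}) \<and> definable (\<lambda>n X Y e. e 0 \<in> S n X Y)"

lemma definable_mem:
  assumes "definable_set S" "definable_fun f" shows "definable (\<lambda>n X Y e. f n X Y e \<in> S n X Y)"
  using definable_subst[where Q = "\<lambda>n X Y e a. a \<in> S n X Y" and f = f] assms by (simp add: definable_set_def)

lemma definable_setI:
  assumes "definable (\<lambda>n X Y e. e 0 < num_args n \<and> P n X Y (e 0))"
  shows "definable_set (\<lambda>n X Y. {a. a < num_args n \<and> P n X Y a})"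
  using assms by (auto simp: definable_set_def)

lemma definable_num_args: "definable_fun (\<lambda>n X Y e. num_args n)"
proof -
  have "is_term (\<lambda>n e. n)" "\<forall>n X Y e. num_args n \<le> n" using num_args_le by (auto intro: is_term_intros)
  moreover have "definable (\<lambda>n X Y e. e 0 = num_args n)" unfolding num_args_eq input_length_def
    by (intro definable_intros)
  ultimately show ?thesis unfolding definable_fun_def by blast
qed

lemma definable_label_pos: "definable_fun (\<lambda>n X Y e. label_pos n k)"
  unfolding label_pos_def by (intro definable_intros definable_num_args)

lemma definable_in_set: "definable_set (\<lambda>n X Y. in_set n X k)"
  unfolding in_set_def by (intro definable_setI definable_intros definable_num_args definable_label_pos)

lemma definable_out_set: "definable_set (\<lambda>n X Y. out_set n X k)"
  unfolding out_set_def by (intro definable_setI definable_intros definable_num_args definable_label_pos)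

lemma definable_is_goal: "definable_fun f \<Longrightarrow> definable (\<lambda>n X Y e. is_goal n X (f n X Y e))"
  unfolding is_goal_def by (intro definable_intros definable_num_args)

lemma definable_well_formed: "definable (\<lambda>n X Y e. well_formed n X)"
  unfolding well_formed_def input_length_def by (intro definable_intros definable_num_args definable_is_goal)

lemma definable_union:
  assumes "definable_set S" "definable_set T" shows "definable_set (\<lambda>n X Y. S n X Y \<union> T n X Y)"
  using assms definable_disj[of "\<lambda>n X Y e. e 0 \<in> S n X Y" "\<lambda>n X Y e. e 0 \<in> T n X Y"]
  unfolding definable_set_def by simp

lemma definable_defeated:
  assumes "definable_set S" shows "definable_set (\<lambda>n X Y. defeated (input_af n X) (S n X Y))"
proof -
  have "defeated (input_af n X) (S n X Y) = {a. a < num_args n \<and>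
      (\<exists>b<num_args n. b \<in> S n X Y \<and> num_args n + 1 + b * num_args n + a \<in> X)}" for n X Y
    by (auto simp: defeated_def input_af_def)
  then show ?thesis
    by (simp only:) (intro definable_setI definable_intros definable_num_args definable_mem[OF assms])
qed

lemma definable_differs:
  assumes "definable_set S" "definable_set T"
  shows "definable_set (\<lambda>n X Y. differs (input_af n X) (S n X Y) (T n X Y))"
proof -
  have "differs (input_af n X) (S n X Y) (T n X Y) = {a. a < num_args n \<and>
      (\<not> (a \<in> S n X Y \<longleftrightarrow> a \<in> T n X Y) \<or>
       \<not> (a \<in> defeated (input_af n X) (S n X Y) \<longleftrightarrow> a \<in> defeated (input_af n X) (T n X Y)))}" for n X Y
    by (auto simp: differs_def input_af_simps)
  then show ?thesis
    by (simp only:) (intro definable_setI definable_intros definable_num_args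
        definable_mem[OF assms(1)] definable_mem[OF assms(2)]
        definable_mem[OF definable_defeated[OF assms(1)]] definable_mem[OF definable_defeated[OF assms(2)]])
qed

lemma definable_set_eq:
  assumes "definable_set S" "definable_set T" shows "definable (\<lambda>n X Y e. S n X Y = T n X Y)"
proof -
  have "S n X Y = T n X Y \<longleftrightarrow> (\<forall>a<num_args n. a \<in> S n X Y \<longleftrightarrow> a \<in> T n X Y)" for n X Y
    using assms unfolding definable_set_def by blast
  then show ?thesis
    by (simp only:) (intro definable_intros definable_num_args definable_mem[OF assms(1)] definable_mem[OF assms(2)])
qed

lemma definable_psubset:
  assumes "definable_set S" "definable_set T" shows "definable (\<lambda>n X Y e. S n X Y \<subset> T n X Y)"
proof -
  have "S n X Y \<subset> T n X Y \<longleftrightarrow> (\<forall>a<num_args n. a \<in> S n X Y \<longrightarrow> a \<in> T n X Y) \<and>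
      (\<exists>a<num_args n. a \<in> T n X Y \<and> \<not> a \<in> S n X Y)" for n X Y
    using assms unfolding definable_set_def by blast
  then show ?thesis
    by (simp only:) (intro definable_intros definable_num_args definable_mem[OF assms(1)] definable_mem[OF assms(2)])
qed

lemma definable_complete_ext:
  assumes "definable_set S" shows "definable (\<lambda>n X Y e. complete_ext (input_af n X) (S n X Y))"
proof -
  have "complete_ext (input_af n X) (S n X Y) \<longleftrightarrow> (\<forall>a<num_args n.
      \<not> (a \<in> S n X Y \<and> a \<in> defeated (input_af n X) (S n X Y)) \<and>
      (a \<in> S n X Y \<longleftrightarrow> (\<forall>b<num_args n. num_args n + 1 + b * num_args n + a \<in> X \<longrightarrow>
         b \<in> defeated (input_af n X) (S n X Y))))" (is "_ \<longleftrightarrow> ?R") for n X Y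
  proof -
    define D where "D = defeated (input_af n X) (S n X Y)"
    have S: "S n X Y \<subseteq> {..<num_args n}" using assms unfolding definable_set_def by blast
    have acc: "acceptable (input_af n X) (S n X Y) = {a. a < num_args n \<and>
        (\<forall>b<num_args n. num_args n + 1 + b * num_args n + a \<in> X \<longrightarrow> b \<in> D)}"
      unfolding acceptable_def D_def[symmetric] by (auto simp: input_af_def)
    have "complete_ext (input_af n X) (S n X Y) \<longleftrightarrow>
        S n X Y \<inter> D = {} \<and> S n X Y = acceptable (input_af n X) (S n X Y)"
      using S unfolding complete_ext_def admissible_def conflict_free_def D_def[symmetric] input_af_simps by blast
    then show ?thesis using S unfolding D_def[symmetric] acc by blast
  qed
  then show ?thesis
    by (simp only:) (intro definable_intros definable_num_args definable_mem[OF assms]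
      definable_mem[OF definable_defeated[OF assms]])
qed

lemma definable_base_ext:
  assumes "definable_set S" shows "definable (\<lambda>n X Y e. base_ext \<sigma> (input_af n X) (S n X Y))"
proof -
  have "definable (\<lambda>n X Y e. \<forall>a<num_args n. a \<in> S n X Y \<union> defeated (input_af n X) (S n X Y))"
    by (intro definable_intros definable_num_args definable_mem definable_union definable_defeated assms)
  moreover have "(\<forall>a<num_args n. a \<in> S n X Y \<union> defeated (input_af n X) (S n X Y)) \<longleftrightarrow>
      S n X Y \<union> defeated (input_af n X) (S n X Y) = args (input_af n X)" for n X Y
    using assms definable_defeated[OF assms] unfolding definable_set_def input_af_simps by blast
  ultimately have "definable (\<lambda>n X Y e. S n X Y \<union> defeated (input_af n X) (S n X Y) = args (input_af n X))"
    by simp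
  then show ?thesis unfolding base_ext_def
    by (intro definable_intros definable_complete_ext assms)
qed

lemma definable_better:
  assumes "definable_set S" "definable_set T"
  shows "definable (\<lambda>n X Y e. better \<sigma> (input_af n X) (S n X Y) (T n X Y))"
  unfolding better_def
  by (intro definable_conj definable_disj definable_const definable_complete_ext definable_psubset
      definable_union definable_defeated assms)

lemma definable_smaller:
  assumes "definable_set A" "definable_set B"
  shows "definable (\<lambda>n X Y e. smaller (num_args n) (Y \<inter> {..<n}) (A n X Y) (B n X Y))"
  unfolding smaller_def Int_iff lessThan_iff
  by (intro definable_intros definable_num_args definable_mem[OF assms(1)] definable_mem[OF assms(2)])

text \<open>The existential certificate lies below position \<open>n\<close>, the rival is shifted
  by \<open>n\<close>.\<close>

lemma definable_cf_refuted:
  "definable (\<lambda>n X Y e. cf_refuted \<sigma> n X (Y \<inter> {..<n}) {a. a < num_args n \<and> n + a \<in> Y})"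
proof -
  have T: "definable_set (\<lambda>n X Y. {a. a < num_args n \<and> a \<in> Y \<inter> {..<n}})"
    unfolding Int_iff lessThan_iff by (intro definable_setI definable_intros definable_num_args)
  have W: "definable_set (\<lambda>n X Y. {a. a < num_args n \<and> n + a \<in> Y})"
    by (intro definable_setI definable_intros definable_num_args)
  note sets = T W definable_in_set definable_out_set definable_defeated definable_differs
  show ?thesis unfolding cf_refuted_def Let_def
    by (intro definable_disj definable_conj definable_not definable_Bex_const definable_ex definable_num_args
      definable_well_formed definable_is_goal definable_fun_var definable_mem definable_set_eq
      definable_base_ext definable_better definable_smaller sets) auto
qed

text \<open>For these semantics nothing is \<open>better\<close> than anything, so refutation does
  not vary with the rival and the existential certificate suffices.\<close>

lemma coNP_member:
  assumes "\<not> quantified \<sigma>" shows "snd (CF_VE \<sigma>) \<in> coNP"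
proof -
  have ind: "cf_refuted \<sigma> n X M W \<longleftrightarrow> cf_refuted \<sigma> n X M W'" for n X M W W'
    using assms by (simp add: cf_refuted_def better_def quantified_def)
  have "x \<in> - snd (CF_VE \<sigma>) \<longleftrightarrow> (\<exists>Y\<subseteq>{..<poly [:0, 1:] (length x)}.
      cf_refuted \<sigma> (length x) (ones x) (Y \<inter> {..<length x}) {a. a < num_args (length x) \<and> length x + a \<in> Y})" for x
  proof -
    have "x \<in> - snd (CF_VE \<sigma>) \<longleftrightarrow> (\<exists>Y\<subseteq>{..<length x}. cf_refuted \<sigma> (length x) (ones x) Y {})"
      unfolding Compl_iff no_instance_iff using ind by blast
    moreover have "Y \<inter> {..<length x} = Y" if "Y \<subseteq> {..<length x}" for Y using that by blast
    moreover have "cf_refuted \<sigma> (length x) (ones x) Y {a. a < num_args (length x) \<and> length x + a \<in> Y} \<longleftrightarrow>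
        cf_refuted \<sigma> (length x) (ones x) Y {}" for Y by (rule ind)
    ultimately show ?thesis by (simp cong: conj_cong)
  qed
  then have "sigma1 (- snd (CF_VE \<sigma>))" unfolding sigma1_def using definable_cf_refuted by blast
  then show ?thesis using sigma1_imp_NP by (simp add: coNP_def co_def)
qed

lemma Pi2p_member: "snd (CF_VE \<sigma>) \<in> Pi2p"
proof -
  \<comment> \<open>There are at most as many arguments as input bits, so the shifted rival fits
    below twice the length of the input.\<close>
  have "x \<in> - snd (CF_VE \<sigma>) \<longleftrightarrow> (\<exists>Y\<subseteq>{..<poly [:0, 1:] (length x)}.
      \<forall>Z\<subseteq>{poly [:0, 1:] (length x)..<poly [:0, 2:] (length x)}. cf_refuted \<sigma> (length x) (ones x)
        ((Y \<union> Z) \<inter> {..<length x}) {a. a < num_args (length x) \<and> length x + a \<in> Y \<union> Z})" for x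
  proof -
    let ?n = "length x" and ?N = "num_args (length x)"
    have "(\<forall>W\<subseteq>{..<?N}. cf_refuted \<sigma> ?n (ones x) Y W) \<longleftrightarrow> (\<forall>Z\<subseteq>{?n..<?n * 2}. cf_refuted \<sigma> ?n (ones x)
        ((Y \<union> Z) \<inter> {..<?n}) {a. a < ?N \<and> ?n + a \<in> Y \<union> Z})" (is "?A \<longleftrightarrow> ?B") if Y: "Y \<subseteq> {..<?n}" for Y
    proof
      assume A: ?A
      show ?B
      proof (intro allI impI)
        fix Z assume "Z \<subseteq> {?n..<?n * 2}"
        then have e: "(Y \<union> Z) \<inter> {..<?n} = Y" using Y by force
        have "{a. a < ?N \<and> ?n + a \<in> Y \<union> Z} \<subseteq> {..<?N}" by blast
        then show "cf_refuted \<sigma> ?n (ones x) ((Y \<union> Z) \<inter> {..<?n}) {a. a < ?N \<and> ?n + a \<in> Y \<union> Z}"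
          unfolding e using A by blast
      qed
    next
      assume B: ?B
      show ?A
      proof (intro allI impI)
        fix W assume W: "W \<subseteq> {..<?N}"
        let ?Z = "(\<lambda>a. ?n + a) ` W"
        have "a < ?n" if "a \<in> W" for a using that W num_args_le[of ?n] by force
        then have Z: "?Z \<subseteq> {?n..<?n * 2}" by force
        then have e: "(Y \<union> ?Z) \<inter> {..<?n} = Y" using Y by force
        have e2: "{a. a < ?N \<and> ?n + a \<in> Y \<union> ?Z} = W" using Y W by force
        have "cf_refuted \<sigma> ?n (ones x) ((Y \<union> ?Z) \<inter> {..<?n}) {a. a < ?N \<and> ?n + a \<in> Y \<union> ?Z}"
          using B Z by blast
        then show "cf_refuted \<sigma> ?n (ones x) Y W" unfolding e e2 .
      qed
    qed
    then show ?thesis unfolding Compl_iff no_instance_iff by (simp cong: conj_cong)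
  qed
  then have "sigma2 (- snd (CF_VE \<sigma>))" unfolding sigma2_def using definable_cf_refuted by blast
  then show ?thesis using sigma2_imp_Sigma2p by (simp add: Pi2p_def co_def)
qed

theorem theorem2:
  "(\<forall>\<sigma>\<in>{CO, ST}. complete_for coNP (CF_VE \<sigma>)) \<and>
   (\<forall>\<sigma>\<in>{PR, SST}. complete_for Pi2p (CF_VE \<sigma>))"
proof (intro conjI ballI)
  fix \<sigma> assume "\<sigma> \<in> {CO, ST}"
  then have "\<not> quantified \<sigma>" by (auto simp: quantified_def)
  from coNP_member[OF this] coNP_hard[OF _ this] show "complete_for coNP (CF_VE \<sigma>)"
    unfolding complete_for_def by (simp add: split_beta)
next
  fix \<sigma> assume "\<sigma> \<in> {PR, SST}"
  then have "quantified \<sigma>" by (auto simp: quantified_def)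
  from Pi2p_member Pi2p_hard[OF _ this] show "complete_for Pi2p (CF_VE \<sigma>)"
    unfolding complete_for_def by (simp add: split_beta)
qed

end
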